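(* Let $n\ge 1$, $a\in\mathbb{R}^n$, $q>1$ and fix $0<\beta<1$. Assume that $u_0\in L^1(\mathbb{R}^n)\cap L^q(\mathbb{R}^n)$ satisfies the inequality $$\|e^{t\Delta}u_0\|_1\le Ct^{-\beta/2}$$ for all $t>0$ and a constant $C$ independent of $t$. Let $u$ be the solution of the Cauchy problem $$u_t-\Delta u+a\cdot\nabla(u|u|^{q-1})=0\ \ (x\in\mathbb{R}^n,\ t>0),\qquad u(x,0)=u_0(x).$$ If $q>1+\frac1n$, then there exists a constant $C$ such that $$\|u(\cdot,t)\|_1\le C(1+t)^{-\beta/2}\quad\text{for all } t>0.$$ The same estimate also holds true for $1+\frac1{n+\beta}\le q\le 1+\frac1n$ (with $0<\beta<1$), provided $u_0\in L^1(\mathbb{R}^n)\cap L^\infty(\mathbb{R}^n)$ and $\sup_{t>0}t^{\beta/2}\|e^{t\Delta}u_0\|_1$ is sufficiently small.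
   Context: $\|\cdot\|_p$ is the norm of $L^p(\mathbb{R}^n)$. $e^{t\Delta}u_0=G(\cdot,t)*u_0$ with $G(x,t)=(4\pi t)^{-n/2}\exp(-|x|^2/(4t))$. For every $u_0\in L^1(\mathbb{R}^n)$ the Cauchy problem has a unique solution $u\in C([0,\infty);L^1(\mathbb{R}^n))$ satisfying $u\in C((0,\infty);W^{2,p}(\mathbb{R}^n))\cap C^1((0,\infty);L^p(\mathbb{R}^n))$ for all $p\in(1,\infty)$; "the solution" means this one. It satisfies the integral equation $u(t)=e^{t\Delta}u_0-\int_0^t a\cdot\nabla e^{(t-\tau)\Delta}(u|u|^{q-1})(\tau)\,d\tau$. *)

theory Defs
  imports "HOL-Analysis.Analysis" "HOL-Probability.Essential_Supremum"
begin

section \<open>Lebesgue spaces\<close>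

text \<open>
  Elements of a Lebesgue space are represented by Borel functions; every class modulo null sets
  contains one, and nothing below depends on the choice of representative.  The exponent \<open>p\<close> is
  meant to satisfy \<open>1 \<le> p < \<infinity>\<close>; the case \<open>p = \<infinity>\<close> is \<open>Linf_space\<close>.
\<close>

definition Lp_space :: "real \<Rightarrow> ('a::euclidean_space \<Rightarrow> real) set" where
  "Lp_space p = {f. f \<in> borel_measurable lborel \<and> integrable lborel (\<lambda>x. \<bar>f x\<bar> powr p)}"

definition Lp_norm :: "real \<Rightarrow> ('a::euclidean_space \<Rightarrow> real) \<Rightarrow> real" where
  "Lp_norm p f = (LINT x|lborel. \<bar>f x\<bar> powr p) powr (1 / p)"

definition Linf_norm :: "('a::euclidean_space \<Rightarrow> real) \<Rightarrow> ereal" where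
  "Linf_norm f = esssup lborel (\<lambda>x. ereal \<bar>f x\<bar>)"

definition Linf_space :: "('a::euclidean_space \<Rightarrow> real) set" where
  "Linf_space = {f. f \<in> borel_measurable lborel \<and> Linf_norm f < \<infinity>}"

section \<open>Weak derivatives and the Sobolev space of order two\<close>

definition partial_deriv ::
    "'a::euclidean_space \<Rightarrow> ('a \<Rightarrow> real) \<Rightarrow> 'a \<Rightarrow> real" where
  "partial_deriv i f x = frechet_derivative f (at x) i"

fun k_times_cont_diff :: "nat \<Rightarrow> ('a::euclidean_space \<Rightarrow> real) \<Rightarrow> bool" where
  "k_times_cont_diff 0 f \<longleftrightarrow> continuous_on UNIV f"
| "k_times_cont_diff (Suc k) f \<longleftrightarrow>
     (\<forall>x. f differentiable at x) \<and> (\<forall>i\<in>Basis. k_times_cont_diff k (partial_deriv i f))"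

definition test_functions :: "('a::euclidean_space \<Rightarrow> real) set" where
  "test_functions =
     {\<phi>. (\<forall>k. k_times_cont_diff k \<phi>) \<and> (\<exists>K. compact K \<and> (\<forall>x. x \<notin> K \<longrightarrow> \<phi> x = 0))}"

definition locally_integrable :: "('a::euclidean_space \<Rightarrow> real) \<Rightarrow> bool" where
  "locally_integrable f \<longleftrightarrow> (\<forall>K. compact K \<longrightarrow> set_integrable lborel K f)"

definition has_weak_deriv ::
    "'a::euclidean_space \<Rightarrow> ('a \<Rightarrow> real) \<Rightarrow> ('a \<Rightarrow> real) \<Rightarrow> bool" where
  "has_weak_deriv i f g \<longleftrightarrow>
     locally_integrable f \<and> locally_integrable g \<and>
     (\<forall>\<phi>\<in>test_functions.
        (LINT x|lborel. f x * partial_deriv i \<phi> x) = - (LINT x|lborel. g x * \<phi> x))"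

definition weakly_differentiable :: "('a::euclidean_space \<Rightarrow> real) \<Rightarrow> bool" where
  "weakly_differentiable f \<longleftrightarrow> (\<forall>i\<in>Basis. \<exists>g. has_weak_deriv i f g)"

text \<open>
  The weak derivative is unique only almost everywhere, so \<open>weak_deriv\<close> picks a representative.  It
  is meaningful only together with \<open>weakly_differentiable\<close>.
\<close>

definition weak_deriv :: "'a::euclidean_space \<Rightarrow> ('a \<Rightarrow> real) \<Rightarrow> 'a \<Rightarrow> real" where
  "weak_deriv i f = (SOME g. has_weak_deriv i f g)"

definition weak_grad :: "('a::euclidean_space \<Rightarrow> real) \<Rightarrow> 'a \<Rightarrow> 'a" where
  "weak_grad f x = (\<Sum>i\<in>Basis. weak_deriv i f x *\<^sub>R i)"

definition weak_laplacian :: "('a::euclidean_space \<Rightarrow> real) \<Rightarrow> 'a \<Rightarrow> real" where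
  "weak_laplacian f x = (\<Sum>i\<in>Basis. weak_deriv i (weak_deriv i f) x)"

definition W2p_space :: "real \<Rightarrow> ('a::euclidean_space \<Rightarrow> real) set" where
  "W2p_space p =
     {f. f \<in> Lp_space p \<and> weakly_differentiable f \<and>
         (\<forall>i\<in>Basis. weak_deriv i f \<in> Lp_space p \<and> weakly_differentiable (weak_deriv i f) \<and>
            (\<forall>j\<in>Basis. weak_deriv j (weak_deriv i f) \<in> Lp_space p))}"

definition W2p_norm :: "real \<Rightarrow> ('a::euclidean_space \<Rightarrow> real) \<Rightarrow> real" where
  "W2p_norm p f =
     Lp_norm p f + (\<Sum>i\<in>Basis. Lp_norm p (weak_deriv i f))
     + (\<Sum>i\<in>Basis. \<Sum>j\<in>Basis. Lp_norm p (weak_deriv j (weak_deriv i f)))"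

section \<open>Curves with values in these spaces\<close>

definition continuous_into_Lp ::
    "real \<Rightarrow> real set \<Rightarrow> (real \<Rightarrow> 'a::euclidean_space \<Rightarrow> real) \<Rightarrow> bool" where
  "continuous_into_Lp p T u \<longleftrightarrow>
     (\<forall>t\<in>T. u t \<in> Lp_space p \<and>
        ((\<lambda>s. Lp_norm p (\<lambda>x. u s x - u t x)) \<longlongrightarrow> 0) (at t within T))"

definition continuous_into_W2p ::
    "real \<Rightarrow> real set \<Rightarrow> (real \<Rightarrow> 'a::euclidean_space \<Rightarrow> real) \<Rightarrow> bool" where
  "continuous_into_W2p p T u \<longleftrightarrow>
     (\<forall>t\<in>T. u t \<in> W2p_space p \<and>
        ((\<lambda>s. W2p_norm p (\<lambda>x. u s x - u t x)) \<longlongrightarrow> 0) (at t within T))"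

text \<open>
  \<open>C1_into_Lp p T u v\<close>: on the open set \<open>T\<close> of times, \<open>u\<close> is continuously differentiable as a map
  into the Lebesgue space of exponent \<open>p\<close>, with derivative \<open>v\<close>.
\<close>

definition C1_into_Lp ::
    "real \<Rightarrow> real set \<Rightarrow> (real \<Rightarrow> 'a::euclidean_space \<Rightarrow> real) \<Rightarrow>
     (real \<Rightarrow> 'a \<Rightarrow> real) \<Rightarrow> bool" where
  "C1_into_Lp p T u v \<longleftrightarrow>
     continuous_into_Lp p T u \<and> continuous_into_Lp p T v \<and>
     (\<forall>t\<in>T. ((\<lambda>h. Lp_norm p (\<lambda>x. (u (t + h) x - u t x) / h - v t x)) \<longlongrightarrow> 0) (at 0))"

section \<open>The heat semigroup and the Cauchy problem\<close>

definition heat_kernel :: "real \<Rightarrow> 'a::euclidean_space \<Rightarrow> real" where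
  "heat_kernel t x =
     (4 * pi * t) powr (- (real DIM('a) / 2)) * exp (- ((norm x)\<^sup>2 / (4 * t)))"

definition heat_semigroup ::
    "real \<Rightarrow> ('a::euclidean_space \<Rightarrow> real) \<Rightarrow> 'a \<Rightarrow> real" where
  "heat_semigroup t f x = (LINT y|lborel. heat_kernel t (x - y) * f y)"

definition flux :: "real \<Rightarrow> real \<Rightarrow> real" where
  "flux q r = r * \<bar>r\<bar> powr (q - 1)"

text \<open>
  \<open>v\<close> is the time derivative of \<open>u\<close>.  Derivatives taken in Lebesgue spaces of different exponents
  agree almost everywhere, so one \<open>v\<close> serves for all \<open>p\<close>.
\<close>

definition cauchy_solution ::
    "'a::euclidean_space \<Rightarrow> real \<Rightarrow> ('a \<Rightarrow> real) \<Rightarrow> (real \<Rightarrow> 'a \<Rightarrow> real) \<Rightarrow> bool" where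
  "cauchy_solution a q u0 u \<longleftrightarrow>
     continuous_into_Lp 1 {0..} u \<and>
     (AE x in lborel. u 0 x = u0 x) \<and>
     (\<forall>p>1. continuous_into_W2p p {0<..} u) \<and>
     (\<exists>v. (\<forall>p>1. C1_into_Lp p {0<..} u v) \<and>
        (\<forall>t>0. weakly_differentiable (\<lambda>x. flux q (u t x)) \<and>
           (AE x in lborel.
              v t x - weak_laplacian (u t) x + a \<bullet> weak_grad (\<lambda>y. flux q (u t y)) x = 0)))"

end

(* Convolving the equation with the heat kernel G_e turns u into a smooth function of x whose
   time derivative is classical; the price is the commutator G_e * (u|u|^(q-1)) minus the flux of
   G_e * u, which vanishes as e tends to 0.  Testing with convex entropies and letting e tend to 0
   makes the L^1, L^q and L^infinity bounds of u nonincreasing in time.  For even powers the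
   dissipation combines with Nash's inequality; iterating over dyadic exponents and interpolating
   gives ||u(t)||_p^p <= C (t - s)^(-n(p-1)/2) ||u(s)||_1^p, independently of a.  Inserting this in
   Duhamel's inequality
     ||u(t)||_1 <= ||exp(t Laplacian) u_0||_1 + C |a| int_0^t (t - tau)^(-1/2) ||u(tau)||_q^q dtau
   improves a decay rate t^(-g/2) to t^(-min(beta, g + d)/2) for 0 < d <= n(q-1) - 1, so for
   q > 1 + 1/n finitely many steps reach t^(-beta/2).  In the critical range the same bound, with
   p = 1 + 1/(n+beta) <= q and |u|^q <= ||u_0||_infinity^(q-p) |u|^p, reproduces exactly the rate t^(-beta/2), and for
   small data the estimate with constant 2 epsilon cannot fail at a first time. *)
theory Submission
  imports Defs "HOL-Probability.Probability"
begin

section \<open>The heat kernel\<close>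

text \<open>The weak equation gives no classical derivative of an entropy, so it is differentiated
  along the convolved solution; the commutator is small in L^1 uniformly on [s,t] for s > 0 only,
  because at time 0 nothing beyond L^1 continuity is known. Estimates are therefore proved between
  positive times and reach 0 by L^1 continuity or, for the L^q norm, by writing |r|^q as a
  superposition of hinges (|r| - k)_+. The smoothing constants are free of a because the flux term
  integrates to zero against any function eta'(u).

  A bound ||u(tau)||_q^q <= K tau^(-kappa) with kappa = (1+g)/2 turns Duhamel's integral into
  t^(1/2-kappa) = t^(-g/2), and beta < 1 keeps kappa < 1, so that the singularity at tau = 0 is
  integrable. For large q smoothing alone may be too singular there; for tau <= 1 the L^q bound
  replaces it. In the critical range p solves n(p-1)/2 + beta p/2 = (1+beta)/2: smoothing is then
  integrable at 0 and contributes a multiple of epsilon^p with p > 1, which small data keep below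
  epsilon.\<close>

lemma distr_lborel_reflect:
  fixes c :: "'a::euclidean_space"
  shows "distr lborel borel (\<lambda>x. c - x) = lborel"
  by (subst (2) lborel_affine[of "-1" c]) (auto simp: density_1)

lemma nn_integral_lborel_shift:
  fixes c :: "'a::euclidean_space"
  assumes [measurable]: "f \<in> borel_measurable borel"
  shows "(\<integral>\<^sup>+x. f (x - c) \<partial>lborel) = (\<integral>\<^sup>+x. f x \<partial>lborel)"
  by (subst (2) lborel_distr_plus[of "- c", symmetric]) (simp add: nn_integral_distr)

lemma integrable_lborel_shift:
  fixes c :: "'a::euclidean_space" and f :: "'a \<Rightarrow> 'b::{banach, second_countable_topology}"
  assumes "integrable lborel f"
  shows "integrable lborel (\<lambda>x. f (x + c))" "(LINT x|lborel. f (x + c)) = (LINT x|lborel. f x)"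
proof -
  have [measurable]: "f \<in> borel_measurable borel" using assms by auto
  have "integrable (distr lborel borel ((+) c)) f" using assms by (simp add: lborel_distr_plus)
  then show "integrable lborel (\<lambda>x. f (x + c))" by (subst (asm) integrable_distr_eq) (auto simp: add.commute)
  show "(LINT x|lborel. f (x + c)) = (LINT x|lborel. f x)"
    by (subst (2) lborel_distr_plus[of c, symmetric]) (simp add: integral_distr add.commute)
qed

lemma integrable_lborel_reflect:
  fixes c :: "'a::euclidean_space" and f :: "'a \<Rightarrow> 'b::{banach, second_countable_topology}"
  assumes "integrable lborel f"
  shows "integrable lborel (\<lambda>x. f (c - x))" "(LINT x|lborel. f (c - x)) = (LINT x|lborel. f x)"
proof -
  have [measurable]: "f \<in> borel_measurable borel" using assms by auto
  have "integrable (distr lborel borel (\<lambda>x. c - x)) f" using assms by (simp add: distr_lborel_reflect)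
  then show "integrable lborel (\<lambda>x. f (c - x))" by (subst (asm) integrable_distr_eq) auto
  show "(LINT x|lborel. f (c - x)) = (LINT x|lborel. f x)"
    by (subst (2) distr_lborel_reflect[of c, symmetric]) (simp add: integral_distr)
qed

section \<open>Gaussian kernel: derivatives, mass and pointwise bounds\<close>

definition heat_grad :: "real \<Rightarrow> 'a::euclidean_space \<Rightarrow> 'a" where
  "heat_grad t x = - (heat_kernel t x / (2 * t)) *\<^sub>R x"

text \<open>The row of the Hessian of the kernel in direction \<open>i\<close>, that is the gradient
  of the component \<open>heat_grad t x \<bullet> i\<close>. Kept as a vector, it makes second
  derivatives one more instance of convolution with a vector kernel.\<close>

definition heat_hess :: "real \<Rightarrow> 'a \<Rightarrow> 'a::euclidean_space \<Rightarrow> 'a" where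
  "heat_hess t i x = heat_kernel t x *\<^sub>R ((x \<bullet> i / (4 * t\<^sup>2)) *\<^sub>R x - (1 / (2 * t)) *\<^sub>R i)"

text \<open>Plays two roles: it is the trace of the Hessian rows and, since the kernel solves the
  heat equation, also its time derivative.\<close>

definition heat_lapl :: "real \<Rightarrow> 'a::euclidean_space \<Rightarrow> real" where
  "heat_lapl t x = heat_kernel t x * ((norm x)\<^sup>2 / (4 * t\<^sup>2) - real DIM('a) / (2 * t))"

text \<open>No sign condition on \<open>t\<close>: at \<open>t = 0\<close> the totalised division
  makes the function constant. Measurability of the kernels is therefore unconditional.\<close>

lemma continuous_on_heat_kernel [continuous_intros]: "continuous_on S (heat_kernel t)"
  unfolding heat_kernel_def by (cases "t = 0") (auto intro!: continuous_intros)

lemma continuous_on_heat_grad: "continuous_on S (heat_grad t)"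
  unfolding heat_grad_def by (cases "t = 0") (auto intro!: continuous_intros)

lemma continuous_on_heat_hess: "continuous_on S (heat_hess t i)"
  unfolding heat_hess_def by (cases "t = 0") (auto intro!: continuous_intros)

lemma continuous_on_heat_lapl: "continuous_on S (heat_lapl t)"
  unfolding heat_lapl_def by (cases "t = 0") (auto intro!: continuous_intros)

lemma heat_measurable [measurable]:
  "heat_kernel t \<in> borel_measurable borel" "heat_grad t \<in> borel_measurable borel"
  "heat_hess t i \<in> borel_measurable borel" "heat_lapl t \<in> borel_measurable borel"
  by (auto intro!: borel_measurable_continuous_onI continuous_on_heat_kernel continuous_on_heat_grad
      continuous_on_heat_hess continuous_on_heat_lapl)

lemma heat_kernel_nonneg [simp]: "heat_kernel t x \<ge> 0"
  unfolding heat_kernel_def by simp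

lemma heat_kernel_minus: "heat_kernel t (- x) = heat_kernel t x"
  by (simp add: heat_kernel_def)

lemma heat_kernel_le:
  fixes x :: "'a::euclidean_space"
  assumes "t > 0"
  shows "heat_kernel t x \<le> (4 * pi * t) powr (- (real DIM('a) / 2))"
  using assms unfolding heat_kernel_def by (intro mult_left_le) auto

text \<open>Factorising into one-dimensional normal densities of variance 2t reduces the mass of the
  kernel to the known mass of a normal density.\<close>

lemma heat_kernel_eq_prod:
  fixes x :: "'a::euclidean_space"
  assumes "t > 0"
  shows "heat_kernel t x = (\<Prod>b\<in>Basis. normal_density 0 (sqrt (2 * t)) (x \<bullet> b))"
proof -
  have "(\<Prod>b\<in>(Basis::'a set). normal_density 0 (sqrt (2 * t)) (x \<bullet> b))
    = (1 / sqrt (4 * pi * t)) ^ DIM('a) * exp (\<Sum>b\<in>Basis. - (x \<bullet> b)\<^sup>2 / (4 * t))"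
    using assms by (simp add: normal_density_def prod.distrib exp_sum power_divide prod_dividef mult.assoc)
  also have "(1 / sqrt (4 * pi * t)) ^ DIM('a) = (4 * pi * t) powr (- (real DIM('a) / 2))"
  proof -
    have "1 / sqrt (4 * pi * t) = (4 * pi * t) powr (- (1/2))"
      using assms by (simp add: powr_minus powr_half_sqrt field_simps)
    then have "(1 / sqrt (4 * pi * t)) ^ DIM('a) = ((4 * pi * t) powr (- (1/2))) powr real DIM('a)"
      using assms by (simp only:) (simp add: powr_realpow)
    then show ?thesis by (simp add: powr_powr)
  qed
  also have "(\<Sum>b\<in>Basis. - (x \<bullet> b)\<^sup>2 / (4 * t)) = - ((norm x)\<^sup>2 / (4 * t))"
    unfolding power2_norm_eq_inner euclidean_inner[of x x] by (simp add: sum_negf sum_divide_distrib power2_eq_square)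
  finally show ?thesis by (simp add: heat_kernel_def)
qed

lemma nn_integral_heat_kernel:
  assumes "t > 0"
  shows "(\<integral>\<^sup>+x. heat_kernel t (x::'a::euclidean_space) \<partial>lborel) = 1"
proof -
  have "(\<integral>\<^sup>+x. heat_kernel t (x::'a) \<partial>lborel)
    = (\<integral>\<^sup>+x. (\<Prod>b\<in>(Basis::'a set). ennreal (normal_density 0 (sqrt (2 * t)) (x \<bullet> b))) \<partial>lborel)"
    using assms by (simp add: heat_kernel_eq_prod prod_ennreal)
  also have "\<dots> = (\<Prod>b\<in>(Basis::'a set). \<integral>\<^sup>+x. ennreal (normal_density 0 (sqrt (2 * t)) x) \<partial>lborel)"
    by (rule nn_integral_lborel_prod) auto
  also have "(\<integral>\<^sup>+x. ennreal (normal_density 0 (sqrt (2 * t)) x) \<partial>lborel) = 1"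
    using assms by (subst nn_integral_eq_integral) auto
  finally show ?thesis by simp
qed

lemma integrable_heat_kernel [simp]:
  assumes "t > 0" shows "integrable lborel (heat_kernel t :: 'a::euclidean_space \<Rightarrow> real)"
  using nn_integral_heat_kernel[OF assms, where 'a='a] by (intro integrableI_nonneg) auto

lemma integral_heat_kernel [simp]:
  assumes "t > 0" shows "(LINT x|lborel. heat_kernel t (x::'a::euclidean_space)) = 1"
  using nn_integral_heat_kernel[OF assms, where 'a='a] by (subst integral_eq_nn_integral) auto

text \<open>Passing to twice the time leaves a spare Gaussian factor, which can absorb the
  polynomial factors produced by differentiation while a heat kernel of known mass survives.\<close>

lemma heat_kernel_double:
  fixes x :: "'a::euclidean_space"
  assumes "t > 0"
  shows "heat_kernel t x = 2 powr (real DIM('a) / 2) * heat_kernel (2 * t) x * exp (- ((norm x)\<^sup>2 / (8 * t)))"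
proof -
  have "(4 * pi * t) powr (- (real DIM('a) / 2)) = 2 powr (real DIM('a) / 2) * (4 * pi * (2 * t)) powr (- (real DIM('a) / 2))"
  proof -
    have "(4 * pi * (2 * t)) powr (- (real DIM('a) / 2)) = 2 powr (- (real DIM('a) / 2)) * (4 * pi * t) powr (- (real DIM('a) / 2))"
      using assms by (subst powr_mult[symmetric]) (auto simp: mult_ac)
    then show ?thesis by (simp add: powr_minus)
  qed
  moreover have "exp (- ((norm x)\<^sup>2 / (4 * t))) = exp (- ((norm x)\<^sup>2 / (4 * (2 * t)))) * exp (- ((norm x)\<^sup>2 / (8 * t)))"
    by (simp flip: exp_add)
  ultimately show ?thesis by (simp add: heat_kernel_def)
qed

lemma mult_exp_minus_le_1: "z * exp (- z) \<le> (1::real)"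
proof -
  have "z \<le> exp z" by (rule order_trans[OF _ exp_ge_add_one_self]) simp
  then show ?thesis by (simp add: exp_minus field_simps)
qed

text \<open>With z = |x|^2/(8t) the spare factor is exp(-z), and z exp(-z) <= 1 absorbs |x|^2; for
  |x| the same bound is applied to the square.\<close>

lemma norm_times_heat_kernel_le:
  fixes x :: "'a::euclidean_space"
  assumes "t > 0"
  shows "norm x * heat_kernel t x \<le> 2 powr (real DIM('a) / 2) * sqrt (8 * t) * heat_kernel (2 * t) x"
    "(norm x)\<^sup>2 * heat_kernel t x \<le> 2 powr (real DIM('a) / 2) * (8 * t) * heat_kernel (2 * t) x"
    "heat_kernel t x \<le> 2 powr (real DIM('a) / 2) * heat_kernel (2 * t) x"
proof -
  define z where "z = (norm x)\<^sup>2 / (8 * t)"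
  have z: "z \<ge> 0" using assms by (simp add: z_def)
  have e1: "exp (- z) \<le> 1" using z by simp
  have n2: "(norm x)\<^sup>2 = 8 * t * z" using assms by (simp add: z_def)
  have "(norm x * exp (- z))\<^sup>2 = 8 * t * (z * exp (- z)) * exp (- z)"
    by (simp add: power_mult_distrib n2 power2_eq_square[of "exp _"])
  also have "\<dots> \<le> 8 * t * 1 * 1"
    using assms e1 mult_exp_minus_le_1[of z] z by (intro mult_mono) auto
  finally have 1: "norm x * exp (- z) \<le> sqrt (8 * t)" by (simp add: real_le_rsqrt)
  have 2: "(norm x)\<^sup>2 * exp (- z) \<le> 8 * t"
    using mult_left_mono[OF mult_exp_minus_le_1[of z], of "8 * t"] assms by (simp add: n2 mult.assoc)
  let ?c = "2 powr (real DIM('a) / 2) * heat_kernel (2 * t) x"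
  have c: "?c \<ge> 0" by simp
  have eq: "heat_kernel t x = ?c * exp (- z)"
    using heat_kernel_double[OF assms, of x] by (simp add: z_def)
  show "norm x * heat_kernel t x \<le> 2 powr (real DIM('a) / 2) * sqrt (8 * t) * heat_kernel (2 * t) x"
    using mult_left_mono[OF 1 c] by (simp add: eq mult_ac)
  show "(norm x)\<^sup>2 * heat_kernel t x \<le> 2 powr (real DIM('a) / 2) * (8 * t) * heat_kernel (2 * t) x"
    using mult_left_mono[OF 2 c] by (simp add: eq mult_ac)
  show "heat_kernel t x \<le> 2 powr (real DIM('a) / 2) * heat_kernel (2 * t) x"
    using mult_left_mono[OF e1 c] by (simp add: eq mult_ac)
qed

text \<open>One constant for gradient, Hessian rows and Laplacian: the computations give the factors
  sqrt 2, 5/2 and 2 + n/2, all below 3 + n.\<close>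

definition heat_const :: "'a::euclidean_space itself \<Rightarrow> real" where
  "heat_const _ = 2 powr (real DIM('a) / 2) * (3 + real DIM('a))"

lemma heat_const_pos: "heat_const TYPE('a::euclidean_space) > 0"
  by (simp add: heat_const_def add_pos_nonneg)

lemma heat_grad_bound:
  fixes x :: "'a::euclidean_space"
  assumes "t > 0"
  shows "norm (heat_grad t x) \<le> heat_const TYPE('a) / sqrt t * heat_kernel (2 * t) x"
proof -
  have "norm (heat_grad t x) = (norm x * heat_kernel t x) / (2 * t)"
    using assms by (simp add: heat_grad_def)
  also have "\<dots> \<le> (2 powr (real DIM('a) / 2) * sqrt (8 * t) * heat_kernel (2 * t) x) / (2 * t)"
    using assms by (intro divide_right_mono norm_times_heat_kernel_le) auto
  also have "\<dots> = 2 powr (real DIM('a) / 2) * (sqrt (8 * t) / (2 * t)) * heat_kernel (2 * t) x"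
    by simp
  also have "sqrt (8 * t) / (2 * t) = sqrt 2 / sqrt t"
  proof -
    have "sqrt (8 * t) = 2 * sqrt 2 * sqrt t" 
      using real_sqrt_mult[of 4 2] by (simp add: real_sqrt_mult)
    moreover have "t = sqrt t * sqrt t" using assms by simp
    ultimately show ?thesis using assms by (simp add: field_simps)
  qed
  also have "2 powr (real DIM('a) / 2) * (sqrt 2 / sqrt t) * heat_kernel (2 * t) x
      \<le> 2 powr (real DIM('a) / 2) * ((3 + real DIM('a)) / sqrt t) * heat_kernel (2 * t) x"
  proof -
    have "sqrt 2 \<le> (2::real)" by (rule real_le_lsqrt) auto
    then show ?thesis using assms
      by (intro mult_left_mono mult_right_mono divide_right_mono) auto
  qed
  finally show ?thesis by (simp add: heat_const_def mult_ac)
qed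

lemma heat_hess_bound:
  fixes x :: "'a::euclidean_space"
  assumes "t > 0"
  shows "norm (heat_hess t i x) \<le> heat_const TYPE('a) / t * norm i * heat_kernel (2 * t) x"
proof -
  let ?c = "2 powr (real DIM('a) / 2)"
  have "norm (heat_hess t i x) \<le> heat_kernel t x * ((\<bar>x \<bullet> i\<bar> / (4 * t\<^sup>2)) * norm x + (1 / (2 * t)) * norm i)"
    unfolding heat_hess_def norm_scaleR using assms
    by (intro mult_mono order_trans[OF norm_triangle_ineq4]) auto
  also have "\<dots> \<le> heat_kernel t x * ((norm x * norm i / (4 * t\<^sup>2)) * norm x + (1 / (2 * t)) * norm i)"
    using assms by (intro mult_left_mono add_mono mult_right_mono divide_right_mono) (auto simp: Cauchy_Schwarz_ineq2)
  also have "\<dots> = norm i * (((norm x)\<^sup>2 * heat_kernel t x) / (4 * t\<^sup>2) + heat_kernel t x / (2 * t))"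
    by (simp add: algebra_simps power2_eq_square)
  also have "\<dots> \<le> norm i * ((?c * (8 * t) * heat_kernel (2 * t) x) / (4 * t\<^sup>2) + (?c * heat_kernel (2 * t) x) / (2 * t))"
    using assms by (intro mult_left_mono add_mono divide_right_mono norm_times_heat_kernel_le) auto
  also have "\<dots> = norm i * (?c * (5/2) / t * heat_kernel (2 * t) x)"
    using assms by (simp add: field_simps power2_eq_square)
  also have "\<dots> \<le> norm i * (?c * (3 + real DIM('a)) / t * heat_kernel (2 * t) x)"
    using assms by (intro mult_left_mono mult_right_mono divide_right_mono) auto
  finally show ?thesis by (simp add: heat_const_def mult_ac)
qed

lemma heat_lapl_bound:
  fixes x :: "'a::euclidean_space"
  assumes "t > 0"
  shows "\<bar>heat_lapl t x\<bar> \<le> heat_const TYPE('a) / t * heat_kernel (2 * t) x"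
proof -
  let ?c = "2 powr (real DIM('a) / 2)"
  have "\<bar>heat_lapl t x\<bar> \<le> heat_kernel t x * ((norm x)\<^sup>2 / (4 * t\<^sup>2) + real DIM('a) / (2 * t))"
    unfolding heat_lapl_def abs_mult using assms
    by (intro mult_mono order_trans[OF abs_triangle_ineq4]) auto
  also have "\<dots> = (((norm x)\<^sup>2 * heat_kernel t x) / (4 * t\<^sup>2) + real DIM('a) * heat_kernel t x / (2 * t))"
    by (simp add: algebra_simps power2_eq_square)
  also have "\<dots> \<le> ((?c * (8 * t) * heat_kernel (2 * t) x) / (4 * t\<^sup>2) + real DIM('a) * (?c * heat_kernel (2 * t) x) / (2 * t))"
    using assms by (intro mult_left_mono add_mono divide_right_mono norm_times_heat_kernel_le) auto
  also have "\<dots> = (?c * (2 + real DIM('a) / 2) / t * heat_kernel (2 * t) x)"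
    using assms by (simp add: field_simps power2_eq_square)
  also have "\<dots> \<le> (?c * (3 + real DIM('a)) / t * heat_kernel (2 * t) x)"
    using assms by (intro mult_left_mono mult_right_mono divide_right_mono) auto
  finally show ?thesis by (simp add: heat_const_def mult_ac)
qed

lemma heat_kernel_has_derivative:
  assumes "t > 0"
  shows "(heat_kernel t has_derivative (\<lambda>h. heat_grad t x \<bullet> h)) (at x)"
proof -
  have "((\<lambda>x. - ((x \<bullet> x) / (4 * t))) has_derivative (\<lambda>h. - ((x \<bullet> h + h \<bullet> x) / (4 * t)))) (at x)"
    unfolding divide_inverse
    by (intro has_derivative_minus has_derivative_mult_left has_derivative_inner has_derivative_ident)
  note has_derivative_exp[OF this]
  from has_derivative_mult_right[OF this, of "(4 * pi * t) powr (- (real DIM('a) / 2))"] show ?thesis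
    unfolding heat_kernel_def[abs_def] power2_norm_eq_inner
    by (rule has_derivative_eq_rhs)
      (use assms in \<open>simp add: fun_eq_iff heat_grad_def heat_kernel_def power2_norm_eq_inner inner_commute field_simps\<close>)
qed

lemma heat_grad_has_derivative:
  assumes "t > 0"
  shows "((\<lambda>x. heat_grad t x \<bullet> i) has_derivative (\<lambda>h. heat_hess t i x \<bullet> h)) (at x)"
proof -
  have "((\<lambda>x. heat_kernel t x * (x \<bullet> i)) has_derivative
      (\<lambda>h. heat_kernel t x * (h \<bullet> i) + (heat_grad t x \<bullet> h) * (x \<bullet> i))) (at x)"
    by (intro has_derivative_mult heat_kernel_has_derivative[OF assms] has_derivative_inner_left has_derivative_ident)
  from has_derivative_mult_right[OF this, of "- 1 / (2 * t)"] show ?thesis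
    unfolding heat_grad_def inner_scaleR_left
    by (rule back_subst[where P = "\<lambda>D. (_ has_derivative D) _", OF back_subst[where P = "\<lambda>f. (f has_derivative _) _"]])
      (use assms in \<open>auto simp: fun_eq_iff heat_hess_def heat_grad_def inner_diff_left inner_diff_right inner_commute power2_eq_square field_simps\<close>)
qed

lemma heat_lapl_eq_sum:
  assumes "t > 0"
  shows "(\<Sum>i\<in>Basis. heat_hess t i x \<bullet> i) = heat_lapl t x"
proof -
  have "(\<Sum>i\<in>Basis. heat_hess t i x \<bullet> i)
     = heat_kernel t x * ((\<Sum>i\<in>Basis. (x \<bullet> i) * (x \<bullet> i)) / (4 * t\<^sup>2) - (\<Sum>i\<in>(Basis::'a set). i \<bullet> i) / (2 * t))"
    by (simp add: heat_hess_def inner_diff_left right_diff_distrib sum_subtractf sum_distrib_left sum_divide_distrib)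
  also have "(\<Sum>i\<in>Basis. (x \<bullet> i) * (x \<bullet> i)) = (norm x)\<^sup>2"
    by (simp add: power2_norm_eq_inner euclidean_inner[of x x])
  finally show ?thesis by (simp add: heat_lapl_def)
qed

lemma heat_kernel_has_time_derivative:
  fixes x :: "'a::euclidean_space"
  assumes "t > 0"
  shows "((\<lambda>t. heat_kernel t x) has_real_derivative heat_lapl t x) (at t)"
proof -
  have p: "(4 * pi * t) powr (- (real DIM('a) / 2) - of_nat 1) = (4 * pi * t) powr (- (real DIM('a) / 2)) / (4 * pi * t)"
    using assms by (simp add: powr_diff)
  have 1: "((\<lambda>t. (4 * pi * t) powr (- (real DIM('a) / 2))) has_real_derivative
     (- (real DIM('a) / 2)) * (4 * pi * t) powr (- (real DIM('a) / 2) - of_nat 1) * (4 * pi)) (at t)"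
    by (rule DERIV_fun_powr) (use assms in \<open>auto intro!: derivative_eq_intros\<close>)
  have 2: "((\<lambda>t. exp (- ((norm x)\<^sup>2 / (4 * t)))) has_real_derivative
     exp (- ((norm x)\<^sup>2 / (4 * t))) * ((norm x)\<^sup>2 / (4 * t\<^sup>2))) (at t)"
    using assms by (auto intro!: derivative_eq_intros simp: power2_eq_square field_simps)
  from DERIV_mult[OF 1[unfolded p] 2] show ?thesis
    unfolding heat_kernel_def[abs_def]
    by (rule back_subst[where P = "\<lambda>D. (_ has_real_derivative D) _"])
      (use assms in \<open>simp add: heat_lapl_def heat_kernel_def field_simps power2_eq_square\<close>)
qed

section \<open>Convolution\<close>

lemma integrable_dominated:
  fixes f :: "'a \<Rightarrow> 'b::{banach, second_countable_topology}" and g :: "'a \<Rightarrow> real"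
  assumes "integrable M g" "f \<in> borel_measurable M" "\<And>x. norm (f x) \<le> g x"
  shows "integrable M f"
  by (rule Bochner_Integration.integrable_bound[OF assms(1,2)])
    (use assms(3) in \<open>auto intro!: AE_I2 intro: order_trans[OF _ abs_ge_self]\<close>)

lemma integral_abs_mono:
  fixes f g :: "'a \<Rightarrow> real"
  assumes "integrable M g" "f \<in> borel_measurable M" "\<And>x. \<bar>f x\<bar> \<le> g x"
  shows "integrable M f" "\<bar>LINT x|M. f x\<bar> \<le> (LINT x|M. g x)" "(LINT x|M. \<bar>f x\<bar>) \<le> (LINT x|M. g x)"
proof -
  show f: "integrable M f" using integrable_dominated[OF assms(1,2)] assms(3) by auto
  show le: "(LINT x|M. \<bar>f x\<bar>) \<le> (LINT x|M. g x)"
    using assms f by (intro integral_mono) auto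
  show "\<bar>LINT x|M. f x\<bar> \<le> (LINT x|M. g x)"
    using integral_abs_bound[of M f] le by linarith
qed

text \<open>The kernel may take values in a Banach space, so the scalar kernel, its gradient and its
  Hessian rows share one set of lemmas; the convolved function stays scalar.\<close>

definition conv :: "('a::euclidean_space \<Rightarrow> 'b::{banach, second_countable_topology}) \<Rightarrow> ('a \<Rightarrow> real) \<Rightarrow> 'a \<Rightarrow> 'b" where
  "conv K f x = (LINT y|lborel. f y *\<^sub>R K (x - y))"

lemma heat_semigroup_eq_conv: "heat_semigroup t f = conv (heat_kernel t) f"
  by (simp add: heat_semigroup_def conv_def fun_eq_iff mult.commute)

lemma conv_integrand:
  fixes K :: "'a::euclidean_space \<Rightarrow> 'b::{banach, second_countable_topology}"
  assumes f: "integrable lborel f" and K [measurable]: "K \<in> borel_measurable borel"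
    and B: "\<And>z. norm (K z) \<le> B"
  shows "integrable lborel (\<lambda>y. f y *\<^sub>R K (x - y))"
proof -
  have [measurable]: "f \<in> borel_measurable borel" using f by auto
  show ?thesis
  proof (rule integrable_dominated[where g = "\<lambda>y. \<bar>f y\<bar> * B"])
    show "norm (f y *\<^sub>R K (x - y)) \<le> \<bar>f y\<bar> * B" for y
      using B by (simp add: mult_left_mono)
  qed (use f in auto)
qed

lemma conv_bound:
  fixes K :: "'a::euclidean_space \<Rightarrow> 'b::{banach, second_countable_topology}"
  assumes f: "integrable lborel f" and K [measurable]: "K \<in> borel_measurable borel"
    and B: "\<And>z. norm (K z) \<le> B"
  shows "norm (conv K f x) \<le> B * (LINT y|lborel. \<bar>f y\<bar>)"
proof -
  have "norm (conv K f x) \<le> (LINT y|lborel. norm (f y *\<^sub>R K (x - y)))"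
    unfolding conv_def by (rule integral_norm_bound)
  also have "\<dots> \<le> (LINT y|lborel. \<bar>f y\<bar> * B)"
    using B by (intro integral_mono integrable_norm conv_integrand[OF f K B] integrable_mult_left integrable_abs f)
      (auto intro!: mult_left_mono)
  finally show ?thesis by (simp add: mult.commute)
qed

lemma conv_measurable [measurable]:
  fixes K :: "'a::euclidean_space \<Rightarrow> 'b::{banach, second_countable_topology}"
  assumes [measurable]: "f \<in> borel_measurable borel" "K \<in> borel_measurable borel"
  shows "conv K f \<in> borel_measurable borel"
  unfolding conv_def[abs_def] by measurable

lemma continuous_on_conv:
  fixes K :: "'a::euclidean_space \<Rightarrow> 'b::{banach, second_countable_topology}"
  assumes f: "integrable lborel f" and K: "continuous_on UNIV K" and B: "\<And>z. norm (K z) \<le> B"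
  shows "continuous_on UNIV (conv K f)"
proof (rule continuous_at_imp_continuous_on, rule ballI)
  fix x
  have [measurable]: "f \<in> borel_measurable borel" using f by auto
  have Km [measurable]: "K \<in> borel_measurable borel" using K by (rule borel_measurable_continuous_onI)
  show "isCont (conv K f) x"
    unfolding continuous_at_sequentially o_def conv_def
  proof (intro allI impI integral_dominated_convergence[where w = "\<lambda>y. \<bar>f y\<bar> * B"])
    fix u :: "nat \<Rightarrow> 'a" assume u: "u \<longlonglongrightarrow> x"
    show "AE y in lborel. (\<lambda>n. f y *\<^sub>R K (u n - y)) \<longlonglongrightarrow> f y *\<^sub>R K (x - y)"
      using K by (intro AE_I2 tendsto_intros isCont_tendsto_compose[of _ K] u)
        (auto simp: continuous_on_eq_continuous_at)
    show "AE y in lborel. norm (f y *\<^sub>R K (u n - y)) \<le> \<bar>f y\<bar> * B" for n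
      using B by (auto intro!: AE_I2 mult_left_mono)
  qed (use f in auto)
qed

text \<open>Young's inequality for L^1, by Tonelli and translation invariance; working with
  nonnegative integrals first yields integrability as well.\<close>

lemma conv_L1:
  fixes K :: "'a::euclidean_space \<Rightarrow> 'b::{banach, second_countable_topology}"
  assumes f: "integrable lborel f" and K: "integrable lborel K"
  shows "integrable lborel (conv K f)"
    "(LINT x|lborel. norm (conv K f x)) \<le> (LINT x|lborel. norm (K x)) * (LINT x|lborel. \<bar>f x\<bar>)"
proof -
  have fm [measurable]: "f \<in> borel_measurable borel" using f by auto
  have Km [measurable]: "K \<in> borel_measurable borel" using K by auto
  have "(\<integral>\<^sup>+x. norm (conv K f x) \<partial>lborel) \<le> (\<integral>\<^sup>+x. (\<integral>\<^sup>+y. ennreal \<bar>f y\<bar> * norm (K (x - y)) \<partial>lborel) \<partial>lborel)"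
  proof (rule nn_integral_mono)
    fix x
    show "ennreal (norm (conv K f x)) \<le> (\<integral>\<^sup>+y. ennreal \<bar>f y\<bar> * norm (K (x - y)) \<partial>lborel)"
    proof (cases "integrable lborel (\<lambda>y. f y *\<^sub>R K (x - y))")
      case True
      have "ennreal (norm (conv K f x)) \<le> (\<integral>\<^sup>+y. norm (f y *\<^sub>R K (x - y)) \<partial>lborel)"
        unfolding conv_def by (rule integral_norm_bound_ennreal[OF True])
      then show ?thesis by (simp add: ennreal_mult)
    next
      \<comment> \<open>Where the integrand is not integrable, the Bochner integral is 0 by default
        and the bound is trivial.\<close>
      case False
      then show ?thesis by (simp add: conv_def not_integrable_integral_eq)
    qed
  qed
  also have "\<dots> = (\<integral>\<^sup>+y. (\<integral>\<^sup>+x. ennreal \<bar>f y\<bar> * norm (K (x - y)) \<partial>lborel) \<partial>lborel)"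
    by (rule lborel_pair.Fubini') measurable
  also have "\<dots> = (\<integral>\<^sup>+y. ennreal \<bar>f y\<bar> * (\<integral>\<^sup>+x. norm (K x) \<partial>lborel) \<partial>lborel)"
    by (subst nn_integral_cmult)
      (auto intro!: nn_integral_cong simp: nn_integral_lborel_shift[where f = "\<lambda>x. ennreal (norm (K x))"])
  also have "\<dots> = (\<integral>\<^sup>+y. \<bar>f y\<bar> \<partial>lborel) * (\<integral>\<^sup>+x. norm (K x) \<partial>lborel)"
    by (rule nn_integral_multc) auto
  also have "\<dots> = ennreal ((LINT x|lborel. norm (K x)) * (LINT x|lborel. \<bar>f x\<bar>))"
    using f K by (simp add: nn_integral_eq_integral ennreal_mult mult.commute)
  finally have le: "(\<integral>\<^sup>+x. norm (conv K f x) \<partial>lborel) \<le> ennreal ((LINT x|lborel. norm (K x)) * (LINT x|lborel. \<bar>f x\<bar>))" .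
  show i: "integrable lborel (conv K f)"
    by (rule integrableI_bounded) (use le in \<open>auto simp: le_less_trans[OF _ ennreal_less_top]\<close>)
  have "ennreal (LINT x|lborel. norm (conv K f x)) = (\<integral>\<^sup>+x. norm (conv K f x) \<partial>lborel)"
    by (rule nn_integral_eq_integral[symmetric]) (use i in auto)
  moreover have "0 \<le> (LINT x|lborel. norm (K x)) * (LINT x|lborel. \<bar>f x\<bar>)" by (intro mult_nonneg_nonneg) auto
  ultimately show "(LINT x|lborel. norm (conv K f x)) \<le> (LINT x|lborel. norm (K x)) * (LINT x|lborel. \<bar>f x\<bar>)"
    using le by (metis ennreal_le_iff)
qed

text \<open>Differentiation under the integral by dominated convergence: the remainder quotient
  tends to 0 pointwise and is at most 2 B' |f|, since \<open>K\<close> is B'-Lipschitz by the mean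
  value inequality.\<close>

lemma conv_has_derivative:
  fixes K :: "'a::euclidean_space \<Rightarrow> real" and D :: "'a \<Rightarrow> 'a"
  assumes f: "integrable lborel f"
    and K: "\<And>z. (K has_derivative (\<lambda>h. D z \<bullet> h)) (at z)"
    and KB: "\<And>z. \<bar>K z\<bar> \<le> B" and D: "continuous_on UNIV D" and DB: "\<And>z. norm (D z) \<le> B'"
  shows "(conv K f has_derivative (\<lambda>h. conv D f x \<bullet> h)) (at x)"
proof -
  have [measurable]: "f \<in> borel_measurable borel" using f by auto
  have [measurable]: "D \<in> borel_measurable borel" using D by (rule borel_measurable_continuous_onI)
  have "continuous_on UNIV K" using K
    by (meson continuous_at_imp_continuous_on has_derivative_continuous)
  then have Km [measurable]: "K \<in> borel_measurable borel" by (rule borel_measurable_continuous_onI)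
  have Ki: "integrable lborel (\<lambda>y. f y *\<^sub>R K (x - y))" for x
    by (rule conv_integrand[OF f, where B = B]) (use KB in auto)
  have Di: "integrable lborel (\<lambda>y. f y *\<^sub>R D (x - y))" for x
    by (rule conv_integrand[OF f, where B = B']) (use DB in auto)
  have lip: "\<bar>K (z + h) - K z\<bar> \<le> B' * norm h" for z h
  proof -
    have "norm (K (z + h) - K z) \<le> B' * norm (z + h - z)"
    proof (rule differentiable_bound[where S = UNIV])
      show "(K has_derivative (\<lambda>h. D w \<bullet> h)) (at w within UNIV)" for w using K by simp
      show "onorm (\<lambda>h. D w \<bullet> h) \<le> B'" for w
        by (rule onorm_le) (metis DB Cauchy_Schwarz_ineq2 mult_right_mono norm_ge_zero order_trans real_norm_def)
    qed auto
    then show ?thesis by simp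
  qed
  show ?thesis
    unfolding has_derivative_at
  proof (intro conjI)
    show "bounded_linear (\<lambda>h. conv D f x \<bullet> h)" by (rule bounded_linear_inner_right)
    show "(\<lambda>h. norm (conv K f (x + h) - conv K f x - conv D f x \<bullet> h) / norm h) \<midarrow>0\<rightarrow> 0"
    proof (subst tendsto_at_iff_sequentially, intro allI impI)
      fix X :: "nat \<Rightarrow> 'a" assume X0: "\<forall>i. X i \<in> UNIV - {0}" and X: "X \<longlonglongrightarrow> 0"
      let ?R = "\<lambda>n y. f y * ((K (x + X n - y) - K (x - y) - D (x - y) \<bullet> X n) / norm (X n))"
      have "(\<lambda>n. LINT y|lborel. ?R n y) \<longlonglongrightarrow> (LINT y|(lborel::'a measure). (0::real))"
      proof (rule integral_dominated_convergence[where w = "\<lambda>y. 2 * B' * \<bar>f y\<bar>"] )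
        show "AE y in lborel. (\<lambda>n. ?R n y) \<longlonglongrightarrow> 0"
        proof (rule AE_I2, rule tendsto_mult_right_zero)
          fix y
          have "(\<lambda>h. (K (x - y + h) - K (x - y) - D (x - y) \<bullet> h) / norm h) \<midarrow>0\<rightarrow> 0"
            using K[of "x - y"] unfolding has_derivative_at
            by (subst tendsto_norm_zero_iff[symmetric]) simp
          with X X0 have "(\<lambda>n. (K (x - y + X n) - K (x - y) - D (x - y) \<bullet> X n) / norm (X n)) \<longlonglongrightarrow> 0"
            by (subst (asm) tendsto_at_iff_sequentially) (auto simp: o_def)
          then show "(\<lambda>n. (K (x + X n - y) - K (x - y) - D (x - y) \<bullet> X n) / norm (X n)) \<longlonglongrightarrow> 0"
            by (simp add: algebra_simps)
        qed
        show "AE y in lborel. norm (?R n y) \<le> 2 * B' * \<bar>f y\<bar>" for n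
        proof (rule AE_I2)
          fix y
          have n0: "norm (X n) > 0" using X0 by auto
          have "\<bar>D (x - y) \<bullet> X n\<bar> \<le> B' * norm (X n)"
            using DB[of "x - y"] Cauchy_Schwarz_ineq2[of "D (x - y)" "X n"]
            by (meson mult_right_mono norm_ge_zero order_trans)
          moreover have "\<bar>K (x + X n - y) - K (x - y)\<bar> \<le> B' * norm (X n)"
            using lip[of "x - y" "X n"] by (simp add: algebra_simps)
          ultimately have "\<bar>K (x + X n - y) - K (x - y) - D (x - y) \<bullet> X n\<bar> / norm (X n) \<le> 2 * B'"
            using n0 by (simp add: divide_le_eq)
          then have "\<bar>f y\<bar> * (\<bar>K (x + X n - y) - K (x - y) - D (x - y) \<bullet> X n\<bar> / norm (X n)) \<le> \<bar>f y\<bar> * (2 * B')"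
            by (intro mult_left_mono) auto
          then show "norm (?R n y) \<le> 2 * B' * \<bar>f y\<bar>" by (simp add: abs_mult mult.commute)
        qed
      qed (use f in auto)
      then have "(\<lambda>n. \<bar>LINT y|lborel. ?R n y\<bar>) \<longlonglongrightarrow> 0"
        by (intro tendsto_rabs_zero) simp
      moreover have "norm (conv K f (x + X n) - conv K f x - conv D f x \<bullet> X n) / norm (X n) = \<bar>LINT y|lborel. ?R n y\<bar>" for n
      proof -
        have "conv D f x \<bullet> X n = (LINT y|lborel. f y * (D (x - y) \<bullet> X n))"
          unfolding conv_def using Di[of x] by (subst integral_inner_left[symmetric]) auto
        moreover have "integrable lborel (\<lambda>y. f y * (D (x - y) \<bullet> X n))"
          using integrable_inner_left[of "X n", OF Di[of x]] by simp
        ultimately have eq: "conv K f (x + X n) - conv K f x - conv D f x \<bullet> X n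
           = (LINT y|lborel. f y * K (x + X n - y) - f y * K (x - y) - f y * (D (x - y) \<bullet> X n))"
          unfolding conv_def using Ki by simp
        then have "(conv K f (x + X n) - conv K f x - conv D f x \<bullet> X n) / norm (X n)
           = (LINT y|lborel. ?R n y)"
        proof -
          have "?R n y = (f y * K (x + X n - y) - f y * K (x - y) - f y * (D (x - y) \<bullet> X n)) / norm (X n)" for y
            by (simp add: right_diff_distrib)
          then show ?thesis
            by (simp only: eq integral_divide_zero)
        qed
        then show ?thesis by (metis abs_divide abs_norm_cancel real_norm_def)
      qed
      ultimately show "((\<lambda>h. norm (conv K f (x + h) - conv K f x - conv D f x \<bullet> h) / norm h) \<circ> X) \<longlonglongrightarrow> 0"
        by (simp only: o_def)
    qed
  qed
qed

text \<open>Convexity of r^p in tangent form, read off Young's inequality for the product r *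
  c^(p-1) with conjugate exponent p' = p/(p-1).\<close>

lemma powr_tangent_le:
  fixes r c p :: real
  assumes "p \<ge> 1" "r \<ge> 0" "c \<ge> 0"
  shows "c powr p + p * c powr (p - 1) * (r - c) \<le> r powr p"
proof (cases "p = 1 \<or> c = 0")
  case True
  then show ?thesis using assms by (auto simp: powr_one_gt_zero_iff split: if_splits)
next
  case False
  define p' where "p' = p / (p - 1)"
  have p: "p > 1" "p' > 1" "1 / p + 1 / p' = 1" "c > 0"
    using assms False by (auto simp: p'_def field_simps)
  have "r * c powr (p - 1) \<le> r powr p / p + (c powr (p - 1)) powr p' / p'"
    using assms p by (intro Youngs_inequality) auto
  also have "(c powr (p - 1)) powr p' = c powr p"
    using p by (simp add: powr_powr p'_def)
  also have "c powr p / p' = c powr p - c powr p / p"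
    using p by (simp add: p'_def field_simps)
  finally have "p * (r * c powr (p - 1)) \<le> p * (r powr p / p + (c powr p - c powr p / p))"
    using p by (intro mult_left_mono) auto
  then have "p * (r * c powr (p - 1)) \<le> r powr p + p * c powr p - c powr p"
    using p by (simp add: algebra_simps)
  moreover have "c powr (p - 1) * c = c powr p"
    using p by (simp add: powr_diff)
  ultimately show ?thesis by (simp add: algebra_simps)
qed

lemma le_one_plus_powr: 
  fixes r p :: real
  assumes "p \<ge> 1" "r \<ge> 0" shows "r \<le> 1 + r powr p"
proof (cases "r \<le> 1")
  case False
  then have "r powr 1 \<le> r powr p" using assms by (intro powr_mono) auto
  then show ?thesis using False by auto
next
  case True
  then show ?thesis using powr_ge_zero[of r p] by linarith
qed

text \<open>Jensen's inequality for the probability density \<open>heat_kernel t (x - y)\<close>,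
  followed by the L^1 contraction applied to |f|^p. The pointwise integrals exist because |f| <= 1 +
  |f|^p and the kernel is both bounded and integrable.\<close>

lemma heat_conv_Lp:
  fixes f :: "'a::euclidean_space \<Rightarrow> real"
  assumes t: "t > 0" and p: "p \<ge> 1" and fm [measurable]: "f \<in> borel_measurable borel"
    and f: "integrable lborel (\<lambda>x. \<bar>f x\<bar> powr p)"
  shows "integrable lborel (\<lambda>y. f y * heat_kernel t (x - y))"
    "integrable lborel (\<lambda>x. \<bar>conv (heat_kernel t) f x\<bar> powr p)"
    "(LINT x|lborel. \<bar>conv (heat_kernel t) f x\<bar> powr p) \<le> (LINT x|lborel. \<bar>f x\<bar> powr p)"
proof -
  let ?G = "heat_kernel t :: 'a \<Rightarrow> real"
  have G: "integrable lborel (\<lambda>y. ?G (x - y))" "(LINT y|lborel. ?G (x - y)) = 1" for x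
    using integrable_lborel_reflect[OF integrable_heat_kernel[OF t], of x] t by auto
  have fG: "integrable lborel (\<lambda>y. \<bar>f y\<bar> powr p * ?G (x - y))" for x
    using conv_integrand[OF f, of ?G, OF _, of "(4 * pi * t) powr (- (real DIM('a) / 2))" x] heat_kernel_le[OF t] by auto
  show int: "integrable lborel (\<lambda>y. f y * ?G (x - y))" for x
  proof (rule Bochner_Integration.integrable_bound[OF Bochner_Integration.integrable_add[OF G(1)[of x] fG[of x]]])
    show "AE y in lborel. norm (f y * ?G (x - y)) \<le> norm (?G (x - y) + \<bar>f y\<bar> powr p * ?G (x - y))"
    proof (rule AE_I2)
      fix y
      have "\<bar>f y\<bar> * ?G (x - y) \<le> (1 + \<bar>f y\<bar> powr p) * ?G (x - y)"
        using p by (intro mult_right_mono le_one_plus_powr) auto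
      then show "norm (f y * ?G (x - y)) \<le> norm (?G (x - y) + \<bar>f y\<bar> powr p * ?G (x - y))"
        by (simp add: abs_mult algebra_simps)
    qed
  qed auto
  have jensen: "\<bar>conv ?G f x\<bar> powr p \<le> conv ?G (\<lambda>y. \<bar>f y\<bar> powr p) x" for x
  proof -
    define c where "c = (LINT y|lborel. \<bar>f y\<bar> * ?G (x - y))"
    have ia: "integrable lborel (\<lambda>y. \<bar>f y\<bar> * ?G (x - y))"
      using integrable_abs[OF int[of x]] by (simp add: abs_mult)
    have c0: "c \<ge> 0" unfolding c_def by (rule Bochner_Integration.integral_nonneg) auto
    have "\<bar>conv ?G f x\<bar> \<le> c"
      unfolding conv_def c_def using integral_norm_bound[of lborel "\<lambda>y. f y * ?G (x - y)"] by (simp add: abs_mult)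
    then have "\<bar>conv ?G f x\<bar> powr p \<le> c powr p" using p by (intro powr_mono2) auto
    \<comment> \<open>The tangent of r^p at the average \<open>c\<close> is integrated; its linear
      part averages to zero, which leaves \<open>c powr p\<close>.\<close>
    also have "c powr p = (LINT y|lborel. (c powr p - p * c powr (p - 1) * c) * ?G (x - y) + p * c powr (p - 1) * (\<bar>f y\<bar> * ?G (x - y)))"
      using G ia by (simp add: c_def[symmetric])
    also have "\<dots> \<le> (LINT y|lborel. \<bar>f y\<bar> powr p * ?G (x - y))"
    proof (rule integral_mono)
      fix y
      have "(c powr p + p * c powr (p - 1) * (\<bar>f y\<bar> - c)) * ?G (x - y) \<le> \<bar>f y\<bar> powr p * ?G (x - y)"
        using p c0 by (intro mult_right_mono powr_tangent_le) auto
      then show "(c powr p - p * c powr (p - 1) * c) * ?G (x - y) + p * c powr (p - 1) * (\<bar>f y\<bar> * ?G (x - y)) \<le> \<bar>f y\<bar> powr p * ?G (x - y)"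
        by (simp add: algebra_simps)
    qed (use G ia fG in auto)
    finally show ?thesis by (simp add: conv_def)
  qed
  have i: "integrable lborel (conv ?G (\<lambda>y. \<bar>f y\<bar> powr p))"
    by (rule conv_L1(1)[OF f integrable_heat_kernel[OF t]])
  have le: "(LINT x|lborel. norm (conv ?G (\<lambda>y. \<bar>f y\<bar> powr p) x)) \<le> (LINT x|lborel. \<bar>f x\<bar> powr p)"
    using conv_L1(2)[OF f integrable_heat_kernel[OF t]] t by simp
  show j: "integrable lborel (\<lambda>x. \<bar>conv ?G f x\<bar> powr p)"
    by (rule Bochner_Integration.integrable_bound[OF i]) (use jensen in \<open>auto intro: order_trans[OF _ abs_ge_self]\<close>)
  have "(LINT x|lborel. \<bar>conv ?G f x\<bar> powr p) \<le> (LINT x|lborel. norm (conv ?G (\<lambda>y. \<bar>f y\<bar> powr p) x))"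
    using jensen by (intro integral_mono j integrable_norm i) (auto intro: order_trans[OF _ abs_ge_self])
  with le show "(LINT x|lborel. \<bar>conv ?G f x\<bar> powr p) \<le> (LINT x|lborel. \<bar>f x\<bar> powr p)" by linarith
qed

lemma heat_conv_L2:
  fixes f :: "'a::euclidean_space \<Rightarrow> real"
  assumes t: "t > 0" and fm [measurable]: "f \<in> borel_measurable borel"
    and f: "integrable lborel (\<lambda>x. (f x)\<^sup>2)"
  shows "integrable lborel (\<lambda>x. (conv (heat_kernel t) f x)\<^sup>2)"
    "(LINT x|lborel. (conv (heat_kernel t) f x)\<^sup>2) \<le> (LINT x|lborel. (f x)\<^sup>2)"
  using heat_conv_Lp[OF t _ fm, of 2] f by (auto simp: powr_numeral)

lemma heat_conv_L1:
  fixes f :: "'a::euclidean_space \<Rightarrow> real"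
  assumes t: "t > 0" and f: "integrable lborel f"
  shows "integrable lborel (conv (heat_kernel t) f)"
    "(LINT x|lborel. \<bar>conv (heat_kernel t) f x\<bar>) \<le> (LINT x|lborel. \<bar>f x\<bar>)"
  using conv_L1[OF f integrable_heat_kernel[OF t]] t by auto

text \<open>Origin of the (t - tau)^(-1/2) singularity in Duhamel's inequality.\<close>

lemma heat_grad_integrable:
  assumes "t > 0"
  shows "integrable lborel (heat_grad t :: 'a::euclidean_space \<Rightarrow> 'a)"
    "(LINT x|lborel. norm (heat_grad t (x::'a))) \<le> heat_const TYPE('a) / sqrt t"
proof -
  let ?c = "heat_const TYPE('a) / sqrt t"
  have i: "integrable lborel (\<lambda>x. ?c * heat_kernel (2 * t) (x::'a))" using assms by simp
  show "integrable lborel (heat_grad t :: 'a \<Rightarrow> 'a)"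
    by (rule integrable_dominated[OF i _ heat_grad_bound[OF assms]]) simp
  then have "(LINT x|lborel. norm (heat_grad t (x::'a))) \<le> (LINT x|lborel. ?c * heat_kernel (2 * t) (x::'a))"
    by (intro integral_mono i integrable_norm heat_grad_bound assms)
  then show "(LINT x|lborel. norm (heat_grad t (x::'a))) \<le> ?c" using assms by simp
qed

lemma heat_hess_integrable:
  assumes "t > 0"
  shows "integrable lborel (heat_hess t i :: 'a::euclidean_space \<Rightarrow> 'a)"
  by (rule integrable_dominated[OF _ _ heat_hess_bound[OF assms]]) (use assms in auto)

lemma heat_bounded:
  fixes i :: "'a::euclidean_space"
  assumes "t > 0"
  obtains B where "B > 0" "\<And>x::'a. \<bar>heat_kernel t x\<bar> \<le> B" "\<And>x::'a. norm (heat_grad t x) \<le> B"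
    "\<And>x. norm (heat_hess t i x) \<le> B" "\<And>x::'a. \<bar>heat_lapl t x\<bar> \<le> B"
proof -
  define b where "b = (4 * pi * (2 * t)) powr (- (real DIM('a) / 2))"
  define b0 where "b0 = (4 * pi * t) powr (- (real DIM('a) / 2))"
  have b: "heat_kernel (2 * t) (x::'a) \<le> b" for x using heat_kernel_le[of "2 * t" x] assms by (simp add: b_def)
  have b0: "heat_kernel t (x::'a) \<le> b0" for x using heat_kernel_le[of t x] assms by (simp add: b0_def)
  have bp: "b > 0" "b0 > 0" using assms by (auto simp: b_def b0_def)
  define c where "c = heat_const TYPE('a)"
  have c: "c > 0" by (simp add: c_def heat_const_pos)
  define B where "B = b0 + c / sqrt t * b + c / t * norm i * b + c / t * b"
  have p: "c / sqrt t * b > 0" "c / t * norm i * b \<ge> 0" "c / t * b > 0" using assms c bp by auto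
  show ?thesis
  proof (rule that[of B])
    show "B > 0" using p bp by (simp add: B_def)
    fix x :: 'a
    show "\<bar>heat_kernel t x\<bar> \<le> B" using b0[of x] p by (simp add: B_def)
    have "norm (heat_grad t x) \<le> c / sqrt t * b"
      using heat_grad_bound[OF assms, of x] b[of x] c assms mult_left_mono[OF b[of x], of "c / sqrt t"] unfolding c_def[symmetric] by (auto intro: order_trans)
    then show "norm (heat_grad t x) \<le> B" using p bp by (simp add: B_def)
    have "norm (heat_hess t i x) \<le> c / t * norm i * b"
      using heat_hess_bound[OF assms, of i, of x] b[of x] c assms mult_left_mono[OF b[of x], of "c / t * norm i"] unfolding c_def[symmetric] by (auto intro: order_trans)
    then show "norm (heat_hess t i x) \<le> B" using p bp by (simp add: B_def)
    have "\<bar>heat_lapl t x\<bar> \<le> c / t * b"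
      using heat_lapl_bound[OF assms, of x] b[of x] c assms mult_left_mono[OF b[of x], of "c / t"] unfolding c_def[symmetric] by (auto intro: order_trans)
    then show "\<bar>heat_lapl t x\<bar> \<le> B" using p bp by (simp add: B_def)
  qed
qed

lemma heat_conv_has_derivative:
  fixes f :: "'a::euclidean_space \<Rightarrow> real"
  assumes t: "t > 0" and f: "integrable lborel f"
  shows "(conv (heat_kernel t) f has_derivative (\<lambda>h. conv (heat_grad t) f x \<bullet> h)) (at x)"
proof -
  obtain B where "\<And>x::'a. \<bar>heat_kernel t x\<bar> \<le> B" "\<And>x::'a. norm (heat_grad t x) \<le> B"
    using heat_bounded[OF t, of undefined] by metis
  then show ?thesis
    using f t by (intro conv_has_derivative heat_kernel_has_derivative continuous_on_heat_grad) auto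
qed

lemma conv_inner_right:
  fixes K :: "'a::euclidean_space \<Rightarrow> 'a"
  assumes f: "integrable lborel f" and K: "K \<in> borel_measurable borel" and B: "\<And>z. norm (K z) \<le> B"
  shows "conv K f x \<bullet> i = conv (\<lambda>z. K z \<bullet> i) f x"
  unfolding conv_def using integral_inner_left[of i lborel "\<lambda>y. f y *\<^sub>R K (x - y)"] conv_integrand[OF f K B]
  by auto

lemma heat_conv_grad_has_derivative:
  fixes f :: "'a::euclidean_space \<Rightarrow> real"
  assumes t: "t > 0" and f: "integrable lborel f"
  shows "((\<lambda>x. conv (heat_grad t) f x \<bullet> i) has_derivative (\<lambda>h. conv (heat_hess t i) f x \<bullet> h)) (at x)"
proof -
  obtain B where B: "\<And>x::'a. norm (heat_grad t x) \<le> B" "\<And>x::'a. norm (heat_hess t i x) \<le> B"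
    using heat_bounded[OF t, of i] by metis
  have "\<bar>heat_grad t z \<bullet> i\<bar> \<le> B * norm i" for z
    by (rule order_trans[OF Cauchy_Schwarz_ineq2]) (simp add: B mult_right_mono)
  then have "(conv (\<lambda>z. heat_grad t z \<bullet> i) f has_derivative (\<lambda>h. conv (heat_hess t i) f x \<bullet> h)) (at x)"
    using f t B by (intro conv_has_derivative heat_grad_has_derivative continuous_on_heat_hess) auto
  then show ?thesis
    by (subst conv_inner_right[OF f _ B(1)]) (auto simp: eta_contract_eq)
qed

lemma heat_conv_lapl_eq_sum:
  fixes f :: "'a::euclidean_space \<Rightarrow> real"
  assumes t: "t > 0" and f: "integrable lborel f"
  shows "(\<Sum>i\<in>Basis. conv (heat_hess t i) f x \<bullet> i) = conv (heat_lapl t) f x"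
proof -
  have i: "integrable lborel (\<lambda>y. f y *\<^sub>R heat_hess t i (x - y))" for i :: 'a
  proof -
    obtain B where B: "\<And>x::'a. norm (heat_hess t i x) \<le> B" using heat_bounded[OF t, of i] by metis
    show ?thesis by (rule conv_integrand[OF f _ B]) auto
  qed
  have "(\<Sum>i\<in>Basis. conv (heat_hess t i) f x \<bullet> i) = (\<Sum>i\<in>Basis. LINT y|lborel. f y * (heat_hess t i (x - y) \<bullet> i))"
    unfolding conv_def using i by (intro sum.cong refl) (subst integral_inner_left[symmetric], auto)
  also have "\<dots> = (LINT y|lborel. (\<Sum>i\<in>Basis. f y * (heat_hess t i (x - y) \<bullet> i)))"
    by (subst Bochner_Integration.integral_sum) (use integrable_inner_left[OF i] in \<open>auto\<close>)
  finally show ?thesis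
    using t by (simp add: conv_def sum_distrib_left[symmetric] heat_lapl_eq_sum)
qed

lemma conv_diff:
  fixes K :: "'a::euclidean_space \<Rightarrow> 'b::{banach, second_countable_topology}"
  assumes f: "integrable lborel f" "integrable lborel g" and K: "K \<in> borel_measurable borel" and B: "\<And>z. norm (K z) \<le> B"
  shows "conv K (\<lambda>y. f y - g y) x = conv K f x - conv K g x"
  using conv_integrand[OF f(1) K B] conv_integrand[OF f(2) K B]
  by (simp add: conv_def scaleR_diff_left)

lemma heat_kernel_bounded:
  fixes x :: "'a::euclidean_space"
  assumes "t > 0" shows "norm (heat_kernel t x) \<le> (4 * pi * t) powr (- (real DIM('a) / 2))"
  using heat_kernel_le[OF assms, of x] by simp

lemma heat_conv_diff:
  fixes f g :: "'a::euclidean_space \<Rightarrow> real"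
  assumes "t > 0" "integrable lborel f" "integrable lborel g"
  shows "conv (heat_kernel t) (\<lambda>y. f y - g y) x = conv (heat_kernel t) f x - conv (heat_kernel t) g x"
  by (rule conv_diff[OF assms(2,3) _ heat_kernel_bounded[OF assms(1)]]) simp

text \<open>The first absolute moment of the kernel is of order sqrt t, and the resulting error is
  uniform in \<open>x\<close>.\<close>

lemma heat_conv_lipschitz:
  fixes f :: "'a::euclidean_space \<Rightarrow> real"
  assumes t: "t > 0" and f: "integrable lborel f" and lip: "\<And>x y. \<bar>f x - f y\<bar> \<le> L * norm (x - y)"
  shows "\<bar>conv (heat_kernel t) f x - f x\<bar> \<le> L * (2 powr (real DIM('a) / 2) * sqrt (8 * t))"
proof -
  let ?G = "heat_kernel t :: 'a \<Rightarrow> real" and ?c = "2 powr (real DIM('a) / 2) * sqrt (8 * t)"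
  have [measurable]: "f \<in> borel_measurable borel" using f by auto
  obtain b :: 'a where b: "b \<in> Basis" using nonempty_Basis by blast
  have L: "L \<ge> 0" using lip[of 0 b] b order_trans[OF abs_ge_zero lip[of 0 b]] by (simp add: norm_Basis)
  have G: "integrable lborel (\<lambda>y. ?G (x - y))" "(LINT y|lborel. ?G (x - y)) = 1"
    using integrable_lborel_reflect[OF integrable_heat_kernel[OF t], of x] t by auto
  have G2: "integrable lborel (\<lambda>y. heat_kernel (2 * t) (x - y))" "(LINT y|lborel. heat_kernel (2 * t) (x - y)) = 1"
    using integrable_lborel_reflect[OF integrable_heat_kernel, of "2 * t" x] t by auto
  have i: "integrable lborel (\<lambda>y. f y * ?G (x - y))"
    using conv_integrand[OF f, of ?G, OF _ heat_kernel_bounded[OF t], where x = x] by simp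
  have "conv ?G f x - f x = (LINT y|lborel. (f y - f x) * ?G (x - y))"
    using i G by (simp add: conv_def left_diff_distrib)
  also have "\<bar>\<dots>\<bar> \<le> (LINT y|lborel. L * (?c * heat_kernel (2 * t) (x - y)))"
  proof (rule integral_abs_mono(2))
    fix y
    have "\<bar>(f y - f x) * ?G (x - y)\<bar> \<le> (L * norm (x - y)) * ?G (x - y)"
      unfolding abs_mult using lip[of y x] by (intro mult_mono) (auto simp: norm_minus_commute)
    also have "\<dots> = L * (norm (x - y) * ?G (x - y))" by simp
    also have "\<dots> \<le> L * (?c * heat_kernel (2 * t) (x - y))"
      by (intro mult_left_mono norm_times_heat_kernel_le t L)
    finally show "\<bar>(f y - f x) * ?G (x - y)\<bar> \<le> L * (?c * heat_kernel (2 * t) (x - y))" .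
  qed (use G2 in auto)
  also have "\<dots> = L * ?c" using G2 by simp
  finally show ?thesis .
qed

section \<open>Approximation by the heat semigroup\<close>

text \<open>Strong L^1 continuity of the heat semigroup at time 0 for a single function. As a
  predicate it can be carried through the induction principle for integrable functions.\<close>

definition heat_approximable :: "('a::euclidean_space \<Rightarrow> real) \<Rightarrow> bool" where
  "heat_approximable f \<longleftrightarrow> integrable lborel f \<and>
     (\<forall>\<sigma>>0. \<exists>\<epsilon>0>0. \<forall>\<epsilon>. 0 < \<epsilon> \<and> \<epsilon> < \<epsilon>0 \<longrightarrow> (LINT x|lborel. \<bar>conv (heat_kernel \<epsilon>) f x - f x\<bar>) \<le> \<sigma>)"

lemma integral_abs_triangle:
  fixes f g h :: "'a \<Rightarrow> real"
  assumes "integrable M f" "integrable M g" "integrable M h"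
  shows "(LINT x|M. \<bar>f x - h x\<bar>) \<le> (LINT x|M. \<bar>f x - g x\<bar>) + (LINT x|M. \<bar>g x - h x\<bar>)"
proof -
  have "(LINT x|M. \<bar>f x - h x\<bar>) \<le> (LINT x|M. \<bar>f x - g x\<bar> + \<bar>g x - h x\<bar>)"
    using assms by (intro integral_mono) auto
  then show ?thesis using assms by simp
qed

lemma heat_conv_L1_diff:
  fixes f g :: "'a::euclidean_space \<Rightarrow> real"
  assumes "t > 0" "integrable lborel f" "integrable lborel g"
  shows "(LINT x|lborel. \<bar>conv (heat_kernel t) f x - conv (heat_kernel t) g x\<bar>) \<le> (LINT x|lborel. \<bar>f x - g x\<bar>)"
  using heat_conv_L1(2)[OF assms(1), of "\<lambda>x. f x - g x"] assms by (simp add: heat_conv_diff)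

lemma heat_conv_L1_error:
  fixes f g :: "'a::euclidean_space \<Rightarrow> real"
  assumes t: "t > 0" and i: "integrable lborel f" "integrable lborel g"
  shows "(LINT x|lborel. \<bar>conv (heat_kernel t) f x - f x\<bar>)
    \<le> (LINT x|lborel. \<bar>conv (heat_kernel t) g x - g x\<bar>) + 2 * (LINT x|lborel. \<bar>f x - g x\<bar>)"
proof -
  note c = heat_conv_L1(1)[OF t i(1)] heat_conv_L1(1)[OF t i(2)]
  have "(LINT x|lborel. \<bar>conv (heat_kernel t) f x - f x\<bar>)
    \<le> (LINT x|lborel. \<bar>conv (heat_kernel t) f x - conv (heat_kernel t) g x\<bar>) + (LINT x|lborel. \<bar>conv (heat_kernel t) g x - f x\<bar>)"
    using i c by (intro integral_abs_triangle) auto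
  also have "\<dots> \<le> (LINT x|lborel. \<bar>f x - g x\<bar>) + ((LINT x|lborel. \<bar>conv (heat_kernel t) g x - g x\<bar>) + (LINT x|lborel. \<bar>g x - f x\<bar>))"
    using i c t by (intro add_mono integral_abs_triangle heat_conv_L1_diff) auto
  finally show ?thesis by (simp add: abs_minus_commute)
qed

text \<open>Convolution contracts L^1, so replacing \<open>f\<close> by \<open>g\<close> costs at
  most twice their distance; sigma/2 for \<open>g\<close> and twice sigma/4 add up to sigma.\<close>

lemma heat_approximable_closed:
  assumes f: "integrable lborel f" and a: "\<And>\<sigma>::real. \<sigma> > 0 \<Longrightarrow> \<exists>g. heat_approximable g \<and> (LINT x|lborel. \<bar>f x - g x\<bar>) \<le> \<sigma>"
  shows "heat_approximable f"
  unfolding heat_approximable_def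
proof (intro conjI f allI impI)
  fix \<sigma> :: real assume "\<sigma> > 0"
  then obtain g where g: "heat_approximable g" "(LINT x|lborel. \<bar>f x - g x\<bar>) \<le> \<sigma> / 4" using a[of "\<sigma> / 4"] by auto
  with \<open>\<sigma> > 0\<close> obtain \<epsilon>0 where e: "\<epsilon>0 > 0"
    "\<And>\<epsilon>. 0 < \<epsilon> \<Longrightarrow> \<epsilon> < \<epsilon>0 \<Longrightarrow> (LINT x|lborel. \<bar>conv (heat_kernel \<epsilon>) g x - g x\<bar>) \<le> \<sigma> / 2"
    unfolding heat_approximable_def by (meson half_gt_zero)
  have "(LINT x|lborel. \<bar>conv (heat_kernel \<epsilon>) f x - f x\<bar>) \<le> \<sigma>" if "0 < \<epsilon>" "\<epsilon> < \<epsilon>0" for \<epsilon>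
    using heat_conv_L1_error[OF that(1) f, of g] e(2)[OF that] g by (auto simp: heat_approximable_def)
  then show "\<exists>\<epsilon>0>0. \<forall>\<epsilon>. 0 < \<epsilon> \<and> \<epsilon> < \<epsilon>0 \<longrightarrow> (LINT x|lborel. \<bar>conv (heat_kernel \<epsilon>) f x - f x\<bar>) \<le> \<sigma>"
    using e(1) by blast
qed

text \<open>The Lipschitz estimate gives only uniform convergence, which says nothing about L^1 on
  the whole space. Scheffe's lemma closes the gap, because the L^1 norms of the approximations do
  not exceed that of \<open>f\<close>.\<close>

lemma heat_approximable_lipschitz:
  fixes f :: "'a::euclidean_space \<Rightarrow> real"
  assumes f: "integrable lborel f" and lip: "\<And>x y. \<bar>f x - f y\<bar> \<le> L * norm (x - y)"
  shows "heat_approximable f"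
proof (rule ccontr)
  assume "\<not> heat_approximable f"
  then obtain \<sigma> where \<sigma>: "\<sigma> > 0" "\<And>\<epsilon>0. \<epsilon>0 > 0 \<Longrightarrow> \<exists>\<epsilon>. 0 < \<epsilon> \<and> \<epsilon> < \<epsilon>0 \<and> (LINT x|lborel. \<bar>conv (heat_kernel \<epsilon>) f x - f x\<bar>) > \<sigma>"
    using f unfolding heat_approximable_def by (auto simp: not_le)
  have "\<exists>\<epsilon>. \<forall>n. 0 < \<epsilon> n \<and> \<epsilon> n < 1 / real (Suc n) \<and> (LINT x|lborel. \<bar>conv (heat_kernel (\<epsilon> n)) f x - f x\<bar>) > \<sigma>"
    using \<sigma>(2) by (intro choice allI) simp
  then obtain \<epsilon> where \<epsilon>: "\<And>n. 0 < \<epsilon> n" "\<And>n. \<epsilon> n < 1 / real (Suc n)"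
    "\<And>n. (LINT x|lborel. \<bar>conv (heat_kernel (\<epsilon> n)) f x - f x\<bar>) > \<sigma>" by blast
  have \<epsilon>0: "\<epsilon> \<longlonglongrightarrow> 0"
    by (rule real_tendsto_sandwich[where f = "\<lambda>_. 0" and h = "\<lambda>n. 1 / real (Suc n)"])
      (use \<epsilon>(1,2) less_imp_le LIMSEQ_inverse_real_of_nat in \<open>auto simp: inverse_eq_divide intro!: always_eventually\<close>)
  have i: "integrable lborel (conv (heat_kernel (\<epsilon> n)) f)" for n by (rule heat_conv_L1(1)[OF \<epsilon>(1) f])
  have [measurable]: "f \<in> borel_measurable borel" using f by auto
  have "(\<lambda>n. \<integral>\<^sup>+ x. norm (conv (heat_kernel (\<epsilon> n)) f x - f x) \<partial>lborel) \<longlonglongrightarrow> 0"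
  proof (rule Scheffe_lemma2)
    show "AE x in lborel. (\<lambda>n. conv (heat_kernel (\<epsilon> n)) f x) \<longlonglongrightarrow> f x"
    proof (rule AE_I2)
      fix x
      have "(\<lambda>n. L * (2 powr (real DIM('a) / 2) * sqrt (8 * \<epsilon> n))) \<longlonglongrightarrow> L * (2 powr (real DIM('a) / 2) * sqrt (8 * 0))"
        by (intro tendsto_intros \<epsilon>0)
      then have "(\<lambda>n. L * (2 powr (real DIM('a) / 2) * sqrt (8 * \<epsilon> n))) \<longlonglongrightarrow> 0" by simp
      then have "(\<lambda>n. conv (heat_kernel (\<epsilon> n)) f x - f x) \<longlonglongrightarrow> 0"
        by (rule Lim_null_comparison[rotated]) (use heat_conv_lipschitz[OF \<epsilon>(1) f lip] in auto)
      then show "(\<lambda>n. conv (heat_kernel (\<epsilon> n)) f x) \<longlonglongrightarrow> f x" by (simp add: LIM_zero_iff)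
    qed
    show "(\<integral>\<^sup>+ x. norm (conv (heat_kernel (\<epsilon> n)) f x) \<partial>lborel) \<le> (\<integral>\<^sup>+ x. norm (f x) \<partial>lborel)" for n
      using heat_conv_L1(2)[OF \<epsilon>(1) f] i[of n] f by (simp add: nn_integral_eq_integral ennreal_leI)
  qed (use f i in auto)
  then have "(\<lambda>n. ennreal (LINT x|lborel. \<bar>conv (heat_kernel (\<epsilon> n)) f x - f x\<bar>)) \<longlonglongrightarrow> ennreal 0"
    using i f by (simp add: nn_integral_eq_integral)
  then have "(\<lambda>n. LINT x|lborel. \<bar>conv (heat_kernel (\<epsilon> n)) f x - f x\<bar>) \<longlonglongrightarrow> 0"
    by (subst (asm) tendsto_ennreal_iff) auto
  then have "\<sigma> \<le> 0" by (rule LIMSEQ_le_const) (use \<epsilon>(3) less_imp_le in blast)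
  with \<sigma>(1) show False by simp
qed

lemma heat_approximable_open:
  fixes U :: "'a::euclidean_space set"
  assumes U: "open U" and fin: "emeasure lborel U < \<infinity>"
  shows "heat_approximable (\<lambda>x. indicator U x :: real)"
proof (rule heat_approximable_closed)
  have [measurable]: "U \<in> sets borel" using U by simp
  show iU: "integrable lborel (\<lambda>x. indicator U x :: real)" using fin by simp
  \<comment> \<open>\<open>infdist\<close> to the empty set is 0 by convention, which would make all
    cut-offs below vanish; finite measure excludes that case.\<close>
  have ne: "- U \<noteq> {}"
  proof
    assume "- U = {}"
    then have "U = UNIV" by auto
    then show False using fin by simp
  qed
  define g where "g k x = min 1 (real k * infdist x (- U))" for k :: nat and x
  have [measurable]: "g k \<in> borel_measurable borel" for k
    unfolding g_def by (intro borel_measurable_continuous_onI continuous_intros)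
  have g01: "0 \<le> g k x" "g k x \<le> indicator U x" for k x
    by (auto simp: g_def infdist_nonneg indicator_def)
  have ig: "integrable lborel (g k)" for k
    by (rule integrable_dominated[OF iU]) (use g01 in auto)
  have lip: "\<bar>g k x - g k y\<bar> \<le> real k * norm (x - y)" for k x y
  proof -
    have "\<bar>infdist x (- U) - infdist y (- U)\<bar> \<le> dist x y"
      using infdist_triangle_abs[of x "- U" y] by simp
    then have "real k * \<bar>infdist x (- U) - infdist y (- U)\<bar> \<le> real k * dist x y" by (rule mult_left_mono) simp
    then have "\<bar>real k * infdist x (- U) - real k * infdist y (- U)\<bar> \<le> real k * norm (x - y)"
      by (simp add: dist_norm right_diff_distrib[symmetric] abs_mult)
    then show ?thesis unfolding g_def by linarith
  qed
  have "(\<lambda>k. LINT x|lborel. \<bar>indicator U x - g k x\<bar>) \<longlonglongrightarrow> (LINT x|(lborel::'a measure). (0::real))"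
  proof (rule integral_dominated_convergence[where w = "indicator U"])
    show "AE x in lborel. (\<lambda>k. \<bar>indicator U x - g k x\<bar>) \<longlonglongrightarrow> 0"
    proof (rule AE_I2)
      fix x
      show "(\<lambda>k. \<bar>indicator U x - g k x\<bar>) \<longlonglongrightarrow> 0"
      proof (cases "x \<in> U")
        case True
        then have "infdist x (- U) > 0"
          using U ne in_closed_iff_infdist_zero[of "- U" x] infdist_nonneg[of x "- U"] by (auto simp: less_le)
        then obtain k0 :: nat where "1 < real k0 * infdist x (- U)"
          using reals_Archimedean3 by blast
        then have "1 \<le> real k * infdist x (- U)" if "k \<ge> k0" for k
          using \<open>1 < real k0 * infdist x (- U)\<close> mult_right_mono[of "real k0" "real k" "infdist x (- U)"] that infdist_nonneg[of x "- U"] by simp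
        then have "eventually (\<lambda>k. \<bar>indicator U x - g k x\<bar> = 0) sequentially"
          using True by (auto simp: g_def eventually_sequentially intro!: exI[of _ k0])
        then show ?thesis by (rule tendsto_eventually)
      next
        case False
        then have "\<bar>indicator U x - g k x\<bar> = 0" for k using g01(1)[of k x] g01(2)[of k x] by auto
        then show ?thesis by simp
      qed
    qed
    show "AE x in lborel. norm \<bar>indicator U x - g k x\<bar> \<le> indicator U x" for k
      using g01 by (intro AE_I2) (auto simp: abs_le_iff indicator_def split: if_splits)
  qed (use iU in auto)
  then have lim: "(\<lambda>k. LINT x|lborel. \<bar>indicator U x - g k x\<bar>) \<longlonglongrightarrow> 0" by simp
  fix \<sigma> :: real assume "\<sigma> > 0"
  then obtain k where "(LINT x|lborel. \<bar>indicator U x - g k x\<bar>) < \<sigma>"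
    using order_tendstoD(2)[OF lim, of \<sigma>] by (auto simp: eventually_sequentially)
  then show "\<exists>g. heat_approximable g \<and> (LINT x|lborel. \<bar>indicator U x - g x\<bar>) \<le> \<sigma>"
    using heat_approximable_lipschitz[OF ig lip] by (intro exI[of _ "g k"]) auto
qed

lemma heat_approximable_add:
  assumes "heat_approximable f" "heat_approximable g"
  shows "heat_approximable (\<lambda>x. f x + g x)"
  unfolding heat_approximable_def
proof (intro conjI allI impI)
  have fg: "integrable lborel f" "integrable lborel g" using assms by (auto simp: heat_approximable_def)
  then show "integrable lborel (\<lambda>x. f x + g x)" by simp
  fix \<sigma> :: real assume "\<sigma> > 0"
  then have "\<sigma> / 2 > 0" by simp
  obtain e1 where e1: "e1 > 0"
    "\<And>\<epsilon>. 0 < \<epsilon> \<Longrightarrow> \<epsilon> < e1 \<Longrightarrow> (LINT x|lborel. \<bar>conv (heat_kernel \<epsilon>) f x - f x\<bar>) \<le> \<sigma> / 2"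
    using assms(1) \<open>\<sigma> / 2 > 0\<close> unfolding heat_approximable_def by meson
  obtain e2 where e2: "e2 > 0"
    "\<And>\<epsilon>. 0 < \<epsilon> \<Longrightarrow> \<epsilon> < e2 \<Longrightarrow> (LINT x|lborel. \<bar>conv (heat_kernel \<epsilon>) g x - g x\<bar>) \<le> \<sigma> / 2"
    using assms(2) \<open>\<sigma> / 2 > 0\<close> unfolding heat_approximable_def by meson
  note e = e1(1) e2(1) e1(2) e2(2)
  have "(LINT x|lborel. \<bar>conv (heat_kernel \<epsilon>) (\<lambda>x. f x + g x) x - (f x + g x)\<bar>) \<le> \<sigma>" if \<epsilon>: "0 < \<epsilon>" "\<epsilon> < min e1 e2" for \<epsilon>
  proof -
    note i = heat_conv_L1(1)[OF \<epsilon>(1) fg(1)] heat_conv_L1(1)[OF \<epsilon>(1) fg(2)]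
    have eq: "conv (heat_kernel \<epsilon>) (\<lambda>x. f x + g x) x = conv (heat_kernel \<epsilon>) f x + conv (heat_kernel \<epsilon>) g x" for x
      using heat_conv_diff[OF \<epsilon>(1), of "\<lambda>x. f x + g x" g x] fg by simp
    have "(LINT x|lborel. \<bar>conv (heat_kernel \<epsilon>) (\<lambda>x. f x + g x) x - (f x + g x)\<bar>)
      \<le> (LINT x|lborel. \<bar>conv (heat_kernel \<epsilon>) f x - f x\<bar> + \<bar>conv (heat_kernel \<epsilon>) g x - g x\<bar>)"
      unfolding eq using i fg by (intro integral_mono) auto
    also have "\<dots> \<le> \<sigma> / 2 + \<sigma> / 2" using i fg e(3,4)[OF \<epsilon>(1)] \<epsilon>(2) by simp
    finally show ?thesis by simp
  qed
  then show "\<exists>\<epsilon>0>0. \<forall>\<epsilon>. 0 < \<epsilon> \<and> \<epsilon> < \<epsilon>0 \<longrightarrow>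
      (LINT x|lborel. \<bar>conv (heat_kernel \<epsilon>) (\<lambda>x. f x + g x) x - (f x + g x)\<bar>) \<le> \<sigma>"
    using e(1,2) by (intro exI[of _ "min e1 e2"]) auto
qed

lemma heat_approximable_cmult:
  assumes "heat_approximable f"
  shows "heat_approximable (\<lambda>x. f x * c)"
  unfolding heat_approximable_def
proof (intro conjI allI impI)
  have f: "integrable lborel f" using assms by (auto simp: heat_approximable_def)
  then show "integrable lborel (\<lambda>x. f x * c)" by simp
  fix \<sigma> :: real assume "\<sigma> > 0"
  then have "\<sigma> / (\<bar>c\<bar> + 1) > 0" by simp
  with assms obtain e where e: "e > 0"
    "\<And>\<epsilon>. 0 < \<epsilon> \<Longrightarrow> \<epsilon> < e \<Longrightarrow> (LINT x|lborel. \<bar>conv (heat_kernel \<epsilon>) f x - f x\<bar>) \<le> \<sigma> / (\<bar>c\<bar> + 1)"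
    unfolding heat_approximable_def by meson
  have "(LINT x|lborel. \<bar>conv (heat_kernel \<epsilon>) (\<lambda>x. f x * c) x - f x * c\<bar>) \<le> \<sigma>" if \<epsilon>: "0 < \<epsilon>" "\<epsilon> < e" for \<epsilon>
  proof -
    have "conv (heat_kernel \<epsilon>) (\<lambda>x. f x * c) x = conv (heat_kernel \<epsilon>) f x * c" for x
      unfolding conv_def by (subst integral_mult_left_zero[symmetric]) (simp add: mult_ac)
    then have "(LINT x|lborel. \<bar>conv (heat_kernel \<epsilon>) (\<lambda>x. f x * c) x - f x * c\<bar>)
       = (LINT x|lborel. \<bar>conv (heat_kernel \<epsilon>) f x - f x\<bar>) * \<bar>c\<bar>"
      by (simp add: left_diff_distrib[symmetric] abs_mult)
    also have "\<dots> \<le> \<sigma> / (\<bar>c\<bar> + 1) * \<bar>c\<bar>" using e(2)[OF \<epsilon>] by (rule mult_right_mono) simp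
    also have "\<dots> \<le> \<sigma>" using \<open>\<sigma> > 0\<close> by (simp add: divide_le_eq)
    finally show ?thesis .
  qed
  then show "\<exists>\<epsilon>0>0. \<forall>\<epsilon>. 0 < \<epsilon> \<and> \<epsilon> < \<epsilon>0 \<longrightarrow> (LINT x|lborel. \<bar>conv (heat_kernel \<epsilon>) (\<lambda>x. f x * c) x - f x * c\<bar>) \<le> \<sigma>"
    using e(1) by blast
qed

text \<open>Indicators of Borel sets are reached from open sets by outer regularity, open sets from
  the Lipschitz cut-offs min(1, k dist(x, complement)); linearity and closedness do the
  rest.\<close>

lemma heat_approximable_integrable:
  fixes f :: "'a::euclidean_space \<Rightarrow> real"
  assumes "integrable lborel f"
  shows "heat_approximable f"
  using assms
proof (induction rule: integrable_induct)
  case (base A c)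
  have "heat_approximable (\<lambda>x. indicator A x :: real)"
  proof (rule heat_approximable_closed)
    show iA: "integrable lborel (\<lambda>x. indicator A x :: real)" using base by simp
    fix \<sigma> :: real assume \<sigma>: "\<sigma> > 0"
    then obtain U where U: "open U" "A \<subseteq> U" "emeasure lborel (U - A) < \<sigma>"
      using outer_regular_lborel[of A \<sigma>] base by auto
    have [measurable]: "A \<in> sets borel" "U \<in> sets borel" using base U by auto
    have "emeasure lborel U = emeasure lborel A + emeasure lborel (U - A)"
      using U by (subst plus_emeasure) (auto intro!: arg_cong[of _ _ "emeasure lborel"])
    also have "\<dots> < \<infinity>" using U(3) base by (simp add: less_top[symmetric]) auto
    finally have fin: "emeasure lborel U < \<infinity>" .
    have fin': "emeasure lborel (U - A) < \<infinity>" using order_less_trans[OF U(3) ennreal_less_top] by simp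
    have "(LINT x|lborel. \<bar>indicator A x - indicator U x\<bar>) = (LINT x|lborel. (indicator (U - A) x :: real))"
      using U(2) by (intro Bochner_Integration.integral_cong) (auto simp: indicator_def)
    also have "\<dots> = measure lborel (U - A)" by simp
    also have "\<dots> \<le> \<sigma>" using U(3) \<sigma> fin' by (simp add: measure_def enn2real_leI less_imp_le)
    finally show "\<exists>g. heat_approximable g \<and> (LINT x|lborel. \<bar>indicator A x - g x\<bar>) \<le> \<sigma>"
      using heat_approximable_open[OF U(1) fin] by blast
  qed
  then show ?case using heat_approximable_cmult by simp
next
  case (add f g)
  then show ?case by (intro heat_approximable_add)
next
  case (lim f s)
  show ?case
  proof (rule heat_approximable_closed)
    show "integrable lborel f" by (rule lim)
    have "(\<lambda>k. LINT x|lborel. \<bar>f x - s k x\<bar>) \<longlonglongrightarrow> (LINT x|(lborel::'a measure). (0::real))"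
    \<comment> \<open>The approximating simple functions satisfy
      \<open>\<bar>s k x\<bar> \<le> 2 * \<bar>f x\<bar>\<close>, whence the factor 3.\<close>
    proof (rule integral_dominated_convergence[where w = "\<lambda>x. 3 * \<bar>f x\<bar>"])
      show "AE x in lborel. (\<lambda>k. \<bar>f x - s k x\<bar>) \<longlonglongrightarrow> 0"
        using lim(2) by (intro AE_I2 tendsto_rabs_zero) (auto intro!: tendsto_eq_intros)
      show "AE x in lborel. norm \<bar>f x - s k x\<bar> \<le> 3 * \<bar>f x\<bar>" for k
      proof (rule AE_I2)
        fix x show "norm \<bar>f x - s k x\<bar> \<le> 3 * \<bar>f x\<bar>" using lim(3)[of x k] by simp
      qed
    qed (use lim in auto)
    then have l: "(\<lambda>k. LINT x|lborel. \<bar>f x - s k x\<bar>) \<longlonglongrightarrow> 0" by simp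
    fix \<sigma> :: real assume "\<sigma> > 0"
    then obtain k where "(LINT x|lborel. \<bar>f x - s k x\<bar>) < \<sigma>"
      using order_tendstoD(2)[OF l, of \<sigma>] by (auto simp: eventually_sequentially)
    then show "\<exists>g. heat_approximable g \<and> (LINT x|lborel. \<bar>f x - g x\<bar>) \<le> \<sigma>"
      using lim by (intro exI[of _ "s k"]) auto
  qed
qed

text \<open>Compactness in time: near \<open>x0\<close> the error exceeds the one at
  \<open>x0\<close> (sigma/2) by at most twice the L^1 distance (sigma/4), and a property that holds
  on all short intervals and is preserved by concatenation holds on the whole interval.\<close>

lemma heat_approx_uniform:
  fixes w :: "real \<Rightarrow> 'a::euclidean_space \<Rightarrow> real"
  assumes st: "s \<le> t" and w: "\<And>\<tau>. \<tau> \<in> {s..t} \<Longrightarrow> integrable lborel (w \<tau>)"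
    and cont: "\<And>\<tau>. \<tau> \<in> {s..t} \<Longrightarrow> ((\<lambda>\<tau>'. LINT x|lborel. \<bar>w \<tau>' x - w \<tau> x\<bar>) \<longlongrightarrow> 0) (at \<tau> within {s..t})"
    and \<sigma>: "\<sigma> > 0"
  obtains \<epsilon>0 where "\<epsilon>0 > 0"
    "\<And>\<epsilon> \<tau>. 0 < \<epsilon> \<Longrightarrow> \<epsilon> < \<epsilon>0 \<Longrightarrow> \<tau> \<in> {s..t} \<Longrightarrow> (LINT x|lborel. \<bar>conv (heat_kernel \<epsilon>) (w \<tau>) x - w \<tau> x\<bar>) \<le> \<sigma>"
proof -
  define P where "P a b \<longleftrightarrow> (\<exists>\<epsilon>0>0. \<forall>\<epsilon> \<tau>. 0 < \<epsilon> \<and> \<epsilon> < \<epsilon>0 \<and> \<tau> \<in> {a..b} \<inter> {s..t} \<longrightarrow>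
      (LINT x|lborel. \<bar>conv (heat_kernel \<epsilon>) (w \<tau>) x - w \<tau> x\<bar>) \<le> \<sigma>)" for a b
  have "P s t"
  using st
  proof (induction rule: Bolzano)
    case (trans a b c)
    obtain e1 where e1: "e1 > 0" "\<forall>\<epsilon> \<tau>. 0 < \<epsilon> \<and> \<epsilon> < e1 \<and> \<tau> \<in> {a..b} \<inter> {s..t} \<longrightarrow> (LINT x|lborel. \<bar>conv (heat_kernel \<epsilon>) (w \<tau>) x - w \<tau> x\<bar>) \<le> \<sigma>"
      using trans(1) unfolding P_def by blast
    obtain e2 where e2: "e2 > 0" "\<forall>\<epsilon> \<tau>. 0 < \<epsilon> \<and> \<epsilon> < e2 \<and> \<tau> \<in> {b..c} \<inter> {s..t} \<longrightarrow> (LINT x|lborel. \<bar>conv (heat_kernel \<epsilon>) (w \<tau>) x - w \<tau> x\<bar>) \<le> \<sigma>"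
      using trans(2) unfolding P_def by blast
    show ?case unfolding P_def
    proof (intro exI[of _ "min e1 e2"] conjI allI impI)
      fix \<epsilon> \<tau> assume *: "0 < \<epsilon> \<and> \<epsilon> < min e1 e2 \<and> \<tau> \<in> {a..c} \<inter> {s..t}"
      show "(LINT x|lborel. \<bar>conv (heat_kernel \<epsilon>) (w \<tau>) x - w \<tau> x\<bar>) \<le> \<sigma>"
      proof (cases "\<tau> \<le> b")
        case True
        then show ?thesis using * e1(2)[rule_format, of \<epsilon> \<tau>] by simp
      next
        case False
        then show ?thesis using * e2(2)[rule_format, of \<epsilon> \<tau>] by simp
      qed
    qed (use e1 e2 in simp)
  next
    case (local x0)
    then have x0: "x0 \<in> {s..t}" by simp
    have "heat_approximable (w x0)" by (rule heat_approximable_integrable[OF w[OF x0]])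
    moreover have "\<sigma> / 2 > 0" using \<sigma> by simp
    ultimately obtain \<epsilon>0 where e: "\<epsilon>0 > 0" "\<And>\<epsilon>. 0 < \<epsilon> \<Longrightarrow> \<epsilon> < \<epsilon>0 \<Longrightarrow> (LINT x|lborel. \<bar>conv (heat_kernel \<epsilon>) (w x0) x - w x0 x\<bar>) \<le> \<sigma> / 2"
      unfolding heat_approximable_def by meson
    have "eventually (\<lambda>\<tau>. (LINT x|lborel. \<bar>w \<tau> x - w x0 x\<bar>) < \<sigma> / 4) (at x0 within {s..t})"
      using \<sigma> by (intro order_tendstoD(2)[OF cont[OF x0]]) simp
    then obtain d where d: "d > 0" "\<And>\<tau>. \<tau> \<in> {s..t} \<Longrightarrow> \<tau> \<noteq> x0 \<Longrightarrow> dist \<tau> x0 < d \<Longrightarrow> (LINT x|lborel. \<bar>w \<tau> x - w x0 x\<bar>) < \<sigma> / 4"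
      unfolding eventually_at by auto
    have "P a b" if ab: "a \<le> x0 \<and> x0 \<le> b \<and> b - a < d" for a b
      unfolding P_def
    proof (intro exI[of _ \<epsilon>0] conjI e(1) allI impI)
      fix \<epsilon> \<tau> assume \<epsilon>: "0 < \<epsilon> \<and> \<epsilon> < \<epsilon>0 \<and> \<tau> \<in> {a..b} \<inter> {s..t}"
      have "(LINT x|lborel. \<bar>w \<tau> x - w x0 x\<bar>) \<le> \<sigma> / 4"
      proof (cases "\<tau> = x0")
        case False
        have "dist \<tau> x0 < d" using ab \<epsilon> by (auto simp: dist_real_def)
        then show ?thesis using d(2)[of \<tau>] \<epsilon> False by auto
      qed (use \<sigma> in simp)
      then show "(LINT x|lborel. \<bar>conv (heat_kernel \<epsilon>) (w \<tau>) x - w \<tau> x\<bar>) \<le> \<sigma>"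
        using heat_conv_L1_error[of \<epsilon> "w \<tau>" "w x0"] w[of \<tau>] w[OF x0] \<epsilon> e(2)[of \<epsilon>] by auto
    qed
    then show ?case using d(1) by blast
  qed
  then obtain \<epsilon>0 where "\<epsilon>0 > 0" "\<forall>\<epsilon> \<tau>. 0 < \<epsilon> \<and> \<epsilon> < \<epsilon>0 \<and> \<tau> \<in> {s..t} \<inter> {s..t} \<longrightarrow>
      (LINT x|lborel. \<bar>conv (heat_kernel \<epsilon>) (w \<tau>) x - w \<tau> x\<bar>) \<le> \<sigma>" unfolding P_def by blast
  then show ?thesis using that by auto
qed

section \<open>The flux function and its differences in L^1\<close>

lemma powr_add_le:
  fixes x y r :: real
  assumes "x \<ge> 0" "y \<ge> 0" "r \<ge> 0"
  shows "(x + y) powr r \<le> 2 powr r * (x powr r + y powr r)"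
proof -
  have "(x + y) powr r \<le> (2 * max x y) powr r" using assms by (intro powr_mono2) auto
  also have "\<dots> = 2 powr r * (max x y) powr r" using assms by (simp add: powr_mult)
  also have "\<dots> \<le> 2 powr r * (x powr r + y powr r)" by (intro mult_left_mono) (auto simp: max_def)
  finally show ?thesis .
qed

lemma abs_flux: "\<bar>flux q r\<bar> = \<bar>r\<bar> powr q"
  by (cases "r = 0") (auto simp: flux_def abs_mult powr_diff)

lemma flux_has_derivative:
  assumes q: "q > 1"
  shows "(flux q has_real_derivative q * \<bar>r\<bar> powr (q - 1)) (at r)"
proof -
  consider "r > 0" | "r < 0" | "r = 0" by linarith
  then show ?thesis
  proof cases
    case 1
    have "((\<lambda>x. x powr q) has_real_derivative q * r powr (q - 1)) (at r)"
      using 1 by (rule has_real_derivative_powr)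
    then show ?thesis
    proof (rule has_field_derivative_transform_within_open[where S = "{0<..}", THEN DERIV_cong])
      show "x powr q = flux q x" if "x \<in> {0<..}" for x using that by (simp add: flux_def powr_diff)
    qed (use 1 in auto)
  next
    case 2
    have "((\<lambda>x. - ((- x) powr q)) has_real_derivative - (q * (- r) powr (q - 1) * (- 1))) (at r)"
      using 2 by (intro DERIV_minus DERIV_chain2[where f = "\<lambda>x. x powr q" and g = uminus] has_real_derivative_powr)
        (auto intro!: derivative_eq_intros)
    then show ?thesis
    proof (rule has_field_derivative_transform_within_open[where S = "{..<0}", THEN DERIV_cong])
      show "- ((- x) powr q) = flux q x" if "x \<in> {..<0}" for x using that by (simp add: flux_def powr_diff)
    qed (use 2 in auto)
  next
    case 3
    have "((\<lambda>h. \<bar>h\<bar> powr (q - 1)) \<longlongrightarrow> \<bar>0\<bar> powr (q - 1)) (at (0::real))"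
      using q by (intro tendsto_powr' tendsto_intros) auto
    then have "((\<lambda>h. \<bar>h\<bar> powr (q - 1)) \<longlongrightarrow> 0) (at (0::real))" using q by simp
    then have "((\<lambda>h. (flux q (0 + h) - flux q 0) / h) \<longlongrightarrow> 0) (at 0)"
      by (rule Lim_transform_eventually) (auto simp: flux_def eventually_at_filter)
    then show ?thesis using 3 q by (simp add: DERIV_def)
  qed
qed

lemma continuous_on_flux: "q > 1 \<Longrightarrow> continuous_on S (flux q)"
  by (meson DERIV_isCont continuous_at_imp_continuous_on flux_has_derivative)

lemma flux_measurable [measurable]: "flux q \<in> borel_measurable borel"
  unfolding flux_def[abs_def] by measurable

lemma flux_diff_le:
  assumes q: "q > 1"
  shows "\<bar>flux q x - flux q y\<bar> \<le> q * \<bar>x - y\<bar> * (\<bar>x\<bar> + \<bar>y\<bar>) powr (q - 1)"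
proof -
  have "norm (flux q x - flux q y) \<le> (q * (\<bar>x\<bar> + \<bar>y\<bar>) powr (q - 1)) * norm (x - y)"
  proof (rule field_differentiable_bound[where S = "closed_segment x y"])
    show "(flux q has_field_derivative q * \<bar>z\<bar> powr (q - 1)) (at z within closed_segment x y)" for z
      using flux_has_derivative[OF q] has_field_derivative_at_within by blast
    show "norm (q * \<bar>z\<bar> powr (q - 1)) \<le> q * (\<bar>x\<bar> + \<bar>y\<bar>) powr (q - 1)" if "z \<in> closed_segment x y" for z
      using that q by (auto simp: abs_mult closed_segment_eq_real_ivl split: if_splits intro!: mult_left_mono powr_mono2)
  qed auto
  then show ?thesis by (simp add: mult_ac)
qed

text \<open>The flux is not globally Lipschitz: its increment carries the weight Y = (|x| +
  |y|)^(q-1). Splitting by Y <= 1/c + c Y^2 separates a multiple of |x - y|, for which L^1 closeness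
  suffices, from a moment of order 2q - 1 with a factor \<open>c\<close> that can be made small.
  Only moment bounds are needed to make the whole small.\<close>

lemma flux_diff_le_split:
  assumes q: "q > 1" and c: "c > 0"
  shows "\<bar>flux q x - flux q y\<bar> \<le> q * (\<bar>x - y\<bar> / c + c * (2 powr (2 * q - 1) * (\<bar>x\<bar> powr (2 * q - 1) + \<bar>y\<bar> powr (2 * q - 1))))"
proof -
  define X Y where "X = \<bar>x - y\<bar>" and "Y = (\<bar>x\<bar> + \<bar>y\<bar>) powr (q - 1)"
  have Y0: "Y \<ge> 0" "X \<ge> 0" by (auto simp: X_def Y_def)
  have "Y \<le> 1 / c + c * Y\<^sup>2"
  proof (cases "Y \<le> 1 / c")
    case True then show ?thesis using c by (simp add: add_increasing2)
  next
    case False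
    then have "1 \<le> c * Y" using c by (simp add: field_simps)
    then have "Y * 1 \<le> Y * (c * Y)" using Y0 by (intro mult_left_mono)
    then show ?thesis using c by (simp add: power2_eq_square mult_ac add_increasing)
  qed
  then have "X * Y \<le> X * (1 / c + c * Y\<^sup>2)" using Y0 by (intro mult_left_mono)
  also have "\<dots> = X / c + c * (X * Y\<^sup>2)" by (simp add: algebra_simps)
  also have "X * Y\<^sup>2 \<le> (\<bar>x\<bar> + \<bar>y\<bar>) powr (2 * q - 1)"
  proof (cases "\<bar>x\<bar> + \<bar>y\<bar> = 0")
    case False
    then have p: "\<bar>x\<bar> + \<bar>y\<bar> > 0" by auto
    have "X * Y\<^sup>2 \<le> (\<bar>x\<bar> + \<bar>y\<bar>) * Y\<^sup>2" by (intro mult_right_mono) (auto simp: X_def)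
    also have "\<dots> = (\<bar>x\<bar> + \<bar>y\<bar>) powr 1 * ((\<bar>x\<bar> + \<bar>y\<bar>) powr (q - 1) * (\<bar>x\<bar> + \<bar>y\<bar>) powr (q - 1))"
      using p by (simp add: Y_def power2_eq_square)
    also have "\<dots> = (\<bar>x\<bar> + \<bar>y\<bar>) powr (2 * q - 1)"
      by (simp only: powr_add[symmetric]) (simp add: algebra_simps)
    finally show ?thesis .
  next
    case True
    then have "X = 0" by (simp add: X_def)
    then show ?thesis by simp
  qed
  also have "(\<bar>x\<bar> + \<bar>y\<bar>) powr (2 * q - 1) \<le> 2 powr (2 * q - 1) * (\<bar>x\<bar> powr (2 * q - 1) + \<bar>y\<bar> powr (2 * q - 1))"
    using q by (intro powr_add_le) auto
  finally have "X * Y \<le> X / c + c * (2 powr (2 * q - 1) * (\<bar>x\<bar> powr (2 * q - 1) + \<bar>y\<bar> powr (2 * q - 1)))"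
    using c by simp
  then have "q * (X * Y) \<le> q * (X / c + c * (2 powr (2 * q - 1) * (\<bar>x\<bar> powr (2 * q - 1) + \<bar>y\<bar> powr (2 * q - 1))))"
    using q by (intro mult_left_mono) auto
  then show ?thesis using flux_diff_le[OF q, of x y] by (simp add: X_def Y_def mult_ac)
qed

lemma flux_L1_diff:
  fixes f g :: "'a::euclidean_space \<Rightarrow> real"
  assumes q: "q > 1" and c: "c > 0" and i: "integrable lborel f" "integrable lborel g"
    and ip: "integrable lborel (\<lambda>x. \<bar>f x\<bar> powr (2 * q - 1))" "integrable lborel (\<lambda>x. \<bar>g x\<bar> powr (2 * q - 1))"
  shows "(LINT x|lborel. \<bar>flux q (f x) - flux q (g x)\<bar>)
    \<le> q * ((LINT x|lborel. \<bar>f x - g x\<bar>) / c + c * (2 powr (2 * q - 1) *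
      ((LINT x|lborel. \<bar>f x\<bar> powr (2 * q - 1)) + (LINT x|lborel. \<bar>g x\<bar> powr (2 * q - 1)))))"
proof -
  have [measurable]: "f \<in> borel_measurable borel" "g \<in> borel_measurable borel" using i by auto
  have "(LINT x|lborel. \<bar>flux q (f x) - flux q (g x)\<bar>) \<le> (LINT x|lborel. q * (\<bar>f x - g x\<bar> / c + c * (2 powr (2 * q - 1) * (\<bar>f x\<bar> powr (2 * q - 1) + \<bar>g x\<bar> powr (2 * q - 1)))))"
    by (rule integral_abs_mono(3)) (use flux_diff_le_split[OF q c] i ip in auto)
  also have "\<dots> = q * ((LINT x|lborel. \<bar>f x - g x\<bar>) / c + c * (2 powr (2 * q - 1) *
      ((LINT x|lborel. \<bar>f x\<bar> powr (2 * q - 1)) + (LINT x|lborel. \<bar>g x\<bar> powr (2 * q - 1)))))"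
    using i ip by simp
  finally show ?thesis .
qed

lemma integrable_flux:
  fixes f :: "'a::euclidean_space \<Rightarrow> real"
  assumes "f \<in> borel_measurable borel" "integrable lborel (\<lambda>x. \<bar>f x\<bar> powr q)"
  shows "integrable lborel (\<lambda>x. flux q (f x))"
  by (rule integrable_dominated[OF assms(2)]) (use assms in \<open>auto simp: abs_flux\<close>)

section \<open>Test functions and the mollified equation\<close>

lemma partial_deriv_eq:
  assumes "(f has_derivative D) (at x)" shows "partial_deriv i f x = D i"
  unfolding partial_deriv_def using frechet_derivative_at[OF assms] by simp

lemma k_times_cont_diff_SucI:
  assumes "\<And>x. (f has_derivative D x) (at x)" "\<And>i. i \<in> Basis \<Longrightarrow> k_times_cont_diff k (\<lambda>x. D x i)"
  shows "k_times_cont_diff (Suc k) f"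
proof -
  have "partial_deriv i f = (\<lambda>x. D x i)" for i using partial_deriv_eq[OF assms(1)] by auto
  then show ?thesis using assms by (auto simp: differentiable_def)
qed

lemma k_times_cont_diff_SucD:
  "k_times_cont_diff (Suc k) f \<Longrightarrow> k_times_cont_diff k f"
proof (induction k arbitrary: f)
  case 0
  then show ?case by (auto intro!: continuous_at_imp_continuous_on differentiable_imp_continuous_within)
next
  case (Suc k)
  then show ?case by (metis k_times_cont_diff.simps(2))
qed

lemma has_derivative_partial_deriv:
  fixes f :: "'a::euclidean_space \<Rightarrow> real"
  assumes "f differentiable at x"
  shows "(f has_derivative (\<lambda>h. frechet_derivative f (at x) h)) (at x)"
  using assms frechet_derivative_works by blast

lemma k_times_cont_diff_add:
  "k_times_cont_diff k f \<Longrightarrow> k_times_cont_diff k g \<Longrightarrow> k_times_cont_diff k (\<lambda>x. f x + g x)"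
proof (induction k arbitrary: f g)
  case (Suc k)
  show ?case
  proof (rule k_times_cont_diff_SucI)
    show "((\<lambda>x. f x + g x) has_derivative (\<lambda>h. frechet_derivative f (at x) h + frechet_derivative g (at x) h)) (at x)" for x
      using Suc.prems by (intro has_derivative_add has_derivative_partial_deriv) auto
    show "k_times_cont_diff k (\<lambda>x. frechet_derivative f (at x) i + frechet_derivative g (at x) i)" if "i \<in> Basis" for i
      using Suc.IH[of "partial_deriv i f" "partial_deriv i g"] Suc.prems that by (simp add: partial_deriv_def[abs_def])
  qed
qed (auto intro: continuous_intros)

lemma k_times_cont_diff_mult:
  "k_times_cont_diff k f \<Longrightarrow> k_times_cont_diff k g \<Longrightarrow> k_times_cont_diff k (\<lambda>x. f x * g x)"
proof (induction k arbitrary: f g)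
  case (Suc k)
  show ?case
  proof (rule k_times_cont_diff_SucI)
    show "((\<lambda>x. f x * g x) has_derivative (\<lambda>h. f x * frechet_derivative g (at x) h + frechet_derivative f (at x) h * g x)) (at x)" for x
      using Suc.prems by (intro has_derivative_mult has_derivative_partial_deriv) auto
    show "k_times_cont_diff k (\<lambda>x. f x * frechet_derivative g (at x) i + frechet_derivative f (at x) i * g x)" if "i \<in> Basis" for i
      using k_times_cont_diff_add[OF Suc.IH[of f "partial_deriv i g"] Suc.IH[of "partial_deriv i f" g]]
        Suc.prems that k_times_cont_diff_SucD[of k f] k_times_cont_diff_SucD[of k g] by (simp add: partial_deriv_def[abs_def])
  qed
qed (auto intro: continuous_intros)

lemma k_times_cont_diff_const: "k_times_cont_diff k (\<lambda>x. c)"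
proof (induction k arbitrary: c)
  case (Suc k)
  show ?case by (rule k_times_cont_diff_SucI[of _ "\<lambda>_ _. 0"]) (use Suc in auto)
qed auto

lemma k_times_cont_diff_inner: "k_times_cont_diff k (\<lambda>x. (x - z) \<bullet> b)"
proof (cases k)
  case (Suc m)
  show ?thesis unfolding Suc
    by (rule k_times_cont_diff_SucI[of _ "\<lambda>x h. h \<bullet> b"])
      (auto intro!: derivative_eq_intros k_times_cont_diff_const)
next
  case 0
  show ?thesis unfolding 0 k_times_cont_diff.simps by (intro continuous_intros)
qed

lemma heat_kernel_reflect_has_derivative:
  assumes "t > 0"
  shows "((\<lambda>y. heat_kernel t (x - y)) has_derivative (\<lambda>h. - (heat_grad t (x - y) \<bullet> h))) (at y)"
proof -
  have "((\<lambda>y. x - y) has_derivative (\<lambda>h. - h)) (at y)" by (auto intro!: derivative_eq_intros)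
  from has_derivative_compose[OF this heat_kernel_has_derivative[OF assms]] show ?thesis by simp
qed

lemma heat_grad_reflect_has_derivative:
  assumes "t > 0"
  shows "((\<lambda>y. - (heat_grad t (x - y) \<bullet> i)) has_derivative (\<lambda>h. heat_hess t i (x - y) \<bullet> h)) (at y)"
proof -
  have "((\<lambda>y. x - y) has_derivative (\<lambda>h. - h)) (at y)" by (auto intro!: derivative_eq_intros)
  from has_derivative_minus[OF has_derivative_compose[OF this heat_grad_has_derivative[OF assms]]] show ?thesis by simp
qed

text \<open>Each partial derivative is the kernel times an affine function, so the class of smooth
  products closes the induction.\<close>

lemma k_times_cont_diff_heat:
  assumes "t > 0"
  shows "k_times_cont_diff k (\<lambda>y. heat_kernel t (x - y))"
proof (induction k)
  case 0
  then show ?case by (auto intro!: continuous_on_compose2[OF continuous_on_heat_kernel] continuous_intros)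
next
  case (Suc k)
  show ?case
  proof (rule k_times_cont_diff_SucI[OF heat_kernel_reflect_has_derivative[OF assms]])
    fix i :: 'a
    have "k_times_cont_diff k (\<lambda>y. (heat_kernel t (x - y) * (- 1 / (2 * t))) * ((y - x) \<bullet> i))"
      by (intro k_times_cont_diff_mult Suc k_times_cont_diff_const k_times_cont_diff_inner)
    moreover have "(heat_kernel t (x - y) * (- 1 / (2 * t))) * ((y - x) \<bullet> i) = - (heat_grad t (x - y) \<bullet> i)" for y
      by (simp add: heat_grad_def inner_diff_left right_diff_distrib)
    ultimately show "k_times_cont_diff k (\<lambda>y. - (heat_grad t (x - y) \<bullet> i))" by simp
  qed
qed

text \<open>The functions exp(-1/r) r^(-j), extended by 0, form a family closed under
  differentiation up to linear combinations. Hence every derivative of the cutoff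
  \<open>bump 0 (1 - |y|^2 / R^2)\<close> is again an explicit expression in the family.\<close>

definition bump :: "nat \<Rightarrow> real \<Rightarrow> real" where
  "bump j r = (if r > 0 then exp (- (1 / r)) * (1 / r) ^ j else 0)"

lemma bump_nonneg: "bump j r \<ge> 0" by (simp add: bump_def)

lemma bump_le: "bump j r \<le> fact j"
proof (cases "r > 0")
  case True
  define z where "z = 1 / r"
  have z: "z > 0" using True by (simp add: z_def)
  have "z ^ j / fact j \<le> exp z"
  proof -
    \<comment> \<open>A single term of the exponential series is below its sum.\<close>
    have "(\<Sum>n\<in>{j}. z ^ n /\<^sub>R fact n) \<le> (\<Sum>n. z ^ n /\<^sub>R fact n)"
      using z by (intro sum_le_suminf summable_exp_generic) auto
    then have "(\<Sum>n\<in>{j}. z ^ n /\<^sub>R fact n) \<le> exp z" by (simp add: exp_def)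
    then show ?thesis by (simp add: divide_inverse mult.commute)
  qed
  then have "exp (- z) * z ^ j \<le> fact j"
    by (simp add: exp_minus field_simps)
  then show ?thesis using True by (simp add: bump_def z_def)
qed (simp add: bump_def)

text \<open>Only r = 0 needs an argument: with z = 1/h the right difference quotient is z^(j+1)
  exp(-z), which tends to 0.\<close>

lemma bump_has_derivative:
  "(bump j has_real_derivative (bump (j + 2) r - real j * bump (j + 1) r)) (at r)"
proof -
  consider "r > 0" | "r < 0" | "r = 0" by linarith
  then show ?thesis
  proof cases
    case 1
    have "((\<lambda>r. exp (- (1 / r)) * (1 / r) ^ j) has_real_derivative
        (exp (- (1 / r)) * (1 / r\<^sup>2)) * (1 / r) ^ j + (real j * (1 / r) ^ (j - 1) * (- 1 / r\<^sup>2)) * exp (- (1 / r))) (at r)"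
      using 1 by (auto intro!: derivative_eq_intros simp: power2_eq_square)
    moreover have "(exp (- (1 / r)) * (1 / r\<^sup>2)) * (1 / r) ^ j + (real j * (1 / r) ^ (j - 1) * (- 1 / r\<^sup>2)) * exp (- (1 / r))
        = bump (j + 2) r - real j * bump (j + 1) r"
      using 1 by (cases j) (auto simp: bump_def power_divide power_add power2_eq_square field_simps)
    ultimately have "((\<lambda>r. exp (- (1 / r)) * (1 / r) ^ j) has_real_derivative bump (j + 2) r - real j * bump (j + 1) r) (at r)"
      by simp
    then show ?thesis
      by (rule has_field_derivative_transform_within_open[where S = "{0<..}"]) (use 1 in \<open>auto simp: bump_def\<close>)
  next
    case 2
    have "((\<lambda>r. 0) has_real_derivative 0) (at r)" by simp
    then have "(bump j has_real_derivative 0) (at r)"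
      by (rule has_field_derivative_transform_within_open[where S = "{..<0}"]) (use 2 in \<open>auto simp: bump_def\<close>)
    then show ?thesis using 2 by (simp add: bump_def)
  next
    case 3
    have "((\<lambda>z::real. z ^ Suc j / exp z) \<longlongrightarrow> 0) at_top" by (rule tendsto_power_div_exp_0)
    from filterlim_compose[OF this filterlim_inverse_at_top_right]
    have "((\<lambda>h. inverse h ^ Suc j / exp (inverse h)) \<longlongrightarrow> (0::real)) (at_right 0)" .
    then have "((\<lambda>h. (bump j (0 + h) - bump j 0) / h) \<longlongrightarrow> 0) (at_right 0)"
      by (rule Lim_transform_eventually) (auto simp: bump_def eventually_at_filter exp_minus divide_simps)
    moreover have "((\<lambda>h. (bump j (0 + h) - bump j 0) / h) \<longlongrightarrow> 0) (at_left 0)"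
      by (rule tendsto_eventually) (auto simp: bump_def eventually_at_filter)
    ultimately have "((\<lambda>h. (bump j (0 + h) - bump j 0) / h) \<longlongrightarrow> 0) (at 0)"
      by (simp add: filterlim_split_at)
    then show ?thesis using 3 by (simp add: DERIV_def bump_def)
  qed
qed

lemma bump_ball_has_derivative:
  fixes y :: "'a::euclidean_space"
  shows "((\<lambda>y. bump j (1 - (norm y)\<^sup>2 / R\<^sup>2)) has_derivative
    (\<lambda>h. (bump (j + 2) (1 - (norm y)\<^sup>2 / R\<^sup>2) - real j * bump (j + 1) (1 - (norm y)\<^sup>2 / R\<^sup>2)) * (- 2 * (y \<bullet> h) / R\<^sup>2))) (at y)"
proof -
  have "((\<lambda>y::'a. 1 - (y \<bullet> y) * inverse (R\<^sup>2)) has_derivative (\<lambda>h. 0 - (y \<bullet> h + h \<bullet> y) * inverse (R\<^sup>2))) (at y)"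
    by (intro has_derivative_diff has_derivative_mult_left has_derivative_inner has_derivative_ident has_derivative_const)
  from has_derivative_compose[OF this bump_has_derivative[THEN has_field_derivative_imp_has_derivative]]
  show ?thesis by (simp add: power2_norm_eq_inner divide_inverse inner_commute algebra_simps)
qed

lemma k_times_cont_diff_bump:
  "k_times_cont_diff k (\<lambda>y::'a::euclidean_space. bump j (1 - (norm y)\<^sup>2 / R\<^sup>2))"
proof (induction k arbitrary: j)
  case 0
  have "isCont (bump j) r" for r using bump_has_derivative DERIV_isCont by blast
  then have "continuous_on UNIV (bump j)" by (simp add: continuous_at_imp_continuous_on)
  then show ?case by (auto simp: divide_inverse intro!: continuous_on_compose2[of UNIV "bump j"] continuous_intros)
next
  case (Suc k)
  show ?case
  proof (rule k_times_cont_diff_SucI[OF bump_ball_has_derivative])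
    fix i :: 'a
    have "k_times_cont_diff k (\<lambda>y::'a. (bump (j + 2) (1 - (norm y)\<^sup>2 / R\<^sup>2) + (- real j) * bump (j + 1) (1 - (norm y)\<^sup>2 / R\<^sup>2)) * ((- 2 / R\<^sup>2) * ((y - 0) \<bullet> i)))"
      by (intro k_times_cont_diff_mult k_times_cont_diff_add k_times_cont_diff_const k_times_cont_diff_inner Suc)
    then show "k_times_cont_diff k (\<lambda>y. (bump (j + 2) (1 - (norm y)\<^sup>2 / R\<^sup>2) - real j * bump (j + 1) (1 - (norm y)\<^sup>2 / R\<^sup>2)) * (- 2 * (y \<bullet> i) / R\<^sup>2))"
      by simp
  qed
qed

lemma test_function_partial_deriv:
  assumes "\<phi> \<in> test_functions" "i \<in> Basis"
  shows "partial_deriv i \<phi> \<in> test_functions"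
proof -
  obtain K where K: "compact K" "\<And>x. x \<notin> K \<Longrightarrow> \<phi> x = 0" using assms by (auto simp: test_functions_def)
  have "partial_deriv i \<phi> x = 0" if "x \<notin> K" for x
  proof -
    have "((\<lambda>x. 0::real) has_derivative (\<lambda>h. 0)) (at x)" by simp
    then have "(\<phi> has_derivative (\<lambda>h. 0)) (at x)"
      by (rule has_derivative_transform_within_open[of _ _ x UNIV "- K"])
        (use K that compact_imp_closed in \<open>auto simp: open_Compl\<close>)
    then show ?thesis by (rule partial_deriv_eq)
  qed
  moreover have "k_times_cont_diff k (partial_deriv i \<phi>)" for k
    using assms k_times_cont_diff.simps(2)[of k \<phi>] by (auto simp: test_functions_def simp del: k_times_cont_diff.simps)
  ultimately show ?thesis using K(1) by (auto simp: test_functions_def)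
qed

lemma test_function_integrable:
  assumes \<phi>: "\<phi> \<in> test_functions" and g: "locally_integrable g"
  shows "integrable lborel (\<lambda>x. g x * \<phi> x)"
proof -
  obtain K where K: "compact K" "\<And>x. x \<notin> K \<Longrightarrow> \<phi> x = 0" using \<phi> by (auto simp: test_functions_def)
  have c: "continuous_on UNIV \<phi>" using \<phi> k_times_cont_diff.simps(1)[of \<phi>] by (auto simp: test_functions_def)
  have [measurable]: "\<phi> \<in> borel_measurable borel" using c by (rule borel_measurable_continuous_onI)
  have "compact (\<phi> ` K)" by (rule compact_continuous_image[OF continuous_on_subset[OF c subset_UNIV] K(1)])
  then have "bounded (\<phi> ` K)" by (rule compact_imp_bounded)
  then obtain B where "\<forall>y\<in>\<phi> ` K. norm y \<le> B" unfolding bounded_iff by (rule exE)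
  then have B: "\<bar>\<phi> x\<bar> \<le> B" if "x \<in> K" for x using that by auto
  have i: "integrable lborel (\<lambda>x. \<bar>indicator K x * g x\<bar> * \<bar>B\<bar>)"
    using g K(1) by (simp add: locally_integrable_def set_integrable_def)
  have "(\<lambda>x. (indicator K x *\<^sub>R g x) * \<phi> x) \<in> borel_measurable lborel"
    using g K(1) by (intro borel_measurable_times) (auto simp: locally_integrable_def set_integrable_def dest!: spec[of _ K])
  moreover have "(\<lambda>x. (indicator K x *\<^sub>R g x) * \<phi> x) = (\<lambda>x. g x * \<phi> x)" using K(2) by (auto simp: fun_eq_iff indicator_def)
  ultimately have gm: "(\<lambda>x. g x * \<phi> x) \<in> borel_measurable lborel" by (simp only:)
  show ?thesis
  proof (rule integrable_dominated[OF i gm])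
    fix x show "norm (g x * \<phi> x) \<le> \<bar>indicator K x * g x\<bar> * \<bar>B\<bar>"
    proof (cases "x \<in> K")
      case True
      then show ?thesis using order_trans[OF B[OF True] abs_ge_self] by (simp add: abs_mult mult_left_mono)
    qed (use K in auto)
  qed
qed

section \<open>From the weak equation to the mollified one\<close>

lemma weak_deriv_works:
  assumes "weakly_differentiable f" "i \<in> Basis"
  shows "has_weak_deriv i f (weak_deriv i f)"
  using assms unfolding weakly_differentiable_def weak_deriv_def by (metis someI_ex)

text \<open>Moves all spatial derivatives onto the test function, so that the arbitrarily chosen
  representatives of the weak derivatives disappear from the later argument.\<close>

lemma weak_equation_tested:
  fixes u v :: "'a::euclidean_space \<Rightarrow> real"
  assumes u: "u \<in> W2p_space 2" and F: "weakly_differentiable (\<lambda>x. flux q (u x))"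
    and eq: "AE x in lborel. v x - weak_laplacian u x + a \<bullet> weak_grad (\<lambda>y. flux q (u y)) x = 0"
    and v: "v \<in> borel_measurable borel" and \<phi>: "\<phi> \<in> test_functions"
  shows "(LINT x|lborel. v x * \<phi> x) = (\<Sum>i\<in>Basis. LINT x|lborel. u x * partial_deriv i (partial_deriv i \<phi>) x)
     + (\<Sum>i\<in>Basis. (a \<bullet> i) * (LINT x|lborel. flux q (u x) * partial_deriv i \<phi> x))"
proof -
  let ?F = "\<lambda>x. flux q (u x)"
  have \<phi>m [measurable]: "\<phi> \<in> borel_measurable borel"
    using \<phi> k_times_cont_diff.simps(1)[of \<phi>] by (auto simp: test_functions_def intro: borel_measurable_continuous_onI)
  have D: "has_weak_deriv i u (weak_deriv i u)" "has_weak_deriv i (weak_deriv i u) (weak_deriv i (weak_deriv i u))"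
    "has_weak_deriv i ?F (weak_deriv i ?F)" if "i \<in> Basis" for i
    using u F that by (auto simp: W2p_space_def intro!: weak_deriv_works)
  have I: "integrable lborel (\<lambda>x. weak_deriv i (weak_deriv i u) x * \<phi> x)" "integrable lborel (\<lambda>x. weak_deriv i ?F x * \<phi> x)"
    if "i \<in> Basis" for i
    using D[OF that] by (auto intro!: test_function_integrable[OF \<phi>] simp: has_weak_deriv_def)
  let ?w = "\<lambda>x. (\<Sum>i\<in>Basis. weak_deriv i (weak_deriv i u) x * \<phi> x) - (\<Sum>i\<in>Basis. (a \<bullet> i) * (weak_deriv i ?F x * \<phi> x))"
  have iw: "integrable lborel ?w"
    using I by (intro Bochner_Integration.integrable_diff Bochner_Integration.integrable_sum integrable_mult_right) auto
  have "AE x in lborel. v x * \<phi> x = ?w x"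
    using eq
  proof eventually_elim
    case (elim x)
    have "v x = (\<Sum>i\<in>Basis. weak_deriv i (weak_deriv i u) x) - (\<Sum>i\<in>Basis. (a \<bullet> i) * weak_deriv i ?F x)"
      using elim by (simp add: weak_laplacian_def weak_grad_def inner_sum_right mult.commute)
    then show ?case by (simp add: left_diff_distrib sum_distrib_right mult.assoc)
  qed
  then have "(LINT x|lborel. v x * \<phi> x) = (LINT x|lborel. ?w x)"
    using v iw by (intro integral_cong_AE) auto
  also have "\<dots> = (\<Sum>i\<in>Basis. LINT x|lborel. weak_deriv i (weak_deriv i u) x * \<phi> x)
      - (\<Sum>i\<in>Basis. (a \<bullet> i) * (LINT x|lborel. weak_deriv i ?F x * \<phi> x))"
    using I by (subst Bochner_Integration.integral_diff)
      (auto simp: Bochner_Integration.integral_sum intro!: Bochner_Integration.integrable_sum)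
  also have "\<dots> = (\<Sum>i\<in>Basis. LINT x|lborel. u x * partial_deriv i (partial_deriv i \<phi>) x)
     + (\<Sum>i\<in>Basis. (a \<bullet> i) * (LINT x|lborel. ?F x * partial_deriv i \<phi> x))"
  proof -
    have "(LINT x|lborel. weak_deriv i (weak_deriv i u) x * \<phi> x) = (LINT x|lborel. u x * partial_deriv i (partial_deriv i \<phi>) x)"
      "(LINT x|lborel. weak_deriv i ?F x * \<phi> x) = - (LINT x|lborel. ?F x * partial_deriv i \<phi> x)" if i: "i \<in> Basis" for i
      using D[OF i] \<phi> test_function_partial_deriv[OF \<phi> i] by (auto simp: has_weak_deriv_def)
    then show ?thesis by (simp add: sum_negf)
  qed
  finally show ?thesis .
qed

text \<open>The natural test function \<open>heat_kernel t (x - y)\<close> in \<open>y\<close> is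
  smooth but not compactly supported. It is multiplied by cutoffs of radius \<open>R n\<close>, and
  dominated convergence removes them; terms in which a cutoff was differentiated vanish because of
  the factor 1/R^2.\<close>

lemma heat_equation_mollified:
  fixes u v F :: "'a::euclidean_space \<Rightarrow> real"
  assumes eq: "\<And>\<phi>. \<phi> \<in> test_functions \<Longrightarrow>
      (LINT x|lborel. v x * \<phi> x) = (\<Sum>i\<in>Basis. LINT x|lborel. u x * partial_deriv i (partial_deriv i \<phi>) x)
     + (\<Sum>i\<in>Basis. (a \<bullet> i) * (LINT x|lborel. F x * partial_deriv i \<phi> x))"
    and u: "integrable lborel u" and F: "integrable lborel F"
    and v [measurable]: "v \<in> borel_measurable borel" and v2: "integrable lborel (\<lambda>x. (v x)\<^sup>2)" and t: "t > 0"
  shows "conv (heat_kernel t) v x = conv (heat_lapl t) u x - a \<bullet> conv (heat_grad t) F x"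
proof -
  have um [measurable]: "u \<in> borel_measurable borel" "F \<in> borel_measurable borel" using u F by auto
  define R where "R n = real (Suc n)" for n
  have R: "R n \<ge> 1" for n by (simp add: R_def)
  define g where "g y = heat_kernel t (x - y)" for y
  define g1 where "g1 i y = - (heat_grad t (x - y) \<bullet> i)" for i y
  define g2 where "g2 i y = heat_hess t i (x - y) \<bullet> i" for i y
  define b where "b j n y = bump j (1 - (norm y)\<^sup>2 / (R n)\<^sup>2)" for j n and y :: 'a
  define \<rho> where "\<rho> i n y = - 2 * (y \<bullet> i) / (R n)\<^sup>2" for i n and y :: 'a
  \<comment> \<open>The factor \<open>exp 1\<close> normalises the cutoff:
    \<open>bump 0 1 = exp (- 1)\<close>, so the product tends to \<open>g\<close>.\<close>
  define \<phi> where "\<phi> n y = g y * (exp 1 * b 0 n y)" for n y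
  define \<phi>1 where "\<phi>1 i n y = g y * (exp 1 * (b 2 n y * \<rho> i n y)) + g1 i y * (exp 1 * b 0 n y)" for i n y
  \<comment> \<open>Second derivative along \<open>i\<close>: the indices 4 and 3 come from
    differentiating \<open>bump 2\<close>, whose derivative is
    \<open>bump 4 - 2 * bump 3\<close>.\<close>
  define \<phi>2 where "\<phi>2 i n y = g y * (exp 1 * (b 2 n y * (- 2 / (R n)\<^sup>2) + ((b 4 n y - 2 * b 3 n y) * \<rho> i n y) * \<rho> i n y))
     + 2 * (g1 i y * (exp 1 * (b 2 n y * \<rho> i n y))) + g2 i y * (exp 1 * b 0 n y)" for i n y
  have dg: "(g has_derivative (\<lambda>h. - (heat_grad t (x - y) \<bullet> h))) (at y)" for y
    unfolding g_def[abs_def] by (rule heat_kernel_reflect_has_derivative[OF t])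
  have dg1: "(g1 i has_derivative (\<lambda>h. heat_hess t i (x - y) \<bullet> h)) (at y)" for i y
    unfolding g1_def[abs_def] by (rule heat_grad_reflect_has_derivative[OF t])
  have db: "(b j n has_derivative (\<lambda>h. (b (j + 2) n y - real j * b (j + 1) n y) * \<rho> h n y)) (at y)" for j n y
    unfolding b_def[abs_def] \<rho>_def by (rule bump_ball_has_derivative)
  have db0: "(b 0 n has_derivative (\<lambda>h. b 2 n y * \<rho> h n y)) (at y)" for n y
    using db[of 0 n y] by (simp del: add_2_eq_Suc add_2_eq_Suc')
  have db2: "(b 2 n has_derivative (\<lambda>h. (b 4 n y - 2 * b 3 n y) * \<rho> h n y)) (at y)" for n y
    using db[of 2 n y] by (simp del: add_2_eq_Suc add_2_eq_Suc')
  have d\<rho>: "(\<rho> i n has_derivative \<rho> i n) (at y)" for i n y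
    unfolding \<rho>_def[abs_def] divide_inverse
    by (intro has_derivative_mult_left has_derivative_mult_right has_derivative_inner_left has_derivative_ident)
  have d\<phi>: "(\<phi> n has_derivative (\<lambda>h. \<phi>1 h n y)) (at y)" for n y
    unfolding \<phi>_def[abs_def]
    by (rule has_derivative_eq_rhs[OF has_derivative_mult[OF dg has_derivative_mult_right[OF db0]]])
      (simp add: \<phi>1_def g1_def fun_eq_iff)
  have p\<phi>: "partial_deriv i (\<phi> n) = \<phi>1 i n" for i n
    using partial_deriv_eq[OF d\<phi>] by auto
  have p\<phi>1: "partial_deriv i (\<phi>1 i n) y = \<phi>2 i n y" if i: "i \<in> Basis" for i n y
    unfolding \<phi>1_def[abs_def]
    by (subst partial_deriv_eq[OF has_derivative_add[OF has_derivative_mult[OF dg has_derivative_mult_right[OF has_derivative_mult[OF db2 d\<rho>]]]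
          has_derivative_mult[OF dg1 has_derivative_mult_right[OF db0]]]])
      (use i in \<open>simp add: \<phi>2_def g1_def g2_def \<rho>_def inner_same_Basis algebra_simps\<close>)
  have test: "\<phi> n \<in> test_functions" for n
  proof -
    have "k_times_cont_diff k (\<phi> n)" for k
      unfolding \<phi>_def[abs_def] g_def b_def
      by (intro k_times_cont_diff_mult k_times_cont_diff_heat k_times_cont_diff_const k_times_cont_diff_bump t)
    moreover have "\<phi> n y = 0" if "y \<notin> cball 0 (R n)" for y
    proof -
      have "(R n)\<^sup>2 \<le> (norm y)\<^sup>2" using that R[of n] by (intro power_mono) auto
      then have "1 - (norm y)\<^sup>2 / (R n)\<^sup>2 \<le> 0" using R[of n] by (simp add: field_simps)
      then show ?thesis by (simp add: \<phi>_def b_def bump_def)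
    qed
    ultimately show ?thesis unfolding test_functions_def using compact_cball by blast
  qed
  have Rl: "(\<lambda>n. inverse ((R n)\<^sup>2)) \<longlonglongrightarrow> 0"
    using tendsto_mult[OF LIMSEQ_inverse_real_of_nat LIMSEQ_inverse_real_of_nat] by (simp add: R_def power2_eq_square)
  have bl: "(\<lambda>n. b j n y) \<longlonglongrightarrow> exp (- 1)" for j y
  proof -
    have "(\<lambda>n. 1 - (norm y)\<^sup>2 * inverse ((R n)\<^sup>2)) \<longlonglongrightarrow> 1 - (norm y)\<^sup>2 * 0"
      by (intro tendsto_intros Rl)
    then have "(\<lambda>n. bump j (1 - (norm y)\<^sup>2 / (R n)\<^sup>2)) \<longlonglongrightarrow> bump j (1 - 0)"
      by (intro isCont_tendsto_compose[OF DERIV_isCont[OF bump_has_derivative]]) (simp add: divide_inverse)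
    then show ?thesis by (simp add: b_def bump_def)
  qed
  have \<rho>l: "(\<lambda>n. \<rho> i n y) \<longlonglongrightarrow> 0" for i y
  proof -
    have "(\<lambda>n. - 2 * (y \<bullet> i) * inverse ((R n)\<^sup>2)) \<longlonglongrightarrow> - 2 * (y \<bullet> i) * 0" by (intro tendsto_intros Rl)
    then show ?thesis by (simp add: \<rho>_def divide_inverse)
  qed
  have ee: "exp (1::real) * exp (- 1) = 1" by (simp add: exp_minus)
  have l0: "(\<lambda>n. \<phi> n y) \<longlonglongrightarrow> g y" for y
  proof -
    have "(\<lambda>n. \<phi> n y) \<longlonglongrightarrow> g y * (exp 1 * exp (- 1))" unfolding \<phi>_def by (intro tendsto_intros bl)
    then show ?thesis by (simp only: ee mult_1_right)
  qed
  have l1: "(\<lambda>n. \<phi>1 i n y) \<longlonglongrightarrow> g1 i y" for i y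
  proof -
    have "(\<lambda>n. \<phi>1 i n y) \<longlonglongrightarrow> g y * (exp 1 * (exp (- 1) * 0)) + g1 i y * (exp 1 * exp (- 1))" unfolding \<phi>1_def by (intro tendsto_intros bl \<rho>l)
    then show ?thesis by (simp only: ee mult_1_right mult_zero_right add_0)
  qed
  have l2: "(\<lambda>n. \<phi>2 i n y) \<longlonglongrightarrow> g2 i y" for i y
  proof -
    have "(\<lambda>n. \<phi>2 i n y) \<longlonglongrightarrow> g y * (exp 1 * (exp (- 1) * (- 2 * 0) + ((exp (- 1) - 2 * exp (- 1)) * 0) * 0))
      + 2 * (g1 i y * (exp 1 * (exp (- 1) * 0))) + g2 i y * (exp 1 * exp (- 1))"
      unfolding \<phi>2_def divide_inverse by (intro tendsto_intros bl \<rho>l Rl)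
    then show ?thesis by (simp only: ee mult_1_right mult_zero_right mult_zero_left add_0)
  qed
  have bb: "\<bar>b j n y\<bar> \<le> fact j" for j n y
    using bump_nonneg bump_le by (simp add: b_def)
  \<comment> \<open>Inside the ball, R >= 1 gives |y . i| <= R <= R^2; outside,
    \<open>\<rho>\<close> is unbounded but every bump factor is 0.\<close>
  have b\<rho>: "\<bar>\<rho> i n y\<bar> \<le> 2 \<or> (\<forall>j. b j n y = 0)" if "i \<in> Basis" for i n y
  proof (cases "norm y \<le> R n")
    case True
    have "\<bar>y \<bullet> i\<bar> \<le> R n" using True Basis_le_norm[OF that, of y] by linarith
    also have "R n \<le> (R n)\<^sup>2" using R[of n] by (simp add: power2_eq_square)
    finally show ?thesis using R[of n] by (simp add: \<rho>_def abs_mult divide_le_eq)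
  next
    case False
    then have "(R n)\<^sup>2 \<le> (norm y)\<^sup>2" using R[of n] by (intro power_mono) auto
    then have "1 - (norm y)\<^sup>2 / (R n)\<^sup>2 \<le> 0" using R[of n] by (simp add: field_simps)
    then show ?thesis by (simp add: b_def bump_def)
  qed
  have b\<rho>1: "\<bar>b j n y * \<rho> i n y\<bar> \<le> fact j * 2" if "i \<in> Basis" for i j n y
    using b\<rho>[OF that, of n y]
  proof
    assume "\<bar>\<rho> i n y\<bar> \<le> 2"
    then show ?thesis unfolding abs_mult using bb[of j n y] by (intro mult_mono) auto
  qed simp
  have b\<rho>2: "\<bar>b j n y * \<rho> i n y * \<rho> i n y\<bar> \<le> fact j * 2 * 2" if "i \<in> Basis" for i j n y
    using b\<rho>[OF that, of n y]
  proof
    assume "\<bar>\<rho> i n y\<bar> \<le> 2"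
    then show ?thesis unfolding abs_mult[of "_ * _" "\<rho> i n y"] using b\<rho>1[OF that, of j n y] by (intro mult_mono) auto
  qed simp
  have Ri: "\<bar>- 2 / (R n)\<^sup>2\<bar> \<le> 2" for n using R[of n] by (simp add: divide_le_eq power2_eq_square mult_ge1_I)
  define e where "e = exp (1::real)"
  have e0: "e \<ge> 0" by (simp add: e_def)
  have tri: "\<bar>A + 2 * B + C\<bar> \<le> a + 2 * b + c" if "\<bar>A\<bar> \<le> a" "\<bar>B\<bar> \<le> b" "\<bar>C\<bar> \<le> c" for A B C a b c :: real
    using that by linarith
  have exb: "\<exists>B. \<forall>y. \<bar>g y\<bar> \<le> B \<and> \<bar>g1 i y\<bar> \<le> B \<and> \<bar>g2 i y\<bar> \<le> B" if i: "i \<in> Basis" for i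
  proof -
    obtain B where B: "\<And>x::'a. \<bar>heat_kernel t x\<bar> \<le> B" "\<And>x::'a. norm (heat_grad t x) \<le> B" "\<And>x. norm (heat_hess t i x) \<le> B"
      using heat_bounded[OF t, of i] by metis
    have "\<bar>z \<bullet> i\<bar> \<le> norm z" for z using Basis_le_norm[OF i] by simp
    then have "\<bar>g y\<bar> \<le> B \<and> \<bar>g1 i y\<bar> \<le> B \<and> \<bar>g2 i y\<bar> \<le> B" for y
      unfolding g_def g1_def g2_def abs_minus_cancel using B order_trans by blast
    then show ?thesis by blast
  qed
  have bound: "\<exists>B. \<forall>n y. \<bar>\<phi>1 i n y\<bar> \<le> B \<and> \<bar>\<phi>2 i n y\<bar> \<le> B" if i: "i \<in> Basis" for i
  proof -
    obtain B where B: "\<And>y. \<bar>g y\<bar> \<le> B" "\<And>y. \<bar>g1 i y\<bar> \<le> B" "\<And>y. \<bar>g2 i y\<bar> \<le> B" using exb[OF i] by blast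
    have B0: "B \<ge> 0" using B(1)[of 0] by linarith
    have "\<bar>\<phi>1 i n y\<bar> \<le> B * (e * 4) + B * (e * 1)" for n y
    proof -
      have "\<bar>b 2 n y * \<rho> i n y\<bar> \<le> 4" "\<bar>b 0 n y\<bar> \<le> 1" using b\<rho>1[OF i, of 2 n y] bb[of 0 n y] by (simp_all add: fact_numeral)
      then have "\<bar>g y * (e * (b 2 n y * \<rho> i n y))\<bar> \<le> B * (e * 4)" "\<bar>g1 i y * (e * b 0 n y)\<bar> \<le> B * (e * 1)"
        unfolding abs_mult[of "g y"] abs_mult[of "g1 i y"] abs_mult[of e] using B B0 e0
        by (intro mult_mono; simp)+
      then show ?thesis unfolding \<phi>1_def e_def[symmetric] by linarith
    qed
    \<comment> \<open>148 = 4 + 96 + 2 * 24, from the bounds j! on the bumps with j = 2, 4, 3 and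
      the bound 2 on each of \<open>\<rho>\<close> and 2/R^2.\<close>
    moreover have "\<bar>\<phi>2 i n y\<bar> \<le> B * (e * 148) + 2 * (B * (e * 4)) + B * (e * 1)" for n y
    proof -
      have 1: "\<bar>b 2 n y * \<rho> i n y\<bar> \<le> 4" "\<bar>b 0 n y\<bar> \<le> 1" using b\<rho>1[OF i, of 2 n y] bb[of 0 n y] by (simp_all add: fact_numeral)
      have "\<bar>b 2 n y * (- 2 / (R n)\<^sup>2)\<bar> \<le> 2 * 2" unfolding abs_mult using bb[of 2 n y] Ri[of n] by (intro mult_mono) (auto simp: fact_numeral)
      moreover have "\<bar>b 4 n y * \<rho> i n y * \<rho> i n y\<bar> \<le> 96" "\<bar>b 3 n y * \<rho> i n y * \<rho> i n y\<bar> \<le> 24"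
        using b\<rho>2[OF i, of 4 n y] b\<rho>2[OF i, of 3 n y] by (simp_all add: fact_numeral)
      moreover have "((b 4 n y - 2 * b 3 n y) * \<rho> i n y) * \<rho> i n y = b 4 n y * \<rho> i n y * \<rho> i n y - 2 * (b 3 n y * \<rho> i n y * \<rho> i n y)"
        by (simp add: algebra_simps)
      ultimately have 2: "\<bar>b 2 n y * (- 2 / (R n)\<^sup>2) + ((b 4 n y - 2 * b 3 n y) * \<rho> i n y) * \<rho> i n y\<bar> \<le> 148" by linarith
      have "\<bar>g y * (e * (b 2 n y * (- 2 / (R n)\<^sup>2) + ((b 4 n y - 2 * b 3 n y) * \<rho> i n y) * \<rho> i n y))\<bar> \<le> B * (e * 148)"
        "\<bar>g1 i y * (e * (b 2 n y * \<rho> i n y))\<bar> \<le> B * (e * 4)" "\<bar>g2 i y * (e * b 0 n y)\<bar> \<le> B * (e * 1)"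
        unfolding abs_mult[of "g y"] abs_mult[of "g1 i y"] abs_mult[of "g2 i y"] abs_mult[of e] using B B0 e0 1 2
        by (intro mult_mono; simp)+
      then show ?thesis unfolding \<phi>2_def e_def[symmetric] by (rule tri)
    qed
    ultimately show ?thesis
      by (intro exI[of _ "max (B * (e * 4) + B * (e * 1)) (B * (e * 148) + 2 * (B * (e * 4)) + B * (e * 1))"])
        (auto simp: le_max_iff_disj)
  qed
  have [measurable]: "g \<in> borel_measurable borel" "g1 i \<in> borel_measurable borel" "g2 i \<in> borel_measurable borel"
     "\<rho> i n \<in> borel_measurable borel" for i n
    unfolding g_def[abs_def] g1_def[abs_def] g2_def[abs_def] \<rho>_def[abs_def] by measurable
  have [measurable]: "b j n \<in> borel_measurable borel" for j n
    using db has_derivative_continuous by (intro borel_measurable_continuous_onI continuous_at_imp_continuous_on) blast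
  have [measurable]: "\<phi> n \<in> borel_measurable borel" "\<phi>1 i n \<in> borel_measurable borel" "\<phi>2 i n \<in> borel_measurable borel" for i n
    unfolding \<phi>_def[abs_def] \<phi>1_def[abs_def] \<phi>2_def[abs_def] by measurable
  \<comment> \<open>\<open>v\<close> is known only in L^2, so domination uses the product
    \<open>v y * g y\<close>, which is integrable by the Jensen argument with exponent 2.\<close>
  have lim_v: "(\<lambda>n. LINT y|lborel. v y * \<phi> n y) \<longlonglongrightarrow> (LINT y|lborel. v y * g y)"
  proof (rule integral_dominated_convergence[where w = "\<lambda>y. e * \<bar>v y * g y\<bar>"])
    show "AE y in lborel. (\<lambda>n. v y * \<phi> n y) \<longlonglongrightarrow> v y * g y" by (intro AE_I2 tendsto_intros l0)
    have "integrable lborel (\<lambda>y. v y * g y)"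
      unfolding g_def using heat_conv_Lp(1)[OF t, of 2 v x] v2 by (simp add: powr_numeral)
    then show "integrable lborel (\<lambda>y. e * \<bar>v y * g y\<bar>)" by simp
    show "AE y in lborel. norm (v y * \<phi> n y) \<le> e * \<bar>v y * g y\<bar>" for n
    proof (rule AE_I2)
      fix y
      have "\<bar>v y * g y\<bar> * (e * \<bar>b 0 n y\<bar>) \<le> \<bar>v y * g y\<bar> * (e * 1)"
        using bb[of 0 n y] e0 by (intro mult_left_mono) auto
      then show "norm (v y * \<phi> n y) \<le> e * \<bar>v y * g y\<bar>" using e0 by (simp add: \<phi>_def abs_mult e_def mult_ac)
    qed
  qed auto
  have lim_F: "(\<lambda>n. LINT y|lborel. F y * \<phi>1 i n y) \<longlonglongrightarrow> (LINT y|lborel. F y * g1 i y)"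
    and lim_u: "(\<lambda>n. LINT y|lborel. u y * \<phi>2 i n y) \<longlonglongrightarrow> (LINT y|lborel. u y * g2 i y)" if i: "i \<in> Basis" for i
  proof -
    obtain B where B: "\<And>n y. \<bar>\<phi>1 i n y\<bar> \<le> B" "\<And>n y. \<bar>\<phi>2 i n y\<bar> \<le> B" using bound[OF i] by blast
    show "(\<lambda>n. LINT y|lborel. F y * \<phi>1 i n y) \<longlonglongrightarrow> (LINT y|lborel. F y * g1 i y)"
      by (rule integral_dominated_convergence[where w = "\<lambda>y. \<bar>F y\<bar> * B"])
        (use F B in \<open>auto intro!: AE_I2 tendsto_intros l1 mult_left_mono simp: abs_mult\<close>)
    show "(\<lambda>n. LINT y|lborel. u y * \<phi>2 i n y) \<longlonglongrightarrow> (LINT y|lborel. u y * g2 i y)"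
      by (rule integral_dominated_convergence[where w = "\<lambda>y. \<bar>u y\<bar> * B"])
        (use u B in \<open>auto intro!: AE_I2 tendsto_intros l2 mult_left_mono simp: abs_mult\<close>)
  qed
  have eqn: "(LINT y|lborel. v y * \<phi> n y) = (\<Sum>i\<in>Basis. LINT y|lborel. u y * \<phi>2 i n y)
     + (\<Sum>i\<in>Basis. (a \<bullet> i) * (LINT y|lborel. F y * \<phi>1 i n y))" for n
    using eq[OF test[of n]] by (simp add: p\<phi> p\<phi>1)
  have "(\<lambda>n. LINT y|lborel. v y * \<phi> n y) \<longlonglongrightarrow> (\<Sum>i\<in>Basis. LINT y|lborel. u y * g2 i y)
     + (\<Sum>i\<in>Basis. (a \<bullet> i) * (LINT y|lborel. F y * g1 i y))"
    unfolding eqn by (intro tendsto_intros lim_u lim_F)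
  from LIMSEQ_unique[OF lim_v this]
  have "(LINT y|lborel. v y * g y) = (\<Sum>i\<in>Basis. LINT y|lborel. u y * g2 i y)
     + (\<Sum>i\<in>Basis. (a \<bullet> i) * (LINT y|lborel. F y * g1 i y))" .
  moreover have "(\<Sum>i\<in>Basis. LINT y|lborel. u y * g2 i y) = conv (heat_lapl t) u x"
  proof -
    have "(LINT y|lborel. u y * g2 i y) = conv (heat_hess t i) u x \<bullet> i" if i: "i \<in> Basis" for i
    proof -
      obtain B where B: "\<And>x. norm (heat_hess t i x) \<le> B" using heat_bounded[OF t, of i] by metis
      show ?thesis by (subst conv_inner_right[OF u _ B]) (auto simp: conv_def g2_def)
    qed
    then show ?thesis by (simp add: heat_conv_lapl_eq_sum[OF t u, symmetric])
  qed
  moreover have "(\<Sum>i\<in>Basis. (a \<bullet> i) * (LINT y|lborel. F y * g1 i y)) = - (a \<bullet> conv (heat_grad t) F x)"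
  proof -
    obtain B where B: "\<And>x::'a. norm (heat_grad t x) \<le> B" using heat_bounded[OF t, of undefined] by metis
    have "(LINT y|lborel. F y * g1 i y) = - (conv (heat_grad t) F x \<bullet> i)" for i
      by (subst conv_inner_right[OF F _ B]) (simp_all add: conv_def g1_def)
    then show ?thesis by (simp add: euclidean_inner[of a "conv (heat_grad t) F x"] sum_negf)
  qed
  moreover have "(LINT y|lborel. v y * g y) = conv (heat_kernel t) v x" by (simp add: conv_def g_def)
  ultimately show ?thesis by simp
qed

section \<open>Dissipation of convex entropies\<close>

text \<open>Supplies the entropy flux: through a primitive of \<open>\<eta>'' r * flux q r\<close>
  the convective term becomes an exact directional derivative.\<close>

lemma antiderivative_exists:
  fixes h :: "real \<Rightarrow> real"
  assumes "continuous_on UNIV h"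
  shows "\<exists>H. H 0 = 0 \<and> (\<forall>r. (H has_real_derivative h r) (at r))"
proof (intro exI[of _ "\<lambda>x::real. (LBINT y=0..x. h y)"] conjI allI)
  let ?H = "\<lambda>x::real. (LBINT y=0..x. h y)"
  show "?H 0 = 0" by (simp add: zero_ereal_def)
  fix r :: real
  have "(?H has_vector_derivative h r) (at r within {- (\<bar>r\<bar> + 1)..\<bar>r\<bar> + 1})"
    using assms unfolding zero_ereal_def by (intro interval_integral_FTC2 continuous_on_subset[OF assms]) auto
  moreover have "at r within {- (\<bar>r\<bar> + 1)..\<bar>r\<bar> + 1} = at r"
    by (intro at_within_interior) (auto simp: interior_atLeastAtMost_real)
  ultimately show "(?H has_real_derivative h r) (at r)"
    by (simp add: has_real_derivative_iff_has_vector_derivative)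
qed

text \<open>Replaces integration by parts without any decay at infinity. The increment g(x + w) -
  g(x) has integral zero by translation invariance; writing it as an integral of the derivative
  along the segment and exchanging integrals gives the integral of
  \<open>Dg x \<bullet> w\<close>.\<close>

lemma integral_directional_derivative_eq_0:
  fixes g :: "'a::euclidean_space \<Rightarrow> real" and Dg :: "'a \<Rightarrow> 'a"
  assumes g: "integrable lborel g" and D: "\<And>x. (g has_derivative (\<lambda>h. Dg x \<bullet> h)) (at x)"
    and c: "continuous_on UNIV Dg" and i: "integrable lborel (\<lambda>x. Dg x \<bullet> w)"
  shows "(LINT x|lborel. Dg x \<bullet> w) = 0"
proof -
  have [measurable]: "Dg \<in> borel_measurable borel" using c by (rule borel_measurable_continuous_onI)
  let ?f = "\<lambda>(s::real, x). indicator {0..1} s * (Dg (x + s *\<^sub>R w) \<bullet> w)"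
  note sh = integrable_lborel_shift[OF i]
  note sh' = integrable_lborel_shift[OF integrable_abs[OF i]]
  have int: "integrable (lborel \<Otimes>\<^sub>M lborel) ?f"
  proof (rule lborel_pair.Fubini_integrable)
    have "integrable lborel (\<lambda>s. indicator {0..1::real} s * (LINT x|lborel. \<bar>Dg x \<bullet> w\<bar>))" by simp
    then show "integrable lborel (\<lambda>s. LINT x|lborel. norm (?f (s, x)))"
      by (simp add: abs_mult sh'(2))
    show "AE s in lborel. integrable lborel (\<lambda>x. ?f (s, x))"
      using sh(1) by (auto intro!: AE_I2 integrable_mult_right)
  qed measurable
  have ftc: "(LINT s|lborel. indicator {0..1} s * (Dg (x + s *\<^sub>R w) \<bullet> w)) = g (x + w) - g x" for x
  proof -
    have "(LINT s|lborel. indicator {0..1} s *\<^sub>R (Dg (x + s *\<^sub>R w) \<bullet> w)) = g (x + 1 *\<^sub>R w) - g (x + 0 *\<^sub>R w)"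
    proof (rule integral_FTC_atLeastAtMost[where F = "\<lambda>s. g (x + s *\<^sub>R w)"])
      fix s :: real
      have 1: "((\<lambda>s. x + s *\<^sub>R w) has_derivative (\<lambda>h. h *\<^sub>R w)) (at s)" by (auto intro!: derivative_eq_intros)
      have "((\<lambda>s. g (x + s *\<^sub>R w)) has_derivative (\<lambda>h. Dg (x + s *\<^sub>R w) \<bullet> (h *\<^sub>R w))) (at s)"
        by (rule has_derivative_compose[OF 1 D])
      then have "((\<lambda>s. g (x + s *\<^sub>R w)) has_vector_derivative (Dg (x + s *\<^sub>R w) \<bullet> w)) (at s)"
        by (simp add: has_vector_derivative_def)
      then show "((\<lambda>s. g (x + s *\<^sub>R w)) has_vector_derivative (Dg (x + s *\<^sub>R w) \<bullet> w)) (at s within {0..1})"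
        by (rule has_vector_derivative_at_within)
    qed (auto intro!: continuous_intros continuous_on_compose2[OF c])
    then show ?thesis by simp
  qed
  have "0 = (LINT x|lborel. g (x + w) - g x)"
    using integrable_lborel_shift[OF g, of w] g by simp
  also have "\<dots> = (LINT x|lborel. LINT s|lborel. ?f (s, x))" by (simp add: ftc)
  also have "\<dots> = (LINT s|lborel. LINT x|lborel. ?f (s, x))"
    using lborel_pair.Fubini_integral[of "\<lambda>s x. ?f (s, x)"] int by simp
  also have "\<dots> = (LINT s|lborel. indicator {0..1::real} s * (LINT x|lborel. Dg x \<bullet> w))"
    by (simp add: sh(2))
  also have "\<dots> = (LINT x|lborel. Dg x \<bullet> w)" by simp
  finally show ?thesis by simp
qed

lemma integrable_mult_bounded:
  fixes f g :: "'a \<Rightarrow> real"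
  assumes "integrable M f" "g \<in> borel_measurable M" "\<And>x. \<bar>g x\<bar> \<le> B"
  shows "integrable M (\<lambda>x. g x * f x)"
proof (rule integrable_dominated[where g = "\<lambda>x. B * \<bar>f x\<bar>"])
  show "norm (g x * f x) \<le> B * \<bar>f x\<bar>" for x using assms(3) by (simp add: abs_mult mult_right_mono)
qed (use assms in auto)

lemma continuous_bounded_on_interval:
  fixes h :: "real \<Rightarrow> real"
  assumes "continuous_on UNIV h"
  obtains B where "B > 0" "\<And>r. \<bar>r\<bar> \<le> L \<Longrightarrow> \<bar>h r\<bar> \<le> B"
proof -
  have "compact (h ` {-L..L})"
    by (rule compact_continuous_image[OF continuous_on_subset[OF assms subset_UNIV]]) simp
  then have "bounded (h ` {-L..L})" by (rule compact_imp_bounded)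
  then obtain B where "\<forall>y\<in>h ` {-L..L}. norm y \<le> B" unfolding bounded_iff by (rule exE)
  then have "\<bar>h r\<bar> \<le> \<bar>B\<bar> + 1" if "\<bar>r\<bar> \<le> L" for r
  proof -
    have "h r \<in> h ` {-L..L}" using that by (auto simp: abs_le_iff)
    with \<open>\<forall>y\<in>h ` {-L..L}. norm y \<le> B\<close> have "norm (h r) \<le> B" by blast
    then show ?thesis by simp
  qed
  then show ?thesis using that[of "\<bar>B\<bar> + 1"] by auto
qed

lemma DERIV_lipschitz_bound:
  fixes f f' :: "real \<Rightarrow> real"
  assumes "\<And>r. (f has_real_derivative f' r) (at r)" "\<And>r. \<bar>r\<bar> \<le> L \<Longrightarrow> \<bar>f' r\<bar> \<le> B"
    and "\<bar>x\<bar> \<le> L" "\<bar>y\<bar> \<le> L"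
  shows "\<bar>f x - f y\<bar> \<le> B * \<bar>x - y\<bar>"
proof -
  have "norm (f x - f y) \<le> B * norm (x - y)"
    by (rule field_differentiable_bound[where S = "{-L..L}" and f' = f'])
      (use assms in \<open>auto intro: has_field_derivative_at_within\<close>)
  then show ?thesis by simp
qed

lemma real_chain_has_derivative:
  fixes f :: "'a::real_inner \<Rightarrow> real"
  assumes "(f has_derivative (\<lambda>h. Df \<bullet> h)) (at x)" "(\<eta> has_real_derivative d) (at (f x))"
  shows "((\<lambda>x. \<eta> (f x)) has_derivative (\<lambda>h. (d *\<^sub>R Df) \<bullet> h)) (at x)"
  using has_derivative_compose[OF assms(1) assms(2)[THEN has_field_derivative_imp_has_derivative]]
  by (simp add: mult.commute)

text \<open>
  The flux term integrates to zero up to the commutator, since \<open>\<eta>'' (U) flux q U\<close> is the derivative of a function of \<open>U\<close>;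
  half of the parabolic dissipation absorbs the commutator.
\<close>

lemma dissipation_estimate:
  fixes f F :: "'a::euclidean_space \<Rightarrow> real" and a :: 'a and \<eta>' \<eta>'' :: "real \<Rightarrow> real"
  assumes q: "q > 1" and e: "\<epsilon> > 0" and f: "integrable lborel f" and F: "integrable lborel F"
    and d1: "\<And>r. (\<eta>' has_real_derivative \<eta>'' r) (at r)" and c2: "continuous_on UNIV \<eta>''"
    and nn: "\<And>r. \<eta>'' r \<ge> 0" and z: "\<eta>' 0 = 0"
  defines "U \<equiv> conv (heat_kernel \<epsilon>) f" and "P \<equiv> conv (heat_kernel \<epsilon>) F"
  shows "integrable lborel (\<lambda>x. \<eta>'' (U x) * (norm (conv (heat_grad \<epsilon>) f x))\<^sup>2)"
    and "integrable lborel (\<lambda>x. \<eta>'' (U x) * (P x - flux q (U x))\<^sup>2)"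
    and "(LINT x|lborel. \<eta>' (U x) * (conv (heat_lapl \<epsilon>) f x - a \<bullet> conv (heat_grad \<epsilon>) F x))
     \<le> - (1/2) * (LINT x|lborel. \<eta>'' (U x) * (norm (conv (heat_grad \<epsilon>) f x))\<^sup>2)
       + (norm a)\<^sup>2 / 2 * (LINT x|lborel. \<eta>'' (U x) * (P x - flux q (U x))\<^sup>2)"
proof -
  let ?gU = "conv (heat_grad \<epsilon>) f" and ?gP = "conv (heat_grad \<epsilon>) F"
  obtain B0 where B0: "\<And>x::'a. \<bar>heat_kernel \<epsilon> x\<bar> \<le> B0" "\<And>x::'a. norm (heat_grad \<epsilon> x) \<le> B0"
    using heat_bounded[OF e, of undefined] by metis
  have [measurable]: "f \<in> borel_measurable borel" "F \<in> borel_measurable borel" using f F by auto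
  have cU: "continuous_on UNIV U" "continuous_on UNIV P" "continuous_on UNIV ?gU" "continuous_on UNIV ?gP"
    unfolding U_def P_def using B0 f F
    by (auto intro!: continuous_on_conv continuous_on_heat_kernel continuous_on_heat_grad)
  have dU: "(U has_derivative (\<lambda>h. ?gU x \<bullet> h)) (at x)" "(P has_derivative (\<lambda>h. ?gP x \<bullet> h)) (at x)" for x
    unfolding U_def P_def using heat_conv_has_derivative[OF e] f F by auto
  have [measurable]: "U \<in> borel_measurable borel" "P \<in> borel_measurable borel" 
    unfolding U_def P_def by measurable
  have iU: "integrable lborel U" "integrable lborel P" "integrable lborel ?gU" "integrable lborel ?gP"
    unfolding U_def P_def using f F e by (auto intro!: conv_L1 heat_grad_integrable)
  define L where "L = Max {B0 * (LINT y|lborel. \<bar>f y\<bar>), B0 * (LINT y|lborel. \<bar>F y\<bar>)}"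
  have L: "\<bar>U x\<bar> \<le> L" "\<bar>P x\<bar> \<le> L" "norm (?gU x) \<le> L" for x
    using conv_bound[OF f _ B0(1)[folded real_norm_def], where x = x] conv_bound[OF F _ B0(1)[folded real_norm_def], where x = x]
      conv_bound[OF f _ B0(2), where x = x]
    unfolding U_def P_def L_def by (auto simp: le_max_iff_disj)
  have L0: "L \<ge> 0" using L(1)[of 0] by linarith
  have c1: "continuous_on UNIV \<eta>'" using d1 by (meson DERIV_isCont continuous_at_imp_continuous_on)
  have [measurable]: "\<eta>' \<in> borel_measurable borel" "\<eta>'' \<in> borel_measurable borel"
    using c1 c2 by (auto intro: borel_measurable_continuous_onI)
  have cc: "continuous_on UNIV (\<lambda>x. \<eta>' (U x))" "continuous_on UNIV (\<lambda>x. \<eta>'' (U x))" "continuous_on UNIV (\<lambda>x. flux q (U x))"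
    using continuous_on_compose2[OF c1 cU(1)] continuous_on_compose2[OF c2 cU(1)]
      continuous_on_compose2[OF continuous_on_flux[OF q, of UNIV] cU(1)] by auto
  obtain B where B: "B > 0" "\<And>r. \<bar>r\<bar> \<le> L \<Longrightarrow> \<bar>\<eta>'' r\<bar> \<le> B" using continuous_bounded_on_interval[OF c2, of L] by blast
  obtain B1 where B1: "B1 > 0" "\<And>r. \<bar>r\<bar> \<le> L \<Longrightarrow> \<bar>\<eta>' r\<bar> \<le> B1" using continuous_bounded_on_interval[OF c1, of L] by blast
  have bU: "\<bar>\<eta>'' (U x)\<bar> \<le> B" "\<bar>\<eta>' (U x)\<bar> \<le> B1" for x using B B1 L by auto
  have gUw: "\<bar>?gU x \<bullet> w\<bar> \<le> L * norm w" for x w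
    by (rule order_trans[OF Cauchy_Schwarz_ineq2]) (simp add: L mult_right_mono)
  have igUw: "integrable lborel (\<lambda>x. ?gU x \<bullet> w)" "integrable lborel (\<lambda>x. ?gP x \<bullet> w)" for w
    using iU by auto
  have igg: "integrable lborel (\<lambda>x. \<eta>'' (U x) * ((?gU x \<bullet> w) * (?gU x \<bullet> w)))" for w
    by (intro integrable_mult_bounded[OF _ _ bU(1)] integrable_mult_bounded[OF igUw(1) _ gUw]) auto
  have grad_int: "(LINT x|lborel. \<eta>' (U x) * (conv (heat_hess \<epsilon> i) f x \<bullet> i)) = - (LINT x|lborel. \<eta>'' (U x) * ((?gU x \<bullet> i) * (?gU x \<bullet> i)))"
    and ih: "integrable lborel (\<lambda>x. \<eta>' (U x) * (conv (heat_hess \<epsilon> i) f x \<bullet> i))" for i :: 'a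
  proof -
    obtain B2 where B2: "\<And>x::'a. norm (heat_hess \<epsilon> i x) \<le> B2" using heat_bounded[OF e, of i] by metis
    have ch: "continuous_on UNIV (conv (heat_hess \<epsilon> i) f)" by (rule continuous_on_conv[OF f continuous_on_heat_hess B2])
    have ihh: "integrable lborel (\<lambda>x. conv (heat_hess \<epsilon> i) f x \<bullet> i)"
      using conv_L1(1)[OF f heat_hess_integrable[OF e]] by auto
    show ih: "integrable lborel (\<lambda>x. \<eta>' (U x) * (conv (heat_hess \<epsilon> i) f x \<bullet> i))"
      by (rule integrable_mult_bounded[OF ihh _ bU(2)]) auto
    let ?D = "\<lambda>x. (\<eta>'' (U x) * (?gU x \<bullet> i)) *\<^sub>R ?gU x + \<eta>' (U x) *\<^sub>R conv (heat_hess \<epsilon> i) f x"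
    have Di: "?D x \<bullet> i = \<eta>'' (U x) * ((?gU x \<bullet> i) * (?gU x \<bullet> i)) + \<eta>' (U x) * (conv (heat_hess \<epsilon> i) f x \<bullet> i)" for x
      by (simp add: inner_add_left)
    have "(LINT x|lborel. ?D x \<bullet> i) = 0"
    proof (rule integral_directional_derivative_eq_0[where g = "\<lambda>x. \<eta>' (U x) * (?gU x \<bullet> i)"])
      show "integrable lborel (\<lambda>x. \<eta>' (U x) * (?gU x \<bullet> i))" by (rule integrable_mult_bounded[OF igUw(1) _ bU(2)]) auto
      show "((\<lambda>x. \<eta>' (U x) * (?gU x \<bullet> i)) has_derivative (\<lambda>h. ?D x \<bullet> h)) (at x)" for x
        by (rule has_derivative_eq_rhs[OF has_derivative_mult[OF real_chain_has_derivative[OF dU(1) d1] heat_conv_grad_has_derivative[OF e f]]])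
          (simp add: fun_eq_iff inner_add_left)
      show "continuous_on UNIV ?D" by (intro continuous_intros cc cU ch)
      show "integrable lborel (\<lambda>x. ?D x \<bullet> i)" unfolding Di by (intro Bochner_Integration.integrable_add igg ih)
    qed
    then show "(LINT x|lborel. \<eta>' (U x) * (conv (heat_hess \<epsilon> i) f x \<bullet> i)) = - (LINT x|lborel. \<eta>'' (U x) * ((?gU x \<bullet> i) * (?gU x \<bullet> i)))"
      unfolding Di using igg ih by simp
  qed
  have n2: "\<eta>'' (U x) * (norm (?gU x))\<^sup>2 = (\<Sum>i\<in>Basis. \<eta>'' (U x) * ((?gU x \<bullet> i) * (?gU x \<bullet> i)))" for x
    unfolding power2_norm_eq_inner euclidean_inner[of "?gU x" "?gU x"] by (simp add: sum_distrib_left)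
  show ig2: "integrable lborel (\<lambda>x. \<eta>'' (U x) * (norm (?gU x))\<^sup>2)"
    unfolding n2 by (intro Bochner_Integration.integrable_sum igg)
  have lapl: "(LINT x|lborel. \<eta>' (U x) * conv (heat_lapl \<epsilon>) f x) = - (LINT x|lborel. \<eta>'' (U x) * (norm (?gU x))\<^sup>2)"
    and ilapl: "integrable lborel (\<lambda>x. \<eta>' (U x) * conv (heat_lapl \<epsilon>) f x)"
  proof -
    have l: "\<eta>' (U x) * conv (heat_lapl \<epsilon>) f x = (\<Sum>i\<in>Basis. \<eta>' (U x) * (conv (heat_hess \<epsilon> i) f x \<bullet> i))" for x
      by (simp add: heat_conv_lapl_eq_sum[OF e f, symmetric] sum_distrib_left)
    show "integrable lborel (\<lambda>x. \<eta>' (U x) * conv (heat_lapl \<epsilon>) f x)" unfolding l by (intro Bochner_Integration.integrable_sum ih)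
    show "(LINT x|lborel. \<eta>' (U x) * conv (heat_lapl \<epsilon>) f x) = - (LINT x|lborel. \<eta>'' (U x) * (norm (?gU x))\<^sup>2)"
      unfolding l n2 using ih igg grad_int by (simp add: Bochner_Integration.integral_sum sum_negf)
  qed
  have iP: "integrable lborel (\<lambda>x. \<eta>'' (U x) * (P x * (?gU x \<bullet> a)))"
    by (intro integrable_mult_bounded[OF _ _ bU(1)] integrable_mult_bounded[OF igUw(1) _ L(2)]) auto
  have igP: "integrable lborel (\<lambda>x. \<eta>' (U x) * (?gP x \<bullet> a))"
    by (rule integrable_mult_bounded[OF igUw(2) _ bU(2)]) auto
  have flux_int: "(LINT x|lborel. \<eta>' (U x) * (?gP x \<bullet> a)) = - (LINT x|lborel. \<eta>'' (U x) * (P x * (?gU x \<bullet> a)))"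
  proof -
    let ?D = "\<lambda>x. (\<eta>'' (U x) * P x) *\<^sub>R ?gU x + \<eta>' (U x) *\<^sub>R ?gP x"
    have Di: "?D x \<bullet> a = \<eta>'' (U x) * (P x * (?gU x \<bullet> a)) + \<eta>' (U x) * (?gP x \<bullet> a)" for x
      by (simp add: inner_add_left)
    have "(LINT x|lborel. ?D x \<bullet> a) = 0"
    proof (rule integral_directional_derivative_eq_0[where g = "\<lambda>x. \<eta>' (U x) * P x"])
      show "integrable lborel (\<lambda>x. \<eta>' (U x) * P x)" by (rule integrable_mult_bounded[OF iU(2) _ bU(2)]) auto
      show "((\<lambda>x. \<eta>' (U x) * P x) has_derivative (\<lambda>h. ?D x \<bullet> h)) (at x)" for x
        by (rule has_derivative_eq_rhs[OF has_derivative_mult[OF real_chain_has_derivative[OF dU(1) d1] dU(2)]])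
          (simp add: fun_eq_iff inner_add_left)
      show "continuous_on UNIV ?D" by (intro continuous_intros cc cU)
      show "integrable lborel (\<lambda>x. ?D x \<bullet> a)" unfolding Di by (intro Bochner_Integration.integrable_add iP igP)
    qed
    then show ?thesis unfolding Di using iP igP by simp
  qed
  have cf: "continuous_on UNIV (\<lambda>r. \<eta>'' r * flux q r)" by (intro continuous_intros c2 continuous_on_flux q)
  obtain B3 where B3: "B3 > 0" "\<And>r. \<bar>r\<bar> \<le> L \<Longrightarrow> \<bar>\<eta>'' r * flux q r\<bar> \<le> B3" using continuous_bounded_on_interval[OF cf, of L] by blast
  have b3: "\<bar>\<eta>'' (U x) * flux q (U x)\<bar> \<le> B3" for x using B3 L by auto
  have iH: "integrable lborel (\<lambda>x. (\<eta>'' (U x) * flux q (U x)) * (?gU x \<bullet> a))"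
    by (rule integrable_mult_bounded[OF igUw(1) _ b3]) auto
  have H_int: "(LINT x|lborel. (\<eta>'' (U x) * flux q (U x)) * (?gU x \<bullet> a)) = 0"
  proof -
    obtain H where H: "H 0 = 0" "\<And>r. (H has_real_derivative \<eta>'' r * flux q r) (at r)"
      using antiderivative_exists[OF cf] by blast
    have cH: "continuous_on UNIV H" using H(2) by (meson DERIV_isCont continuous_at_imp_continuous_on)
    have [measurable]: "H \<in> borel_measurable borel" using cH by (rule borel_measurable_continuous_onI)
    have "(LINT x|lborel. ((\<eta>'' (U x) * flux q (U x)) *\<^sub>R ?gU x) \<bullet> a) = 0"
    proof (rule integral_directional_derivative_eq_0[where g = "\<lambda>x. H (U x)"])
      show "integrable lborel (\<lambda>x. H (U x))"
      proof (rule integrable_dominated[where g = "\<lambda>x. B3 * \<bar>U x\<bar>"])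
        show "norm (H (U x)) \<le> B3 * \<bar>U x\<bar>" for x
          using DERIV_lipschitz_bound[OF H(2) B3(2) L(1), of 0] L0 H(1) by simp
      qed (use iU in auto)
      show "((\<lambda>x. H (U x)) has_derivative (\<lambda>h. ((\<eta>'' (U x) * flux q (U x)) *\<^sub>R ?gU x) \<bullet> h)) (at x)" for x
        by (rule real_chain_has_derivative[OF dU(1) H(2)])
      show "continuous_on UNIV (\<lambda>x. (\<eta>'' (U x) * flux q (U x)) *\<^sub>R ?gU x)" by (intro continuous_intros cc cU)
    qed (use iH in simp)
    then show ?thesis by simp
  qed
  obtain B4 where B4: "B4 > 0" "\<And>r. \<bar>r\<bar> \<le> L \<Longrightarrow> \<bar>flux q r\<bar> \<le> B4"
    using continuous_bounded_on_interval[OF continuous_on_flux[OF q], of L] by blast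
  obtain B5 where B5: "B5 > 0" "\<And>r. \<bar>r\<bar> \<le> L \<Longrightarrow> \<bar>q * \<bar>r\<bar> powr (q - 1)\<bar> \<le> B5"
  proof
    show "q * L powr (q - 1) + 1 > 0" using q by (simp add: add_nonneg_pos)
    show "\<bar>q * \<bar>r\<bar> powr (q - 1)\<bar> \<le> q * L powr (q - 1) + 1" if "\<bar>r\<bar> \<le> L" for r
    proof -
      have "\<bar>r\<bar> powr (q - 1) \<le> L powr (q - 1)" using that q by (intro powr_mono2) auto
      then have "q * \<bar>r\<bar> powr (q - 1) \<le> q * L powr (q - 1)" using q by (intro mult_left_mono) auto
      moreover have "\<bar>q * \<bar>r\<bar> powr (q - 1)\<bar> = q * \<bar>r\<bar> powr (q - 1)" using q by (simp add: abs_mult)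
      ultimately show ?thesis by linarith
    qed
  qed
  have iflux: "integrable lborel (\<lambda>x. flux q (U x))"
  proof (rule integrable_dominated[where g = "\<lambda>x. B5 * \<bar>U x\<bar>"])
    show "norm (flux q (U x)) \<le> B5 * \<bar>U x\<bar>" for x
      using DERIV_lipschitz_bound[OF flux_has_derivative[OF q] B5(2) L(1), of 0] L0 by (simp add: flux_def)
  qed (use iU in auto)
  have "\<bar>P x - flux q (U x)\<bar> \<le> L + B4" for x using L(2)[of x] B4(2)[OF L(1)[of x]] by linarith
  then have "integrable lborel (\<lambda>x. (P x - flux q (U x)) * (P x - flux q (U x)))"
    by (intro integrable_mult_bounded[where B = "L + B4"] Bochner_Integration.integrable_diff iU iflux) auto
  then show id2: "integrable lborel (\<lambda>x. \<eta>'' (U x) * (P x - flux q (U x))\<^sup>2)"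
    unfolding power2_eq_square by (intro integrable_mult_bounded[OF _ _ bU(1)]) auto
  have "(LINT x|lborel. \<eta>' (U x) * (conv (heat_lapl \<epsilon>) f x - a \<bullet> ?gP x))
    = (LINT x|lborel. \<eta>' (U x) * conv (heat_lapl \<epsilon>) f x) - (LINT x|lborel. \<eta>' (U x) * (?gP x \<bullet> a))"
    using ilapl igP by (simp add: right_diff_distrib inner_commute)
  also have "\<dots> = - (LINT x|lborel. \<eta>'' (U x) * (norm (?gU x))\<^sup>2) + (LINT x|lborel. \<eta>'' (U x) * (P x * (?gU x \<bullet> a)))
     - (LINT x|lborel. (\<eta>'' (U x) * flux q (U x)) * (?gU x \<bullet> a))"
    by (simp add: lapl flux_int H_int)
  also have "\<dots> = (LINT x|lborel. - (\<eta>'' (U x) * (norm (?gU x))\<^sup>2) + \<eta>'' (U x) * (P x * (?gU x \<bullet> a)) - (\<eta>'' (U x) * flux q (U x)) * (?gU x \<bullet> a))"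
    using ig2 iP iH by simp
  also have "\<dots> \<le> (LINT x|lborel. - (1/2) * (\<eta>'' (U x) * (norm (?gU x))\<^sup>2) + (norm a)\<^sup>2 / 2 * (\<eta>'' (U x) * (P x - flux q (U x))\<^sup>2))"
  proof (rule integral_mono)
    fix x
    let ?d = "P x - flux q (U x)"
    have "?d * (?gU x \<bullet> a) \<le> \<bar>?d\<bar> * (norm (?gU x) * norm a)"
      by (rule order_trans[OF abs_ge_self]) (simp add: abs_mult mult_left_mono Cauchy_Schwarz_ineq2)
    also have "\<dots> = norm (?gU x) * (norm a * \<bar>?d\<bar>)" by simp
    also have "\<dots> \<le> (1/2) * (norm (?gU x))\<^sup>2 + (1/2) * (norm a * \<bar>?d\<bar>)\<^sup>2"
      using sum_squares_bound[of "norm (?gU x)" "norm a * \<bar>?d\<bar>"] by simp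
    also have "\<dots> = (1/2) * (norm (?gU x))\<^sup>2 + (norm a)\<^sup>2 / 2 * ?d\<^sup>2" by (simp add: power_mult_distrib)
    finally have "\<eta>'' (U x) * (?d * (?gU x \<bullet> a)) \<le> \<eta>'' (U x) * ((1/2) * (norm (?gU x))\<^sup>2 + (norm a)\<^sup>2 / 2 * ?d\<^sup>2)"
      using nn by (intro mult_left_mono) auto
    then show "- (\<eta>'' (U x) * (norm (?gU x))\<^sup>2) + \<eta>'' (U x) * (P x * (?gU x \<bullet> a)) - (\<eta>'' (U x) * flux q (U x)) * (?gU x \<bullet> a)
       \<le> - (1/2) * (\<eta>'' (U x) * (norm (?gU x))\<^sup>2) + (norm a)\<^sup>2 / 2 * (\<eta>'' (U x) * ?d\<^sup>2)"
      by (simp add: algebra_simps)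
  qed (use ig2 iP iH id2 in auto)
  also have "\<dots> = - (1/2) * (LINT x|lborel. \<eta>'' (U x) * (norm (?gU x))\<^sup>2) + (norm a)\<^sup>2 / 2 * (LINT x|lborel. \<eta>'' (U x) * (P x - flux q (U x))\<^sup>2)"
    using ig2 id2 by simp
  finally show "(LINT x|lborel. \<eta>' (U x) * (conv (heat_lapl \<epsilon>) f x - a \<bullet> ?gP x))
     \<le> - (1/2) * (LINT x|lborel. \<eta>'' (U x) * (norm (?gU x))\<^sup>2) + (norm a)\<^sup>2 / 2 * (LINT x|lborel. \<eta>'' (U x) * (P x - flux q (U x))\<^sup>2)" .
qed

section \<open>Mollified solutions of the Cauchy problem\<close>

lemma Lp_norm_powr: "p > 0 \<Longrightarrow> Lp_norm p f powr p = (LINT x|lborel. \<bar>f x\<bar> powr p)"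
  by (simp add: Lp_norm_def powr_powr)

lemma Lp_norm_tendsto_zero:
  assumes "p > 0" "((\<lambda>s. Lp_norm p (f s)) \<longlongrightarrow> 0) S"
  shows "((\<lambda>s. LINT x|lborel. \<bar>f s x\<bar> powr p) \<longlongrightarrow> 0) S"
proof -
  have "((\<lambda>s. Lp_norm p (f s) powr p) \<longlongrightarrow> 0 powr p) S"
    using assms by (intro tendsto_powr' tendsto_intros) (auto simp: Lp_norm_def)
  then show ?thesis using assms by (simp add: Lp_norm_powr)
qed

lemma Lp_norm_1: "Lp_norm 1 f = (LINT x|lborel. \<bar>f x\<bar>)"
proof -
  have "\<bar>f x\<bar> powr 1 = \<bar>f x\<bar>" for x by simp
  then show ?thesis by (simp add: Lp_norm_def)
qed

lemma Lp_space_1: "f \<in> Lp_space 1 \<longleftrightarrow> integrable lborel f"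
proof -
  have "\<bar>f x\<bar> powr 1 = \<bar>f x\<bar>" for x by simp
  then show ?thesis unfolding Lp_space_def by (auto simp: integrable_abs_iff)
qed

lemma Lp_space_2: "f \<in> Lp_space 2 \<longleftrightarrow> f \<in> borel_measurable lborel \<and> integrable lborel (\<lambda>x. (f x)\<^sup>2)"
  by (simp add: Lp_space_def powr_numeral)

text \<open>Records exactly what the estimates use: continuity in the L^p spaces, a time derivative
  in L^2 and the mollified equation. Weak derivatives and Sobolev spaces enter only when the locale
  is instantiated.\<close>

locale viscous_flow =
  fixes a :: "'a::euclidean_space" and q :: real and u v :: "real \<Rightarrow> 'a \<Rightarrow> real"
  assumes q: "q > 1"
    and u_L1: "continuous_into_Lp 1 {0..} u"
    and u_Lp: "\<And>p. p > 1 \<Longrightarrow> continuous_into_Lp p {0<..} u"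
    and u_C1: "C1_into_Lp 2 {0<..} u v"
    and mollified: "\<And>t \<epsilon> x. t > 0 \<Longrightarrow> \<epsilon> > 0 \<Longrightarrow> conv (heat_kernel \<epsilon>) (v t) x
        = conv (heat_lapl \<epsilon>) (u t) x - a \<bullet> conv (heat_grad \<epsilon>) (\<lambda>x. flux q (u t x)) x"

lemma cauchy_solution_viscous_flow:
  assumes q: "q > 1" and sol: "cauchy_solution a q u0 u"
  obtains v where "viscous_flow a q u v"
proof -
  from sol obtain v where v: "\<And>p. p > 1 \<Longrightarrow> C1_into_Lp p {0<..} u v"
    and eq: "\<And>t. t > 0 \<Longrightarrow> weakly_differentiable (\<lambda>x. flux q (u t x)) \<and>
          (AE x in lborel. v t x - weak_laplacian (u t) x + a \<bullet> weak_grad (\<lambda>y. flux q (u t y)) x = 0)"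
    and W: "\<And>p. p > 1 \<Longrightarrow> continuous_into_W2p p {0<..} u" and L1: "continuous_into_Lp 1 {0..} u"
    unfolding cauchy_solution_def by blast
  have Lp: "continuous_into_Lp p {0<..} u" if "p > 1" for p using v[OF that] by (simp add: C1_into_Lp_def)
  have "viscous_flow a q u v"
  proof
    fix t \<epsilon> :: real and x assume t: "t > 0" and e: "\<epsilon> > 0"
    have vt: "v t \<in> Lp_space 2" using v[of 2] t by (auto simp: C1_into_Lp_def continuous_into_Lp_def)
    have ut: "integrable lborel (u t)" using L1 t by (auto simp: continuous_into_Lp_def Lp_space_1)
    have "u t \<in> Lp_space q" using Lp[OF q] t by (auto simp: continuous_into_Lp_def)
    then have F: "integrable lborel (\<lambda>x. flux q (u t x))" by (intro integrable_flux) (auto simp: Lp_space_def)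
    have W2: "u t \<in> W2p_space 2" using W[of 2] t by (auto simp: continuous_into_W2p_def)
    show "conv (heat_kernel \<epsilon>) (v t) x
        = conv (heat_lapl \<epsilon>) (u t) x - a \<bullet> conv (heat_grad \<epsilon>) (\<lambda>x. flux q (u t x)) x"
      by (rule heat_equation_mollified[OF weak_equation_tested[OF W2 _ _ _ ] ut F _ _ e])
        (use eq[OF t] vt in \<open>auto simp: Lp_space_2\<close>)
  qed (use q L1 Lp v in auto)
  then show ?thesis by (rule that)
qed

section \<open>Moments and time continuity of the solution and its flux at positive times\<close>

context viscous_flow
begin

abbreviation (input) F :: "real \<Rightarrow> 'a \<Rightarrow> real" where "F t x \<equiv> flux q (u t x)"

lemma u_int: "t \<ge> 0 \<Longrightarrow> integrable lborel (u t)"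
  using u_L1 by (auto simp: continuous_into_Lp_def Lp_space_1)

lemma u_meas: "t \<ge> 0 \<Longrightarrow> u t \<in> borel_measurable borel"
  using u_int[of t] by auto

lemma u_intp: "t > 0 \<Longrightarrow> p \<ge> 1 \<Longrightarrow> integrable lborel (\<lambda>x. \<bar>u t x\<bar> powr p)"
  using u_Lp[of p] u_int[of t] by (cases "p = 1") (auto simp: continuous_into_Lp_def Lp_space_def)

lemma v_L2: "t > 0 \<Longrightarrow> v t \<in> borel_measurable borel \<and> integrable lborel (\<lambda>x. (v t x)\<^sup>2)"
  using u_C1 by (auto simp: C1_into_Lp_def continuous_into_Lp_def Lp_space_2)

lemma F_int: "t > 0 \<Longrightarrow> integrable lborel (F t)"
  using u_meas[of t] u_intp[of t q] q by (intro integrable_flux) auto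

lemma F_intp: "t > 0 \<Longrightarrow> p \<ge> 1 \<Longrightarrow> integrable lborel (\<lambda>x. \<bar>F t x\<bar> powr p)"
  and F_intp_eq: "(LINT x|lborel. \<bar>F t x\<bar> powr p) = (LINT x|lborel. \<bar>u t x\<bar> powr (q * p))"
  using u_intp[of t "q * p"] mult_mono[of 1 q 1 p] q by (auto simp: abs_flux powr_powr)

lemma u_cont1: "t \<ge> 0 \<Longrightarrow> ((\<lambda>s. LINT x|lborel. \<bar>u s x - u t x\<bar>) \<longlongrightarrow> 0) (at t within {0..})"
  using u_L1 by (auto simp: continuous_into_Lp_def Lp_norm_1)

lemma u_contp:
  assumes "t > 0" "p > 1"
  shows "((\<lambda>s. LINT x|lborel. \<bar>u s x - u t x\<bar> powr p) \<longlongrightarrow> 0) (at t within {0<..})"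
  using assms u_Lp[of p] by (intro Lp_norm_tendsto_zero) (auto simp: continuous_into_Lp_def)

text \<open>Near a time x0 with moment I, continuity into L^p bounds the moment by 2^p (1 + I); the
  local bounds are patched over the compact interval. The interval starts at a positive time since
  continuity for p > 1 is given only there.\<close>

lemma u_bdd:
  assumes s: "0 < s" and p: "p \<ge> 1"
  obtains C where "C \<ge> 0" "\<And>\<tau>. \<tau> \<in> {s..t} \<Longrightarrow> (LINT x|lborel. \<bar>u \<tau> x\<bar> powr p) \<le> C"
proof (cases "s \<le> t")
  case False
  then show ?thesis using that[of 0] by auto
next
  case st: True
  define P where "P a b \<longleftrightarrow> (\<exists>C\<ge>0. \<forall>\<tau>. \<tau> \<in> {a..b} \<inter> {s..t} \<longrightarrow> (LINT x|lborel. \<bar>u \<tau> x\<bar> powr p) \<le> C)" for a b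
  have "P s t"
    using st
  proof (induction rule: Bolzano)
    case (trans a b c)
    obtain C1 where C1: "C1 \<ge> 0" "\<forall>\<tau>. \<tau> \<in> {a..b} \<inter> {s..t} \<longrightarrow> (LINT x|lborel. \<bar>u \<tau> x\<bar> powr p) \<le> C1"
      using trans(1) unfolding P_def by blast
    obtain C2 where C2: "C2 \<ge> 0" "\<forall>\<tau>. \<tau> \<in> {b..c} \<inter> {s..t} \<longrightarrow> (LINT x|lborel. \<bar>u \<tau> x\<bar> powr p) \<le> C2"
      using trans(2) unfolding P_def by blast
    show ?case unfolding P_def
    proof (intro exI[of _ "C1 + C2"] conjI allI impI)
      fix \<tau> assume *: "\<tau> \<in> {a..c} \<inter> {s..t}"
      show "(LINT x|lborel. \<bar>u \<tau> x\<bar> powr p) \<le> C1 + C2"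
      proof (cases "\<tau> \<le> b")
        case True
        then show ?thesis using * C1(2)[rule_format, of \<tau>] C2(1) by simp
      next
        case False
        then show ?thesis using * C2(2)[rule_format, of \<tau>] C1(1) by simp
      qed
    qed (use C1 C2 in simp)
  next
    case (local x0)
    then have x0: "x0 > 0" using s by simp
    have "((\<lambda>s. LINT x|lborel. \<bar>u s x - u x0 x\<bar> powr p) \<longlongrightarrow> 0) (at x0 within {0<..})"
    proof (cases "p = 1")
      case True
      then show ?thesis using u_cont1[of x0] x0 by (auto intro: tendsto_within_subset)
    qed (use u_contp[OF x0, of p] p in auto)
    then have "eventually (\<lambda>\<tau>. (LINT x|lborel. \<bar>u \<tau> x - u x0 x\<bar> powr p) < 1) (at x0 within {0<..})"
      by (rule order_tendstoD(2)) simp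
    then obtain d where d: "d > 0" "\<And>\<tau>. \<tau> > 0 \<Longrightarrow> \<tau> \<noteq> x0 \<Longrightarrow> dist \<tau> x0 < d \<Longrightarrow> (LINT x|lborel. \<bar>u \<tau> x - u x0 x\<bar> powr p) < 1"
      unfolding eventually_at by auto
    define I where "I = (LINT x|lborel. \<bar>u x0 x\<bar> powr p)"
    have I0: "I \<ge> 0" by (simp add: I_def)
    have "P a b" if ab: "a \<le> x0 \<and> x0 \<le> b \<and> b - a < d" for a b
      unfolding P_def
    proof (intro exI[of _ "2 powr p * (1 + I)"] conjI allI impI)
      fix \<tau> assume \<tau>: "\<tau> \<in> {a..b} \<inter> {s..t}"
      then have \<tau>0: "\<tau> > 0" using s by auto
      have le1: "(LINT x|lborel. \<bar>u \<tau> x - u x0 x\<bar> powr p) \<le> 1"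
      proof (cases "\<tau> = x0")
        case False
        have "dist \<tau> x0 < d" using ab \<tau> by (auto simp: dist_real_def)
        then show ?thesis using d(2)[of \<tau>] \<tau>0 False by auto
      qed simp
      have [measurable]: "u \<tau> \<in> borel_measurable borel" "u x0 \<in> borel_measurable borel" using u_meas \<tau>0 x0 by auto
      have bound: "\<bar>u \<tau> x - u x0 x\<bar> powr p \<le> 2 powr p * (\<bar>u \<tau> x\<bar> powr p + \<bar>u x0 x\<bar> powr p)" for x
        using p by (intro order_trans[OF powr_mono2 powr_add_le]) auto
      have id: "integrable lborel (\<lambda>x. \<bar>u \<tau> x - u x0 x\<bar> powr p)"
        by (rule integrable_dominated[where g = "\<lambda>x. 2 powr p * (\<bar>u \<tau> x\<bar> powr p + \<bar>u x0 x\<bar> powr p)"])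
          (use bound u_intp[OF \<tau>0 p] u_intp[OF x0 p] in auto)
      have "(LINT x|lborel. \<bar>u \<tau> x\<bar> powr p) \<le> (LINT x|lborel. 2 powr p * (\<bar>u \<tau> x - u x0 x\<bar> powr p + \<bar>u x0 x\<bar> powr p))"
      proof (rule integral_mono)
        show "\<bar>u \<tau> x\<bar> powr p \<le> 2 powr p * (\<bar>u \<tau> x - u x0 x\<bar> powr p + \<bar>u x0 x\<bar> powr p)" for x
          using p by (intro order_trans[OF powr_mono2 powr_add_le]) auto
      qed (use id u_intp[OF \<tau>0 p] u_intp[OF x0 p] in auto)
      also have "\<dots> \<le> 2 powr p * (1 + I)" using id u_intp[OF x0 p] le1 by (simp add: I_def)
      finally show "(LINT x|lborel. \<bar>u \<tau> x\<bar> powr p) \<le> 2 powr p * (1 + I)" .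
    qed (use I0 in simp)
    then show ?case using d(1) by blast
  qed
  then obtain C where "C \<ge> 0" "\<forall>\<tau>. \<tau> \<in> {s..t} \<inter> {s..t} \<longrightarrow> (LINT x|lborel. \<bar>u \<tau> x\<bar> powr p) \<le> C" unfolding P_def by blast
  then show ?thesis using that by auto
qed

lemma u_cont_on:
  assumes "0 < s" "\<tau> \<in> {s..t}"
  shows "((\<lambda>\<tau>'. LINT x|lborel. \<bar>u \<tau>' x - u \<tau> x\<bar>) \<longlongrightarrow> 0) (at \<tau> within {s..t})"
  using u_cont1[of \<tau>] assms by (auto intro: tendsto_within_subset)

lemma F_cont_on:
  assumes s: "0 < s" and \<tau>: "\<tau> \<in> {s..t}"
  shows "((\<lambda>\<tau>'. LINT x|lborel. \<bar>F \<tau>' x - F \<tau> x\<bar>) \<longlongrightarrow> 0) (at \<tau> within {s..t})"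
proof (rule tendstoI)
  fix e :: real assume e: "e > 0"
  have r: "2 * q - 1 \<ge> 1" using q by simp
  obtain C where C: "C \<ge> 0" "\<And>\<tau>. \<tau> \<in> {s..t} \<Longrightarrow> (LINT x|lborel. \<bar>u \<tau> x\<bar> powr (2 * q - 1)) \<le> C"
    using u_bdd[OF s r] by blast
  define K where "K = 2 powr (2 * q - 1) * (C + C) + 1"
  have K: "K > 0" using C by (simp add: K_def add_nonneg_pos)
  \<comment> \<open>With this \<open>c\<close> and an L^1 distance below e c/(4q), each half of the
    split flux difference contributes e/4.\<close>
  define c where "c = e / (4 * q * K)"
  have c: "c > 0" using e K q by (simp add: c_def)
  have "e * c / (4 * q) > 0" using e c q by simp
  from order_tendstoD(2)[OF u_cont_on[OF s \<tau>] this]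
  have "eventually (\<lambda>\<tau>'. (LINT x|lborel. \<bar>u \<tau>' x - u \<tau> x\<bar>) < e * c / (4 * q)) (at \<tau> within {s..t})" .
  moreover have "eventually (\<lambda>\<tau>'. \<tau>' \<in> {s..t}) (at \<tau> within {s..t})" by (simp add: eventually_at_filter)
  ultimately show "eventually (\<lambda>\<tau>'. dist (LINT x|lborel. \<bar>F \<tau>' x - F \<tau> x\<bar>) 0 < e) (at \<tau> within {s..t})"
  proof eventually_elim
    case (elim \<tau>')
    have pos: "\<tau>' > 0" "\<tau> > 0" using elim \<tau> s by auto
    have "(LINT x|lborel. \<bar>F \<tau>' x - F \<tau> x\<bar>) \<le> q * ((LINT x|lborel. \<bar>u \<tau>' x - u \<tau> x\<bar>) / c + c * (2 powr (2 * q - 1) *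
      ((LINT x|lborel. \<bar>u \<tau>' x\<bar> powr (2 * q - 1)) + (LINT x|lborel. \<bar>u \<tau> x\<bar> powr (2 * q - 1)))))"
      using pos r by (intro flux_L1_diff q c u_int u_intp) auto
    also have "\<dots> \<le> q * ((e * c / (4 * q)) / c + c * K)"
    proof (intro mult_left_mono add_mono divide_right_mono)
      have "2 powr (2 * q - 1) * ((LINT x|lborel. \<bar>u \<tau>' x\<bar> powr (2 * q - 1)) + (LINT x|lborel. \<bar>u \<tau> x\<bar> powr (2 * q - 1)))
         \<le> 2 powr (2 * q - 1) * (C + C)"
        using C(2) \<tau> elim by (intro mult_left_mono add_mono) auto
      then show "2 powr (2 * q - 1) * ((LINT x|lborel. \<bar>u \<tau>' x\<bar> powr (2 * q - 1)) + (LINT x|lborel. \<bar>u \<tau> x\<bar> powr (2 * q - 1))) \<le> K"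
        unfolding K_def by linarith
    qed (use q c elim in auto)
    also have "\<dots> = e / 2" using q c K by (simp add: c_def field_simps)
    finally show ?case using e by (simp add: abs_less_iff)
  qed
qed

text \<open>The commutator is compared through the unmollified flux \<open>F \<tau>\<close>: both G
  * F(u) - F(u) and F(u) - F(G * u) are at most sigma/2. The moments of G * u are controlled by
  those of u, so the estimate is uniform in time.\<close>

lemma mollified_flux_error:
  assumes s: "0 < s" and st: "s \<le> t" and \<sigma>: "\<sigma> > 0"
  obtains \<epsilon>0 where "\<epsilon>0 > 0" "\<And>\<epsilon> \<tau>. 0 < \<epsilon> \<Longrightarrow> \<epsilon> < \<epsilon>0 \<Longrightarrow> \<tau> \<in> {s..t} \<Longrightarrow>
    integrable lborel (\<lambda>x. flux q (conv (heat_kernel \<epsilon>) (u \<tau>) x)) \<and>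
    (LINT x|lborel. \<bar>conv (heat_kernel \<epsilon>) (F \<tau>) x - flux q (conv (heat_kernel \<epsilon>) (u \<tau>) x)\<bar>) \<le> \<sigma>"
proof -
  have r: "2 * q - 1 \<ge> 1" using q by simp
  obtain C where C: "C \<ge> 0" "\<And>\<tau>. \<tau> \<in> {s..t} \<Longrightarrow> (LINT x|lborel. \<bar>u \<tau> x\<bar> powr (2 * q - 1)) \<le> C"
    using u_bdd[OF s r] by blast
  define K where "K = 2 powr (2 * q - 1) * (C + C) + 1"
  have K: "K > 0" using C by (simp add: K_def add_nonneg_pos)
  define c where "c = \<sigma> / (4 * q * K)"
  have c: "c > 0" using \<sigma> K q by (simp add: c_def)
  have p1: "\<sigma> * c / (4 * q) > 0" using \<sigma> c q by simp
  have ui: "integrable lborel (u \<tau>)" "integrable lborel (F \<tau>)" if "\<tau> \<in> {s..t}" for \<tau> using that s u_int[of \<tau>] F_int[of \<tau>] by auto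
  obtain e1 where e1: "e1 > 0" "\<And>\<epsilon> \<tau>. 0 < \<epsilon> \<Longrightarrow> \<epsilon> < e1 \<Longrightarrow> \<tau> \<in> {s..t} \<Longrightarrow> (LINT x|lborel. \<bar>conv (heat_kernel \<epsilon>) (u \<tau>) x - u \<tau> x\<bar>) \<le> \<sigma> * c / (4 * q)"
    by (rule heat_approx_uniform[OF st ui(1) u_cont_on[OF s] p1], assumption, assumption, rule that)
  have p2: "\<sigma> / 2 > 0" using \<sigma> by simp
  obtain e2 where e2: "e2 > 0" "\<And>\<epsilon> \<tau>. 0 < \<epsilon> \<Longrightarrow> \<epsilon> < e2 \<Longrightarrow> \<tau> \<in> {s..t} \<Longrightarrow> (LINT x|lborel. \<bar>conv (heat_kernel \<epsilon>) (F \<tau>) x - F \<tau> x\<bar>) \<le> \<sigma> / 2"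
    by (rule heat_approx_uniform[OF st ui(2) F_cont_on[OF s] p2], assumption, assumption, rule that)
  show ?thesis
  proof (rule that[of "min e1 e2"])
    fix \<epsilon> \<tau> assume e: "0 < \<epsilon>" "\<epsilon> < min e1 e2" and \<tau>: "\<tau> \<in> {s..t}"
    have pos: "\<tau> > 0" using \<tau> s by auto
    let ?U = "conv (heat_kernel \<epsilon>) (u \<tau>)" and ?P = "conv (heat_kernel \<epsilon>) (F \<tau>)"
    have [measurable]: "u \<tau> \<in> borel_measurable borel" using pos by (intro u_meas) simp
    have iU: "integrable lborel ?U" "integrable lborel ?P" using heat_conv_L1(1)[OF e(1)] u_int[of \<tau>] F_int[of \<tau>] pos by auto
    have iUp: "integrable lborel (\<lambda>x. \<bar>?U x\<bar> powr p)" "(LINT x|lborel. \<bar>?U x\<bar> powr p) \<le> (LINT x|lborel. \<bar>u \<tau> x\<bar> powr p)" if "p \<ge> 1" for p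
      using heat_conv_Lp(2,3)[OF e(1) that _ u_intp[OF pos that]] by auto
    have iF: "integrable lborel (\<lambda>x. flux q (?U x))" using iUp(1)[of q] q by (intro integrable_flux) auto
    have "(LINT x|lborel. \<bar>F \<tau> x - flux q (?U x)\<bar>) \<le> q * ((LINT x|lborel. \<bar>u \<tau> x - ?U x\<bar>) / c + c * (2 powr (2 * q - 1) *
      ((LINT x|lborel. \<bar>u \<tau> x\<bar> powr (2 * q - 1)) + (LINT x|lborel. \<bar>?U x\<bar> powr (2 * q - 1)))))"
      using pos r by (intro flux_L1_diff q c u_int u_intp iU iUp) auto
    also have "\<dots> \<le> q * ((\<sigma> * c / (4 * q)) / c + c * K)"
    proof (intro mult_left_mono add_mono divide_right_mono)
      have "2 powr (2 * q - 1) * ((LINT x|lborel. \<bar>u \<tau> x\<bar> powr (2 * q - 1)) + (LINT x|lborel. \<bar>?U x\<bar> powr (2 * q - 1)))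
         \<le> 2 powr (2 * q - 1) * (C + C)"
        using C(2)[OF \<tau>] order_trans[OF iUp(2)[OF r] C(2)[OF \<tau>]] by (intro mult_left_mono add_mono) auto
      then show "2 powr (2 * q - 1) * ((LINT x|lborel. \<bar>u \<tau> x\<bar> powr (2 * q - 1)) + (LINT x|lborel. \<bar>?U x\<bar> powr (2 * q - 1))) \<le> K"
        unfolding K_def by linarith
      show "(LINT x|lborel. \<bar>u \<tau> x - ?U x\<bar>) \<le> \<sigma> * c / (4 * q)"
        using e1(2)[of \<epsilon> \<tau>] e \<tau> by (simp add: abs_minus_commute)
    qed (use q c in auto)
    also have "\<dots> = \<sigma> / 2" using q c K by (simp add: c_def field_simps)
    finally have 1: "(LINT x|lborel. \<bar>F \<tau> x - flux q (?U x)\<bar>) \<le> \<sigma> / 2" .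
    have "(LINT x|lborel. \<bar>?P x - flux q (?U x)\<bar>) \<le> (LINT x|lborel. \<bar>?P x - F \<tau> x\<bar>) + (LINT x|lborel. \<bar>F \<tau> x - flux q (?U x)\<bar>)"
      using iU F_int[OF pos] iF by (intro integral_abs_triangle) auto
    also have "\<dots> \<le> \<sigma> / 2 + \<sigma> / 2" using 1 e2(2)[of \<epsilon> \<tau>] e \<tau> by (intro add_mono) auto
    finally show "integrable lborel (\<lambda>x. flux q (?U x)) \<and> (LINT x|lborel. \<bar>?P x - flux q (?U x)\<bar>) \<le> \<sigma>" using iF by simp
  qed (use e1 e2 in simp)
qed

end

text \<open>
  The weight \<open>X\<close> is unbounded, so the commutator \<open>D\<close> is split to use only its smallness in \<open>L\<^sup>1\<close> and bounds on
  higher moments.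
\<close>

lemma weighted_square_split:
  fixes X D c :: real
  assumes "c > 0" "D \<ge> 0" "X \<ge> 0"
  shows "X * D\<^sup>2 \<le> D / c + c * (X\<^sup>2 * D ^ 3)"
proof -
  have "X * D \<le> 1 / c + c * (X * D)\<^sup>2"
  proof (cases "X * D \<le> 1 / c")
    case True then show ?thesis using assms by (simp add: add_increasing2)
  next
    case False
    then have "1 \<le> c * (X * D)" using assms by (simp add: field_simps)
    then have "(X * D) * 1 \<le> (X * D) * (c * (X * D))" using assms by (intro mult_left_mono) auto
    then show ?thesis using assms by (simp add: power2_eq_square mult_ac add_increasing)
  qed
  then have "D * (X * D) \<le> D * (1 / c + c * (X * D)\<^sup>2)" using assms by (intro mult_left_mono)
  then show ?thesis by (simp add: algebra_simps power2_eq_square power3_eq_cube)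
qed

text \<open>Splitting the mixed products leaves pure powers. Since \<open>P\<close> will be a
  mollified flux, all of them are controlled by moments of the solution of order 3q, 6q and 4N,
  which are bounded on compact time intervals.\<close>

lemma cube_weight_le:
  fixes U P N q :: real
  assumes "U \<ge> 0" "P \<ge> 0" "N \<ge> 1" "q > 1"
  shows "(1 + U powr N)\<^sup>2 * (P + U powr q) ^ 3
    \<le> 16 * (P powr 3 + P powr 6 + U powr (3 * q) + U powr (6 * q) + U powr (4 * N))"
proof -
  define A B where "A = U powr N" and "B = U powr q"
  have n: "A \<ge> 0" "B \<ge> 0" by (auto simp: A_def B_def)
  have pw: "P powr 3 = P ^ 3" "P powr 6 = P ^ 6" using assms by (auto simp: powr_numeral)
  have pw2: "U powr (3 * q) = B ^ 3" "U powr (6 * q) = B ^ 6" "U powr (4 * N) = A ^ 4"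
    using assms by (cases "U = 0"; simp add: A_def B_def powr_powr[symmetric] mult.commute[of _ q] mult.commute[of _ N] powr_numeral)+
  have 1: "(1 + A)\<^sup>2 \<le> 2 * (1 + A\<^sup>2)" using zero_le_power2[of "1 - A"] by (simp add: power2_eq_square algebra_simps)
  have 2: "(P + B) ^ 3 \<le> 4 * (P ^ 3 + B ^ 3)"
  proof -
    have "4 * (P ^ 3 + B ^ 3) - (P + B) ^ 3 = 3 * (P + B) * (P - B)\<^sup>2" by (simp add: power2_eq_square power3_eq_cube algebra_simps)
    then show ?thesis using assms n by (smt (verit) zero_le_power2 mult_nonneg_nonneg)
  qed
  have 3: "A\<^sup>2 * P ^ 3 \<le> (A ^ 4 + P ^ 6) / 2"
    using sum_squares_bound[of "A\<^sup>2" "P ^ 3"] by (simp add: power2_eq_square power3_eq_cube algebra_simps numeral_eq_Suc)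
  have 4: "A\<^sup>2 * B ^ 3 \<le> (A ^ 4 + B ^ 6) / 2"
    using sum_squares_bound[of "A\<^sup>2" "B ^ 3"] by (simp add: power2_eq_square power3_eq_cube algebra_simps numeral_eq_Suc)
  have gen: "8 * (x + y + z + w) \<le> 8 * (x + y + z' + w')" if "z \<le> z'" "w \<le> w'" for x y z w z' w' :: real
    using that by simp
  have "(1 + A)\<^sup>2 * (P + B) ^ 3 \<le> (2 * (1 + A\<^sup>2)) * (4 * (P ^ 3 + B ^ 3))"
    using 1 2 assms n by (intro mult_mono) auto
  also have "\<dots> = 8 * (P ^ 3 + B ^ 3 + A\<^sup>2 * P ^ 3 + A\<^sup>2 * B ^ 3)" by (simp add: algebra_simps)
  also have "\<dots> \<le> 8 * (P ^ 3 + B ^ 3 + (A ^ 4 + P ^ 6) / 2 + (A ^ 4 + B ^ 6) / 2)" by (rule gen[OF 3 4])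
  also have "\<dots> \<le> 16 * (P ^ 3 + P ^ 6 + B ^ 3 + B ^ 6 + A ^ 4)"
  proof -
    have "8 * (x + y + (w + z) / 2 + (w + r) / 2) \<le> 16 * (x + z + y + r + w)"
      if "x \<ge> 0" "y \<ge> 0" "z \<ge> 0" "r \<ge> 0" "w \<ge> 0" for x y z r w :: real
      using that by (simp add: field_simps)
    then show ?thesis using assms n by simp
  qed
  finally show ?thesis unfolding pw pw2 by (simp add: A_def B_def)
qed

context viscous_flow
begin

text \<open>The weight admits entropies whose second derivative grows polynomially. The splitting
  constant is fixed first from the moment bound; only then is the L^1 smallness of the commutator
  demanded, relative to that constant.\<close>

lemma mollified_flux_error_weighted:
  assumes s: "0 < s" and st: "s \<le> t" and N: "N \<ge> 1" and \<delta>: "\<delta> > 0"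
  obtains \<epsilon>0 where "\<epsilon>0 > 0" "\<And>\<epsilon> \<tau>. 0 < \<epsilon> \<Longrightarrow> \<epsilon> < \<epsilon>0 \<Longrightarrow> \<tau> \<in> {s..t} \<Longrightarrow>
    integrable lborel (\<lambda>x. (1 + \<bar>conv (heat_kernel \<epsilon>) (u \<tau>) x\<bar> powr N) *
       (conv (heat_kernel \<epsilon>) (F \<tau>) x - flux q (conv (heat_kernel \<epsilon>) (u \<tau>) x))\<^sup>2) \<and>
    (LINT x|lborel. (1 + \<bar>conv (heat_kernel \<epsilon>) (u \<tau>) x\<bar> powr N) *
       (conv (heat_kernel \<epsilon>) (F \<tau>) x - flux q (conv (heat_kernel \<epsilon>) (u \<tau>) x))\<^sup>2) \<le> \<delta>"
proof -
  have r: "3 * q \<ge> 1" "6 * q \<ge> 1" "4 * N \<ge> 1" using q N by auto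
  obtain C3 where C3: "C3 \<ge> 0" "\<And>\<tau>. \<tau> \<in> {s..t} \<Longrightarrow> (LINT x|lborel. \<bar>u \<tau> x\<bar> powr (3 * q)) \<le> C3"
    using u_bdd[OF s r(1)] by blast
  obtain C6 where C6: "C6 \<ge> 0" "\<And>\<tau>. \<tau> \<in> {s..t} \<Longrightarrow> (LINT x|lborel. \<bar>u \<tau> x\<bar> powr (6 * q)) \<le> C6"
    using u_bdd[OF s r(2)] by blast
  obtain C4 where C4: "C4 \<ge> 0" "\<And>\<tau>. \<tau> \<in> {s..t} \<Longrightarrow> (LINT x|lborel. \<bar>u \<tau> x\<bar> powr (4 * N)) \<le> C4"
    using u_bdd[OF s r(3)] by blast
  \<comment> \<open>\<open>C3\<close> and \<open>C6\<close> occur twice: the third and sixth moments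
    of the mollified flux are also bounded by moments of order 3q and 6q of the solution.\<close>
  define K where "K = 16 * (C3 + C6 + C3 + C6 + C4) + 1"
  have K: "K > 0" using C3 C6 C4 by (simp add: K_def add_nonneg_pos)
  \<comment> \<open>Half of \<open>\<delta>\<close> goes to c K, the other half to an L^1 commutator
    of at most delta c/2, divided by \<open>c\<close>.\<close>
  define c where "c = \<delta> / (2 * K)"
  have c: "c > 0" using \<delta> K by (simp add: c_def)
  have p: "\<delta> * c / 2 > 0" using \<delta> c by simp
  obtain \<epsilon>0 where e0: "\<epsilon>0 > 0"
    "\<And>\<epsilon> \<tau>. 0 < \<epsilon> \<Longrightarrow> \<epsilon> < \<epsilon>0 \<Longrightarrow> \<tau> \<in> {s..t} \<Longrightarrow>
    integrable lborel (\<lambda>x. flux q (conv (heat_kernel \<epsilon>) (u \<tau>) x)) \<and>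
    (LINT x|lborel. \<bar>conv (heat_kernel \<epsilon>) (F \<tau>) x - flux q (conv (heat_kernel \<epsilon>) (u \<tau>) x)\<bar>) \<le> \<delta> * c / 2"
    by (rule mollified_flux_error[OF s st p]) (rule that)
  show ?thesis
  proof (rule that[OF e0(1)])
    fix \<epsilon> \<tau> assume e: "0 < \<epsilon>" "\<epsilon> < \<epsilon>0" and \<tau>: "\<tau> \<in> {s..t}"
    have pos: "\<tau> > 0" using \<tau> s by auto
    let ?U = "conv (heat_kernel \<epsilon>) (u \<tau>)" and ?P = "conv (heat_kernel \<epsilon>) (F \<tau>)"
    let ?D = "\<lambda>x. \<bar>?P x - flux q (?U x)\<bar>" and ?X = "\<lambda>x. 1 + \<bar>?U x\<bar> powr N"
    have [measurable]: "u \<tau> \<in> borel_measurable borel" using pos by (intro u_meas) simp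
    have iUp: "integrable lborel (\<lambda>x. \<bar>?U x\<bar> powr p)" "(LINT x|lborel. \<bar>?U x\<bar> powr p) \<le> (LINT x|lborel. \<bar>u \<tau> x\<bar> powr p)" if "p \<ge> 1" for p
      using heat_conv_Lp(2,3)[OF e(1) that _ u_intp[OF pos that]] by auto
    have iPp: "integrable lborel (\<lambda>x. \<bar>?P x\<bar> powr p)" "(LINT x|lborel. \<bar>?P x\<bar> powr p) \<le> (LINT x|lborel. \<bar>u \<tau> x\<bar> powr (q * p))" if "p \<ge> 1" for p
      using heat_conv_Lp(2,3)[OF e(1) that _ F_intp[OF pos that]] by (auto simp: F_intp_eq)
    have iD: "integrable lborel ?D" using e0(2)[OF e \<tau>] heat_conv_L1(1)[OF e(1) F_int[OF pos]] by auto
    let ?S = "\<lambda>x. 16 * (\<bar>?P x\<bar> powr 3 + \<bar>?P x\<bar> powr 6 + \<bar>?U x\<bar> powr (3 * q) + \<bar>?U x\<bar> powr (6 * q) + \<bar>?U x\<bar> powr (4 * N))"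
    have iS: "integrable lborel ?S" using iPp(1)[of 3] iPp(1)[of 6] iUp(1)[OF r(1)] iUp(1)[OF r(2)] iUp(1)[OF r(3)] by auto
    have "(LINT x|lborel. ?S x) \<le> 16 * (C3 + C6 + C3 + C6 + C4)"
    proof -
      have "(LINT x|lborel. ?S x) = 16 * ((LINT x|lborel. \<bar>?P x\<bar> powr 3) + (LINT x|lborel. \<bar>?P x\<bar> powr 6) + (LINT x|lborel. \<bar>?U x\<bar> powr (3 * q))
         + (LINT x|lborel. \<bar>?U x\<bar> powr (6 * q)) + (LINT x|lborel. \<bar>?U x\<bar> powr (4 * N)))"
        using iPp(1)[of 3] iPp(1)[of 6] iUp(1)[OF r(1)] iUp(1)[OF r(2)] iUp(1)[OF r(3)] by simp
      also have "\<dots> \<le> 16 * (C3 + C6 + C3 + C6 + C4)"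
        using order_trans[OF iPp(2)[of 3]] order_trans[OF iPp(2)[of 6]] order_trans[OF iUp(2)[OF r(1)] C3(2)[OF \<tau>]]
          order_trans[OF iUp(2)[OF r(2)] C6(2)[OF \<tau>]] order_trans[OF iUp(2)[OF r(3)] C4(2)[OF \<tau>]] C3(2)[OF \<tau>] C6(2)[OF \<tau>]
        by (intro mult_left_mono add_mono) (auto simp: mult.commute)
      finally show ?thesis .
    qed
    then have SK: "(LINT x|lborel. ?S x) \<le> K" by (simp add: K_def)
    have bound: "?X x * (?P x - flux q (?U x))\<^sup>2 \<le> ?D x / c + c * ?S x" for x
    proof -
      have "?X x * (?P x - flux q (?U x))\<^sup>2 = ?X x * (?D x)\<^sup>2" by simp
      also have "\<dots> \<le> ?D x / c + c * ((?X x)\<^sup>2 * (?D x) ^ 3)" using c by (intro weighted_square_split) (auto intro: add_nonneg_nonneg)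
      also have "(?D x) ^ 3 \<le> (\<bar>?P x\<bar> + \<bar>?U x\<bar> powr q) ^ 3"
        by (intro power_mono order_trans[OF abs_triangle_ineq4]) (auto simp: abs_flux)
      then have "?D x / c + c * ((?X x)\<^sup>2 * (?D x) ^ 3) \<le> ?D x / c + c * ((?X x)\<^sup>2 * (\<bar>?P x\<bar> + \<bar>?U x\<bar> powr q) ^ 3)"
        using c by (intro add_left_mono mult_left_mono) auto
      also have "\<dots> \<le> ?D x / c + c * ?S x"
        using c N q by (intro add_left_mono mult_left_mono cube_weight_le) auto
      finally show ?thesis .
    qed
    have nn: "0 \<le> ?X x * (?P x - flux q (?U x))\<^sup>2" for x by (intro mult_nonneg_nonneg add_nonneg_nonneg) auto
    have iB: "integrable lborel (\<lambda>x. ?D x / c + c * ?S x)" using iD iS by auto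
    have b2: "\<bar>?X x * (?P x - flux q (?U x))\<^sup>2\<bar> \<le> ?D x / c + c * ?S x" for x
      using bound[of x] nn[of x] by (simp only: abs_of_nonneg)
    have m: "(\<lambda>x. ?X x * (?P x - flux q (?U x))\<^sup>2) \<in> borel_measurable lborel" by measurable
    note res = integral_abs_mono[OF iB m b2]
    have "(LINT x|lborel. ?X x * (?P x - flux q (?U x))\<^sup>2) \<le> (LINT x|lborel. ?D x / c + c * ?S x)"
      using res(2) by linarith
    also have "\<dots> = (LINT x|lborel. ?D x) / c + c * (LINT x|lborel. ?S x)"
      using iD iS by (subst Bochner_Integration.integral_add) auto
    also have "\<dots> \<le> (\<delta> * c / 2) / c + c * K"
      using e0(2)[OF e \<tau>] SK c by (intro add_mono divide_right_mono mult_left_mono) auto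
    also have "\<dots> = \<delta>" using c K by (simp add: c_def field_simps)
    finally show "integrable lborel (\<lambda>x. ?X x * (?P x - flux q (?U x))\<^sup>2) \<and> (LINT x|lborel. ?X x * (?P x - flux q (?U x))\<^sup>2) \<le> \<delta>"
      using res(1) by simp
  qed
qed

end

section \<open>Time derivative of an entropy of the mollified solution\<close>

lemma taylor_quadratic_bound:
  fixes \<eta> \<eta>' \<eta>'' :: "real \<Rightarrow> real"
  assumes d0: "\<And>r. (\<eta> has_real_derivative \<eta>' r) (at r)" and d1: "\<And>r. (\<eta>' has_real_derivative \<eta>'' r) (at r)"
    and B: "\<And>r. \<bar>r\<bar> \<le> L \<Longrightarrow> \<bar>\<eta>'' r\<bar> \<le> B" and r: "\<bar>r\<bar> \<le> L" "\<bar>r'\<bar> \<le> L"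
  shows "\<bar>\<eta> r' - \<eta> r - \<eta>' r * (r' - r)\<bar> \<le> B * (r' - r)\<^sup>2"
proof -
  have B0: "B \<ge> 0" using B[OF r(1)] by linarith
  have "norm ((\<eta> r' - \<eta>' r * r') - (\<eta> r - \<eta>' r * r)) \<le> (B * \<bar>r' - r\<bar>) * norm (r' - r)"
  proof (rule field_differentiable_bound[where S = "closed_segment r r'"])
    show "((\<lambda>s. \<eta> s - \<eta>' r * s) has_field_derivative (\<eta>' z - \<eta>' r)) (at z within closed_segment r r')" for z
      by (rule has_field_derivative_at_within) (auto intro!: derivative_eq_intros d0)
    show "norm (\<eta>' z - \<eta>' r) \<le> B * \<bar>r' - r\<bar>" if "z \<in> closed_segment r r'" for z
    proof -
      have z: "\<bar>z\<bar> \<le> L" "\<bar>z - r\<bar> \<le> \<bar>r' - r\<bar>"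
        using that r by (auto simp: closed_segment_eq_real_ivl split: if_splits)
      have "\<bar>\<eta>' z - \<eta>' r\<bar> \<le> B * \<bar>z - r\<bar>" by (rule DERIV_lipschitz_bound[OF d1 B z(1) r(1)])
      also have "\<dots> \<le> B * \<bar>r' - r\<bar>" using z(2) B0 by (rule mult_left_mono)
      finally show ?thesis by simp
    qed
  qed auto
  then show ?thesis by (simp add: algebra_simps power2_eq_square)
qed

lemma abs_mult_le_squares: "\<bar>x * y\<bar> \<le> x\<^sup>2 + y\<^sup>2" for x y :: real
proof -
  have "2 * \<bar>x\<bar> * \<bar>y\<bar> \<le> x\<^sup>2 + y\<^sup>2" using sum_squares_bound[of "\<bar>x\<bar>" "\<bar>y\<bar>"] by simp
  moreover have "0 \<le> \<bar>x\<bar> * \<bar>y\<bar>" by simp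
  ultimately show ?thesis unfolding abs_mult by linarith
qed

lemma heat_conv_diff_L2:
  fixes f g :: "'a::euclidean_space \<Rightarrow> real"
  assumes t: "t > 0" and m: "f \<in> borel_measurable borel" "g \<in> borel_measurable borel"
    and i: "integrable lborel (\<lambda>x. (f x)\<^sup>2)" "integrable lborel (\<lambda>x. (g x)\<^sup>2)"
  shows "conv (heat_kernel t) (\<lambda>y. f y - g y) x = conv (heat_kernel t) f x - conv (heat_kernel t) g x"
  using heat_conv_Lp(1)[OF t _ m(1), of 2] heat_conv_Lp(1)[OF t _ m(2), of 2] i
  by (simp add: conv_def left_diff_distrib powr_numeral)

lemma integrable_square_diff:
  fixes f g :: "'a \<Rightarrow> real"
  assumes "f \<in> borel_measurable M" "g \<in> borel_measurable M" "integrable M (\<lambda>x. (f x)\<^sup>2)" "integrable M (\<lambda>x. (g x)\<^sup>2)"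
  shows "integrable M (\<lambda>x. (f x - g x)\<^sup>2)"
proof (rule integrable_dominated[where g = "\<lambda>x. 2 * ((f x)\<^sup>2 + (g x)\<^sup>2)"])
  show "norm ((f x - g x)\<^sup>2) \<le> 2 * ((f x)\<^sup>2 + (g x)\<^sup>2)" for x
    using zero_le_power2[of "f x + g x"] unfolding real_norm_def abs_power2 by (simp add: power2_eq_square algebra_simps)
qed (use assms in auto)

context viscous_flow
begin

abbreviation (input) ue :: "real \<Rightarrow> real \<Rightarrow> 'a \<Rightarrow> real" where "ue \<epsilon> t \<equiv> conv (heat_kernel \<epsilon>) (u t)"
abbreviation (input) ve :: "real \<Rightarrow> real \<Rightarrow> 'a \<Rightarrow> real" where "ve \<epsilon> t \<equiv> conv (heat_kernel \<epsilon>) (v t)"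

lemma u_L2: "t > 0 \<Longrightarrow> integrable lborel (\<lambda>x. (u t x)\<^sup>2)"
  using u_intp[of t 2] by (simp add: powr_numeral)

text \<open>Mollification is linear and contracts L^2, so the difference quotients inherit the
  convergence assumed for \<open>u\<close>.\<close>

lemma ue_difference_quotient:
  assumes e: "\<epsilon> > 0" and \<tau>: "\<tau> > 0"
  defines "d \<equiv> \<lambda>h x. (ue \<epsilon> (\<tau> + h) x - ue \<epsilon> \<tau> x) / h - ve \<epsilon> \<tau> x"
  shows "\<And>h. h \<noteq> 0 \<Longrightarrow> \<bar>h\<bar> < \<tau> \<Longrightarrow> integrable lborel (\<lambda>x. (d h x)\<^sup>2)"
    and "((\<lambda>h. LINT x|lborel. (d h x)\<^sup>2) \<longlongrightarrow> 0) (at 0)"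
proof -
  let ?w = "\<lambda>h x. (u (\<tau> + h) x - u \<tau> x) / h - v \<tau> x"
  have *: "integrable lborel (\<lambda>x. (d h x)\<^sup>2) \<and> (LINT x|lborel. (d h x)\<^sup>2) \<le> (LINT x|lborel. (?w h x)\<^sup>2)"
    if h: "h \<noteq> 0" "\<bar>h\<bar> < \<tau>" for h
  proof -
    have pos: "\<tau> + h > 0" using h by auto
    have [measurable]: "u (\<tau> + h) \<in> borel_measurable borel" "u \<tau> \<in> borel_measurable borel" "v \<tau> \<in> borel_measurable borel"
      using u_meas pos \<tau> v_L2[OF \<tau>] by auto
    have i1: "integrable lborel (\<lambda>x. (u (\<tau> + h) x - u \<tau> x)\<^sup>2)" by (rule integrable_square_diff) (use u_L2 pos \<tau> in auto)
    have i2: "integrable lborel (\<lambda>x. ((u (\<tau> + h) x - u \<tau> x) / h)\<^sup>2)" using i1 by (simp add: power_divide)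
    have i3: "integrable lborel (\<lambda>x. (?w h x)\<^sup>2)" by (rule integrable_square_diff) (use i2 v_L2[OF \<tau>] in auto)
    have "d h x = conv (heat_kernel \<epsilon>) (?w h) x" for x
    proof -
      have "conv (heat_kernel \<epsilon>) (?w h) x = conv (heat_kernel \<epsilon>) (\<lambda>x. (u (\<tau> + h) x - u \<tau> x) / h) x - ve \<epsilon> \<tau> x"
        by (rule heat_conv_diff_L2[OF e _ _ i2]) (use v_L2[OF \<tau>] in auto)
      also have "conv (heat_kernel \<epsilon>) (\<lambda>x. (u (\<tau> + h) x - u \<tau> x) / h) x = conv (heat_kernel \<epsilon>) (\<lambda>x. u (\<tau> + h) x - u \<tau> x) x / h"
        by (simp add: conv_def)
      also have "conv (heat_kernel \<epsilon>) (\<lambda>x. u (\<tau> + h) x - u \<tau> x) x = ue \<epsilon> (\<tau> + h) x - ue \<epsilon> \<tau> x"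
        using pos \<tau> by (intro heat_conv_diff e u_int) auto
      finally show ?thesis by (simp add: d_def)
    qed
    then show ?thesis using heat_conv_L2[OF e _ i3] by simp
  qed
  then show "\<And>h. h \<noteq> 0 \<Longrightarrow> \<bar>h\<bar> < \<tau> \<Longrightarrow> integrable lborel (\<lambda>x. (d h x)\<^sup>2)" by blast
  have "((\<lambda>h. LINT x|lborel. \<bar>?w h x\<bar> powr 2) \<longlongrightarrow> 0) (at 0)"
    using u_C1 \<tau> by (intro Lp_norm_tendsto_zero) (auto simp: C1_into_Lp_def)
  then have lim: "((\<lambda>h. LINT x|lborel. (?w h x)\<^sup>2) \<longlongrightarrow> 0) (at 0)" by (simp add: powr_numeral)
  have "eventually (\<lambda>h. h \<noteq> 0 \<and> \<bar>h\<bar> < \<tau>) (at 0)"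
    unfolding eventually_at using \<tau> by (intro exI[of _ \<tau>]) (auto simp: dist_real_def)
  then have "eventually (\<lambda>h. norm (LINT x|lborel. (d h x)\<^sup>2) \<le> (LINT x|lborel. (?w h x)\<^sup>2)) (at 0)"
    by eventually_elim (use * in auto)
  then show "((\<lambda>h. LINT x|lborel. (d h x)\<^sup>2) \<longlongrightarrow> 0) (at 0)" by (rule Lim_null_comparison[OF _ lim])
qed

lemma ue_bounded:
  assumes e: "\<epsilon> > 0" and s: "s > 0"
  obtains L where "L > 0" "\<And>\<tau> x. \<tau> \<in> {s..t} \<Longrightarrow> \<bar>ue \<epsilon> \<tau> x\<bar> \<le> L"
proof -
  obtain C where C: "C \<ge> 0" "\<And>\<tau>. \<tau> \<in> {s..t} \<Longrightarrow> (LINT x|lborel. \<bar>u \<tau> x\<bar> powr 1) \<le> C" using u_bdd[OF s order_refl] by blast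
  define b where "b = (4 * pi * \<epsilon>) powr (- (real DIM('a) / 2))"
  have b: "b \<ge> 0" by (simp add: b_def)
  have "\<bar>ue \<epsilon> \<tau> x\<bar> \<le> b * C + 1" if "\<tau> \<in> {s..t}" for \<tau> x
  proof -
    have "norm (ue \<epsilon> \<tau> x) \<le> b * (LINT x|lborel. \<bar>u \<tau> x\<bar>)"
      using that s unfolding b_def by (intro conv_bound heat_kernel_bounded e u_int) auto
    also have "\<dots> \<le> b * C" using C(2)[OF that] b by (intro mult_left_mono) auto
    finally show ?thesis by simp
  qed
  then show ?thesis using that[of "b * C + 1"] b C by (simp add: add_nonneg_pos)
qed

text \<open>For fixed \<open>\<epsilon>\<close> the mollified solution is bounded on a window around
  \<open>\<tau>\<close>, so an entropy of arbitrary growth is there as good as one with bounded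
  second derivative; vanishing to second order at 0 makes it integrable by comparison with the
  square. The quotients converge only in L^2, so the first-order error is split with a weight that
  itself tends to 0.\<close>

lemma energy_has_derivative:
  assumes e: "\<epsilon> > 0" and \<tau>: "\<tau> > 0"
    and d0: "\<And>r. (\<eta> has_real_derivative \<eta>' r) (at r)" and d1: "\<And>r. (\<eta>' has_real_derivative \<eta>'' r) (at r)"
    and c2: "continuous_on UNIV \<eta>''" and z: "\<eta> 0 = 0" "\<eta>' 0 = 0"
  shows "((\<lambda>\<tau>. LINT x|lborel. \<eta> (ue \<epsilon> \<tau> x)) has_real_derivative (LINT x|lborel. \<eta>' (ue \<epsilon> \<tau> x) * ve \<epsilon> \<tau> x)) (at \<tau>)"
    and "integrable lborel (\<lambda>x. \<eta> (ue \<epsilon> \<tau> x))"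
proof -
  obtain L where L: "L > 0" "\<And>\<tau>' x. \<tau>' \<in> {\<tau>/2..2*\<tau>} \<Longrightarrow> \<bar>ue \<epsilon> \<tau>' x\<bar> \<le> L"
    using ue_bounded[OF e, of "\<tau> / 2" "2 * \<tau>"] \<tau> by auto
  obtain B where B: "B > 0" "\<And>r. \<bar>r\<bar> \<le> L \<Longrightarrow> \<bar>\<eta>'' r\<bar> \<le> B" using continuous_bounded_on_interval[OF c2, of L] by blast
  have c0: "continuous_on UNIV \<eta>" "continuous_on UNIV \<eta>'" using d0 d1 by (meson DERIV_isCont continuous_at_imp_continuous_on)+
  then have [measurable]: "\<eta> \<in> borel_measurable borel" "\<eta>' \<in> borel_measurable borel" by (auto intro: borel_measurable_continuous_onI)
  have \<eta>'_le: "\<bar>\<eta>' r\<bar> \<le> B * \<bar>r\<bar>" if "\<bar>r\<bar> \<le> L" for r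
    using DERIV_lipschitz_bound[OF d1 B(2) that, of 0] L z by simp
  have \<eta>_le: "\<bar>\<eta> r\<bar> \<le> B * r\<^sup>2" if "\<bar>r\<bar> \<le> L" for r
    using taylor_quadratic_bound[OF d0 d1 B(2) _ that, of 0] L z by simp
  have sq: "integrable lborel (\<lambda>x. (ue \<epsilon> \<tau>' x)\<^sup>2)" if "\<tau>' > 0" for \<tau>'
    using heat_conv_L2(1)[OF e u_meas u_L2] that by auto
  have um [measurable]: "ue \<epsilon> \<tau>' \<in> borel_measurable borel" if "\<tau>' > 0" for \<tau>'
    using that by (intro conv_measurable u_meas heat_measurable) auto
  have int: "integrable lborel (\<lambda>x. \<eta> (ue \<epsilon> \<tau>' x))" if "\<tau>' \<in> {\<tau>/2..2*\<tau>}" for \<tau>'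
  proof -
    have p: "\<tau>' > 0" using that \<tau> by auto
    note [measurable] = um[OF p]
    show ?thesis
      by (rule integrable_dominated[where g = "\<lambda>x. B * (ue \<epsilon> \<tau>' x)\<^sup>2"]) (use sq[OF p] \<eta>_le[OF L(2)[OF that]] in auto)
  qed
  then show "integrable lborel (\<lambda>x. \<eta> (ue \<epsilon> \<tau> x))" using \<tau> by auto
  note [measurable] = um[OF \<tau>]
  have vm [measurable]: "v \<tau> \<in> borel_measurable borel" using v_L2[OF \<tau>] by simp
  define N where "N = (LINT x|lborel. (\<eta>' (ue \<epsilon> \<tau> x))\<^sup>2)"
  define V where "V = (LINT x|lborel. (ve \<epsilon> \<tau> x)\<^sup>2)"
  define d where "d h x = (ue \<epsilon> (\<tau> + h) x - ue \<epsilon> \<tau> x) / h - ve \<epsilon> \<tau> x" for h x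
  define \<delta> where "\<delta> h = (LINT x|lborel. (d h x)\<^sup>2)" for h
  have id: "\<And>h. h \<noteq> 0 \<Longrightarrow> \<bar>h\<bar> < \<tau> \<Longrightarrow> integrable lborel (\<lambda>x. (d h x)\<^sup>2)" and \<delta>lim: "(\<delta> \<longlongrightarrow> 0) (at 0)"
    using ue_difference_quotient[OF e \<tau>] unfolding d_def[abs_def] \<delta>_def[abs_def] by auto
  have \<delta>0: "\<delta> h \<ge> 0" for h by (simp add: \<delta>_def)
  have \<tau>in: "\<tau> \<in> {\<tau>/2..2*\<tau>}" using \<tau> by simp
  have iN: "integrable lborel (\<lambda>x. (\<eta>' (ue \<epsilon> \<tau> x))\<^sup>2)"
  proof (rule integrable_dominated[where g = "\<lambda>x. B\<^sup>2 * (ue \<epsilon> \<tau> x)\<^sup>2"])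
    show "norm ((\<eta>' (ue \<epsilon> \<tau> x))\<^sup>2) \<le> B\<^sup>2 * (ue \<epsilon> \<tau> x)\<^sup>2" for x
      using power_mono[OF \<eta>'_le[OF L(2)[OF \<tau>in, of x]], of 2] by (simp add: power_mult_distrib)
  qed (use sq[OF \<tau>] in auto)
  have iV: "integrable lborel (\<lambda>x. (ve \<epsilon> \<tau> x)\<^sup>2)" using heat_conv_L2(1)[OF e vm] v_L2[OF \<tau>] by auto
  have iD: "integrable lborel (\<lambda>x. \<eta>' (ue \<epsilon> \<tau> x) * ve \<epsilon> \<tau> x)"
  proof (rule integrable_dominated[where g = "\<lambda>x. (\<eta>' (ue \<epsilon> \<tau> x))\<^sup>2 + (ve \<epsilon> \<tau> x)\<^sup>2"])
    show "norm (\<eta>' (ue \<epsilon> \<tau> x) * ve \<epsilon> \<tau> x) \<le> (\<eta>' (ue \<epsilon> \<tau> x))\<^sup>2 + (ve \<epsilon> \<tau> x)\<^sup>2" for x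
      unfolding real_norm_def by (rule abs_mult_le_squares)
  qed (use iN iV in auto)
  let ?\<Phi> = "\<lambda>\<tau>. LINT x|lborel. \<eta> (ue \<epsilon> \<tau> x)" and ?D = "LINT x|lborel. \<eta>' (ue \<epsilon> \<tau> x) * ve \<epsilon> \<tau> x"
  let ?R = "\<lambda>h. 2 * B * \<bar>h\<bar> * (\<delta> h + V) + (sqrt (\<delta> h) + \<bar>h\<bar>) * N + sqrt (\<delta> h)"
  have bound: "norm ((?\<Phi> (\<tau> + h) - ?\<Phi> \<tau>) / h - ?D) \<le> ?R h" if h: "h \<noteq> 0" "\<bar>h\<bar> < \<tau> / 2" for h
  proof -
    have hin: "\<tau> + h \<in> {\<tau>/2..2*\<tau>}" "\<tau> + h > 0" using h \<tau> by auto
    note [measurable] = um[OF hin(2)]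
    \<comment> \<open>The weight tends to 0 with \<open>h\<close>, satisfies
      \<open>\<delta> h / c \<le> sqrt (\<delta> h)\<close>, and stays positive through the summand
      \<open>\<bar>h\<bar>\<close> even when \<open>\<delta> h = 0\<close>.\<close>
    define c where "c = sqrt (\<delta> h) + \<bar>h\<bar>"
    have c: "c > 0" using h real_sqrt_ge_zero[OF \<delta>0[of h]] unfolding c_def by linarith
    have idh: "integrable lborel (\<lambda>x. (d h x)\<^sup>2)" using id h by auto
    let ?g = "\<lambda>x. \<eta> (ue \<epsilon> (\<tau> + h) x) - \<eta> (ue \<epsilon> \<tau> x) - h * (\<eta>' (ue \<epsilon> \<tau> x) * ve \<epsilon> \<tau> x)"
    let ?b = "\<lambda>x. 2 * B * h\<^sup>2 * ((d h x)\<^sup>2 + (ve \<epsilon> \<tau> x)\<^sup>2) + \<bar>h\<bar> * (c * (\<eta>' (ue \<epsilon> \<tau> x))\<^sup>2 + (d h x)\<^sup>2 / c)"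
    have gb: "\<bar>?g x\<bar> \<le> ?b x" for x
    proof -
      let ?r = "ue \<epsilon> \<tau> x" and ?r' = "ue \<epsilon> (\<tau> + h) x"
      have w: "?r' - ?r = h * (d h x + ve \<epsilon> \<tau> x)" using h by (simp add: d_def)
      have "\<bar>\<eta> ?r' - \<eta> ?r - \<eta>' ?r * (?r' - ?r)\<bar> \<le> B * (?r' - ?r)\<^sup>2"
        by (rule taylor_quadratic_bound[OF d0 d1 B(2) L(2)[OF \<tau>in] L(2)[OF hin(1)]])
      also have "\<dots> \<le> B * (h\<^sup>2 * (2 * ((d h x)\<^sup>2 + (ve \<epsilon> \<tau> x)\<^sup>2)))"
        unfolding w power_mult_distrib using B zero_le_power2[of "d h x - ve \<epsilon> \<tau> x"]
        by (intro mult_left_mono) (auto simp: power2_eq_square algebra_simps)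
      also have "\<dots> = 2 * B * h\<^sup>2 * ((d h x)\<^sup>2 + (ve \<epsilon> \<tau> x)\<^sup>2)" by (simp add: algebra_simps)
      finally have 1: "\<bar>\<eta> ?r' - \<eta> ?r - \<eta>' ?r * (?r' - ?r)\<bar> \<le> 2 * B * h\<^sup>2 * ((d h x)\<^sup>2 + (ve \<epsilon> \<tau> x)\<^sup>2)" .
      have "\<bar>\<eta>' ?r * d h x\<bar> \<le> c * (\<eta>' ?r)\<^sup>2 + (d h x)\<^sup>2 / c"
      proof -
        have "2 * (c * \<bar>\<eta>' ?r\<bar>) * \<bar>d h x\<bar> \<le> (c * \<bar>\<eta>' ?r\<bar>)\<^sup>2 + \<bar>d h x\<bar>\<^sup>2" by (rule sum_squares_bound)
        moreover have "(c * \<bar>\<eta>' ?r\<bar>) * \<bar>d h x\<bar> \<ge> 0" using c by simp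
        ultimately have "(c * \<bar>\<eta>' ?r\<bar>) * \<bar>d h x\<bar> \<le> (c * \<bar>\<eta>' ?r\<bar>)\<^sup>2 + \<bar>d h x\<bar>\<^sup>2" by linarith
        then show ?thesis using c by (simp add: abs_mult power2_eq_square field_simps)
      qed
      then have "\<bar>h\<bar> * \<bar>\<eta>' ?r * d h x\<bar> \<le> \<bar>h\<bar> * (c * (\<eta>' ?r)\<^sup>2 + (d h x)\<^sup>2 / c)" by (rule mult_left_mono) simp
      then have 2: "\<bar>h * (\<eta>' ?r * d h x)\<bar> \<le> \<bar>h\<bar> * (c * (\<eta>' ?r)\<^sup>2 + (d h x)\<^sup>2 / c)" by (simp only: abs_mult)
      have "?g x = (\<eta> ?r' - \<eta> ?r - \<eta>' ?r * (?r' - ?r)) + h * (\<eta>' ?r * d h x)"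
        unfolding w by (simp add: algebra_simps)
      then show ?thesis using 1 2 by linarith
    qed
    have ib: "integrable lborel ?b" using idh iV iN by auto
    have "\<bar>LINT x|lborel. ?g x\<bar> \<le> (LINT x|lborel. ?b x)"
      by (rule integral_abs_mono(2)[OF ib _ gb]) measurable
    also have "(LINT x|lborel. ?b x) = 2 * B * h\<^sup>2 * (\<delta> h + V) + \<bar>h\<bar> * (c * N + \<delta> h / c)"
      using idh iV iN by (simp add: \<delta>_def V_def N_def)
    also have "(LINT x|lborel. ?g x) = ?\<Phi> (\<tau> + h) - ?\<Phi> \<tau> - h * ?D"
      using int[OF hin(1)] int[OF \<tau>in] iD by simp
    finally have "\<bar>?\<Phi> (\<tau> + h) - ?\<Phi> \<tau> - h * ?D\<bar> / \<bar>h\<bar> \<le> (2 * B * h\<^sup>2 * (\<delta> h + V) + \<bar>h\<bar> * (c * N + \<delta> h / c)) / \<bar>h\<bar>"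
      by (rule divide_right_mono) simp
    also have "(2 * B * h\<^sup>2 * (\<delta> h + V) + \<bar>h\<bar> * (c * N + \<delta> h / c)) / \<bar>h\<bar> = 2 * B * \<bar>h\<bar> * (\<delta> h + V) + (c * N + \<delta> h / c)"
    proof -
      have gen: "(2 * B * (k * k) * X + k * Y) / k = 2 * B * k * X + Y" if "k \<noteq> 0" for k X Y :: real
        using that by (simp add: add_divide_distrib)
      have hh: "h\<^sup>2 = \<bar>h\<bar> * \<bar>h\<bar>" by (simp add: power2_eq_square)
      show ?thesis unfolding hh using h by (intro gen) simp
    qed
    also have "\<bar>?\<Phi> (\<tau> + h) - ?\<Phi> \<tau> - h * ?D\<bar> / \<bar>h\<bar> = norm ((?\<Phi> (\<tau> + h) - ?\<Phi> \<tau>) / h - ?D)"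
      using h by (simp add: abs_divide[symmetric] diff_divide_distrib)
    also have "\<delta> h / c \<le> sqrt (\<delta> h)"
    proof -
      have "\<delta> h = sqrt (\<delta> h) * sqrt (\<delta> h)" using \<delta>0 by simp
      also have "\<dots> \<le> sqrt (\<delta> h) * c" using \<delta>0[of h] by (intro mult_left_mono) (auto simp: c_def)
      finally show ?thesis using c by (simp add: divide_le_eq)
    qed
    finally show ?thesis by (simp add: c_def)
  qed
  have "((?R) \<longlongrightarrow> 2 * B * \<bar>0\<bar> * (0 + V) + (sqrt 0 + \<bar>0\<bar>) * N + sqrt 0) (at 0)"
    by (intro tendsto_intros \<delta>lim)
  then have Rlim: "((?R) \<longlongrightarrow> 0) (at 0)" by simp
  have "eventually (\<lambda>h. h \<noteq> 0 \<and> \<bar>h\<bar> < \<tau> / 2) (at 0)"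
    unfolding eventually_at using \<tau> by (intro exI[of _ "\<tau> / 2"]) (auto simp: dist_real_def)
  then have "eventually (\<lambda>h. norm ((?\<Phi> (\<tau> + h) - ?\<Phi> \<tau>) / h - ?D) \<le> ?R h) (at 0)"
    by eventually_elim (use bound in auto)
  then have "((\<lambda>h. (?\<Phi> (\<tau> + h) - ?\<Phi> \<tau>) / h - ?D) \<longlongrightarrow> 0) (at 0)" by (rule Lim_null_comparison[OF _ Rlim])
  then show "(?\<Phi> has_real_derivative ?D) (at \<tau>)" by (simp add: DERIV_def LIM_zero_iff)
qed

text \<open>Combines the dissipation estimate with the growth bound on \<open>\<eta>''\<close>,
  which exchanges the entropy-dependent commutator term for the weighted error already known to be
  uniformly small.\<close>

lemma energy_dissipation:
  assumes e: "\<epsilon> > 0" and \<tau>: "\<tau> > 0"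
    and d0: "\<And>r. (\<eta> has_real_derivative \<eta>' r) (at r)" and d1: "\<And>r. (\<eta>' has_real_derivative \<eta>'' r) (at r)"
    and c2: "continuous_on UNIV \<eta>''" and nn: "\<And>r. \<eta>'' r \<ge> 0" and z: "\<eta> 0 = 0" "\<eta>' 0 = 0"
    and B: "B \<ge> 0" "\<And>r. \<eta>'' r \<le> B * (1 + \<bar>r\<bar> powr N)"
    and i: "integrable lborel (\<lambda>x. (1 + \<bar>ue \<epsilon> \<tau> x\<bar> powr N) * (conv (heat_kernel \<epsilon>) (F \<tau>) x - flux q (ue \<epsilon> \<tau> x))\<^sup>2)"
  shows "\<exists>D. ((\<lambda>\<tau>. LINT x|lborel. \<eta> (ue \<epsilon> \<tau> x)) has_real_derivative D) (at \<tau>) \<and>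
     D \<le> - (1/2) * (LINT x|lborel. \<eta>'' (ue \<epsilon> \<tau> x) * (norm (conv (heat_grad \<epsilon>) (u \<tau>) x))\<^sup>2)
       + (norm a)\<^sup>2 / 2 * (B * (LINT x|lborel. (1 + \<bar>ue \<epsilon> \<tau> x\<bar> powr N) * (conv (heat_kernel \<epsilon>) (F \<tau>) x - flux q (ue \<epsilon> \<tau> x))\<^sup>2))"
proof -
  have ui: "integrable lborel (u \<tau>)" using u_int \<tau> by auto
  note D = dissipation_estimate(2)[OF q e ui F_int[OF \<tau>] d1 c2 nn z(2)] dissipation_estimate(3)[OF q e ui F_int[OF \<tau>] d1 c2 nn z(2)]
  let ?E = "\<lambda>x. (conv (heat_kernel \<epsilon>) (F \<tau>) x - flux q (ue \<epsilon> \<tau> x))\<^sup>2"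
  have "(LINT x|lborel. \<eta>'' (ue \<epsilon> \<tau> x) * ?E x) \<le> (LINT x|lborel. B * ((1 + \<bar>ue \<epsilon> \<tau> x\<bar> powr N) * ?E x))"
  proof (rule integral_mono[OF D(1)])
    show "\<eta>'' (ue \<epsilon> \<tau> x) * ?E x \<le> B * ((1 + \<bar>ue \<epsilon> \<tau> x\<bar> powr N) * ?E x)" for x
      using mult_right_mono[OF B(2)[of "ue \<epsilon> \<tau> x"], of "?E x"] by (simp add: mult.assoc)
  qed (use i in simp)
  then have "(norm a)\<^sup>2 / 2 * (LINT x|lborel. \<eta>'' (ue \<epsilon> \<tau> x) * ?E x) \<le> (norm a)\<^sup>2 / 2 * (B * (LINT x|lborel. (1 + \<bar>ue \<epsilon> \<tau> x\<bar> powr N) * ?E x))"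
    by (intro mult_left_mono) auto
  moreover have "(LINT x|lborel. \<eta>' (ue \<epsilon> \<tau> x) * ve \<epsilon> \<tau> x)
      = (LINT x|lborel. \<eta>' (ue \<epsilon> \<tau> x) * (conv (heat_lapl \<epsilon>) (u \<tau>) x - a \<bullet> conv (heat_grad \<epsilon>) (F \<tau>) x))"
    by (simp add: mollified[OF \<tau> e])
  ultimately show ?thesis
    using energy_has_derivative(1)[OF e \<tau> d0 d1 c2 z] D(2)[of a] by (intro exI conjI) (assumption, linarith)
qed

end

section \<open>Monotone norms\<close>

text \<open>At 0 the quotient of the truncated function is dominated by that of \<open>h\<close>,
  whose limit \<open>h' 0\<close> is 0.\<close>

lemma pos_part_has_derivative:
  fixes h h' :: "real \<Rightarrow> real"
  assumes d: "\<And>z. (h has_real_derivative h' z) (at z)" and z: "h 0 = 0" "h' 0 = 0"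
  shows "((\<lambda>z. if z > 0 then h z else 0) has_real_derivative (if z > 0 then h' z else 0)) (at z)"
proof -
  consider "z > 0" | "z < 0" | "z = 0" by linarith
  then show ?thesis
  proof cases
    case 1
    have "((\<lambda>z. if z > 0 then h z else 0) has_real_derivative h' z) (at z)"
      by (rule has_field_derivative_transform_within_open[OF d, where S = "{0<..}"]) (use 1 in auto)
    then show ?thesis using 1 by simp
  next
    case 2
    have "((\<lambda>z. 0) has_real_derivative 0) (at z)" by simp
    then have "((\<lambda>z. if z > 0 then h z else 0) has_real_derivative 0) (at z)"
      by (rule has_field_derivative_transform_within_open[where S = "{..<0}"]) (use 2 in auto)
    then show ?thesis using 2 by simp
  next
    case 3
    have "((\<lambda>k. (h (0 + k) - h 0) / k) \<longlongrightarrow> 0) (at 0)" using d[of 0] z by (simp add: DERIV_def)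
    then have "((\<lambda>k. \<bar>(h (0 + k) - h 0) / k\<bar>) \<longlongrightarrow> 0) (at 0)" by (rule tendsto_rabs_zero)
    then have "((\<lambda>k. ((if 0 + k > 0 then h (0 + k) else 0) - 0) / k) \<longlongrightarrow> 0) (at 0)"
      by (rule Lim_null_comparison[rotated], intro always_eventually allI) (simp add: z del: abs_divide)
    then show ?thesis using 3 by (simp add: DERIV_def)
  qed
qed

context viscous_flow
begin

text \<open>For the mollified solution the entropy can grow at most at a rate \<open>k\<close> that
  is arbitrarily small. The 1-Lipschitz condition then carries the inequality back to
  \<open>u\<close> by L^1 approximation at the two end times; each of the three errors costs
  delta/3.\<close>

lemma entropy_nonincreasing:
  assumes s: "0 < s" and st: "s \<le> t"
    and d0: "\<And>r. (\<eta> has_real_derivative \<eta>' r) (at r)" and d1: "\<And>r. (\<eta>' has_real_derivative \<eta>'' r) (at r)"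
    and c2: "continuous_on UNIV \<eta>''" and nn: "\<And>r. \<eta>'' r \<ge> 0" and z: "\<eta> 0 = 0" "\<eta>' 0 = 0"
    and B: "\<And>r. \<eta>'' r \<le> B" and lip: "\<And>r r'. \<bar>\<eta> r - \<eta> r'\<bar> \<le> \<bar>r - r'\<bar>"
  shows "(LINT x|lborel. \<eta> (u t x)) \<le> (LINT x|lborel. \<eta> (u s x))"
proof (rule field_le_epsilon)
  fix \<delta> :: real assume \<delta>: "\<delta> > 0"
  have B0: "B \<ge> 0" using order_trans[OF nn B] .
  \<comment> \<open>Scales the commutator tolerance so that its accumulated effect over [s,t] is at
    most delta/3; the summand 1 permits division when \<open>a = 0\<close> or
    \<open>s = t\<close>.\<close>
  define K where "K = (norm a)\<^sup>2 / 2 * B * (t - s) + 1"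
  have K: "K > 0" using B0 st by (simp add: K_def add_nonneg_pos)
  have d3: "\<delta> / 3 > 0" "\<delta> / (3 * K) > 0" using \<delta> K by auto
  have c0: "continuous_on UNIV \<eta>" using d0 by (meson DERIV_isCont continuous_at_imp_continuous_on)
  then have \<eta>m [measurable]: "\<eta> \<in> borel_measurable borel" by (rule borel_measurable_continuous_onI)
  have \<eta>_le: "\<bar>\<eta> r\<bar> \<le> \<bar>r\<bar>" for r using lip[of r 0] z by simp
  have ui: "integrable lborel (u t)" "integrable lborel (u s)" using u_int s st by auto
  obtain e1 where e1: "e1 > 0" "\<And>\<epsilon> \<tau>. 0 < \<epsilon> \<Longrightarrow> \<epsilon> < e1 \<Longrightarrow> \<tau> \<in> {s..t} \<Longrightarrow>
    integrable lborel (\<lambda>x. (1 + \<bar>ue \<epsilon> \<tau> x\<bar> powr 1) * (conv (heat_kernel \<epsilon>) (F \<tau>) x - flux q (ue \<epsilon> \<tau> x))\<^sup>2) \<and>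
    (LINT x|lborel. (1 + \<bar>ue \<epsilon> \<tau> x\<bar> powr 1) * (conv (heat_kernel \<epsilon>) (F \<tau>) x - flux q (ue \<epsilon> \<tau> x))\<^sup>2) \<le> \<delta> / (3 * K)"
    by (rule mollified_flux_error_weighted[OF s st order_refl d3(2)], rule that)
  obtain e2 where e2: "e2 > 0" "\<And>\<epsilon>. 0 < \<epsilon> \<Longrightarrow> \<epsilon> < e2 \<Longrightarrow> (LINT x|lborel. \<bar>ue \<epsilon> t x - u t x\<bar>) \<le> \<delta> / 3"
    using heat_approximable_integrable[OF ui(1)] d3(1) unfolding heat_approximable_def by meson
  obtain e3 where e3: "e3 > 0" "\<And>\<epsilon>. 0 < \<epsilon> \<Longrightarrow> \<epsilon> < e3 \<Longrightarrow> (LINT x|lborel. \<bar>ue \<epsilon> s x - u s x\<bar>) \<le> \<delta> / 3"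
    using heat_approximable_integrable[OF ui(2)] d3(1) unfolding heat_approximable_def by meson
  define \<epsilon> where "\<epsilon> = min e1 (min e2 e3) / 2"
  have \<epsilon>: "\<epsilon> > 0" "\<epsilon> < e1" "\<epsilon> < e2" "\<epsilon> < e3" using e1 e2 e3 by (auto simp: \<epsilon>_def)
  let ?\<Phi> = "\<lambda>\<tau>. LINT x|lborel. \<eta> (ue \<epsilon> \<tau> x)"
  define k where "k = (norm a)\<^sup>2 / 2 * (B * (\<delta> / (3 * K)))"
  have "?\<Phi> t - k * t \<le> ?\<Phi> s - k * s"
  proof (rule DERIV_nonpos_imp_nonincreasing[OF st])
    fix \<tau> assume "s \<le> \<tau>" "\<tau> \<le> t"
    then have \<tau>: "\<tau> \<in> {s..t}" "\<tau> > 0" using s by auto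
    note err = e1(2)[OF \<epsilon>(1,2) \<tau>(1)]
    \<comment> \<open>The bounded second derivative is fitted into the weighted form with the
      smallest admissible exponent 1.\<close>
    have "\<eta>'' r \<le> B * (1 + \<bar>r\<bar> powr 1)" for r
      using B[of r] B0 by (simp add: distrib_left add_increasing2)
    from energy_dissipation[OF \<epsilon>(1) \<tau>(2) d0 d1 c2 nn z B0 this conjunct1[OF err]]
    obtain D where D: "(?\<Phi> has_real_derivative D) (at \<tau>)" "D \<le> - (1/2) * (LINT x|lborel. \<eta>'' (ue \<epsilon> \<tau> x) * (norm (conv (heat_grad \<epsilon>) (u \<tau>) x))\<^sup>2)
       + (norm a)\<^sup>2 / 2 * (B * (LINT x|lborel. (1 + \<bar>ue \<epsilon> \<tau> x\<bar> powr 1) * (conv (heat_kernel \<epsilon>) (F \<tau>) x - flux q (ue \<epsilon> \<tau> x))\<^sup>2))"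
      by blast
    have "(LINT x|lborel. \<eta>'' (ue \<epsilon> \<tau> x) * (norm (conv (heat_grad \<epsilon>) (u \<tau>) x))\<^sup>2) \<ge> 0"
      using nn by (intro Bochner_Integration.integral_nonneg mult_nonneg_nonneg) auto
    moreover have "(norm a)\<^sup>2 / 2 * (B * (LINT x|lborel. (1 + \<bar>ue \<epsilon> \<tau> x\<bar> powr 1) * (conv (heat_kernel \<epsilon>) (F \<tau>) x - flux q (ue \<epsilon> \<tau> x))\<^sup>2)) \<le> k"
      unfolding k_def using err B0 by (intro mult_left_mono) auto
    ultimately have "D - k * 1 \<le> 0" using D(2) by linarith
    moreover have "((\<lambda>\<tau>. ?\<Phi> \<tau> - k * \<tau>) has_real_derivative D - k * 1) (at \<tau>)"
      by (intro DERIV_diff D(1) DERIV_cmult DERIV_ident)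
    ultimately show "\<exists>y. ((\<lambda>\<tau>. ?\<Phi> \<tau> - k * \<tau>) has_real_derivative y) (at \<tau>) \<and> y \<le> 0" by blast
  qed
  moreover have "k * (t - s) \<le> \<delta> / 3"
  proof -
    have "k * (t - s) = ((norm a)\<^sup>2 / 2 * B * (t - s)) * (\<delta> / (3 * K))" by (simp add: k_def mult_ac)
    also have "\<dots> \<le> K * (\<delta> / (3 * K))" using d3 by (intro mult_right_mono) (auto simp: K_def)
    finally show ?thesis using K by simp
  qed
  ultimately have 1: "?\<Phi> t \<le> ?\<Phi> s + \<delta> / 3" by (simp add: algebra_simps)
  have close: "\<bar>(LINT x|lborel. \<eta> (f x)) - (LINT x|lborel. \<eta> (g x))\<bar> \<le> (LINT x|lborel. \<bar>f x - g x\<bar>)"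
    if fg: "integrable lborel f" "integrable lborel g" for f g :: "'a \<Rightarrow> real"
  proof -
    have [measurable]: "f \<in> borel_measurable borel" "g \<in> borel_measurable borel" using fg by auto
    have ig: "integrable lborel (\<lambda>x. \<eta> (f x))" "integrable lborel (\<lambda>x. \<eta> (g x))"
      by (rule integrable_dominated[OF integrable_abs[OF fg(1)]], use \<eta>_le in auto)
         (rule integrable_dominated[OF integrable_abs[OF fg(2)]], use \<eta>_le in auto)
    have "(LINT x|lborel. \<eta> (f x)) - (LINT x|lborel. \<eta> (g x)) = (LINT x|lborel. \<eta> (f x) - \<eta> (g x))" using ig by simp
    then show ?thesis using integral_abs_mono(2)[of lborel "\<lambda>x. \<bar>f x - g x\<bar>" "\<lambda>x. \<eta> (f x) - \<eta> (g x)"] lip fg by auto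
  qed
  have "\<bar>?\<Phi> t - (LINT x|lborel. \<eta> (u t x))\<bar> \<le> \<delta> / 3" "\<bar>?\<Phi> s - (LINT x|lborel. \<eta> (u s x))\<bar> \<le> \<delta> / 3"
    using order_trans[OF close[OF heat_conv_L1(1)[OF \<epsilon>(1) ui(1)] ui(1)] e2(2)[OF \<epsilon>(1,3)]]
      order_trans[OF close[OF heat_conv_L1(1)[OF \<epsilon>(1) ui(2)] ui(2)] e3(2)[OF \<epsilon>(1,4)]] by auto
  with 1 show "(LINT x|lborel. \<eta> (u t x)) \<le> (LINT x|lborel. \<eta> (u s x)) + \<delta>" by linarith
qed

text \<open>
  \<open>z - \<delta> arctan (z / \<delta>)\<close> vanishes to second order at \<open>0\<close>, so that composing it with the positive
  part gives a smooth enough convex approximation of \<open>(\<bar>r\<bar> - k)\<^sub>+\<close>.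
\<close>

lemma smooth_hinge_nonincreasing:
  assumes s: "0 < s" and st: "s \<le> t" and k: "k \<ge> 0" and \<delta>: "\<delta> > 0"
  defines "h \<equiv> \<lambda>z. if z > 0 then z - \<delta> * arctan (z / \<delta>) else 0"
  shows "(LINT x|lborel. h (u t x - k) + h (- u t x - k)) \<le> (LINT x|lborel. h (u s x - k) + h (- u s x - k))"
proof -
  define p1 where "p1 z = z\<^sup>2 / (z\<^sup>2 + \<delta>\<^sup>2)" for z
  define p2 where "p2 z = 2 * z * \<delta>\<^sup>2 / (z\<^sup>2 + \<delta>\<^sup>2)\<^sup>2" for z
  have nz: "z\<^sup>2 + \<delta>\<^sup>2 > 0" for z using \<delta> by (simp add: add_nonneg_pos)
  have D0: "((\<lambda>z. z - \<delta> * arctan (z / \<delta>)) has_real_derivative p1 z) (at z)" for z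
  proof -
    have "((\<lambda>z. z - \<delta> * arctan (z / \<delta>)) has_real_derivative 1 - \<delta> * (inverse (1 + (z / \<delta>)\<^sup>2) * (1 / \<delta>))) (at z)"
      using \<delta> by (auto intro!: derivative_eq_intros)
    moreover have "1 - \<delta> * (inverse (1 + (z / \<delta>)\<^sup>2) * (1 / \<delta>)) = p1 z"
    proof -
      have "1 + (z / \<delta>)\<^sup>2 = (z\<^sup>2 + \<delta>\<^sup>2) / \<delta>\<^sup>2" using \<delta> by (simp add: power_divide field_simps)
      then have "\<delta> * (inverse (1 + (z / \<delta>)\<^sup>2) * (1 / \<delta>)) = \<delta>\<^sup>2 / (z\<^sup>2 + \<delta>\<^sup>2)" using \<delta> by simp
      moreover have "1 - \<delta>\<^sup>2 / (z\<^sup>2 + \<delta>\<^sup>2) = ((z\<^sup>2 + \<delta>\<^sup>2) - \<delta>\<^sup>2) / (z\<^sup>2 + \<delta>\<^sup>2)"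
        using nz[of z] \<delta> by (simp only: diff_divide_distrib) simp
      ultimately show ?thesis by (simp only:) (simp add: p1_def)
    qed
    ultimately show ?thesis by simp
  qed
  have D1: "(p1 has_real_derivative p2 z) (at z)" for z
  proof -
    have "((\<lambda>z. z\<^sup>2 / (z\<^sup>2 + \<delta>\<^sup>2)) has_real_derivative ((2 * z) * (z\<^sup>2 + \<delta>\<^sup>2) - z\<^sup>2 * (2 * z)) / ((z\<^sup>2 + \<delta>\<^sup>2) * (z\<^sup>2 + \<delta>\<^sup>2))) (at z)"
      using nz[of z] by (auto intro!: derivative_eq_intros)
    moreover have "((2 * z) * (z\<^sup>2 + \<delta>\<^sup>2) - z\<^sup>2 * (2 * z)) / ((z\<^sup>2 + \<delta>\<^sup>2) * (z\<^sup>2 + \<delta>\<^sup>2)) = p2 z"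
      by (simp add: p2_def power2_eq_square algebra_simps)
    ultimately show ?thesis by (simp add: p1_def[abs_def])
  qed
  define h1 where "h1 z = (if z > 0 then p1 z else 0)" for z
  define h2 where "h2 z = (if z > 0 then p2 z else 0)" for z
  have dh: "(h has_real_derivative h1 z) (at z)" for z
    unfolding h_def h1_def by (rule pos_part_has_derivative[OF D0]) (auto simp: p1_def)
  have dh1: "(h1 has_real_derivative h2 z) (at z)" for z
    unfolding h1_def[abs_def] h2_def by (rule pos_part_has_derivative[OF D1]) (auto simp: p1_def p2_def)
  have ch2: "continuous_on UNIV h2"
  proof -
    have "h2 z = p2 (max z 0)" for z by (auto simp: h2_def p2_def max_def)
    moreover have "continuous_on UNIV (\<lambda>z. p2 (max z 0))"
      unfolding p2_def using nz by (intro continuous_intros) (auto simp: less_imp_neq[symmetric])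
    ultimately show ?thesis by (simp add: continuous_on_def)
  qed
  have h2b: "0 \<le> h2 z" "h2 z \<le> 1 / \<delta>" for z
  proof -
    show "0 \<le> h2 z" by (simp add: h2_def p2_def)
    show "h2 z \<le> 1 / \<delta>"
    proof (cases "z > 0")
      case True
      have "2 * z * \<delta> * \<delta>\<^sup>2 \<le> (z\<^sup>2 + \<delta>\<^sup>2) * (z\<^sup>2 + \<delta>\<^sup>2)"
        using True \<delta> sum_squares_bound[of z \<delta>] by (intro mult_mono) auto
      then have "2 * z * \<delta>\<^sup>2 * \<delta> \<le> (z\<^sup>2 + \<delta>\<^sup>2)\<^sup>2" by (simp add: power2_eq_square mult_ac)
      then show ?thesis using True \<delta> nz[of z] by (simp add: h2_def p2_def divide_le_eq le_divide_eq)
    qed (use \<delta> in \<open>simp add: h2_def\<close>)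
  qed
  have h1b: "0 \<le> h1 z" "h1 z \<le> 1" "z \<le> 0 \<Longrightarrow> h1 z = 0" for z
    using nz[of z] by (auto simp: h1_def p1_def divide_le_eq)
  let ?\<eta> = "\<lambda>r. h (r - k) + h (- r - k)" and ?\<eta>1 = "\<lambda>r. h1 (r - k) - h1 (- r - k)" and ?\<eta>2 = "\<lambda>r. h2 (r - k) + h2 (- r - k)"
  have d\<eta>: "(?\<eta> has_real_derivative ?\<eta>1 r) (at r)" for r
  proof -
    have "(?\<eta> has_real_derivative h1 (r - k) * 1 + h1 (- r - k) * (- 1)) (at r)"
      by (intro DERIV_add DERIV_chain2[OF dh]) (auto intro!: derivative_eq_intros)
    then show ?thesis by simp
  qed
  have d\<eta>1: "(?\<eta>1 has_real_derivative ?\<eta>2 r) (at r)" for r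
  proof -
    have "(?\<eta>1 has_real_derivative h2 (r - k) * 1 - h2 (- r - k) * (- 1)) (at r)"
      by (intro DERIV_diff DERIV_chain2[OF dh1]) (auto intro!: derivative_eq_intros)
    then show ?thesis by simp
  qed
  show ?thesis
  proof (rule entropy_nonincreasing[OF s st d\<eta> d\<eta>1, where B = "2 / \<delta>"])
    show "continuous_on UNIV ?\<eta>2" by (intro continuous_intros continuous_on_compose2[OF ch2]) auto
    show "0 \<le> ?\<eta>2 r" for r using h2b by simp
    show "?\<eta>2 r \<le> 2 / \<delta>" for r using h2b(2)[of "r - k"] h2b(2)[of "- r - k"] by simp
    show "h (0 - k) + h (- 0 - k) = 0" "h1 (0 - k) - h1 (- 0 - k) = 0" using k by (auto simp: h_def h1_def)
    show "\<bar>?\<eta> r - ?\<eta> r'\<bar> \<le> \<bar>r - r'\<bar>" for r r'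
    proof -
      have "\<bar>?\<eta> r - ?\<eta> r'\<bar> \<le> 1 * \<bar>r - r'\<bar>"
      proof (rule DERIV_lipschitz_bound[OF d\<eta>, where L = "max \<bar>r\<bar> \<bar>r'\<bar>"])
        \<comment> \<open>Since \<open>k \<ge> 0\<close>, at most one of the two hinges is active at
          \<open>w\<close>.\<close>
        show "\<bar>?\<eta>1 w\<bar> \<le> 1" for w
          using h1b[of "w - k"] h1b[of "- w - k"] k by (cases "w > 0") (auto simp: abs_le_iff)
      qed auto
      then show ?thesis by simp
    qed
  qed
qed

text \<open>The smooth hinges lie below the true one and converge to it as delta = 1/(n+1) tends to
  0. The first fact bounds the right side for every delta; both together give dominated convergence
  on the left.\<close>

lemma hinge_nonincreasing_pos:
  assumes s: "0 < s" and st: "s \<le> t" and k: "k \<ge> 0"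
  shows "(LINT x|lborel. max 0 (\<bar>u t x\<bar> - k)) \<le> (LINT x|lborel. max 0 (\<bar>u s x\<bar> - k))"
proof -
  define h where "h \<delta> z = (if z > 0 then z - \<delta> * arctan (z / \<delta>) else 0)" for \<delta> z :: real
  define \<eta> where "\<eta> \<delta> r = h \<delta> (r - k) + h \<delta> (- r - k)" for \<delta> r
  have hb: "0 \<le> h \<delta> z" "h \<delta> z \<le> max 0 z" if "\<delta> > 0" for \<delta> z
  proof -
    have at: "0 \<le> arctan w" "arctan w \<le> w" if "w > 0" for w :: real
      using that arctan_le_self[of w] zero_le_arctan_iff[of w] by auto
    have "0 \<le> \<delta> * arctan (z / \<delta>) \<and> \<delta> * arctan (z / \<delta>) \<le> z" if "z > 0"
      using at[of "z / \<delta>"] that \<open>\<delta> > 0\<close> mult_left_mono[of "arctan (z / \<delta>)" "z / \<delta>" \<delta>] by auto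
    then show "0 \<le> h \<delta> z" "h \<delta> z \<le> max 0 z" by (auto simp: h_def)
  qed
  have eb: "0 \<le> \<eta> \<delta> r" "\<eta> \<delta> r \<le> max 0 (\<bar>r\<bar> - k)" if "\<delta> > 0" for \<delta> r
  proof -
    show "0 \<le> \<eta> \<delta> r" using hb[OF that] by (simp add: \<eta>_def)
    have "r - k \<le> 0 \<or> - r - k \<le> 0" using k by linarith
    then show "\<eta> \<delta> r \<le> max 0 (\<bar>r\<bar> - k)"
      using hb(2)[OF that, of "r - k"] hb(2)[OF that, of "- r - k"] by (auto simp: \<eta>_def h_def split: if_splits)
  qed
  have ui: "integrable lborel (u t)" "integrable lborel (u s)" using u_int s st by auto
  have [measurable]: "u t \<in> borel_measurable borel" "u s \<in> borel_measurable borel" using ui by auto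
  have hm [measurable]: "h \<delta> \<in> borel_measurable borel" for \<delta> unfolding h_def[abs_def] by measurable
  have em [measurable]: "\<eta> \<delta> \<in> borel_measurable borel" for \<delta> unfolding \<eta>_def[abs_def] by measurable
  have imax: "integrable lborel (\<lambda>x. max 0 (\<bar>f x\<bar> - k))" if "integrable lborel f" for f :: "'a \<Rightarrow> real"
  proof (rule integrable_dominated[OF integrable_abs[OF that]])
    show "norm (max 0 (\<bar>f x\<bar> - k)) \<le> \<bar>f x\<bar>" for x using k by auto
  qed (use that in auto)
  have le: "(LINT x|lborel. \<eta> (inverse (real (Suc n))) (u t x)) \<le> (LINT x|lborel. max 0 (\<bar>u s x\<bar> - k))" for n
  proof -
    let ?\<delta> = "inverse (real (Suc n))"
    have "(LINT x|lborel. \<eta> ?\<delta> (u t x)) \<le> (LINT x|lborel. \<eta> ?\<delta> (u s x))"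
      unfolding \<eta>_def h_def by (rule smooth_hinge_nonincreasing[OF s st k]) simp
    also have "\<dots> \<le> (LINT x|lborel. max 0 (\<bar>u s x\<bar> - k))"
    proof (rule integral_mono[OF _ imax[OF ui(2)]])
      show "integrable lborel (\<lambda>x. \<eta> ?\<delta> (u s x))"
        by (rule integrable_dominated[OF imax[OF ui(2)]]) (use eb[of ?\<delta>] in auto)
    qed (use eb[of ?\<delta>] in auto)
    finally show ?thesis .
  qed
  have "(\<lambda>n. LINT x|lborel. \<eta> (inverse (real (Suc n))) (u t x)) \<longlonglongrightarrow> (LINT x|lborel. max 0 (\<bar>u t x\<bar> - k))"
  proof (rule integral_dominated_convergence[where w = "\<lambda>x. max 0 (\<bar>u t x\<bar> - k)"])
    have hl: "(\<lambda>n. h (inverse (real (Suc n))) z) \<longlonglongrightarrow> max 0 z" for z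
    proof (cases "z > 0")
      case True
      have "(\<lambda>n. z - inverse (real (Suc n)) * arctan (z / inverse (real (Suc n)))) \<longlonglongrightarrow> z - 0"
      proof (intro tendsto_diff tendsto_const)
        have "(\<lambda>n. inverse (real (Suc n)) * (pi / 2)) \<longlonglongrightarrow> 0 * (pi / 2)"
          by (intro tendsto_intros LIMSEQ_inverse_real_of_nat)
        then have "(\<lambda>n. inverse (real (Suc n)) * (pi / 2)) \<longlonglongrightarrow> 0" by simp
        then show "(\<lambda>n. inverse (real (Suc n)) * arctan (z / inverse (real (Suc n)))) \<longlonglongrightarrow> 0"
        proof (rule Lim_null_comparison[rotated], intro always_eventually allI)
          fix n
          have "\<bar>arctan (z / inverse (real (Suc n)))\<bar> \<le> pi / 2"
            using arctan_lbound[of "z / inverse (real (Suc n))"] arctan_ubound[of "z / inverse (real (Suc n))"] by (intro abs_leI) linarith+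
          then show "norm (inverse (real (Suc n)) * arctan (z / inverse (real (Suc n)))) \<le> inverse (real (Suc n)) * (pi / 2)"
            unfolding real_norm_def abs_mult by (intro mult_mono) auto
        qed
      qed
      then show ?thesis using True by (simp add: h_def)
    qed (simp add: h_def)
    show "AE x in lborel. (\<lambda>n. \<eta> (inverse (real (Suc n))) (u t x)) \<longlonglongrightarrow> max 0 (\<bar>u t x\<bar> - k)"
    proof (rule AE_I2)
      fix x
      have "(\<lambda>n. \<eta> (inverse (real (Suc n))) (u t x)) \<longlonglongrightarrow> max 0 (u t x - k) + max 0 (- u t x - k)"
        unfolding \<eta>_def by (intro tendsto_add hl)
      moreover have "max 0 (u t x - k) + max 0 (- u t x - k) = max 0 (\<bar>u t x\<bar> - k)" using k by auto
      ultimately show "(\<lambda>n. \<eta> (inverse (real (Suc n))) (u t x)) \<longlonglongrightarrow> max 0 (\<bar>u t x\<bar> - k)" by simp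
    qed
    show "AE x in lborel. norm (\<eta> (inverse (real (Suc n))) (u t x)) \<le> max 0 (\<bar>u t x\<bar> - k)" for n
      using eb[of "inverse (real (Suc n))"] by (intro AE_I2) simp
  qed (use imax[OF ui(1)] in auto)
  then show ?thesis by (rule LIMSEQ_le_const2) (use le in blast)
qed

lemma integrable_hinge:
  fixes f :: "'a \<Rightarrow> real"
  assumes "integrable lborel f" "k \<ge> 0"
  shows "integrable lborel (\<lambda>x. max 0 (\<bar>f x\<bar> - k))"
proof (rule integrable_dominated[OF integrable_abs[OF assms(1)]])
  show "norm (max 0 (\<bar>f x\<bar> - k)) \<le> \<bar>f x\<bar>" for x using assms(2) by auto
qed (use assms in auto)

text \<open>Time 0 is reached because the hinge is 1-Lipschitz and the solution is L^1-continuous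
  there.\<close>

lemma hinge_nonincreasing:
  assumes t: "0 \<le> t" and k: "k \<ge> 0"
  shows "(LINT x|lborel. max 0 (\<bar>u t x\<bar> - k)) \<le> (LINT x|lborel. max 0 (\<bar>u 0 x\<bar> - k))"
proof (cases "t = 0")
  case False
  then have t: "t > 0" using t by simp
  show ?thesis
  proof (rule field_le_epsilon)
    fix \<delta> :: real assume \<delta>: "\<delta> > 0"
    have "eventually (\<lambda>s. (LINT x|lborel. \<bar>u s x - u 0 x\<bar>) < \<delta>) (at 0 within {0..})"
      by (rule order_tendstoD(2)[OF u_cont1 \<delta>]) simp
    then obtain d where d: "d > 0" "\<And>s. s > 0 \<Longrightarrow> s < d \<Longrightarrow> (LINT x|lborel. \<bar>u s x - u 0 x\<bar>) < \<delta>"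
      unfolding eventually_at by (auto simp: dist_real_def)
    define s where "s = min t d / 2"
    have s: "s > 0" "s \<le> t" "s < d" using t d by (auto simp: s_def)
    have ui: "integrable lborel (u s)" "integrable lborel (u 0)" using u_int s by auto
    have "(LINT x|lborel. max 0 (\<bar>u t x\<bar> - k)) \<le> (LINT x|lborel. max 0 (\<bar>u s x\<bar> - k))"
      by (rule hinge_nonincreasing_pos[OF s(1,2) k])
    also have "\<dots> \<le> (LINT x|lborel. max 0 (\<bar>u 0 x\<bar> - k) + \<bar>u s x - u 0 x\<bar>)"
    proof (rule integral_mono)
      show "max 0 (\<bar>u s x\<bar> - k) \<le> max 0 (\<bar>u 0 x\<bar> - k) + \<bar>u s x - u 0 x\<bar>" for x by linarith
    qed (use integrable_hinge k ui in auto)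
    also have "\<dots> = (LINT x|lborel. max 0 (\<bar>u 0 x\<bar> - k)) + (LINT x|lborel. \<bar>u s x - u 0 x\<bar>)"
      using integrable_hinge[OF ui(2) k] ui by simp
    also have "\<dots> \<le> (LINT x|lborel. max 0 (\<bar>u 0 x\<bar> - k)) + \<delta>" using d(2)[OF s(1,3)] by simp
    finally show "(LINT x|lborel. max 0 (\<bar>u t x\<bar> - k)) \<le> (LINT x|lborel. max 0 (\<bar>u 0 x\<bar> - k)) + \<delta>" .
  qed
qed simp

lemma L1_norm_nonincreasing:
  assumes "0 \<le> s" "s \<le> t"
  shows "(LINT x|lborel. \<bar>u t x\<bar>) \<le> (LINT x|lborel. \<bar>u s x\<bar>)"
proof (cases "s = 0")
  case True
  then show ?thesis using hinge_nonincreasing[of t 0] assms by (simp add: max_def)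
next
  case False
  then show ?thesis using hinge_nonincreasing_pos[of s t 0] assms by (simp add: max_def)
qed

text \<open>The hinge at level \<open>M\<close> has integral zero initially, hence at all later
  times, and a nonnegative function with integral zero vanishes almost everywhere.\<close>

lemma Linf_bound_preserved:
  assumes t: "0 \<le> t" and M: "M \<ge> 0" and b: "AE x in lborel. \<bar>u 0 x\<bar> \<le> M"
  shows "AE x in lborel. \<bar>u t x\<bar> \<le> M"
proof -
  note i = integrable_hinge[OF u_int[OF t] M]
  have "(LINT x|lborel. max 0 (\<bar>u 0 x\<bar> - M)) = (LINT x|(lborel::'a measure). 0)"
    using b u_meas[of 0] by (intro integral_cong_AE) (auto elim!: eventually_mono)
  then have "(LINT x|lborel. max 0 (\<bar>u t x\<bar> - M)) \<le> 0" using hinge_nonincreasing[OF t M] by simp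
  then have "(LINT x|lborel. max 0 (\<bar>u t x\<bar> - M)) = 0"
    by (intro antisym Bochner_Integration.integral_nonneg) auto
  then have "AE x in lborel. max 0 (\<bar>u t x\<bar> - M) = 0"
    using integral_nonneg_eq_0_iff_AE[OF i] by simp
  then show ?thesis by (auto elim!: eventually_mono simp: max_def split: if_splits)
qed

end

text \<open>Represents r^q as a positive superposition of the hinges (r - k)_+ with density q(q-1)
  k^(q-2), so that monotonicity at every level transfers to the power.\<close>

lemma powr_layer_cake:
  fixes r q :: real
  assumes q: "q > 1" and r: "r \<ge> 0"
  shows "(\<integral>\<^sup>+k. ennreal (indicator {0..} k * (k powr (q - 2) * max 0 (r - k))) \<partial>lborel) = ennreal (r powr q / (q * (q - 1)))"
proof -
  let ?H = "\<lambda>k. r * (k powr (q - 1) / (q - 1)) - k powr q / q"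
  have "((\<lambda>k. k powr (q - 2) * (r - k)) has_integral (?H r - ?H 0)) {0..r}"
  \<comment> \<open>For q < 2 the integrand is unbounded near 0; the interior form of the theorem
    needs differentiability only inside the interval and continuity of the primitive up to its
    ends.\<close>
  proof (rule fundamental_theorem_of_calculus_interior[OF r])
    show "continuous_on {0..r} ?H" using q by (intro continuous_intros continuous_on_powr') auto
    show "(?H has_vector_derivative k powr (q - 2) * (r - k)) (at k)" if "k \<in> {0<..<r}" for k
    proof -
      have "(?H has_real_derivative r * ((q - 1) * k powr (q - 1 - 1) / (q - 1)) - q * k powr (q - 1) / q) (at k)"
        using that by (intro DERIV_diff DERIV_cmult DERIV_cdivide has_real_derivative_powr) auto
      moreover have "k powr (q - 1) = k powr (q - 2) * k" using that by (simp add: powr_diff field_simps power2_eq_square)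
      moreover have "r * ((q - 1) * k powr (q - 1 - 1) / (q - 1)) - q * k powr (q - 1) / q = r * k powr (q - 2) - k powr (q - 1)"
      proof -
        have "q - 1 - 1 = q - 2" by simp
        then show ?thesis using q by (simp only:) simp
      qed
      ultimately have "(?H has_real_derivative k powr (q - 2) * (r - k)) (at k)" by (simp only:) (simp add: algebra_simps)
      then show ?thesis by (simp only: has_real_derivative_iff_has_vector_derivative)
    qed
  qed
  moreover have "?H r - ?H 0 = r powr q / (q * (q - 1))"
  proof (cases "r = 0")
    case False
    then have "r * r powr (q - 1) = r powr q" using r by (simp add: powr_diff)
    then show ?thesis using q by (simp add: field_simps)
  qed (use q in auto)
  ultimately have "((\<lambda>k. k powr (q - 2) * (r - k)) has_integral (r powr q / (q * (q - 1)))) {0..r}" by simp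
  then have "((\<lambda>k. if k \<in> {0..r} then k powr (q - 2) * (r - k) else 0) has_integral (r powr q / (q * (q - 1)))) UNIV"
    by (subst has_integral_restrict_UNIV)
  moreover have "(if k \<in> {0..r} then k powr (q - 2) * (r - k) else 0) = indicator {0..} k * (k powr (q - 2) * max 0 (r - k))" for k
    by (auto simp: indicator_def max_def)
  ultimately have hi: "((\<lambda>k. indicator {0..} k * (k powr (q - 2) * max 0 (r - k))) has_integral (r powr q / (q * (q - 1)))) UNIV" by simp
  show ?thesis by (rule nn_integral_has_integral_lborel[OF _ _ hi]) auto
qed

context viscous_flow
begin

lemma Lq_norm_nonincreasing:
  assumes t: "0 < t" and i: "integrable lborel (\<lambda>x. \<bar>u 0 x\<bar> powr q)"
  shows "(LINT x|lborel. \<bar>u t x\<bar> powr q) \<le> (LINT x|lborel. \<bar>u 0 x\<bar> powr q)"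
proof -
  have [measurable]: "u s \<in> borel_measurable borel" if "s \<ge> 0" for s using u_meas[OF that] .
  have cake: "(\<integral>\<^sup>+x. ennreal (\<bar>u s x\<bar> powr q / (q * (q - 1))) \<partial>lborel)
     = (\<integral>\<^sup>+k. ennreal (indicator {0..} k * k powr (q - 2)) * ennreal (LINT x|lborel. max 0 (\<bar>u s x\<bar> - k)) \<partial>lborel)" if s: "s \<ge> 0" for s
  proof -
    note m [measurable] = u_meas[OF s]
    have "(\<integral>\<^sup>+x. ennreal (\<bar>u s x\<bar> powr q / (q * (q - 1))) \<partial>lborel)
      = (\<integral>\<^sup>+x. (\<integral>\<^sup>+k. ennreal (indicator {0..} k * (k powr (q - 2) * max 0 (\<bar>u s x\<bar> - k))) \<partial>lborel) \<partial>lborel)"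
      using powr_layer_cake[OF q] by simp
    also have "\<dots> = (\<integral>\<^sup>+k. (\<integral>\<^sup>+x. ennreal (indicator {0..} k * (k powr (q - 2) * max 0 (\<bar>u s x\<bar> - k))) \<partial>lborel) \<partial>lborel)"
      by (rule lborel_pair.Fubini') measurable
    also have "\<dots> = (\<integral>\<^sup>+k. ennreal (indicator {0..} k * k powr (q - 2)) * ennreal (LINT x|lborel. max 0 (\<bar>u s x\<bar> - k)) \<partial>lborel)"
    proof (rule nn_integral_cong)
      fix k :: real
      show "(\<integral>\<^sup>+x. ennreal (indicator {0..} k * (k powr (q - 2) * max 0 (\<bar>u s x\<bar> - k))) \<partial>lborel)
        = ennreal (indicator {0..} k * k powr (q - 2)) * ennreal (LINT x|lborel. max 0 (\<bar>u s x\<bar> - k))"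
      proof (cases "k \<ge> 0")
        case True
        have "(\<integral>\<^sup>+x. ennreal (indicator {0..} k * (k powr (q - 2) * max 0 (\<bar>u s x\<bar> - k))) \<partial>lborel)
          = (\<integral>\<^sup>+x. ennreal (indicator {0..} k * k powr (q - 2)) * ennreal (max 0 (\<bar>u s x\<bar> - k)) \<partial>lborel)"
          by (intro nn_integral_cong, subst ennreal_mult[symmetric]) (auto simp: mult.assoc)
        also have "\<dots> = ennreal (indicator {0..} k * k powr (q - 2)) * (\<integral>\<^sup>+x. ennreal (max 0 (\<bar>u s x\<bar> - k)) \<partial>lborel)"
          by (rule nn_integral_cmult) measurable
        also have "(\<integral>\<^sup>+x. ennreal (max 0 (\<bar>u s x\<bar> - k)) \<partial>lborel) = ennreal (LINT x|lborel. max 0 (\<bar>u s x\<bar> - k))"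
          by (rule nn_integral_eq_integral[OF integrable_hinge[OF u_int[OF s] True]]) auto
        finally show ?thesis .
      qed simp
    qed
    finally show ?thesis .
  qed
  have "(\<integral>\<^sup>+x. ennreal (\<bar>u t x\<bar> powr q / (q * (q - 1))) \<partial>lborel) \<le> (\<integral>\<^sup>+x. ennreal (\<bar>u 0 x\<bar> powr q / (q * (q - 1))) \<partial>lborel)"
    using t unfolding cake[OF less_imp_le[OF t]] cake[OF order_refl]
    by (intro nn_integral_mono) (auto split: split_indicator intro!: mult_left_mono ennreal_leI hinge_nonincreasing)
  also have "\<dots> = ennreal (LINT x|lborel. \<bar>u 0 x\<bar> powr q / (q * (q - 1)))" using i q by (intro nn_integral_eq_integral) auto
  also have "(\<integral>\<^sup>+x. ennreal (\<bar>u t x\<bar> powr q / (q * (q - 1))) \<partial>lborel) = ennreal (LINT x|lborel. \<bar>u t x\<bar> powr q / (q * (q - 1)))"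
    using u_intp[OF t, of q] q by (intro nn_integral_eq_integral) auto
  finally have "(LINT x|lborel. \<bar>u t x\<bar> powr q / (q * (q - 1))) \<le> (LINT x|lborel. \<bar>u 0 x\<bar> powr q / (q * (q - 1)))"
    using q by (subst (asm) ennreal_le_iff) (auto intro!: Bochner_Integration.integral_nonneg)
  then show ?thesis using q by (simp add: divide_le_cancel mult_less_0_iff)
qed

end

section \<open>Nash's inequality and smoothing\<close>

text \<open>The increment is the mean of the derivative along the segment; its square is at most the
  mean of the squares, and integrating in \<open>x\<close> first makes every point of the segment
  contribute the same amount.\<close>

lemma translation_L2_bound:
  fixes w :: "'a::euclidean_space \<Rightarrow> real" and g :: "'a \<Rightarrow> 'a"
  assumes D: "\<And>x. (w has_derivative (\<lambda>h. g x \<bullet> h)) (at x)" and c: "continuous_on UNIV g"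
    and w: "integrable lborel (\<lambda>x. (w x)\<^sup>2)" and g2: "integrable lborel (\<lambda>x. (norm (g x))\<^sup>2)"
  shows "(LINT x|lborel. (w (x + y) - w x)\<^sup>2) \<le> (norm y)\<^sup>2 * (LINT x|lborel. (norm (g x))\<^sup>2)"
proof -
  have cw: "continuous_on UNIV w" using D by (meson continuous_at_imp_continuous_on has_derivative_continuous)
  have wm [measurable]: "w \<in> borel_measurable borel" using cw by (rule borel_measurable_continuous_onI)
  have gm [measurable]: "g \<in> borel_measurable borel" using c by (rule borel_measurable_continuous_onI)
  let ?f = "\<lambda>x s. g (x + s *\<^sub>R y) \<bullet> y"
  have pt: "(w (x + y) - w x)\<^sup>2 \<le> (LINT s|lborel. indicator {0..1} s * (?f x s)\<^sup>2)" for x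
  proof -
    have cf: "continuous_on {0..1} (?f x)" by (intro continuous_intros continuous_on_compose2[OF c]) auto
    have i: "integrable lborel (\<lambda>s. indicator {0..1} s * (?f x s)\<^sup>2)" "integrable lborel (\<lambda>s. indicator {0..1} s * ?f x s)"
      using borel_integrable_compact[of "{0..1::real}" "\<lambda>s. (?f x s)\<^sup>2"] borel_integrable_compact[of "{0..1::real}" "?f x"]
        cf continuous_on_power[OF cf, of 2] by (auto simp: if_distrib indicator_def cong: if_cong)
    define m where "m = w (x + y) - w x"
    have ftc: "(LINT s|lborel. indicator {0..1} s *\<^sub>R ?f x s) = w (x + 1 *\<^sub>R y) - w (x + 0 *\<^sub>R y)"
    proof (rule integral_FTC_atLeastAtMost[where F = "\<lambda>s. w (x + s *\<^sub>R y)"])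
      fix s :: real
      have 1: "((\<lambda>s. x + s *\<^sub>R y) has_derivative (\<lambda>h. h *\<^sub>R y)) (at s)" by (auto intro!: derivative_eq_intros)
      have "((\<lambda>s. w (x + s *\<^sub>R y)) has_derivative (\<lambda>h. g (x + s *\<^sub>R y) \<bullet> (h *\<^sub>R y))) (at s)"
        by (rule has_derivative_compose[OF 1 D])
      then have "((\<lambda>s. w (x + s *\<^sub>R y)) has_vector_derivative ?f x s) (at s)"
        by (simp add: has_vector_derivative_def)
      then show "((\<lambda>s. w (x + s *\<^sub>R y)) has_vector_derivative ?f x s) (at s within {0..1})"
        by (rule has_vector_derivative_at_within)
    qed (use cf in auto)
    then have m: "(LINT s|lborel. indicator {0..1} s * ?f x s) = m" by (simp add: m_def)
    \<comment> \<open>Nonnegativity of the variance on the unit interval gives the required Jensen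
      inequality.\<close>
    have "0 \<le> (LINT s|lborel. indicator {0..1} s * (?f x s - m)\<^sup>2)" by (intro Bochner_Integration.integral_nonneg) auto
    also have "\<dots> = (LINT s|lborel. indicator {0..1} s * (?f x s)\<^sup>2 - 2 * m * (indicator {0..1} s * ?f x s) + m\<^sup>2 * indicator {0..1} s)"
      by (intro Bochner_Integration.integral_cong) (auto simp: power2_eq_square algebra_simps)
    also have "\<dots> = (LINT s|lborel. indicator {0..1} s * (?f x s)\<^sup>2) - 2 * m * m + m\<^sup>2"
      using i m by simp
    finally have "m\<^sup>2 \<le> (LINT s|lborel. indicator {0..1} s * (?f x s)\<^sup>2)" by (simp add: power2_eq_square[of m])
    then show ?thesis by (simp add: m_def)
  qed
  have "(\<integral>\<^sup>+x. ennreal ((w (x + y) - w x)\<^sup>2) \<partial>lborel) \<le> (\<integral>\<^sup>+x. (\<integral>\<^sup>+s. ennreal (indicator {0..1} s * (?f x s)\<^sup>2) \<partial>lborel) \<partial>lborel)"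
  proof (rule nn_integral_mono)
    fix x
    have cf: "continuous_on {0..1} (?f x)" by (intro continuous_intros continuous_on_compose2[OF c]) auto
    have i: "integrable lborel (\<lambda>s. indicator {0..1} s * (?f x s)\<^sup>2)"
      using borel_integrable_compact[of "{0..1::real}" "\<lambda>s. (?f x s)\<^sup>2"] continuous_on_power[OF cf, of 2] by (auto simp: if_distrib indicator_def cong: if_cong)
    show "ennreal ((w (x + y) - w x)\<^sup>2) \<le> (\<integral>\<^sup>+s. ennreal (indicator {0..1} s * (?f x s)\<^sup>2) \<partial>lborel)"
      using pt[of x] by (subst nn_integral_eq_integral[OF i]) (auto intro: ennreal_leI)
  qed
  also have "\<dots> = (\<integral>\<^sup>+s. (\<integral>\<^sup>+x. ennreal (indicator {0..1} s * (?f x s)\<^sup>2) \<partial>lborel) \<partial>lborel)"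
    by (rule lborel_pair.Fubini') measurable
  also have "\<dots> \<le> (\<integral>\<^sup>+s. ennreal (indicator {0..1::real} s * ((norm y)\<^sup>2 * (LINT x|lborel. (norm (g x))\<^sup>2))) \<partial>lborel)"
  proof (rule nn_integral_mono)
    fix s :: real
    have le: "indicator {0..1} s * (?f x s)\<^sup>2 \<le> indicator {0..1} s * ((norm y)\<^sup>2 * (norm (g (x + s *\<^sub>R y)))\<^sup>2)" for x
    proof (rule mult_left_mono)
      have "\<bar>?f x s\<bar>\<^sup>2 \<le> (norm (g (x + s *\<^sub>R y)) * norm y)\<^sup>2" by (intro power_mono Cauchy_Schwarz_ineq2) auto
      then show "(?f x s)\<^sup>2 \<le> (norm y)\<^sup>2 * (norm (g (x + s *\<^sub>R y)))\<^sup>2" by (simp add: power_mult_distrib mult.commute)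
    qed auto
    note sh = integrable_lborel_shift[OF g2, of "s *\<^sub>R y"]
    have "(\<integral>\<^sup>+x. ennreal (indicator {0..1} s * (?f x s)\<^sup>2) \<partial>lborel) \<le> (\<integral>\<^sup>+x. ennreal (indicator {0..1} s * ((norm y)\<^sup>2 * (norm (g (x + s *\<^sub>R y)))\<^sup>2)) \<partial>lborel)"
      using le by (intro nn_integral_mono ennreal_leI)
    also have "\<dots> = ennreal (LINT x|lborel. indicator {0..1} s * ((norm y)\<^sup>2 * (norm (g (x + s *\<^sub>R y)))\<^sup>2))"
      using sh(1) by (intro nn_integral_eq_integral) auto
    also have "\<dots> = ennreal (indicator {0..1} s * ((norm y)\<^sup>2 * (LINT x|lborel. (norm (g x))\<^sup>2)))"
      using sh by simp
    finally show "(\<integral>\<^sup>+x. ennreal (indicator {0..1} s * (?f x s)\<^sup>2) \<partial>lborel) \<le> ennreal (indicator {0..1} s * ((norm y)\<^sup>2 * (LINT x|lborel. (norm (g x))\<^sup>2)))" .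
  qed
  also have "\<dots> = ennreal (LINT s|lborel. indicator {0..1::real} s * ((norm y)\<^sup>2 * (LINT x|lborel. (norm (g x))\<^sup>2)))"
    by (intro nn_integral_eq_integral) (auto intro!: AE_I2 mult_nonneg_nonneg Bochner_Integration.integral_nonneg)
  finally have le: "(\<integral>\<^sup>+x. ennreal ((w (x + y) - w x)\<^sup>2) \<partial>lborel) \<le> ennreal ((norm y)\<^sup>2 * (LINT x|lborel. (norm (g x))\<^sup>2))" by simp
  have i: "integrable lborel (\<lambda>x. (w (x + y) - w x)\<^sup>2)"
    by (rule integrable_square_diff) (use integrable_lborel_shift(1)[OF w, of y] w in auto)
  have "ennreal (LINT x|lborel. (w (x + y) - w x)\<^sup>2) \<le> ennreal ((norm y)\<^sup>2 * (LINT x|lborel. (norm (g x))\<^sup>2))"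
    using le by (subst (asm) nn_integral_eq_integral[OF i]) auto
  then show ?thesis by (subst (asm) ennreal_le_iff) (auto intro!: mult_nonneg_nonneg Bochner_Integration.integral_nonneg)
qed

text \<open>
  Writing \<open>\<parallel>w\<parallel>\<^sup>2 = \<langle>w, G\<^sub>h * w\<rangle> + \<langle>w, w - G\<^sub>h * w\<rangle>\<close>, the first term is controlled by the bound of the heat
  kernel and the second one equals half the Gaussian average of the squared increments of \<open>w\<close>.
\<close>

lemma nash_inequality:
  fixes w :: "'a::euclidean_space \<Rightarrow> real" and g :: "'a \<Rightarrow> 'a"
  assumes D: "\<And>x. (w has_derivative (\<lambda>h. g x \<bullet> h)) (at x)" and c: "continuous_on UNIV g"
    and w1: "integrable lborel w" and w2: "integrable lborel (\<lambda>x. (w x)\<^sup>2)" and g2: "integrable lborel (\<lambda>x. (norm (g x))\<^sup>2)"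
    and h: "h > 0"
  shows "(LINT x|lborel. (w x)\<^sup>2) \<le> 4 * 2 powr (real DIM('a) / 2) * h * (LINT x|lborel. (norm (g x))\<^sup>2)
     + (4 * pi * h) powr (- (real DIM('a) / 2)) * (LINT x|lborel. \<bar>w x\<bar>)\<^sup>2"
proof -
  let ?G = "heat_kernel h :: 'a \<Rightarrow> real"
  define W where "W = (LINT x|lborel. (w x)\<^sup>2)"
  define N where "N = (LINT x|lborel. (norm (g x))\<^sup>2)"
  have N0: "N \<ge> 0" "W \<ge> 0" by (auto simp: N_def W_def)
  have [measurable]: "w \<in> borel_measurable borel" using w1 by auto
  have i1: "integrable lborel (\<lambda>x. w x * w (x + y))" for y
  proof (rule integrable_dominated[where g = "\<lambda>x. (w x)\<^sup>2 + (w (x + y))\<^sup>2"])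
    show "norm (w x * w (x + y)) \<le> (w x)\<^sup>2 + (w (x + y))\<^sup>2" for x unfolding real_norm_def by (rule abs_mult_le_squares)
  qed (use w2 integrable_lborel_shift(1)[OF w2, of y] in auto)
  have inner: "W - (norm y)\<^sup>2 * N / 2 \<le> (LINT x|lborel. w x * w (x + y))" "(LINT x|lborel. \<bar>w x * w (x + y)\<bar>) \<le> W" for y
  \<comment> \<open>Polarisation: the squared increment has integral 2 W minus twice the
    correlation, so the translation bound becomes a lower bound for the correlation.\<close>
  proof -
    note sh = integrable_lborel_shift[OF w2, of y]
    have "(LINT x|lborel. (w (x + y) - w x)\<^sup>2) = (LINT x|lborel. (w (x + y))\<^sup>2 + (w x)\<^sup>2 - 2 * (w x * w (x + y)))"
      by (intro Bochner_Integration.integral_cong) (auto simp: power2_eq_square algebra_simps)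
    also have "\<dots> = W + W - 2 * (LINT x|lborel. w x * w (x + y))" using sh w2 i1 by (simp add: W_def)
    finally show "W - (norm y)\<^sup>2 * N / 2 \<le> (LINT x|lborel. w x * w (x + y))"
      using translation_L2_bound[OF D c w2 g2, of y] by (simp add: N_def)
    have "(LINT x|lborel. \<bar>w x * w (x + y)\<bar>) \<le> (LINT x|lborel. (1/2) * ((w x)\<^sup>2 + (w (x + y))\<^sup>2))"
    proof (rule integral_mono)
      show "\<bar>w x * w (x + y)\<bar> \<le> (1/2) * ((w x)\<^sup>2 + (w (x + y))\<^sup>2)" for x
        using sum_squares_bound[of "\<bar>w x\<bar>" "\<bar>w (x + y)\<bar>"] by (simp add: abs_mult)
    qed (use i1 sh w2 in auto)
    also have "\<dots> = W" using sh w2 by (simp add: W_def)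
    finally show "(LINT x|lborel. \<bar>w x * w (x + y)\<bar>) \<le> W" .
  qed
  let ?f = "\<lambda>(y, x). ?G y * (w x * w (x + y))"
  have int: "integrable (lborel \<Otimes>\<^sub>M lborel) ?f"
  proof (rule lborel_pair.Fubini_integrable)
    show "AE y in lborel. integrable lborel (\<lambda>x. ?f (y, x))" using i1 by auto
    have "integrable lborel (\<lambda>y. ?G y * W)" using h by simp
    then show "integrable lborel (\<lambda>y. LINT x|lborel. norm (?f (y, x)))"
    proof (rule integrable_dominated)
      show "norm (LINT x|lborel. norm (?f (y, x))) \<le> ?G y * W" for y
        using mult_left_mono[OF inner(2)[of y], of "?G y"] by (simp add: abs_mult)
    qed measurable
  qed measurable
  have i2: "integrable lborel (\<lambda>y. ?G y * (norm y)\<^sup>2)" "(LINT y|lborel. ?G y * (norm y)\<^sup>2) \<le> 2 powr (real DIM('a) / 2) * (8 * h)"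
  proof -
    let ?k = "\<lambda>y::'a. 2 powr (real DIM('a) / 2) * (8 * h) * heat_kernel (2 * h) y"
    have ik: "integrable lborel ?k" using h by simp
    have le: "\<bar>?G y * (norm y)\<^sup>2\<bar> \<le> ?k y" for y using norm_times_heat_kernel_le(2)[OF h, of y] by (simp add: abs_mult mult.commute)
    note m = integral_abs_mono[OF ik _ le]
    show "integrable lborel (\<lambda>y. ?G y * (norm y)\<^sup>2)" by (rule m) measurable
    have "(LINT y|lborel. ?G y * (norm y)\<^sup>2) \<le> (LINT y|lborel. ?k y)" using m(2) by (simp add: abs_le_iff)
    then show "(LINT y|lborel. ?G y * (norm y)\<^sup>2) \<le> 2 powr (real DIM('a) / 2) * (8 * h)" using h by simp
  qed
  \<comment> \<open>The lower bound is averaged over the Gaussian, whose second moment is at most 8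
    h 2^(n/2); halving gives the coefficient 4 h 2^(n/2) of the statement.\<close>
  have "W - 2 powr (real DIM('a) / 2) * (8 * h) * N / 2 \<le> W - (LINT y|lborel. ?G y * (norm y)\<^sup>2) * N / 2"
    using mult_right_mono[OF i2(2) N0(1)] by linarith
  also have "\<dots> = (LINT y|lborel. ?G y * (W - (norm y)\<^sup>2 * N / 2))"
  proof -
    have "(LINT y|lborel. ?G y * (W - (norm y)\<^sup>2 * N / 2)) = (LINT y|lborel. W * ?G y - (N / 2) * (?G y * (norm y)\<^sup>2))"
      by (intro Bochner_Integration.integral_cong) (auto simp: algebra_simps)
    also have "\<dots> = W - (N / 2) * (LINT y|lborel. ?G y * (norm y)\<^sup>2)" using i2(1) h by simp
    finally show ?thesis by simp
  qed
  also have "\<dots> \<le> (LINT y|lborel. LINT x|lborel. ?f (y, x))"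
  proof (rule integral_mono)
    have "integrable lborel (\<lambda>y. W * ?G y - (N / 2) * (?G y * (norm y)\<^sup>2))" using i2(1) h by simp
    then show "integrable lborel (\<lambda>y. ?G y * (W - (norm y)\<^sup>2 * N / 2))" by (simp add: algebra_simps)
    show "integrable lborel (\<lambda>y. LINT x|lborel. ?f (y, x))" using lborel_pair.integrable_fst[OF int] by simp
    show "?G y * (W - (norm y)\<^sup>2 * N / 2) \<le> (LINT x|lborel. ?f (y, x))" for y
      using mult_left_mono[OF inner(1)[of y], of "?G y"] by simp
  qed
  also have "\<dots> = (LINT x|lborel. LINT y|lborel. ?f (y, x))"
    using lborel_pair.Fubini_integral[of "\<lambda>y x. ?f (y, x)"] int by simp
  also have "\<dots> = (LINT x|lborel. w x * conv ?G w x)"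
  proof (rule Bochner_Integration.integral_cong[OF refl])
    fix x
    have iG: "integrable lborel (\<lambda>y. w y * ?G (x - y))" using conv_integrand[OF w1, of ?G, OF _ heat_kernel_bounded[OF h], where x = x] by simp
    have "conv ?G w x = (LINT y|lborel. w (x + y) * ?G (x - (x + y)))"
      unfolding conv_def using integrable_lborel_shift(2)[OF iG, of x] by (simp add: add.commute)
    then have "conv ?G w x = (LINT y|lborel. w (x + y) * ?G y)" by (simp add: heat_kernel_minus)
    then show "(LINT y|lborel. ?f (y, x)) = w x * conv ?G w x" by (simp add: mult_ac)
  qed
  also have "\<dots> \<le> (LINT x|lborel. \<bar>w x\<bar> * ((4 * pi * h) powr (- (real DIM('a) / 2)) * (LINT x|lborel. \<bar>w x\<bar>)))"
  proof -
    have "norm (conv ?G w x) \<le> (4 * pi * h) powr (- (real DIM('a) / 2)) * (LINT x|lborel. \<bar>w x\<bar>)" for x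
      by (rule conv_bound[OF w1 _ heat_kernel_bounded[OF h]]) measurable
    then have b: "\<bar>w x * conv ?G w x\<bar> \<le> \<bar>w x\<bar> * ((4 * pi * h) powr (- (real DIM('a) / 2)) * (LINT x|lborel. \<bar>w x\<bar>))" for x
      unfolding abs_mult by (intro mult_left_mono) auto
    have "\<bar>LINT x|lborel. w x * conv ?G w x\<bar> \<le> (LINT x|lborel. \<bar>w x\<bar> * ((4 * pi * h) powr (- (real DIM('a) / 2)) * (LINT x|lborel. \<bar>w x\<bar>)))"
      by (rule integral_abs_mono(2)[OF _ _ b]) (use w1 in auto)
    then show ?thesis by linarith
  qed
  also have "\<dots> = (4 * pi * h) powr (- (real DIM('a) / 2)) * (LINT x|lborel. \<bar>w x\<bar>)\<^sup>2"
    by (simp add: power2_eq_square)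
  finally show ?thesis unfolding W_def[symmetric] N_def[symmetric] by (simp add: mult_ac)
qed

text \<open>With c = 4 * 2^(n/2), this is what N (4 pi h)^(-n/2) leaves at the scale h = l/(c N), N
  = n + 1, once l^(-n/2) has been split off.\<close>

definition nash_const :: "'a::euclidean_space itself \<Rightarrow> real" where
  "nash_const _ = (4 * pi) powr (- (real DIM('a) / 2)) * real (DIM('a) + 1) *
      (4 * 2 powr (real DIM('a) / 2) * real (DIM('a) + 1)) powr (real DIM('a) / 2)"

section \<open>From L^1 to L^p: dyadic iteration of Nash's inequality\<close>

context viscous_flow
begin

text \<open>For the entropy U^(2m) the dissipation controls the gradient of w = U^m in L^2, while
  the L^1 norm of w is at most \<open>K\<close>. Nash's inequality then gives a linear differential
  inequality for the entropy E with a free scale h. Multiplied by a power of the elapsed time, it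
  forgets E at the start and yields the bound after integration; mollification errors are absorbed
  in sigma.\<close>

lemma even_power_decay:
  fixes m :: nat
  assumes m: "m \<ge> 1" and s: "0 < s" and st: "s < t" and K: "\<And>\<tau>. \<tau> \<in> {s..t} \<Longrightarrow> (LINT x|lborel. \<bar>u \<tau> x\<bar> ^ m) \<le> K"
  shows "(LINT x|lborel. (u t x) ^ (2 * m)) \<le> nash_const TYPE('a) * (t - s) powr (- (real DIM('a) / 2)) * K\<^sup>2"
proof (rule field_le_epsilon)
  fix \<sigma> :: real assume \<sigma>: "\<sigma> > 0"
  let ?n = "real DIM('a)"
  define c where "c = 4 * 2 powr (?n / 2)"
  have c: "c > 0" by (simp add: c_def)
  have K0: "K \<ge> 0" using order_trans[OF _ K[of t]] st by simp
  have pw: "\<bar>r\<bar> powr real j = \<bar>r\<bar> ^ j" if "j \<ge> 1" for r :: real and j :: nat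
    using that by (cases "r = 0") (auto simp: powr_realpow)
  \<comment> \<open>Coefficient of the second derivative of r^(2m). Half of it, the part left by the
    dissipation estimate, is at least m^2, the coefficient in the squared gradient of U^m, because
    2m - 1 >= m.\<close>
  define Q where "Q = 2 * real m * (2 * real m - 1)"
  have Q0: "Q \<ge> 0" using m by (simp add: Q_def)
  have Qm: "Q / 2 \<ge> (real m)\<^sup>2" using m by (simp add: Q_def power2_eq_square)
  \<comment> \<open>Makes the accumulated commutator over [s,t] at most sigma/2; the summand 1
    covers \<open>a = 0\<close>.\<close>
  define \<delta> where "\<delta> = \<sigma> / (2 * ((norm a)\<^sup>2 / 2 * Q + 1) * (t - s))"
  have A: "(norm a)\<^sup>2 / 2 * Q + 1 > 0" using Q0 by (intro add_nonneg_pos) auto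
  have \<delta>: "\<delta> > 0" using A \<sigma> st by (simp add: \<delta>_def)
  have N1: "real (2 * m) \<ge> 1" using m by simp
  obtain e1 where e1: "e1 > 0" "\<And>\<epsilon> \<tau>. 0 < \<epsilon> \<Longrightarrow> \<epsilon> < e1 \<Longrightarrow> \<tau> \<in> {s..t} \<Longrightarrow>
    integrable lborel (\<lambda>x. (1 + \<bar>ue \<epsilon> \<tau> x\<bar> powr real (2 * m)) * (conv (heat_kernel \<epsilon>) (F \<tau>) x - flux q (ue \<epsilon> \<tau> x))\<^sup>2) \<and>
    (LINT x|lborel. (1 + \<bar>ue \<epsilon> \<tau> x\<bar> powr real (2 * m)) * (conv (heat_kernel \<epsilon>) (F \<tau>) x - flux q (ue \<epsilon> \<tau> x))\<^sup>2) \<le> \<delta>"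
    by (rule mollified_flux_error_weighted[OF s less_imp_le[OF st] N1 \<delta>], rule that)
  have t: "t > 0" using s st by simp
  have p: "2 * real (2 * m) - 1 \<ge> 1" "real (2 * m) > 1" using m by auto
  \<comment> \<open>The final passage from G * u to u at time t uses the flux estimate with exponent
    2m, since \<open>flux (real (2 * m))\<close> has absolute value r^(2m). \<open>C - 1\<close> is
    the moment factor occurring there, and \<open>b\<close> makes its share sigma/4.\<close>
  define C where "C = real (2 * m) * (2 powr (2 * real (2 * m) - 1) * (2 * (LINT x|lborel. \<bar>u t x\<bar> powr (2 * real (2 * m) - 1)))) + 1"
  have C: "C > 0" by (simp add: C_def add_nonneg_pos)
  define b where "b = \<sigma> / (4 * C)"
  have b: "b > 0" using \<sigma> C by (simp add: b_def)
  have ui: "integrable lborel (u t)" using u_int t by auto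
  have "\<sigma> * b / (4 * real (2 * m)) > 0" using \<sigma> b m by simp
  then obtain e2 where e2: "e2 > 0" "\<And>\<epsilon>. 0 < \<epsilon> \<Longrightarrow> \<epsilon> < e2 \<Longrightarrow> (LINT x|lborel. \<bar>ue \<epsilon> t x - u t x\<bar>) \<le> \<sigma> * b / (4 * real (2 * m))"
    using heat_approximable_integrable[OF ui] unfolding heat_approximable_def by meson
  define \<epsilon> where "\<epsilon> = min e1 e2 / 2"
  have \<epsilon>: "\<epsilon> > 0" "\<epsilon> < e1" "\<epsilon> < e2" using e1 e2 by (auto simp: \<epsilon>_def)
  have um: "u \<tau> \<in> borel_measurable borel" if "\<tau> > 0" for \<tau> using that u_meas by auto
  have Uint: "integrable lborel (\<lambda>x. \<bar>ue \<epsilon> \<tau> x\<bar> powr p)" "(LINT x|lborel. \<bar>ue \<epsilon> \<tau> x\<bar> powr p) \<le> (LINT x|lborel. \<bar>u \<tau> x\<bar> powr p)"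
    if "\<tau> > 0" "p \<ge> 1" for \<tau> p
    using heat_conv_Lp(2,3)[OF \<epsilon>(1) that(2) um[OF that(1)] u_intp[OF that]] by auto
  have abs2m: "\<bar>r\<bar> powr real (2 * m) = r ^ (2 * m)" for r :: real
    using pw[of "2 * m" r] m by (simp add: power_even_abs)
  define E where "E \<tau> = (LINT x|lborel. (ue \<epsilon> \<tau> x) ^ (2 * m))" for \<tau>
  let ?\<eta> = "\<lambda>r::real. r ^ (2 * m)" and ?\<eta>1 = "\<lambda>r::real. 2 * real m * r ^ (2 * m - 1)" and ?\<eta>2 = "\<lambda>r::real. Q * r ^ (2 * m - 2)"
  have d0: "(?\<eta> has_real_derivative ?\<eta>1 r) (at r)" for r by (auto intro!: derivative_eq_intros)
  have d1: "(?\<eta>1 has_real_derivative ?\<eta>2 r) (at r)" for r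
    using m by (auto intro!: derivative_eq_intros simp: Q_def of_nat_diff numeral_2_eq_2)
  have nn: "?\<eta>2 r \<ge> 0" for r
  proof -
    have "even (2 * m - 2)" using m by simp
    then have "r ^ (2 * m - 2) \<ge> 0" by (rule zero_le_even_power)
    then show ?thesis using Q0 by (intro mult_nonneg_nonneg)
  qed
  have gr: "?\<eta>2 r \<le> Q * (1 + \<bar>r\<bar> powr real (2 * m))" for r
  proof (rule mult_left_mono[OF _ Q0])
    have "r ^ (2 * m - 2) \<le> \<bar>r\<bar> ^ (2 * m - 2)" by (simp add: power_abs[symmetric])
    also have "\<dots> \<le> 1 + \<bar>r\<bar> ^ (2 * m)"
    proof (cases "\<bar>r\<bar> \<le> 1")
      case True
      then have "\<bar>r\<bar> ^ (2 * m - 2) \<le> 1" by (intro power_le_one) auto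
      moreover have "0 \<le> \<bar>r\<bar> ^ (2 * m)" by simp
      ultimately show ?thesis by linarith
    next
      case False
      then have "\<bar>r\<bar> ^ (2 * m - 2) \<le> \<bar>r\<bar> ^ (2 * m)" by (intro power_increasing) auto
      then show ?thesis by linarith
    qed
    finally show "r ^ (2 * m - 2) \<le> 1 + \<bar>r\<bar> powr real (2 * m)" using pw[of "2 * m" r] m by simp
  qed
  have z: "?\<eta> 0 = 0" "?\<eta>1 0 = 0" using m by auto
  have c2: "continuous_on UNIV ?\<eta>2" by (intro continuous_intros)
  \<comment> \<open>One derivative \<open>D\<close> serves all scales \<open>h\<close>, so the scale
    may be chosen depending on the time.\<close>
  have key: "\<exists>D. (E has_real_derivative D) (at \<tau>) \<and> (\<forall>h>0. D \<le> - (E \<tau> - (4 * pi * h) powr (- (?n / 2)) * K\<^sup>2) / (c * h) + (norm a)\<^sup>2 / 2 * (Q * \<delta>))"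
    if \<tau>: "\<tau> \<in> {s..t}" for \<tau>
  proof -
    have \<tau>0: "\<tau> > 0" using \<tau> s by auto
    let ?gU = "conv (heat_grad \<epsilon>) (u \<tau>)"
    note err = e1(2)[OF \<epsilon>(1,2) \<tau>]
    obtain D where D: "(E has_real_derivative D) (at \<tau>)" "D \<le> - (1/2) * (LINT x|lborel. ?\<eta>2 (ue \<epsilon> \<tau> x) * (norm (?gU x))\<^sup>2)
       + (norm a)\<^sup>2 / 2 * (Q * (LINT x|lborel. (1 + \<bar>ue \<epsilon> \<tau> x\<bar> powr real (2 * m)) * (conv (heat_kernel \<epsilon>) (F \<tau>) x - flux q (ue \<epsilon> \<tau> x))\<^sup>2))"
      using energy_dissipation[OF \<epsilon>(1) \<tau>0 d0 d1 c2 nn z Q0 gr conjunct1[OF err]] unfolding E_def[abs_def] by blast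
    have uti: "integrable lborel (u \<tau>)" using u_int \<tau>0 by auto
    note igU = dissipation_estimate(1)[OF q \<epsilon>(1) uti F_int[OF \<tau>0] d1 c2 nn z(2)]
    define w where "w x = (ue \<epsilon> \<tau> x) ^ m" for x
    define gw where "gw x = (real m * (ue \<epsilon> \<tau> x) ^ (m - 1)) *\<^sub>R ?gU x" for x
    obtain B0 where B0: "\<And>x::'a. \<bar>heat_kernel \<epsilon> x\<bar> \<le> B0" "\<And>x::'a. norm (heat_grad \<epsilon> x) \<le> B0"
      using heat_bounded[OF \<epsilon>(1), of undefined] by metis
    have cU: "continuous_on UNIV (ue \<epsilon> \<tau>)" "continuous_on UNIV ?gU"
      using B0 uti by (auto intro!: continuous_on_conv continuous_on_heat_kernel continuous_on_heat_grad)
    have Um [measurable]: "ue \<epsilon> \<tau> \<in> borel_measurable borel" using cU(1) by (rule borel_measurable_continuous_onI)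
    have gUm [measurable]: "?gU \<in> borel_measurable borel" using cU(2) by (rule borel_measurable_continuous_onI)
    have dw: "(w has_derivative (\<lambda>h. gw x \<bullet> h)) (at x)" for x
      unfolding w_def[abs_def] gw_def
      by (rule real_chain_has_derivative[OF heat_conv_has_derivative[OF \<epsilon>(1) uti]]) (auto intro!: derivative_eq_intros)
    have cgw: "continuous_on UNIV gw" unfolding gw_def by (intro continuous_intros cU)
    have wabs: "\<bar>w x\<bar> = \<bar>ue \<epsilon> \<tau> x\<bar> powr real m" for x using pw[OF m] by (simp add: w_def power_abs)
    have w2: "(w x)\<^sup>2 = (ue \<epsilon> \<tau> x) ^ (2 * m)" for x by (simp add: w_def power_mult[symmetric] mult.commute)
    have wm: "w \<in> borel_measurable borel" unfolding w_def[abs_def] by measurable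
    have iw: "integrable lborel w"
      by (rule integrable_dominated[OF Uint(1)[OF \<tau>0, of "real m"]]) (use m wm wabs in auto)
    have iw2: "integrable lborel (\<lambda>x. (w x)\<^sup>2)" unfolding w2 using Uint(1)[OF \<tau>0 N1] by (simp add: abs2m del: of_nat_mult)
    have gw2: "(norm (gw x))\<^sup>2 = (real m)\<^sup>2 * ((ue \<epsilon> \<tau> x) ^ (2 * m - 2) * (norm (?gU x))\<^sup>2)" for x
    proof -
      have "((ue \<epsilon> \<tau> x) ^ (m - 1))\<^sup>2 = (ue \<epsilon> \<tau> x) ^ (2 * m - 2)" by (simp add: power_mult[symmetric] mult.commute diff_mult_distrib2)
      then show ?thesis unfolding gw_def norm_scaleR by (simp add: power_mult_distrib mult.assoc)
    qed
    have Qp: "Q > 0" using m by (simp add: Q_def)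
    have igw0: "integrable lborel (\<lambda>x. (ue \<epsilon> \<tau> x) ^ (2 * m - 2) * (norm (?gU x))\<^sup>2)"
      using integrable_mult_right[OF igU, of "1 / Q"] Qp by (simp add: mult.assoc[symmetric])
    have igw: "integrable lborel (\<lambda>x. (norm (gw x))\<^sup>2)" unfolding gw2 using igw0 by simp
    have gE: "(LINT x|lborel. (norm (gw x))\<^sup>2) \<le> (1/2) * (LINT x|lborel. ?\<eta>2 (ue \<epsilon> \<tau> x) * (norm (?gU x))\<^sup>2)"
    proof -
      define I where "I = (LINT x|lborel. (ue \<epsilon> \<tau> x) ^ (2 * m - 2) * (norm (?gU x))\<^sup>2)"
      have "even (2 * m - 2)" using m by simp
      then have "I \<ge> 0" unfolding I_def
        by (intro Bochner_Integration.integral_nonneg mult_nonneg_nonneg zero_le_even_power) auto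
      then have "(real m)\<^sup>2 * I \<le> (Q / 2) * I" using Qm by (intro mult_right_mono)
      then show ?thesis unfolding gw2 mult.assoc I_def by simp
    qed
    have wK: "(LINT x|lborel. \<bar>w x\<bar>) \<le> K"
    proof -
      have "(LINT x|lborel. \<bar>w x\<bar>) \<le> (LINT x|lborel. \<bar>u \<tau> x\<bar> powr real m)" unfolding wabs using Uint(2)[OF \<tau>0, of "real m"] m by simp
      also have "\<dots> \<le> K" using K[OF \<tau>] by (simp add: pw[OF m])
      finally show ?thesis .
    qed
    have "D \<le> - (E \<tau> - (4 * pi * h) powr (- (?n / 2)) * K\<^sup>2) / (c * h) + (norm a)\<^sup>2 / 2 * (Q * \<delta>)" if h: "h > 0" for h
    proof -
      have "E \<tau> \<le> c * h * (LINT x|lborel. (norm (gw x))\<^sup>2) + (4 * pi * h) powr (- (?n / 2)) * (LINT x|lborel. \<bar>w x\<bar>)\<^sup>2"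
        using nash_inequality[OF dw cgw iw iw2 igw h] unfolding w2 by (simp add: E_def c_def)
      also have "(LINT x|lborel. \<bar>w x\<bar>)\<^sup>2 \<le> K\<^sup>2" using wK by (intro power_mono) auto
      then have "c * h * (LINT x|lborel. (norm (gw x))\<^sup>2) + (4 * pi * h) powr (- (?n / 2)) * (LINT x|lborel. \<bar>w x\<bar>)\<^sup>2
         \<le> c * h * (LINT x|lborel. (norm (gw x))\<^sup>2) + (4 * pi * h) powr (- (?n / 2)) * K\<^sup>2"
        by (intro add_left_mono mult_left_mono) auto
      finally have "(E \<tau> - (4 * pi * h) powr (- (?n / 2)) * K\<^sup>2) / (c * h) \<le> (LINT x|lborel. (norm (gw x))\<^sup>2)"
        using c h by (simp add: divide_le_eq mult.commute)
      moreover have "(norm a)\<^sup>2 / 2 * (Q * (LINT x|lborel. (1 + \<bar>ue \<epsilon> \<tau> x\<bar> powr real (2 * m)) * (conv (heat_kernel \<epsilon>) (F \<tau>) x - flux q (ue \<epsilon> \<tau> x))\<^sup>2)) \<le> (norm a)\<^sup>2 / 2 * (Q * \<delta>)"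
        using err Q0 by (intro mult_left_mono) auto
      ultimately show ?thesis using D(2) gE by (simp only: minus_divide_left[symmetric])
    qed
    then show ?thesis using D(1) by blast
  qed
  \<comment> \<open>Exponent of the time weight: the weight vanishes at \<open>s\<close>, and
    l^(N-1) l^(-n/2) = l^(n/2) stays bounded as the elapsed time l tends to 0.\<close>
  define N where "N = DIM('a) + 1"
  have N: "N \<ge> 2" using DIM_positive[where 'a='a] by (simp add: N_def)
  define R where "R = nash_const TYPE('a) * K\<^sup>2 * (t - s) powr (?n / 2) + (norm a)\<^sup>2 / 2 * (Q * \<delta>) * (t - s) ^ N"
  have nc: "nash_const TYPE('a) \<ge> 0" by (simp add: nash_const_def)
  have R0: "R \<ge> 0" using nc Q0 \<delta> st by (auto simp: R_def intro!: add_nonneg_nonneg mult_nonneg_nonneg)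
  have "(t - s) ^ N * E t - R * t \<le> (s - s) ^ N * E s - R * s"
  proof (rule DERIV_nonpos_imp_nonincreasing[OF less_imp_le[OF st]])
    fix \<tau> assume \<tau>: "s \<le> \<tau>" "\<tau> \<le> t"
    then obtain D where D: "(E has_real_derivative D) (at \<tau>)"
      "\<And>h. h > 0 \<Longrightarrow> D \<le> - (E \<tau> - (4 * pi * h) powr (- (?n / 2)) * K\<^sup>2) / (c * h) + (norm a)\<^sup>2 / 2 * (Q * \<delta>)"
      using key[of \<tau>] by auto
    define y where "y = real N * (\<tau> - s) ^ (N - 1) * E \<tau> + D * (\<tau> - s) ^ N"
    have dy: "((\<lambda>\<tau>. (\<tau> - s) ^ N * E \<tau> - R * \<tau>) has_real_derivative (y - R)) (at \<tau>)"
      unfolding y_def by (auto intro!: derivative_eq_intros D(1))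
    have "y \<le> R"
    proof (cases "\<tau> = s")
      case True
      then show ?thesis using N R0 by (auto simp: y_def power_0_left)
    next
      case False
      define l where "l = \<tau> - s"
      have l: "l > 0" "l \<le> t - s" using False \<tau> by (auto simp: l_def)
      \<comment> \<open>At this scale 1/(c h) = N/l, so the decay term cancels exactly the term N
        l^(N-1) E produced by differentiating the weight.\<close>
      define h where "h = l / (c * real N)"
      have h: "h > 0" using l c N by (simp add: h_def)
      have ch: "c * h = l / real N" using c N by (simp add: h_def)
      have lN: "l ^ N = l ^ (N - 1) * l" using N by (simp add: power_eq_if)
      have "D * l ^ N \<le> (- (E \<tau> - (4 * pi * h) powr (- (?n / 2)) * K\<^sup>2) / (c * h) + (norm a)\<^sup>2 / 2 * (Q * \<delta>)) * l ^ N"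
        using D(2)[OF h] l by (intro mult_right_mono) auto
      also have "\<dots> = - (real N * l ^ (N - 1) * E \<tau>) + real N * l ^ (N - 1) * ((4 * pi * h) powr (- (?n / 2)) * K\<^sup>2) + (norm a)\<^sup>2 / 2 * (Q * \<delta>) * l ^ N"
        unfolding ch using l N by (simp add: lN field_simps)
      finally have "y \<le> real N * l ^ (N - 1) * ((4 * pi * h) powr (- (?n / 2)) * K\<^sup>2) + (norm a)\<^sup>2 / 2 * (Q * \<delta>) * l ^ N"
        by (simp add: y_def l_def)
      also have "real N * l ^ (N - 1) * ((4 * pi * h) powr (- (?n / 2)) * K\<^sup>2) = nash_const TYPE('a) * K\<^sup>2 * l powr (?n / 2)"
      proof -
        have "(4 * pi * h) powr (- (?n / 2)) = (4 * pi) powr (- (?n / 2)) * (l powr (- (?n / 2)) * (c * real N) powr (?n / 2))"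
          using l c N by (simp add: h_def powr_mult powr_divide powr_minus field_simps)
        moreover have "l ^ (N - 1) * l powr (- (?n / 2)) = l powr (?n / 2)"
        proof -
          have "l ^ (N - 1) = l powr ?n" using l by (simp add: N_def powr_realpow)
          then show ?thesis by (simp add: powr_add[symmetric])
        qed
        ultimately show ?thesis by (simp add: nash_const_def c_def N_def mult_ac)
      qed
      also have "nash_const TYPE('a) * K\<^sup>2 * l powr (?n / 2) \<le> nash_const TYPE('a) * K\<^sup>2 * (t - s) powr (?n / 2)"
        using l nc by (intro mult_left_mono powr_mono2) auto
      also have "(norm a)\<^sup>2 / 2 * (Q * \<delta>) * l ^ N \<le> (norm a)\<^sup>2 / 2 * (Q * \<delta>) * (t - s) ^ N"
        using l Q0 \<delta> by (intro mult_left_mono power_mono) auto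
      finally show ?thesis by (simp add: R_def)
    qed
    then show "\<exists>y. ((\<lambda>\<tau>. (\<tau> - s) ^ N * E \<tau> - R * \<tau>) has_real_derivative y) (at \<tau>) \<and> y \<le> 0"
      using dy by (intro exI[of _ "y - R"]) auto
  qed
  then have "(t - s) ^ N * E t \<le> R * (t - s)" using N by (auto simp: algebra_simps power_0_left)
  then have "E t \<le> R * (t - s) / (t - s) ^ N" using st by (simp add: field_simps)
  also have "\<dots> = nash_const TYPE('a) * (t - s) powr (- (?n / 2)) * K\<^sup>2 + (norm a)\<^sup>2 / 2 * (Q * \<delta>) * (t - s)"
  proof -
    define l where "l = t - s"
    have l: "l > 0" using st by (simp add: l_def)
    have lN: "l ^ N = l powr ?n * l" using l by (simp add: N_def powr_realpow mult.commute)
    have "l powr (?n / 2) / l powr ?n = l powr (- (?n / 2))" by (simp add: powr_diff[symmetric])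
    moreover have "R * l / l ^ N = nash_const TYPE('a) * K\<^sup>2 * (l powr (?n / 2) / l powr ?n) + (norm a)\<^sup>2 / 2 * (Q * \<delta>) * l"
      unfolding R_def l_def[symmetric] lN using l by (simp add: field_simps)
    ultimately show ?thesis by (simp add: l_def mult_ac)
  qed
  also have "(norm a)\<^sup>2 / 2 * (Q * \<delta>) * (t - s) \<le> \<sigma> / 2"
  proof -
    have "(norm a)\<^sup>2 / 2 * (Q * \<delta>) * (t - s) = ((norm a)\<^sup>2 / 2 * Q) * (\<delta> * (t - s))" by simp
    also have "\<dots> \<le> ((norm a)\<^sup>2 / 2 * Q + 1) * (\<delta> * (t - s))" using \<delta> st by (intro mult_right_mono) auto
    also have "\<dots> = \<sigma> / 2"
    proof -
      have gen: "x * (\<sigma> / (2 * x * y) * y) = \<sigma> / 2" if "x > 0" "y > 0" for x y :: real using that by simp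
      show ?thesis unfolding \<delta>_def by (rule gen[OF A]) (use st in simp)
    qed
    finally show ?thesis .
  qed
  finally have 1: "E t \<le> nash_const TYPE('a) * (t - s) powr (- (?n / 2)) * K\<^sup>2 + \<sigma> / 2" by simp
  have ut1: "integrable lborel (\<lambda>x. \<bar>u t x\<bar> powr (2 * real (2 * m) - 1))" by (rule u_intp[OF t p(1)])
  have iU: "integrable lborel (ue \<epsilon> t)" by (rule heat_conv_L1(1)[OF \<epsilon>(1) ui])
  have "(LINT x|lborel. \<bar>flux (real (2 * m)) (u t x) - flux (real (2 * m)) (ue \<epsilon> t x)\<bar>)
    \<le> real (2 * m) * ((LINT x|lborel. \<bar>u t x - ue \<epsilon> t x\<bar>) / b + b * (2 powr (2 * real (2 * m) - 1) *
      ((LINT x|lborel. \<bar>u t x\<bar> powr (2 * real (2 * m) - 1)) + (LINT x|lborel. \<bar>ue \<epsilon> t x\<bar> powr (2 * real (2 * m) - 1)))))"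
    by (rule flux_L1_diff[OF p(2) b ui iU ut1 Uint(1)[OF t p(1)]])
  also have "\<dots> \<le> real (2 * m) * ((\<sigma> * b / (4 * real (2 * m))) / b + b * (2 powr (2 * real (2 * m) - 1) * (2 * (LINT x|lborel. \<bar>u t x\<bar> powr (2 * real (2 * m) - 1)))))"
    using Uint(2)[OF t p(1)] e2(2)[OF \<epsilon>(1,3)] b by (intro mult_left_mono add_mono divide_right_mono) (auto simp: abs_minus_commute)
  also have "\<dots> = \<sigma> / 4 + b * (C - 1)"
    using b m by (simp add: C_def field_simps)
  also have "\<dots> \<le> \<sigma> / 4 + b * C" using b by simp
  also have "b * C = \<sigma> / 4" using C by (simp add: b_def)
  finally have 2: "(LINT x|lborel. \<bar>flux (real (2 * m)) (u t x) - flux (real (2 * m)) (ue \<epsilon> t x)\<bar>) \<le> \<sigma> / 2" by simp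
  have fi: "integrable lborel (\<lambda>x. flux (real (2 * m)) (u t x))" "integrable lborel (\<lambda>x. flux (real (2 * m)) (ue \<epsilon> t x))"
    using u_intp[OF t N1] Uint(1)[OF t N1] um[OF t] by (auto intro!: integrable_flux)
  have pi: "integrable lborel (\<lambda>x. u t x ^ (2 * m))" "integrable lborel (\<lambda>x. ue \<epsilon> t x ^ (2 * m))"
    using u_intp[OF t N1] Uint(1)[OF t N1] by (simp_all add: abs2m del: of_nat_mult)
  have "(LINT x|lborel. u t x ^ (2 * m)) \<le> (LINT x|lborel. ue \<epsilon> t x ^ (2 * m) + \<bar>flux (real (2 * m)) (u t x) - flux (real (2 * m)) (ue \<epsilon> t x)\<bar>)"
  proof (rule integral_mono)
    show "u t x ^ (2 * m) \<le> ue \<epsilon> t x ^ (2 * m) + \<bar>flux (real (2 * m)) (u t x) - flux (real (2 * m)) (ue \<epsilon> t x)\<bar>" for x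
      using abs_triangle_ineq2[of "flux (real (2 * m)) (u t x)" "flux (real (2 * m)) (ue \<epsilon> t x)"]
      unfolding abs_flux abs2m by linarith
  qed (use fi pi in auto)
  also have "\<dots> \<le> E t + \<sigma> / 2" using fi pi 2 by (simp add: E_def)
  finally show "(LINT x|lborel. u t x ^ (2 * m)) \<le> nash_const TYPE('a) * (t - s) powr (- (?n / 2)) * K\<^sup>2 + \<sigma>"
    using 1 by linarith
qed

end

text \<open>A doubling of the exponent squares the previous constant and brings one Nash constant;
  the power of 2 pays for halving the time interval.\<close>

primrec smoothing_const :: "'a::euclidean_space itself \<Rightarrow> nat \<Rightarrow> real" where
  "smoothing_const T 0 = 1"
| "smoothing_const T (Suc k) = nash_const T * (smoothing_const T k)\<^sup>2 * 2 powr (real DIM('a) * (2 ^ Suc k - 1) / 2)"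

lemma smoothing_const_nonneg: "smoothing_const T k \<ge> 0"
  by (induction k) (auto simp: nash_const_def)

context viscous_flow
begin

text \<open>The first half of the interval is spent on the induction hypothesis, which bounds the
  lower moment throughout the second half; there the even-power decay doubles the exponent. The time
  exponents fit because n/2 + n(2^k - 1) = n(2^(k+1) - 1)/2.\<close>

lemma dyadic_smoothing:
  assumes "0 < s" "s < t" and A: "(LINT x|lborel. \<bar>u s x\<bar>) \<le> A"
  shows "(LINT x|lborel. \<bar>u t x\<bar> ^ (2 ^ k)) \<le> smoothing_const TYPE('a) k * (t - s) powr (- (real DIM('a) * (2 ^ k - 1) / 2)) * A ^ (2 ^ k)"
  using assms(1,2)
proof (induction k arbitrary: t)
  case 0
  then show ?case using L1_norm_nonincreasing[of s t] A by simp
next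
  case (Suc k)
  let ?n = "real DIM('a)" and ?C = "smoothing_const TYPE('a) k"
  define l where "l = (t - s) / 2"
  define s' where "s' = s + l"
  have l: "l > 0" "s' > s" "s' < t" "t - s' = l" "s' > 0" using Suc.prems by (auto simp: l_def s'_def field_simps)
  have A0: "A \<ge> 0" using order_trans[OF _ A] by simp
  define K where "K = ?C * l powr (- (?n * (2 ^ k - 1) / 2)) * A ^ (2 ^ k)"
  have e1: "(2::real) ^ k - 1 \<ge> 0" by simp
  have "(LINT x|lborel. \<bar>u \<tau> x\<bar> ^ (2 ^ k)) \<le> K" if \<tau>: "\<tau> \<in> {s'..t}" for \<tau>
  proof -
    have "(LINT x|lborel. \<bar>u \<tau> x\<bar> ^ (2 ^ k)) \<le> ?C * (\<tau> - s) powr (- (?n * (2 ^ k - 1) / 2)) * A ^ (2 ^ k)"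
      using \<tau> l Suc.prems by (intro Suc.IH) auto
    also have "\<dots> \<le> K"
      unfolding K_def using \<tau> l A0 smoothing_const_nonneg e1
      by (intro mult_right_mono mult_left_mono powr_mono2') (auto simp: s'_def)
    finally show ?thesis .
  qed
  from even_power_decay[OF _ l(5,3) this]
  have "(LINT x|lborel. u t x ^ (2 * 2 ^ k)) \<le> nash_const TYPE('a) * l powr (- (?n / 2)) * K\<^sup>2" by (simp add: l(4))
  also have "nash_const TYPE('a) * l powr (- (?n / 2)) * K\<^sup>2 = nash_const TYPE('a) * ?C\<^sup>2 * (l powr (- (?n / 2)) * (l powr (- (?n * (2 ^ k - 1) / 2)))\<^sup>2) * A ^ (2 ^ Suc k)"
    by (simp add: K_def power_mult_distrib power_mult[symmetric] mult_ac)
  also have "l powr (- (?n / 2)) * (l powr (- (?n * (2 ^ k - 1) / 2)))\<^sup>2 = l powr (- (?n * (2 ^ Suc k - 1) / 2))"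
    unfolding power2_eq_square powr_add[symmetric] by (intro arg_cong[of _ _ "(powr) l"]) (simp add: field_simps)
  also have "l powr (- (?n * (2 ^ Suc k - 1) / 2)) = 2 powr (?n * (2 ^ Suc k - 1) / 2) * (t - s) powr (- (?n * (2 ^ Suc k - 1) / 2))"
    unfolding l_def using Suc.prems by (simp only: powr_divide powr_minus) (simp add: powr_minus field_simps)
  finally show ?case by (simp add: power_even_abs mult_ac)
qed

text \<open>Interpolation between 1 and 2^k by a pointwise split at the level L = A (t-s)^(-n/2). At
  this level both endpoint bounds produce the same powers of A and t - s.\<close>

lemma Lp_smoothing:
  assumes st: "0 < s" "s < t" and A: "A > 0" "(LINT x|lborel. \<bar>u s x\<bar>) \<le> A"
    and p: "1 < p" "p \<le> 2 ^ k" and k: "k \<ge> 1"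
  shows "(LINT x|lborel. \<bar>u t x\<bar> powr p) \<le> (1 + smoothing_const TYPE('a) k) * (t - s) powr (- (real DIM('a) * (p - 1) / 2)) * A powr p"
proof -
  let ?n = "real DIM('a)" and ?C = "smoothing_const TYPE('a) k"
  have t: "t > 0" using st by simp
  define P :: real where "P = 2 ^ k"
  have P: "P \<ge> 1" "p \<le> P" using p by (auto simp: P_def)
  define l where "l = t - s"
  have l: "l > 0" using st by (simp add: l_def)
  define L where "L = A * l powr (- (?n / 2))"
  have L: "L > 0" using A l by (simp add: L_def)
  have pw: "\<bar>r\<bar> powr P = \<bar>r\<bar> ^ (2 ^ k)" for r :: real
    by (cases "r = 0") (auto simp: P_def powr_realpow[symmetric])
  have pt: "\<bar>r\<bar> powr p \<le> L powr (p - 1) * \<bar>r\<bar> + L powr (p - P) * \<bar>r\<bar> powr P" for r :: real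
  proof (cases "r = 0")
    case False
    show ?thesis
    proof (cases "\<bar>r\<bar> \<le> L")
      case True
      have "\<bar>r\<bar> powr p = \<bar>r\<bar> powr (p - 1) * \<bar>r\<bar>" using False by (simp add: powr_diff)
      also have "\<dots> \<le> L powr (p - 1) * \<bar>r\<bar>" using True p by (intro mult_right_mono powr_mono2) auto
      finally show ?thesis by (simp add: add_increasing2)
    next
      case F: False
      have "\<bar>r\<bar> powr p = \<bar>r\<bar> powr (p - P) * \<bar>r\<bar> powr P" by (simp add: powr_add[symmetric])
      also have "\<dots> \<le> L powr (p - P) * \<bar>r\<bar> powr P"
        using F L P by (intro mult_right_mono powr_mono2') auto
      finally show ?thesis by (simp add: add_increasing)
    qed
  qed (use p in auto)
  have ui: "integrable lborel (\<lambda>x. \<bar>u t x\<bar>)" "integrable lborel (\<lambda>x. \<bar>u t x\<bar> powr P)" using u_int[of t] u_intp[OF t P(1)] t by auto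
  have "(LINT x|lborel. \<bar>u t x\<bar> powr p) \<le> (LINT x|lborel. L powr (p - 1) * \<bar>u t x\<bar> + L powr (p - P) * \<bar>u t x\<bar> powr P)"
    using ui u_intp[OF t, of p] p pt by (intro integral_mono) auto
  also have "\<dots> = L powr (p - 1) * (LINT x|lborel. \<bar>u t x\<bar>) + L powr (p - P) * (LINT x|lborel. \<bar>u t x\<bar> powr P)"
    using ui by simp
  also have "\<dots> \<le> L powr (p - 1) * A + L powr (p - P) * (?C * l powr (- (?n * (P - 1) / 2)) * A powr P)"
  proof (intro add_mono mult_left_mono)
    show "(LINT x|lborel. \<bar>u t x\<bar>) \<le> A" using L1_norm_nonincreasing[of s t] st A by simp
    have "A powr P = A ^ (2 ^ k)" using pw[of A] A by simp
    then show "(LINT x|lborel. \<bar>u t x\<bar> powr P) \<le> ?C * l powr (- (?n * (P - 1) / 2)) * A powr P"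
      using dyadic_smoothing[OF st A(2), of k] by (simp add: pw l_def) (simp add: P_def)
  qed auto
  also have "L powr (p - 1) * A = l powr (- (?n * (p - 1) / 2)) * A powr p"
  proof -
    have "L powr (p - 1) = A powr (p - 1) * l powr (- (?n * (p - 1) / 2))"
      unfolding L_def using A l by (simp add: powr_mult powr_powr field_simps)
    moreover have "A powr (p - 1) * A = A powr p" using A by (simp add: powr_diff)
    ultimately show ?thesis by (simp add: mult_ac)
  qed
  also have "L powr (p - P) * (?C * l powr (- (?n * (P - 1) / 2)) * A powr P) = ?C * (l powr (- (?n * (p - 1) / 2)) * A powr p)"
  proof -
    have 1: "L powr (p - P) = A powr (p - P) * l powr (- (?n * (p - P) / 2))"
      unfolding L_def using A l by (simp add: powr_mult powr_powr field_simps)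
    have 2: "A powr (p - P) * A powr P = A powr p" by (simp add: powr_add[symmetric])
    have 3: "l powr (- (?n * (p - P) / 2)) * l powr (- (?n * (P - 1) / 2)) = l powr (- (?n * (p - 1) / 2))"
      unfolding powr_add[symmetric] by (intro arg_cong[of _ _ "(powr) l"]) (simp add: field_simps)
    have "x * y * (?C * z * w) = ?C * ((y * z) * (x * w))" for x y z w :: real by simp
    then show ?thesis unfolding 1 by (simp only: 2 3)
  qed
  finally show ?thesis by (simp add: l_def algebra_simps)
qed

end

section \<open>Duhamel's inequality\<close>

lemma integral_Cauchy_Schwarz:
  fixes f g :: "'a \<Rightarrow> real"
  assumes m: "f \<in> borel_measurable M" "g \<in> borel_measurable M"
    and i: "integrable M (\<lambda>x. (f x)\<^sup>2)" "integrable M (\<lambda>x. (g x)\<^sup>2)"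
  shows "integrable M (\<lambda>x. f x * g x)"
    "\<bar>LINT x|M. f x * g x\<bar> \<le> sqrt (LINT x|M. (f x)\<^sup>2) * sqrt (LINT x|M. (g x)\<^sup>2)"
proof -
  show ifg: "integrable M (\<lambda>x. f x * g x)"
  proof (rule integrable_dominated[where g = "\<lambda>x. (f x)\<^sup>2 + (g x)\<^sup>2"])
    show "norm (f x * g x) \<le> (f x)\<^sup>2 + (g x)\<^sup>2" for x unfolding real_norm_def by (rule abs_mult_le_squares)
  qed (use m i in auto)
  define A B C where "A = (LINT x|M. (f x)\<^sup>2)" and "B = (LINT x|M. (g x)\<^sup>2)" and "C = (LINT x|M. f x * g x)"
  have n: "A \<ge> 0" "B \<ge> 0" by (auto simp: A_def B_def)
  have quad: "0 \<le> A + 2 * r * C + r\<^sup>2 * B" for r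
  proof -
    have "0 \<le> (LINT x|M. (f x + r * g x)\<^sup>2)" by (intro Bochner_Integration.integral_nonneg) auto
    also have "\<dots> = (LINT x|M. (f x)\<^sup>2 + 2 * r * (f x * g x) + r\<^sup>2 * (g x)\<^sup>2)"
      by (intro Bochner_Integration.integral_cong) (auto simp: power2_eq_square algebra_simps)
    also have "\<dots> = A + 2 * r * C + r\<^sup>2 * B" using i ifg by (simp add: A_def B_def C_def)
    finally show ?thesis .
  qed
  have "C\<^sup>2 \<le> A * B"
  proof (cases "B = 0")
    case True
    have "C = 0"
    proof (rule ccontr)
      assume "C \<noteq> 0"
      then show False using quad[of "- (A + 1) / (2 * C)"] True by (simp add: field_simps)
    qed
    then show ?thesis using n by simp
  next
    case False
    then have B: "B > 0" using n by simp
    have "A + 2 * (- C / B) * C + (- C / B)\<^sup>2 * B = A - C\<^sup>2 / B"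
      using B by (simp add: power2_eq_square field_simps)
    then have "C\<^sup>2 / B \<le> A" using quad[of "- C / B"] by simp
    then show ?thesis using B by (simp add: divide_le_eq)
  qed
  then have "sqrt (C\<^sup>2) \<le> sqrt (A * B)" by (rule real_sqrt_le_mono)
  then show "\<bar>LINT x|M. f x * g x\<bar> \<le> sqrt (LINT x|M. (f x)\<^sup>2) * sqrt (LINT x|M. (g x)\<^sup>2)"
    by (simp add: real_sqrt_mult A_def B_def C_def)
qed

section \<open>Square integrable kernels and their difference quotients in time\<close>

lemma conv_L2_bound:
  fixes f K :: "'a::euclidean_space \<Rightarrow> real"
  assumes m: "f \<in> borel_measurable borel" "K \<in> borel_measurable borel"
    and i: "integrable lborel (\<lambda>x. (f x)\<^sup>2)" "integrable lborel (\<lambda>x. (K x)\<^sup>2)"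
  shows "integrable lborel (\<lambda>y. f y * K (x - y))"
    "\<bar>LINT y|lborel. f y * K (x - y)\<bar> \<le> sqrt (LINT x|lborel. (f x)\<^sup>2) * sqrt (LINT x|lborel. (K x)\<^sup>2)"
proof -
  note r = integrable_lborel_reflect[OF i(2), of x]
  have "(\<lambda>y. K (x - y)) \<in> borel_measurable lborel" using m(2) by measurable
  from integral_Cauchy_Schwarz[OF _ this i(1) r(1)] m(1) r(2)
  show "integrable lborel (\<lambda>y. f y * K (x - y))"
    "\<bar>LINT y|lborel. f y * K (x - y)\<bar> \<le> sqrt (LINT x|lborel. (f x)\<^sup>2) * sqrt (LINT x|lborel. (K x)\<^sup>2)" by auto
qed

lemma heat_kernel_L2:
  assumes t: "t > 0"
  shows "integrable lborel (\<lambda>x::'a::euclidean_space. (heat_kernel t x)\<^sup>2)"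
    "(LINT x|lborel. (heat_kernel t (x::'a))\<^sup>2) \<le> (4 * pi * t) powr (- (real DIM('a) / 2))"
proof -
  let ?b = "(4 * pi * t) powr (- (real DIM('a) / 2))"
  have i: "integrable lborel (\<lambda>x::'a. ?b * heat_kernel t x)" using t by simp
  have le: "(heat_kernel t x)\<^sup>2 \<le> ?b * heat_kernel t x" for x :: 'a
    unfolding power2_eq_square by (intro mult_right_mono heat_kernel_le t) auto
  show i2: "integrable lborel (\<lambda>x::'a. (heat_kernel t x)\<^sup>2)"
    by (rule integrable_dominated[OF i]) (use le in auto)
  have "(LINT x|lborel. (heat_kernel t (x::'a))\<^sup>2) \<le> (LINT x|lborel. ?b * heat_kernel t (x::'a))"
    by (rule integral_mono[OF i2 i le])
  then show "(LINT x|lborel. (heat_kernel t (x::'a))\<^sup>2) \<le> ?b" using t by simp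
qed

lemma heat_lapl_L2:
  assumes t: "t > 0"
  shows "integrable lborel (\<lambda>x::'a::euclidean_space. (heat_lapl t x)\<^sup>2)"
proof -
  have i: "integrable lborel (\<lambda>x::'a. (heat_const TYPE('a) / t)\<^sup>2 * (heat_kernel (2 * t) x)\<^sup>2)"
    using heat_kernel_L2(1)[of "2 * t", where 'a = 'a] t by simp
  show ?thesis
  proof (rule integrable_dominated[OF i])
    show "norm ((heat_lapl t x)\<^sup>2) \<le> (heat_const TYPE('a) / t)\<^sup>2 * (heat_kernel (2 * t) x)\<^sup>2" for x :: 'a
      using power_mono[OF heat_lapl_bound[OF t, of x], of 2] unfolding power_mult_distrib[symmetric] by simp
  qed auto
qed

text \<open>For times r in [s/2, 2s] the time derivative of the kernel is dominated by a multiple of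
  the single square integrable function G_(4s), since 2r lies in [s, 4s]. The mean value theorem
  transfers this to the quotients, so \<open>C\<close> holds twice the bound: once for the quotient
  and once for its limit.\<close>

lemma heat_kernel_time_difference_L2:
  fixes s :: real
  assumes s: "s > 0"
  defines "D \<equiv> \<lambda>h (x::'a::euclidean_space). (heat_kernel (s + h) x - heat_kernel s x) / h - heat_lapl s x"
  shows "\<And>h. h \<noteq> 0 \<Longrightarrow> \<bar>h\<bar> < s / 2 \<Longrightarrow> integrable lborel (\<lambda>x. (D h x)\<^sup>2)"
    "((\<lambda>h. LINT x|lborel. (D h x)\<^sup>2) \<longlongrightarrow> 0) (at 0)"
proof -
  let ?n = "real DIM('a)"
  define C where "C = 2 * (heat_const TYPE('a) / (s / 2)) * 4 powr (?n / 2)"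
  have hc: "heat_const TYPE('a) > 0" by (rule heat_const_pos)
  have kernel: "heat_kernel r x \<le> 4 powr (?n / 2) * heat_kernel (4 * s) x" if "s \<le> r" "r \<le> 4 * s" for r and x :: 'a
  proof -
    have "(4 * pi * r) powr (- (?n / 2)) \<le> (4 * pi * s) powr (- (?n / 2))" using that s by (intro powr_mono2') auto
    also have "\<dots> = 4 powr (?n / 2) * (4 * pi * (4 * s)) powr (- (?n / 2))"
    proof -
      have "(4 * pi * (4 * s)) powr (- (?n / 2)) = 4 powr (- (?n / 2)) * (4 * pi * s) powr (- (?n / 2))"
        using s by (subst powr_mult[symmetric]) (auto simp: mult_ac)
      then show ?thesis by (simp add: powr_minus)
    qed
    finally have 1: "(4 * pi * r) powr (- (?n / 2)) \<le> 4 powr (?n / 2) * (4 * pi * (4 * s)) powr (- (?n / 2))" .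
    have "(norm x)\<^sup>2 / (4 * (4 * s)) \<le> (norm x)\<^sup>2 / (4 * r)" using that s by (intro divide_left_mono) auto
    then have 2: "exp (- ((norm x)\<^sup>2 / (4 * r))) \<le> exp (- ((norm x)\<^sup>2 / (4 * (4 * s))))" by simp
    show ?thesis using mult_mono[OF 1 2] by (simp add: heat_kernel_def mult_ac)
  qed
  have lapl: "\<bar>heat_lapl r x\<bar> \<le> C / 2 * heat_kernel (4 * s) x" if "s / 2 \<le> r" "r \<le> 2 * s" for r and x :: 'a
  proof -
    have "\<bar>heat_lapl r x\<bar> \<le> heat_const TYPE('a) / r * heat_kernel (2 * r) x" using that s by (intro heat_lapl_bound) auto
    also have "\<dots> \<le> heat_const TYPE('a) / (s / 2) * (4 powr (?n / 2) * heat_kernel (4 * s) x)"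
      using that s hc by (intro mult_mono[OF divide_left_mono kernel]) auto
    finally show ?thesis by (simp add: C_def mult_ac)
  qed
  have Db: "\<bar>D h x\<bar> \<le> C * heat_kernel (4 * s) x" if h: "h \<noteq> 0" "\<bar>h\<bar> < s / 2" for h x
  proof -
    have "norm (heat_kernel (s + h) x - heat_kernel s x) \<le> (C / 2 * heat_kernel (4 * s) x) * norm (s + h - s)"
    proof (rule field_differentiable_bound[where S = "{s / 2..2 * s}"])
      show "((\<lambda>r. heat_kernel r x) has_field_derivative heat_lapl r x) (at r within {s / 2..2 * s})" if "r \<in> {s / 2..2 * s}" for r
        by (rule has_field_derivative_at_within[OF heat_kernel_has_time_derivative]) (use that s in auto)
      show "norm (heat_lapl r x) \<le> C / 2 * heat_kernel (4 * s) x" if "r \<in> {s / 2..2 * s}" for r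
        using lapl[of r x] that by auto
    qed (use h s in auto)
    then have "\<bar>(heat_kernel (s + h) x - heat_kernel s x) / h\<bar> \<le> C / 2 * heat_kernel (4 * s) x"
      using h by (simp add: divide_le_eq)
    moreover have "\<bar>heat_lapl s x\<bar> \<le> C / 2 * heat_kernel (4 * s) x" using s by (intro lapl) auto
    ultimately show ?thesis unfolding D_def by linarith
  qed
  have i4: "integrable lborel (\<lambda>x::'a. C\<^sup>2 * (heat_kernel (4 * s) x)\<^sup>2)" using heat_kernel_L2(1)[of "4 * s", where 'a = 'a] s by simp
  have Db2: "norm ((D h x)\<^sup>2) \<le> C\<^sup>2 * (heat_kernel (4 * s) x)\<^sup>2" if "h \<noteq> 0" "\<bar>h\<bar> < s / 2" for h x
    using power_mono[OF Db[OF that, of x], of 2] by (simp add: power_mult_distrib)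
  have Dm [measurable]: "D h \<in> borel_measurable borel" for h unfolding D_def by measurable
  show "\<And>h. h \<noteq> 0 \<Longrightarrow> \<bar>h\<bar> < s / 2 \<Longrightarrow> integrable lborel (\<lambda>x. (D h x)\<^sup>2)"
    by (rule integrable_dominated[OF i4]) (use Db2 in auto)
  show "((\<lambda>h. LINT x|lborel. (D h x)\<^sup>2) \<longlongrightarrow> 0) (at 0)"
  proof (subst tendsto_at_iff_sequentially, intro allI impI)
    fix X :: "nat \<Rightarrow> real" assume X0: "\<forall>i. X i \<in> UNIV - {0}" and X: "X \<longlonglongrightarrow> 0"
    have "eventually (\<lambda>n. \<bar>X n\<bar> < s / 2) sequentially"
      using order_tendstoD(2)[OF tendsto_rabs_zero[OF X], of "s / 2"] s by simp
    then obtain n0 where n0: "\<And>n. n \<ge> n0 \<Longrightarrow> \<bar>X n\<bar> < s / 2" by (auto simp: eventually_sequentially)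
    have "(\<lambda>n. LINT x|lborel. (D (X (n + n0)) x)\<^sup>2) \<longlonglongrightarrow> (LINT x|(lborel::'a measure). (0::real))"
    proof (rule integral_dominated_convergence[OF _ _ i4])
      show "AE x in lborel. (\<lambda>n. (D (X (n + n0)) x)\<^sup>2) \<longlonglongrightarrow> 0"
      proof (rule AE_I2)
        fix x :: 'a
        have "((\<lambda>h. (heat_kernel (s + h) x - heat_kernel s x) / h) \<longlongrightarrow> heat_lapl s x) (at 0)"
          using heat_kernel_has_time_derivative[OF s, of x] by (simp add: DERIV_def)
        then have "((\<lambda>h. D h x) \<longlongrightarrow> 0) (at 0)" unfolding D_def by (simp add: LIM_zero_iff)
        then have "(\<lambda>n. D (X n) x) \<longlonglongrightarrow> 0" using X0 X by (subst (asm) tendsto_at_iff_sequentially) (auto simp: o_def)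
        then have "(\<lambda>n. D (X (n + n0)) x) \<longlonglongrightarrow> 0" by (rule LIMSEQ_ignore_initial_segment)
        then have "(\<lambda>n. (D (X (n + n0)) x)\<^sup>2) \<longlonglongrightarrow> 0\<^sup>2" by (rule tendsto_power)
        then show "(\<lambda>n. (D (X (n + n0)) x)\<^sup>2) \<longlonglongrightarrow> 0" by simp
      qed
      show "AE x in lborel. norm ((D (X (n + n0)) x)\<^sup>2) \<le> C\<^sup>2 * (heat_kernel (4 * s) x)\<^sup>2" for n
        using X0 n0[of "n + n0"] by (intro AE_I2 Db2) auto
    qed auto
    then have "(\<lambda>n. LINT x|lborel. (D (X (n + n0)) x)\<^sup>2) \<longlonglongrightarrow> 0" by simp
    then show "((\<lambda>h. LINT x|lborel. (D h x)\<^sup>2) \<circ> X) \<longlonglongrightarrow> 0" unfolding o_def by (rule LIMSEQ_offset)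
  qed
qed

section \<open>Backward heat flow and Duhamel's inequality by duality\<close>

context viscous_flow
begin

text \<open>
  Differentiates \<open>\<tau> \<mapsto> G\<^bsub>\<rho> - \<tau>\<^esub> * u \<tau>\<close>: the terms with the Laplacian cancel, leaving only the flux.
\<close>

lemma backward_heat_difference:
  assumes \<tau>: "\<tau> > 0" and r: "\<tau> < \<rho>"
  obtains R where "(R \<longlongrightarrow> 0) (at 0)" "eventually (\<lambda>h. \<forall>x. \<bar>(conv (heat_kernel (\<rho> - (\<tau> + h))) (u (\<tau> + h)) x
     - conv (heat_kernel (\<rho> - \<tau>)) (u \<tau>) x) / h + a \<bullet> conv (heat_grad (\<rho> - \<tau>)) (F \<tau>) x\<bar> \<le> R h) (at 0)"
proof -
  define s where "s = \<rho> - \<tau>"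
  have s: "s > 0" using r by (simp add: s_def)
  define D where "D h x = (heat_kernel (s + h) x - heat_kernel s x) / h - heat_lapl s x" for h and x :: 'a
  define w where "w h x = (u (\<tau> + h) x - u \<tau> x) / h - v \<tau> x" for h x
  \<comment> \<open>Bound for the squared L^2 norm of G_(s-h) as long as s - h >= s/2: it is (4 pi
    (s/2))^(-n/2).\<close>
  define b where "b = (2 * pi * s) powr (- (real DIM('a) / 2))"
  define L2 where "L2 f = sqrt (LINT x|lborel. (f x)\<^sup>2)" for f :: "'a \<Rightarrow> real"
  \<comment> \<open>Sum of the Cauchy-Schwarz bounds of the error terms; it does not depend on the
    space variable, which makes the convergence uniform in \<open>x\<close>.\<close>
  define R where "R h = L2 (w h) * sqrt b + \<bar>h\<bar> * (L2 (v \<tau>) * (L2 (D (- h)) + L2 (heat_lapl s))) + L2 (u \<tau>) * L2 (D (- h))" for h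
  have "((\<lambda>h. LINT x|lborel. \<bar>w h x\<bar> powr 2) \<longlongrightarrow> 0) (at 0)"
    unfolding w_def using u_C1 \<tau> by (intro Lp_norm_tendsto_zero) (auto simp: C1_into_Lp_def)
  then have "((\<lambda>h. LINT x|lborel. (w h x)\<^sup>2) \<longlongrightarrow> 0) (at 0)" by (simp add: powr_numeral)
  from tendsto_real_sqrt[OF this] have wl: "((\<lambda>h. L2 (w h)) \<longlongrightarrow> 0) (at 0)" by (simp add: L2_def)
  have "((\<lambda>h. LINT x|lborel. (D h x)\<^sup>2) \<longlongrightarrow> 0) (at 0)" unfolding D_def by (rule heat_kernel_time_difference_L2(2)[OF s])
  moreover have "filterlim (\<lambda>h::real. - h) (at 0) (at 0)" by (auto simp: filterlim_at eventually_at_filter intro!: tendsto_eq_intros)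
  ultimately have "((\<lambda>h. LINT x|lborel. (D (- h) x)\<^sup>2) \<longlongrightarrow> 0) (at 0)" by (rule filterlim_compose)
  from tendsto_real_sqrt[OF this] have Dl: "((\<lambda>h. L2 (D (- h))) \<longlongrightarrow> 0) (at 0)" by (simp add: L2_def)
  have "(R \<longlongrightarrow> 0 * sqrt b + \<bar>0\<bar> * (L2 (v \<tau>) * (0 + L2 (heat_lapl s))) + L2 (u \<tau>) * 0) (at 0)"
    unfolding R_def by (intro tendsto_intros wl Dl)
  then have Rl: "(R \<longlongrightarrow> 0) (at 0)" by simp
  have um [measurable]: "u \<tau> \<in> borel_measurable borel" and vm [measurable]: "v \<tau> \<in> borel_measurable borel"
    using u_meas \<tau> v_L2 by auto
  have Dm [measurable]: "D h \<in> borel_measurable borel" for h unfolding D_def[abs_def] by measurable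
  have u2: "integrable lborel (\<lambda>x. (u \<tau> x)\<^sup>2)" and v2: "integrable lborel (\<lambda>x. (v \<tau> x)\<^sup>2)" using u_L2 v_L2 \<tau> by auto
  have main: "\<bar>(conv (heat_kernel (\<rho> - (\<tau> + h))) (u (\<tau> + h)) x
     - conv (heat_kernel (\<rho> - \<tau>)) (u \<tau>) x) / h + a \<bullet> conv (heat_grad (\<rho> - \<tau>)) (F \<tau>) x\<bar> \<le> R h"
    if h: "h \<noteq> 0" "\<bar>h\<bar> < min \<tau> (s / 2)" for h x
  proof -
    have pos: "\<tau> + h > 0" "s - h > 0" "s - h \<ge> s / 2" using h s by auto
    have [measurable]: "u (\<tau> + h) \<in> borel_measurable borel" using u_meas pos by auto
    have i1: "integrable lborel (\<lambda>x. (u (\<tau> + h) x - u \<tau> x)\<^sup>2)" by (rule integrable_square_diff) (use u_L2 pos \<tau> in auto)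
    then have i1': "integrable lborel (\<lambda>x. ((u (\<tau> + h) x - u \<tau> x) / h)\<^sup>2)" by (simp add: power_divide)
    have w2: "integrable lborel (\<lambda>x. (w h x)\<^sup>2)" unfolding w_def by (rule integrable_square_diff) (use i1' v2 in auto)
    have wm: "w h \<in> borel_measurable borel" unfolding w_def[abs_def] by measurable
    have D2: "integrable lborel (\<lambda>x. (D (- h) x)\<^sup>2)" unfolding D_def by (rule heat_kernel_time_difference_L2(1)[OF s]) (use h in auto)
    note G2 = heat_kernel_L2[OF pos(2), where 'a = 'a] and G2s = heat_kernel_L2[OF s, where 'a = 'a] and l2 = heat_lapl_L2[OF s, where 'a = 'a]
    note cG = conv_L2_bound[OF wm heat_measurable(1) w2 G2(1), of x]
    note cDv = conv_L2_bound[OF vm Dm v2 D2, of x]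
    note cLv = conv_L2_bound[OF vm heat_measurable(4) v2 l2, of x]
    note cDu = conv_L2_bound[OF um Dm u2 D2, of x]
    note cGv = conv_L2_bound(1)[OF vm heat_measurable(1) v2 G2s(1), of x]
    note cLu = conv_L2_bound(1)[OF um heat_measurable(4) u2 l2, of x]
    note cGu' = conv_L2_bound(1)[OF _ heat_measurable(1) u_L2[OF pos(1)] G2(1), of x]
    note cGu = conv_L2_bound(1)[OF um heat_measurable(1) u2 G2s(1), of x]
    \<comment> \<open>Exact discrete product rule. All terms but the last bracket carry a small
      factor; the bracket is evaluated by the mollified equation at scale \<open>s\<close>.\<close>
    have pt: "u (\<tau> + h) y * heat_kernel (s - h) (x - y) - u \<tau> y * heat_kernel s (x - y)
       = h * (w h y * heat_kernel (s - h) (x - y) - h * (v \<tau> y * D (- h) (x - y) + v \<tau> y * heat_lapl s (x - y))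
          - u \<tau> y * D (- h) (x - y) + (v \<tau> y * heat_kernel s (x - y) - u \<tau> y * heat_lapl s (x - y)))" for y
    proof -
      define g where "g = heat_kernel s (x - y)"
      define g' where "g' = heat_kernel (s - h) (x - y)"
      define l where "l = heat_lapl s (x - y)"
      define d where "d = D (- h) (x - y)"
      have 1: "g' = g - h * (d + l)" using h by (simp add: d_def D_def g_def g'_def l_def)
      have 2: "u (\<tau> + h) y = u \<tau> y + h * (w h y + v \<tau> y)" using h by (simp add: w_def)
      have "(U + h * (W + V)) * (g - h * (d + l)) - U * g = h * (W * (g - h * (d + l)) - h * (V * d + V * l) - U * d + (V * g - U * l))" for U V W
        by (simp add: algebra_simps)
      then show ?thesis unfolding g_def[symmetric] g'_def[symmetric] l_def[symmetric] d_def[symmetric] 2 1 by blast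
    qed
    have "conv (heat_kernel (s - h)) (u (\<tau> + h)) x - conv (heat_kernel s) (u \<tau>) x
      = (LINT y|lborel. u (\<tau> + h) y * heat_kernel (s - h) (x - y) - u \<tau> y * heat_kernel s (x - y))"
      unfolding conv_def using cGu cGu' by simp
    also have "\<dots> = h * ((LINT y|lborel. w h y * heat_kernel (s - h) (x - y)) - h * ((LINT y|lborel. v \<tau> y * D (- h) (x - y)) + (LINT y|lborel. v \<tau> y * heat_lapl s (x - y)))
          - (LINT y|lborel. u \<tau> y * D (- h) (x - y)) + ((LINT y|lborel. v \<tau> y * heat_kernel s (x - y)) - (LINT y|lborel. u \<tau> y * heat_lapl s (x - y))))"
      unfolding pt using cG(1) cDv(1) cLv(1) cDu(1) cGv cLu by simp
    also have "(LINT y|lborel. v \<tau> y * heat_kernel s (x - y)) - (LINT y|lborel. u \<tau> y * heat_lapl s (x - y)) = - (a \<bullet> conv (heat_grad s) (F \<tau>) x)"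
      using mollified[OF \<tau> s, of x] by (simp add: conv_def)
    finally have "(conv (heat_kernel (s - h)) (u (\<tau> + h)) x - conv (heat_kernel s) (u \<tau>) x) / h + a \<bullet> conv (heat_grad s) (F \<tau>) x
      = (LINT y|lborel. w h y * heat_kernel (s - h) (x - y)) - h * ((LINT y|lborel. v \<tau> y * D (- h) (x - y)) + (LINT y|lborel. v \<tau> y * heat_lapl s (x - y)))
          - (LINT y|lborel. u \<tau> y * D (- h) (x - y))" (is "?l = ?A - h * (?B + ?C) - ?E") using h by simp
    moreover have "\<bar>?A\<bar> \<le> L2 (w h) * sqrt b"
    proof -
      have "(LINT x|lborel. (heat_kernel (s - h) (x::'a))\<^sup>2) \<le> (4 * pi * (s - h)) powr (- (real DIM('a) / 2))" by (rule G2(2))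
      also have "\<dots> \<le> b" unfolding b_def using pos s by (intro powr_mono2') auto
      finally have sb: "sqrt (LINT x|lborel. (heat_kernel (s - h) (x::'a))\<^sup>2) \<le> sqrt b" by (rule real_sqrt_le_mono)
      show ?thesis unfolding L2_def by (rule order_trans[OF cG(2) mult_left_mono[OF sb]]) simp
    qed
    moreover have "\<bar>h * (?B + ?C)\<bar> \<le> \<bar>h\<bar> * (L2 (v \<tau>) * (L2 (D (- h)) + L2 (heat_lapl s)))"
      unfolding abs_mult distrib_left[of "L2 (v \<tau>)"] using cDv(2) cLv(2)
      by (intro mult_left_mono order_trans[OF abs_triangle_ineq] add_mono) (auto simp: L2_def)
    moreover have "\<bar>?E\<bar> \<le> L2 (u \<tau>) * L2 (D (- h))" using cDu(2) by (simp add: L2_def)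
    ultimately have "\<bar>?l\<bar> \<le> R h" unfolding R_def by linarith
    moreover have "\<rho> - (\<tau> + h) = s - h" "\<rho> - \<tau> = s" by (auto simp: s_def)
    ultimately show ?thesis by (simp only:)
  qed
  have "eventually (\<lambda>h. h \<noteq> 0 \<and> \<bar>h\<bar> < min \<tau> (s / 2)) (at 0)"
    unfolding eventually_at using \<tau> s by (intro exI[of _ "min \<tau> (s / 2)"]) (auto simp: dist_real_def)
  then have "eventually (\<lambda>h. \<forall>x. \<bar>(conv (heat_kernel (\<rho> - (\<tau> + h))) (u (\<tau> + h)) x
     - conv (heat_kernel (\<rho> - \<tau>)) (u \<tau>) x) / h + a \<bullet> conv (heat_grad (\<rho> - \<tau>)) (F \<tau>) x\<bar> \<le> R h) (at 0)"
    by eventually_elim (use main in blast)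
  with Rl show ?thesis by (rule that)
qed

text \<open>The L^1 norm is not differentiable, and the quotients converge uniformly in space rather
  than in L^1. Pairing with a fixed integrable function turns uniform convergence into convergence
  of numbers; its bound by 1 is the dual constraint for the L^1 norm.\<close>

lemma backward_heat_pairing_has_derivative:
  assumes \<tau>: "\<tau> > 0" and r: "\<tau> < \<rho>" and \<phi>m: "\<phi> \<in> borel_measurable borel" and \<phi>1: "\<And>x. \<bar>\<phi> x\<bar> \<le> 1" and \<phi>i: "integrable lborel \<phi>"
  shows "((\<lambda>\<tau>. LINT x|lborel. \<phi> x * conv (heat_kernel (\<rho> - \<tau>)) (u \<tau>) x) has_real_derivative
     - (LINT x|lborel. \<phi> x * (a \<bullet> conv (heat_grad (\<rho> - \<tau>)) (F \<tau>) x))) (at \<tau>)"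
proof -
  obtain R where R: "(R \<longlongrightarrow> 0) (at 0)" "eventually (\<lambda>h. \<forall>x. \<bar>(conv (heat_kernel (\<rho> - (\<tau> + h))) (u (\<tau> + h)) x
     - conv (heat_kernel (\<rho> - \<tau>)) (u \<tau>) x) / h + a \<bullet> conv (heat_grad (\<rho> - \<tau>)) (F \<tau>) x\<bar> \<le> R h) (at 0)"
    by (rule backward_heat_difference[OF \<tau> r])
  let ?y = "\<lambda>\<tau>. conv (heat_kernel (\<rho> - \<tau>)) (u \<tau>)" and ?g = "\<lambda>x. a \<bullet> conv (heat_grad (\<rho> - \<tau>)) (F \<tau>) x"
  have iy: "integrable lborel (\<lambda>x. \<phi> x * ?y \<tau>' x)" if "\<tau>' > 0" "\<tau>' < \<rho>" for \<tau>'
    using that u_int[of \<tau>'] by (intro integrable_mult_bounded[OF _ _ \<phi>1] heat_conv_L1) (auto simp: \<phi>m)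
  have ig: "integrable lborel (\<lambda>x. \<phi> x * ?g x)"
    using r conv_L1(1)[OF F_int[OF \<tau>] heat_grad_integrable(1)] by (intro integrable_mult_bounded[OF _ _ \<phi>1] integrable_inner_right) (auto simp: \<phi>m)
  have lim: "((\<lambda>h. R h * (LINT x|lborel. \<bar>\<phi> x\<bar>)) \<longlongrightarrow> 0) (at 0)" by (rule tendsto_mult_left_zero[OF R(1)])
  have "eventually (\<lambda>h. h \<noteq> 0 \<and> \<bar>h\<bar> < min \<tau> (\<rho> - \<tau>)) (at 0)"
    unfolding eventually_at using \<tau> r by (intro exI[of _ "min \<tau> (\<rho> - \<tau>)"]) (auto simp: dist_real_def)
  with R(2) have "eventually (\<lambda>h. norm (((LINT x|lborel. \<phi> x * ?y (\<tau> + h) x) - (LINT x|lborel. \<phi> x * ?y \<tau> x)) / h + (LINT x|lborel. \<phi> x * ?g x))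
     \<le> R h * (LINT x|lborel. \<bar>\<phi> x\<bar>)) (at 0)"
  proof eventually_elim
    case (elim h)
    have pos: "\<tau> + h > 0" "\<tau> + h < \<rho>" using elim by auto
    note I = iy[OF pos] iy[OF \<tau> r] ig
    have eqr: "(p * A - p * B) / h + p * g = p * ((A - B) / h + g)" for p A B g :: real
      by (simp add: distrib_left right_diff_distrib[symmetric])
    have "((LINT x|lborel. \<phi> x * ?y (\<tau> + h) x) - (LINT x|lborel. \<phi> x * ?y \<tau> x)) / h + (LINT x|lborel. \<phi> x * ?g x)
      = (LINT x|lborel. (\<phi> x * ?y (\<tau> + h) x - \<phi> x * ?y \<tau> x) / h + \<phi> x * ?g x)" using I by simp
    also have "\<dots> = (LINT x|lborel. \<phi> x * ((?y (\<tau> + h) x - ?y \<tau> x) / h + ?g x))"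
      unfolding eqr ..
    finally have eqI: "((LINT x|lborel. \<phi> x * ?y (\<tau> + h) x) - (LINT x|lborel. \<phi> x * ?y \<tau> x)) / h + (LINT x|lborel. \<phi> x * ?g x)
      = (LINT x|lborel. \<phi> x * ((?y (\<tau> + h) x - ?y \<tau> x) / h + ?g x))" .
    have "\<bar>LINT x|lborel. \<phi> x * ((?y (\<tau> + h) x - ?y \<tau> x) / h + ?g x)\<bar> \<le> (LINT x|lborel. \<bar>\<phi> x\<bar> * R h)"
    proof (rule integral_abs_mono(2))
      have "integrable lborel (\<lambda>x. (\<phi> x * ?y (\<tau> + h) x - \<phi> x * ?y \<tau> x) / h + \<phi> x * ?g x)"
        by (intro Bochner_Integration.integrable_add integrable_divide Bochner_Integration.integrable_diff I)
      then have "integrable lborel (\<lambda>x. \<phi> x * ((?y (\<tau> + h) x - ?y \<tau> x) / h + ?g x))"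
        unfolding eqr .
      then show "(\<lambda>x. \<phi> x * ((?y (\<tau> + h) x - ?y \<tau> x) / h + ?g x)) \<in> borel_measurable lborel" by (rule borel_measurable_integrable)
      show "\<bar>\<phi> x * ((?y (\<tau> + h) x - ?y \<tau> x) / h + ?g x)\<bar> \<le> \<bar>\<phi> x\<bar> * R h" for x
        unfolding abs_mult[of "\<phi> x"] by (rule mult_left_mono[OF spec[OF elim(1)]]) simp
      show "integrable lborel (\<lambda>x. \<bar>\<phi> x\<bar> * R h)" by (intro integrable_mult_left integrable_abs \<phi>i)
    qed
    moreover have "(LINT x|lborel. \<bar>\<phi> x\<bar> * R h) = R h * (LINT x|lborel. \<bar>\<phi> x\<bar>)"
      by (subst integral_mult_left_zero) (rule mult.commute)
    ultimately show ?case unfolding real_norm_def eqI by (simp only:)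
  qed
  from Lim_null_comparison[OF this lim]
  have "((\<lambda>h. ((LINT x|lborel. \<phi> x * ?y (\<tau> + h) x) - (LINT x|lborel. \<phi> x * ?y \<tau> x)) / h - (- (LINT x|lborel. \<phi> x * ?g x))) \<longlongrightarrow> 0) (at 0)"
    unfolding diff_minus_eq_add .
  then show ?thesis unfolding DERIV_def by (rule LIM_zero_cancel)
qed

text \<open>Instead of a time integral, any \<open>\<Gamma>\<close> whose derivative dominates the
  integrand is allowed, so nothing about integrability in time has to be shown. The extra heat time
  \<open>\<sigma>\<close> keeps the kernel nonsingular up to the end of the interval.\<close>

lemma duhamel_L1:
  assumes t1: "0 < t1" and t12: "t1 \<le> t2" and \<sigma>: "\<sigma> > 0"
    and \<Gamma>: "\<And>\<tau>. t1 \<le> \<tau> \<Longrightarrow> \<tau> \<le> t2 \<Longrightarrow> (\<Gamma> has_real_derivative \<Gamma>' \<tau>) (at \<tau>)"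
    and \<Gamma>': "\<And>\<tau>. t1 \<le> \<tau> \<Longrightarrow> \<tau> \<le> t2 \<Longrightarrow>
        norm a * (heat_const TYPE('a) / sqrt (\<sigma> + t2 - \<tau>)) * (LINT x|lborel. \<bar>u \<tau> x\<bar> powr q) \<le> \<Gamma>' \<tau>"
  shows "(LINT x|lborel. \<bar>conv (heat_kernel \<sigma>) (u t2) x\<bar>) \<le> (LINT x|lborel. \<bar>conv (heat_kernel (\<sigma> + t2 - t1)) (u t1) x\<bar>) + \<Gamma> t2 - \<Gamma> t1"
proof -
  define \<rho> where "\<rho> = \<sigma> + t2"
  have t2: "t2 > 0" using t1 t12 by simp
  have ui: "integrable lborel (u t1)" "integrable lborel (u t2)" using u_int t1 t2 by auto
  have i2: "integrable lborel (conv (heat_kernel \<sigma>) (u t2))" by (rule heat_conv_L1(1)[OF \<sigma> ui(2)])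
  have i1: "integrable lborel (conv (heat_kernel (\<sigma> + t2 - t1)) (u t1))" using \<sigma> t12 by (intro heat_conv_L1(1) ui) auto
  let ?I1 = "LINT x|lborel. \<bar>conv (heat_kernel (\<sigma> + t2 - t1)) (u t1) x\<bar>"
  have [measurable]: "u t2 \<in> borel_measurable borel" using ui by auto
  \<comment> \<open>The sign of the final state, localised to a ball to make it integrable: pairing
    with it recovers the L^1 norm as the radius grows.\<close>
  define \<phi> where "\<phi> n x = sgn (conv (heat_kernel \<sigma>) (u t2) x) * indicator (ball 0 (real n)) x" for n and x :: 'a
  have [measurable]: "ball (0::'a) (real n) \<in> sets borel" for n by simp
  have \<phi>m: "\<phi> n \<in> borel_measurable borel" for n unfolding \<phi>_def[abs_def] by measurable
  have \<phi>1: "\<bar>\<phi> n x\<bar> \<le> 1" for n x by (simp add: \<phi>_def abs_mult sgn_if split: split_indicator)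
  have \<phi>i: "integrable lborel (\<phi> n)" for n
  proof (rule integrable_dominated[where g = "indicator (ball 0 (real n))"])
    show "integrable lborel (indicator (ball (0::'a) (real n)) :: 'a \<Rightarrow> real)"
      using emeasure_bounded_finite[of "ball (0::'a) (real n)"] by simp
    show "norm (\<phi> n x) \<le> indicator (ball 0 (real n)) x" for x by (simp add: \<phi>_def abs_mult sgn_if split: split_indicator)
  qed (use \<phi>m in auto)
  have bound: "(LINT x|lborel. \<phi> n x * conv (heat_kernel \<sigma>) (u t2) x) \<le> ?I1 + \<Gamma> t2 - \<Gamma> t1" for n
  proof -
    let ?\<Psi> = "\<lambda>\<tau>. LINT x|lborel. \<phi> n x * conv (heat_kernel (\<rho> - \<tau>)) (u \<tau>) x"
    have "?\<Psi> t2 - \<Gamma> t2 \<le> ?\<Psi> t1 - \<Gamma> t1"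
    proof (rule DERIV_nonpos_imp_nonincreasing[OF t12])
      fix \<tau> assume \<tau>: "t1 \<le> \<tau>" "\<tau> \<le> t2"
      have p: "\<tau> > 0" "\<tau> < \<rho>" "\<rho> - \<tau> > 0" using \<tau> t1 \<sigma> by (auto simp: \<rho>_def)
      let ?g = "conv (heat_grad (\<rho> - \<tau>)) (F \<tau>)"
      note cg = conv_L1[OF F_int[OF p(1)] heat_grad_integrable(1)[OF p(3)]]
      have "- (LINT x|lborel. \<phi> n x * (a \<bullet> ?g x)) \<le> \<bar>LINT x|lborel. \<phi> n x * (a \<bullet> ?g x)\<bar>" by simp
      also have "\<dots> \<le> (LINT x|lborel. norm a * norm (?g x))"
      proof (rule integral_abs_mono(2))
        show "\<bar>\<phi> n x * (a \<bullet> ?g x)\<bar> \<le> norm a * norm (?g x)" for x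
        proof -
          have "\<bar>\<phi> n x * (a \<bullet> ?g x)\<bar> \<le> 1 * (norm a * norm (?g x))"
            unfolding abs_mult by (intro mult_mono \<phi>1 Cauchy_Schwarz_ineq2) auto
          then show ?thesis by simp
        qed
        show "(\<lambda>x. \<phi> n x * (a \<bullet> ?g x)) \<in> borel_measurable lborel" using cg(1) \<phi>m[of n] by auto
      qed (use cg in auto)
      also have "\<dots> = norm a * (LINT x|lborel. norm (?g x))" by simp
      also have "\<dots> \<le> norm a * ((heat_const TYPE('a) / sqrt (\<rho> - \<tau>)) * (LINT x|lborel. \<bar>F \<tau> x\<bar>))"
        using order_trans[OF cg(2) mult_right_mono[OF heat_grad_integrable(2)[OF p(3)]]]
        by (intro mult_left_mono) auto
      also have "\<dots> \<le> \<Gamma>' \<tau>" using \<Gamma>'[OF \<tau>] by (simp add: abs_flux \<rho>_def mult.assoc)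
      finally have "- (LINT x|lborel. \<phi> n x * (a \<bullet> ?g x)) - \<Gamma>' \<tau> \<le> 0" by simp
      then show "\<exists>y. ((\<lambda>\<tau>. ?\<Psi> \<tau> - \<Gamma> \<tau>) has_real_derivative y) (at \<tau>) \<and> y \<le> 0"
        using DERIV_diff[OF backward_heat_pairing_has_derivative[OF p(1,2) \<phi>m \<phi>1 \<phi>i] \<Gamma>[OF \<tau>]] by blast
    qed
    moreover have "?\<Psi> t1 \<le> ?I1"
    proof -
      have "\<bar>?\<Psi> t1\<bar> \<le> (LINT x|lborel. \<bar>conv (heat_kernel (\<sigma> + t2 - t1)) (u t1) x\<bar>)"
      proof (rule integral_abs_mono(2))
        show "\<bar>\<phi> n x * conv (heat_kernel (\<rho> - t1)) (u t1) x\<bar> \<le> \<bar>conv (heat_kernel (\<sigma> + t2 - t1)) (u t1) x\<bar>" for x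
          using mult_right_mono[OF \<phi>1[of n x], of "\<bar>conv (heat_kernel (\<sigma> + t2 - t1)) (u t1) x\<bar>"] by (simp add: abs_mult \<rho>_def)
        show "(\<lambda>x. \<phi> n x * conv (heat_kernel (\<rho> - t1)) (u t1) x) \<in> borel_measurable lborel" using i1 \<phi>m[of n] by (auto simp: \<rho>_def)
      qed (use i1 in auto)
      then show ?thesis by linarith
    qed
    ultimately show ?thesis by (simp add: \<rho>_def)
  qed
  have "(\<lambda>n. LINT x|lborel. \<phi> n x * conv (heat_kernel \<sigma>) (u t2) x) \<longlonglongrightarrow> (LINT x|lborel. \<bar>conv (heat_kernel \<sigma>) (u t2) x\<bar>)"
  proof (rule integral_dominated_convergence[where w = "\<lambda>x. \<bar>conv (heat_kernel \<sigma>) (u t2) x\<bar>"])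
    show "AE x in lborel. (\<lambda>n. \<phi> n x * conv (heat_kernel \<sigma>) (u t2) x) \<longlonglongrightarrow> \<bar>conv (heat_kernel \<sigma>) (u t2) x\<bar>"
    proof (rule AE_I2)
      fix x :: 'a
      obtain n0 :: nat where n0: "norm x < real n0" using reals_Archimedean2 by blast
      have "eventually (\<lambda>n. \<phi> n x * conv (heat_kernel \<sigma>) (u t2) x = \<bar>conv (heat_kernel \<sigma>) (u t2) x\<bar>) sequentially"
        unfolding eventually_sequentially using n0
        by (intro exI[of _ n0]) (auto simp: \<phi>_def sgn_if split: split_indicator)
      then show "(\<lambda>n. \<phi> n x * conv (heat_kernel \<sigma>) (u t2) x) \<longlonglongrightarrow> \<bar>conv (heat_kernel \<sigma>) (u t2) x\<bar>" by (rule tendsto_eventually)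
    qed
    show "AE x in lborel. norm (\<phi> n x * conv (heat_kernel \<sigma>) (u t2) x) \<le> \<bar>conv (heat_kernel \<sigma>) (u t2) x\<bar>" for n
      using mult_right_mono[OF \<phi>1[of n]] by (intro AE_I2) (auto simp: abs_mult)
  qed (use i2 \<phi>m in auto)
  then show ?thesis by (rule LIMSEQ_le_const2) (use bound in blast)
qed

end

section \<open>Decay\<close>

lemma sqrt_diff_le:
  fixes x y :: real
  assumes "x \<ge> 0" "y \<ge> 0" shows "sqrt (x + y) - sqrt x \<le> sqrt y"
  using sqrt_add_le_add_sqrt[OF assms] by simp

lemma half_powr_minus: "t > 0 \<Longrightarrow> (t / 2) powr (- r) = 2 powr r * t powr (- r)" for t r :: real
  by (simp add: powr_divide powr_minus field_simps)

section \<open>From bounds on the flux to decay of the L^1 norm\<close>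

context viscous_flow
begin

text \<open>Duhamel's integral is split at t/2. On the first half the kernel is at most of order
  (t/2)^(-1/2) and tau^(-kappa) is integrated, giving 1/(1 - kappa); on the second half tau^(-kappa)
  is frozen at t/2 and the kernel is integrated, giving 2. Both halves scale like (t/2)^(1/2 -
  kappa).\<close>

lemma decay_from_power_bound:
  assumes t: "t > 0" and K: "K \<ge> 0" and \<kappa>: "0 \<le> \<kappa>" "\<kappa> < 1"
    and b: "\<And>\<tau>. 0 < \<tau> \<Longrightarrow> \<tau> \<le> t \<Longrightarrow> (LINT x|lborel. \<bar>u \<tau> x\<bar> powr q) \<le> K * \<tau> powr (- \<kappa>)"
    and Z: "(LINT x|lborel. \<bar>conv (heat_kernel t) (u 0) x\<bar>) \<le> Z"
  shows "(LINT x|lborel. \<bar>u t x\<bar>) \<le> Z + norm a * heat_const TYPE('a) * K * (2 + 1 / (1 - \<kappa>)) * (t / 2) powr (1/2 - \<kappa>)"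
proof (rule field_le_epsilon)
  fix \<delta> :: real assume \<delta>: "\<delta> > 0"
  define c where "c = norm a * heat_const TYPE('a)"
  have c: "c \<ge> 0" using heat_const_pos[where 'a = 'a] by (simp add: c_def)
  have ut: "integrable lborel (u t)" using u_int t by auto
  have d2: "\<delta> / 2 > 0" using \<delta> by simp
  obtain e1 where e1: "e1 > 0" "\<And>\<epsilon>. 0 < \<epsilon> \<Longrightarrow> \<epsilon> < e1 \<Longrightarrow> (LINT x|lborel. \<bar>ue \<epsilon> t x - u t x\<bar>) \<le> \<delta> / 2"
    using heat_approximable_integrable[OF ut] d2 unfolding heat_approximable_def by meson
  have "eventually (\<lambda>s. (LINT x|lborel. \<bar>u s x - u 0 x\<bar>) < \<delta> / 2) (at 0 within {0..})"
    by (rule order_tendstoD(2)[OF u_cont1 d2]) simp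
  then obtain e2 where e2: "e2 > 0" "\<And>s. s > 0 \<Longrightarrow> s < e2 \<Longrightarrow> (LINT x|lborel. \<bar>u s x - u 0 x\<bar>) < \<delta> / 2"
    unfolding eventually_at by (auto simp: dist_real_def)
  \<comment> \<open>\<open>s\<close> serves both as positive starting time and as remaining heat
    time at the end; each use costs delta/2.\<close>
  define s where "s = min (min e1 e2) (t / 2) / 2"
  have s: "s > 0" "s < e1" "s < e2" "s \<le> t / 2" using e1 e2 t by (auto simp: s_def)
  have us: "integrable lborel (u s)" "integrable lborel (u 0)" using u_int s by auto
  have t2: "t / 2 > 0" using t by simp
  let ?\<Gamma>1 = "\<lambda>\<tau>. c / sqrt (t / 2) * K * (\<tau> powr (1 - \<kappa>) / (1 - \<kappa>))"
  let ?\<Gamma>2 = "\<lambda>\<tau>. - 2 * c * (K * (t / 2) powr (- \<kappa>)) * sqrt (s + t - \<tau>)"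
  \<comment> \<open>The additional heat time s + t/2 makes the kernel at the start exactly
    \<open>heat_kernel t\<close>, and the state reached at t/2 is the one from which the second half
    starts.\<close>
  have first: "(LINT x|lborel. \<bar>conv (heat_kernel (s + t / 2)) (u (t / 2)) x\<bar>)
    \<le> (LINT x|lborel. \<bar>conv (heat_kernel (s + t / 2 + t / 2 - s)) (u s) x\<bar>) + ?\<Gamma>1 (t / 2) - ?\<Gamma>1 s"
  proof (rule duhamel_L1[OF s(1,4)])
    show "(?\<Gamma>1 has_real_derivative c / sqrt (t / 2) * K * \<tau> powr (- \<kappa>)) (at \<tau>)" if "s \<le> \<tau>" "\<tau> \<le> t / 2" for \<tau>
    proof -
      have "(?\<Gamma>1 has_real_derivative c / sqrt (t / 2) * K * (((1 - \<kappa>) * \<tau> powr (1 - \<kappa> - 1)) / (1 - \<kappa>))) (at \<tau>)"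
        using that s by (intro DERIV_cmult DERIV_cdivide has_real_derivative_powr) auto
      then show ?thesis using \<kappa> by simp
    qed
    show "norm a * (heat_const TYPE('a) / sqrt (s + t / 2 + t / 2 - \<tau>)) * (LINT x|lborel. \<bar>u \<tau> x\<bar> powr q) \<le> c / sqrt (t / 2) * K * \<tau> powr (- \<kappa>)"
      if "s \<le> \<tau>" "\<tau> \<le> t / 2" for \<tau>
    proof -
      have "c / sqrt (s + t / 2 + t / 2 - \<tau>) \<le> c / sqrt (t / 2)"
        using that s t c by (intro divide_left_mono real_sqrt_le_mono mult_pos_pos) auto
      then have "c / sqrt (s + t / 2 + t / 2 - \<tau>) * (LINT x|lborel. \<bar>u \<tau> x\<bar> powr q) \<le> c / sqrt (t / 2) * (K * \<tau> powr (- \<kappa>))"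
        using that s t c b[of \<tau>] by (intro mult_mono) (auto intro!: divide_nonneg_nonneg)
      then show ?thesis by (simp add: c_def mult.assoc)
    qed
  qed (use s t in auto)
  have second: "(LINT x|lborel. \<bar>conv (heat_kernel s) (u t) x\<bar>)
    \<le> (LINT x|lborel. \<bar>conv (heat_kernel (s + t - t / 2)) (u (t / 2)) x\<bar>) + ?\<Gamma>2 t - ?\<Gamma>2 (t / 2)"
  proof (rule duhamel_L1[OF t2 _ s(1)])
    show "(?\<Gamma>2 has_real_derivative c / sqrt (s + t - \<tau>) * (K * (t / 2) powr (- \<kappa>))) (at \<tau>)" if "t / 2 \<le> \<tau>" "\<tau> \<le> t" for \<tau>
    proof -
      have pos: "s + t - \<tau> > 0" using that s by simp
      have D: "((\<lambda>\<tau>. sqrt (s + t - \<tau>)) has_real_derivative - (inverse (sqrt (s + t - \<tau>)) / 2)) (at \<tau>)"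
      proof -
        have "((\<lambda>\<tau>. s + t - \<tau>) has_real_derivative - 1) (at \<tau>)"
          using DERIV_diff[OF DERIV_const DERIV_ident, of "s + t" \<tau> UNIV] unfolding diff_0 .
        from DERIV_chain2[OF DERIV_real_sqrt[OF pos] this] show ?thesis unfolding mult_minus1_right .
      qed
      have gen: "- 2 * c * y * - (inverse z / 2) = c / z * y" for y z :: real
      proof -
        have "- 2 * c * y * - (inverse z / 2) = c * y * inverse z" by simp
        then show ?thesis unfolding divide_inverse by (simp only: mult_ac)
      qed
      show ?thesis using DERIV_cmult[OF D, of "- 2 * c * (K * (t / 2) powr (- \<kappa>))"] unfolding gen .
    qed
    show "norm a * (heat_const TYPE('a) / sqrt (s + t - \<tau>)) * (LINT x|lborel. \<bar>u \<tau> x\<bar> powr q) \<le> c / sqrt (s + t - \<tau>) * (K * (t / 2) powr (- \<kappa>))"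
      if \<tau>: "t / 2 \<le> \<tau>" "\<tau> \<le> t" for \<tau>
    proof -
      have "(LINT x|lborel. \<bar>u \<tau> x\<bar> powr q) \<le> K * \<tau> powr (- \<kappa>)" using \<tau> t by (intro b) auto
      also have "\<dots> \<le> K * (t / 2) powr (- \<kappa>)" using \<tau> t K \<kappa> by (intro mult_left_mono powr_mono2') auto
      finally have "c / sqrt (s + t - \<tau>) * (LINT x|lborel. \<bar>u \<tau> x\<bar> powr q) \<le> c / sqrt (s + t - \<tau>) * (K * (t / 2) powr (- \<kappa>))"
        using \<tau> s c by (intro mult_left_mono) auto
      then show ?thesis by (simp add: c_def)
    qed
  qed (use t in auto)
  have half: "s + t - t / 2 = s + t / 2" "s + t / 2 + t / 2 - s = t" by auto
  have G1: "?\<Gamma>1 (t / 2) - ?\<Gamma>1 s \<le> c * K * (1 / (1 - \<kappa>)) * (t / 2) powr (1/2 - \<kappa>)"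
  proof -
    have "?\<Gamma>1 s \<ge> 0" using c K \<kappa> t by (intro mult_nonneg_nonneg divide_nonneg_nonneg) auto
    moreover have "?\<Gamma>1 (t / 2) = c * K * (1 / (1 - \<kappa>)) * ((t / 2) powr (1 - \<kappa>) / (t / 2) powr (1/2))"
      using t by (simp add: powr_half_sqrt)
    moreover have "(t / 2) powr (1 - \<kappa>) / (t / 2) powr (1/2) = (t / 2) powr (1/2 - \<kappa>)"
      unfolding powr_diff[symmetric] by (intro arg_cong[of _ _ "(powr) (t / 2)"]) simp
    ultimately show ?thesis by simp
  qed
  have G2: "?\<Gamma>2 t - ?\<Gamma>2 (t / 2) \<le> c * K * 2 * (t / 2) powr (1/2 - \<kappa>)"
  proof -
    have "?\<Gamma>2 t - ?\<Gamma>2 (t / 2) = 2 * c * (K * (t / 2) powr (- \<kappa>)) * (sqrt (s + t / 2) - sqrt s)"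
      by (simp add: half algebra_simps)
    also have "\<dots> \<le> 2 * c * (K * (t / 2) powr (- \<kappa>)) * sqrt (t / 2)"
      using c K s t by (intro mult_left_mono sqrt_diff_le mult_nonneg_nonneg) auto
    also have "\<dots> = c * K * 2 * ((t / 2) powr (1/2) * (t / 2) powr (- \<kappa>))" using t by (simp add: powr_half_sqrt)
    also have "(t / 2) powr (1/2) * (t / 2) powr (- \<kappa>) = (t / 2) powr (1/2 - \<kappa>)"
      unfolding powr_add[symmetric] by simp
    finally show ?thesis .
  qed
  have start: "(LINT x|lborel. \<bar>conv (heat_kernel t) (u s) x\<bar>) \<le> Z + \<delta> / 2"
  proof -
    note ci = heat_conv_L1(1)[OF t us(1)] heat_conv_L1(1)[OF t us(2)]
    have "(LINT x|lborel. \<bar>conv (heat_kernel t) (u s) x\<bar>)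
      \<le> (LINT x|lborel. \<bar>conv (heat_kernel t) (u 0) x\<bar> + \<bar>conv (heat_kernel t) (u s) x - conv (heat_kernel t) (u 0) x\<bar>)"
      using ci by (intro integral_mono) auto
    also have "\<dots> = (LINT x|lborel. \<bar>conv (heat_kernel t) (u 0) x\<bar>) + (LINT x|lborel. \<bar>conv (heat_kernel t) (u s) x - conv (heat_kernel t) (u 0) x\<bar>)"
      using ci by simp
    also have "\<dots> \<le> Z + \<delta> / 2"
      using Z order_trans[OF heat_conv_L1_diff[OF t us] less_imp_le[OF e2(2)[OF s(1,3)]]] by (intro add_mono)
    finally show ?thesis .
  qed
  have "(LINT x|lborel. \<bar>u t x\<bar>) \<le> (LINT x|lborel. \<bar>ue s t x\<bar> + \<bar>ue s t x - u t x\<bar>)"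
    using ut heat_conv_L1(1)[OF s(1) ut] by (intro integral_mono) auto
  also have "\<dots> = (LINT x|lborel. \<bar>ue s t x\<bar>) + (LINT x|lborel. \<bar>ue s t x - u t x\<bar>)"
    using ut heat_conv_L1(1)[OF s(1) ut] by simp
  finally have "(LINT x|lborel. \<bar>u t x\<bar>) \<le> (LINT x|lborel. \<bar>ue s t x\<bar>) + \<delta> / 2" using e1(2)[OF s(1,2)] by linarith
  then have "(LINT x|lborel. \<bar>u t x\<bar>) \<le> Z + \<delta> + (c * K * (1 / (1 - \<kappa>)) * (t / 2) powr (1/2 - \<kappa>) + c * K * 2 * (t / 2) powr (1/2 - \<kappa>))"
    using first second G1 G2 start unfolding half by linarith
  then show "(LINT x|lborel. \<bar>u t x\<bar>) \<le> Z + norm a * heat_const TYPE('a) * K * (2 + 1 / (1 - \<kappa>)) * (t / 2) powr (1/2 - \<kappa>) + \<delta>"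
    unfolding c_def by (simp add: algebra_simps)
qed

text \<open>Two bounds on the L^q norm are merged into one power: monotonicity of that norm for
  times up to 1, smoothing over [tau/2, tau] with the known rate \<open>\<gamma>\<close> afterwards.
  The gain \<open>d\<close> is the excess of n(q-1) over 1, the value at which smoothing would only
  reproduce the rate.\<close>

lemma decay_bootstrap:
  assumes d: "real DIM('a) * (q - 1) - 1 \<ge> d" and \<beta>: "0 < \<beta>" "\<beta> < 1" and \<gamma>: "0 \<le> \<gamma>" "\<gamma> \<le> \<beta>" and d0: "d > 0"
    and i: "integrable lborel (\<lambda>x. \<bar>u 0 x\<bar> powr q)"
    and heat: "\<And>t. t > 0 \<Longrightarrow> (LINT x|lborel. \<bar>conv (heat_kernel t) (u 0) x\<bar>) \<le> C0 * t powr (- \<beta> / 2)"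
    and A: "C > 0" "\<And>t. t > 0 \<Longrightarrow> (LINT x|lborel. \<bar>u t x\<bar>) \<le> C * t powr (- \<gamma> / 2)"
  shows "\<exists>C>0. \<forall>t>0. (LINT x|lborel. \<bar>u t x\<bar>) \<le> C * t powr (- min \<beta> (\<gamma> + d) / 2)"
proof -
  let ?n = "real DIM('a)"
  define g where "g = min \<beta> (\<gamma> + d)"
  have g: "0 < g" "g \<le> \<beta>" "g \<le> \<gamma> + d" using \<beta> \<gamma> d0 by (auto simp: g_def)
  \<comment> \<open>The exponent for which Duhamel's inequality returns exactly t^(-g/2); it is
    below 1 because g <= beta < 1.\<close>
  define \<kappa> where "\<kappa> = (1 + g) / 2"
  have \<kappa>: "0 \<le> \<kappa>" "\<kappa> < 1" using g \<beta> by (auto simp: \<kappa>_def)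
  define Q where "Q = (LINT x|lborel. \<bar>u 0 x\<bar> powr q)"
  have Q0: "Q \<ge> 0" by (simp add: Q_def)
  obtain k :: nat where k0: "q < 2 ^ k" using real_arch_pow[of 2 q] by auto
  define k' where "k' = Suc k"
  have k: "q \<le> 2 ^ k'" "k' \<ge> 1" using k0 q by (auto simp: k'_def)
  define S where "S = 1 + smoothing_const TYPE('a) k'"
  have S: "S \<ge> 0" using smoothing_const_nonneg[of "TYPE('a)" k'] by (simp add: S_def)
  \<comment> \<open>Decay exponent delivered by smoothing. It is at least \<open>\<kappa>\<close>
    because n(q-1) >= 1 + d, gamma q >= gamma and g <= gamma + d.\<close>
  define \<mu> where "\<mu> = (?n * (q - 1) + \<gamma> * q) / 2"
  have mu: "\<mu> \<ge> \<kappa>"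
  proof -
    have "\<gamma> * 1 \<le> \<gamma> * q" using \<gamma> q by (intro mult_left_mono) auto
    then show ?thesis using d g by (simp add: \<mu>_def \<kappa>_def)
  qed
  \<comment> \<open>The first summand covers times up to 1, the second the later ones;
    \<open>2 powr \<mu>\<close> comes from smoothing that starts at half the time.\<close>
  define K where "K = Q + S * C powr q * 2 powr \<mu>"
  have K: "K \<ge> 0" using Q0 S by (simp add: K_def)
  have bound: "(LINT x|lborel. \<bar>u \<tau> x\<bar> powr q) \<le> K * \<tau> powr (- \<kappa>)" if \<tau>: "\<tau> > 0" for \<tau>
  proof (cases "\<tau> \<le> 1")
    case True
    have "(LINT x|lborel. \<bar>u \<tau> x\<bar> powr q) \<le> Q * 1" using Lq_norm_nonincreasing[OF \<tau> i] by (simp add: Q_def)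
    also have "\<dots> \<le> K * \<tau> powr (- \<kappa>)"
    proof (rule mult_mono)
      show "1 \<le> \<tau> powr (- \<kappa>)" using powr_mono2'[of "- \<kappa>" \<tau> 1] True \<tau> \<kappa> by simp
    qed (use S Q0 in \<open>auto simp: K_def\<close>)
    finally show ?thesis .
  next
    case False
    have h: "0 < \<tau> / 2" "\<tau> / 2 < \<tau>" using \<tau> by auto
    let ?A = "C * (\<tau> / 2) powr (- \<gamma> / 2)"
    have "?A > 0" using A \<tau> by simp
    from Lp_smoothing[OF h this A(2)[OF h(1)] q k]
    have "(LINT x|lborel. \<bar>u \<tau> x\<bar> powr q) \<le> S * (\<tau> / 2) powr (- (?n * (q - 1) / 2)) * ?A powr q"
      by (simp add: S_def)
    also have "\<dots> = S * C powr q * ((\<tau> / 2) powr (- (?n * (q - 1) / 2)) * (\<tau> / 2) powr (- \<gamma> / 2 * q))"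
      using A \<tau> by (simp add: powr_mult powr_powr)
    also have "(\<tau> / 2) powr (- (?n * (q - 1) / 2)) * (\<tau> / 2) powr (- \<gamma> / 2 * q) = (\<tau> / 2) powr (- \<mu>)"
      unfolding powr_add[symmetric] by (intro arg_cong[of _ _ "(powr) (\<tau> / 2)"]) (simp add: \<mu>_def field_simps)
    also have "(\<tau> / 2) powr (- \<mu>) = 2 powr \<mu> * \<tau> powr (- \<mu>)"
      using \<tau> by (simp add: powr_divide powr_minus field_simps)
    also have "S * C powr q * (2 powr \<mu> * \<tau> powr (- \<mu>)) = (S * C powr q * 2 powr \<mu>) * \<tau> powr (- \<mu>)" by simp
    also have "\<dots> \<le> K * \<tau> powr (- \<kappa>)"
    proof (rule mult_mono)
      show "\<tau> powr (- \<mu>) \<le> \<tau> powr (- \<kappa>)" using False mu by (intro powr_mono) auto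
    qed (use K Q0 in \<open>auto simp: K_def\<close>)
    finally show ?thesis .
  qed
  define B where "B = norm a * heat_const TYPE('a) * K * (2 + 1 / (1 - \<kappa>)) * 2 powr (g / 2)"
  have B: "B \<ge> 0" using K \<kappa> heat_const_pos[where 'a = 'a] by (simp add: B_def)
  have C: "\<bar>C0\<bar> + B + C > 0" using B A by linarith
  define A0 where "A0 = (LINT x|lborel. \<bar>u 0 x\<bar>)"
  have A0: "A0 \<ge> 0" by (simp add: A0_def)
  have "(LINT x|lborel. \<bar>u t x\<bar>) \<le> (\<bar>C0\<bar> + B + C + A0) * t powr (- g / 2)" if t: "t > 0" for t
  proof (cases "t \<le> 1")
    case True
    have "(LINT x|lborel. \<bar>u t x\<bar>) \<le> A0 * 1" using L1_norm_nonincreasing[of 0 t] t by (simp add: A0_def)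
    also have "\<dots> \<le> (\<bar>C0\<bar> + B + C + A0) * t powr (- g / 2)"
    proof (rule mult_mono)
      show "1 \<le> t powr (- g / 2)" using powr_mono2'[of "- g / 2" t 1] True t g by simp
    qed (use A0 B A in auto)
    finally show ?thesis .
  next
    case False
    have "(LINT x|lborel. \<bar>u t x\<bar>) \<le> C0 * t powr (- \<beta> / 2) + norm a * heat_const TYPE('a) * K * (2 + 1 / (1 - \<kappa>)) * (t / 2) powr (1/2 - \<kappa>)"
      by (rule decay_from_power_bound[OF t K \<kappa> bound heat[OF t]])
    also have "(t / 2) powr (1/2 - \<kappa>) = 2 powr (g / 2) * t powr (- g / 2)"
    proof -
      have "1/2 - \<kappa> = - (g / 2)" by (simp add: \<kappa>_def field_simps)
      then show ?thesis using half_powr_minus[OF t, of "g / 2"] by simp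
    qed
    also have "norm a * heat_const TYPE('a) * K * (2 + 1 / (1 - \<kappa>)) * (2 powr (g / 2) * t powr (- g / 2)) = B * t powr (- g / 2)"
      by (simp add: B_def)
    also have "C0 * t powr (- \<beta> / 2) \<le> \<bar>C0\<bar> * t powr (- g / 2)"
      using False g by (intro mult_mono powr_mono) auto
    finally have "(LINT x|lborel. \<bar>u t x\<bar>) \<le> (\<bar>C0\<bar> + B) * t powr (- g / 2)" by (simp add: distrib_right)
    also have "\<dots> \<le> (\<bar>C0\<bar> + B + C + A0) * t powr (- g / 2)" using A A0 by (intro mult_right_mono) auto
    finally show ?thesis .
  qed
  then show ?thesis using C A0 by (intro exI[of _ "\<bar>C0\<bar> + B + C + A0"]) (auto simp: g_def)
qed

text \<open>Both cases pass through (1 + t)/2: for t <= 1 it is at most 1 and the monotone L^1 norm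
  suffices, for t > 1 it is at most t.\<close>

lemma decay_normalised:
  assumes \<beta>: "0 < \<beta>" and A: "\<And>t. t > 0 \<Longrightarrow> (LINT x|lborel. \<bar>u t x\<bar>) \<le> C * t powr (- \<beta> / 2)"
  shows "\<exists>C. \<forall>t>0. (LINT x|lborel. \<bar>u t x\<bar>) \<le> C * (1 + t) powr (- \<beta> / 2)"
proof (intro exI allI impI)
  fix t :: real assume t: "t > 0"
  define A0 where "A0 = (LINT x|lborel. \<bar>u 0 x\<bar>)"
  have A0: "A0 \<ge> 0" by (simp add: A0_def)
  have half: "((1 + t) / 2) powr (- (\<beta> / 2)) = 2 powr (\<beta> / 2) * (1 + t) powr (- (\<beta> / 2))"
    using t by (intro half_powr_minus) simp
  have "(LINT x|lborel. \<bar>u t x\<bar>) \<le> (A0 + \<bar>C\<bar>) * ((1 + t) / 2) powr (- \<beta> / 2)"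
  proof (cases "t \<le> 1")
    case True
    have "(LINT x|lborel. \<bar>u t x\<bar>) \<le> A0 * 1" using L1_norm_nonincreasing[of 0 t] t by (simp add: A0_def)
    also have "\<dots> \<le> (A0 + \<bar>C\<bar>) * ((1 + t) / 2) powr (- \<beta> / 2)"
    proof (rule mult_mono)
      show "1 \<le> ((1 + t) / 2) powr (- \<beta> / 2)" using powr_mono2'[of "- \<beta> / 2" "(1 + t) / 2" 1] True t \<beta> by simp
    qed (use A0 in auto)
    finally show ?thesis .
  next
    case False
    have "(LINT x|lborel. \<bar>u t x\<bar>) \<le> C * t powr (- \<beta> / 2)" by (rule A[OF t])
    also have "\<dots> \<le> (A0 + \<bar>C\<bar>) * ((1 + t) / 2) powr (- \<beta> / 2)"
      using False \<beta> A0 by (intro mult_mono powr_mono2') auto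
    finally show ?thesis .
  qed
  then show "(LINT x|lborel. \<bar>u t x\<bar>) \<le> (A0 + \<bar>C\<bar>) * 2 powr (\<beta> / 2) * (1 + t) powr (- \<beta> / 2)"
    by (simp add: half mult.assoc)
qed

theorem supercritical_decay:
  assumes n: "q > 1 + 1 / real DIM('a)" and \<beta>: "0 < \<beta>" "\<beta> < 1"
    and i: "integrable lborel (\<lambda>x. \<bar>u 0 x\<bar> powr q)"
    and heat: "\<And>t. t > 0 \<Longrightarrow> (LINT x|lborel. \<bar>conv (heat_kernel t) (u 0) x\<bar>) \<le> C0 * t powr (- \<beta> / 2)"
  shows "\<exists>C. \<forall>t>0. (LINT x|lborel. \<bar>u t x\<bar>) \<le> C * (1 + t) powr (- \<beta> / 2)"
proof -
  \<comment> \<open>Fixed gain per step, positive exactly because q > 1 + 1/n; the Archimedean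
    property then ends the iteration after finitely many steps.\<close>
  define d where "d = real DIM('a) * (q - 1) - 1"
  have d0: "d > 0"
  proof -
    have n0: "real DIM('a) > 0" using DIM_positive[where 'a = 'a] by simp
    have "real DIM('a) * (1 / real DIM('a)) < real DIM('a) * (q - 1)" using n n0 by (intro mult_strict_left_mono) auto
    then show ?thesis using n0 by (simp add: d_def)
  qed
  have "\<exists>C>0. \<forall>t>0. (LINT x|lborel. \<bar>u t x\<bar>) \<le> C * t powr (- min \<beta> (real k * d) / 2)" for k
  proof (induction k)
    case 0
    have "(LINT x|lborel. \<bar>u t x\<bar>) \<le> ((LINT x|lborel. \<bar>u 0 x\<bar>) + 1) * t powr (- min \<beta> (real 0 * d) / 2)" if "t > 0" for t
      using L1_norm_nonincreasing[of 0 t] that \<beta> by (simp add: min_def)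
    moreover have "(LINT x|lborel. \<bar>u 0 x\<bar>) + 1 > 0" by (intro add_nonneg_pos) auto
    ultimately show ?case by blast
  next
    case (Suc k)
    then obtain C where C: "C > 0" "\<And>t. t > 0 \<Longrightarrow> (LINT x|lborel. \<bar>u t x\<bar>) \<le> C * t powr (- min \<beta> (real k * d) / 2)" by blast
    have "min \<beta> (min \<beta> (real k * d) + d) = min \<beta> (real (Suc k) * d)" using d0 by (auto simp: min_def algebra_simps)
    then show ?case
      using decay_bootstrap[of d \<beta> "min \<beta> (real k * d)" C0 C] d0 \<beta> i heat C by (auto simp: d_def)
  qed
  moreover obtain k :: nat where "\<beta> < real k * d" using reals_Archimedean3[OF d0] by blast
  ultimately obtain C where "\<And>t. t > 0 \<Longrightarrow> (LINT x|lborel. \<bar>u t x\<bar>) \<le> C * t powr (- \<beta> / 2)"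
    by (metis less_imp_le min.absorb1)
  then show ?thesis by (rule decay_normalised[OF \<beta>(1)])
qed

text \<open>The hypothesis on the L^1 norm covers only times before \<open>t\<close>; this suffices
  because smoothing to a time tau <= t starts at tau/2 < t, and it is what allows a first-time
  argument. Since p <= 2, a single doubling is enough, so the constant with index 1 appears. The new
  contribution is of order b^p, superlinear in \<open>b\<close>.\<close>

lemma critical_step:
  fixes M \<beta> :: real
  assumes \<beta>: "0 < \<beta>" "\<beta> < 1" and M: "M \<ge> 1" and q1: "1 + 1 / (real DIM('a) + \<beta>) \<le> q"
    and bd: "AE x in lborel. \<bar>u 0 x\<bar> \<le> M" and t: "t > 0"
    and heat: "(LINT x|lborel. \<bar>conv (heat_kernel t) (u 0) x\<bar>) \<le> \<epsilon> * t powr (- \<beta> / 2)"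
    and b: "b > 0" and A: "\<And>s. 0 < s \<Longrightarrow> s < t \<Longrightarrow> (LINT x|lborel. \<bar>u s x\<bar>) \<le> b * s powr (- \<beta> / 2)"
  defines "p \<equiv> 1 + 1 / (real DIM('a) + \<beta>)"
  shows "(LINT x|lborel. \<bar>u t x\<bar>) \<le> (\<epsilon> + norm a * heat_const TYPE('a) * M powr (q - p) * (1 + smoothing_const TYPE('a) 1)
      * 2 powr ((1 + \<beta>) / 2) * (2 + 1 / (1 - (1 + \<beta>) / 2)) * 2 powr (\<beta> / 2) * b powr p) * t powr (- \<beta> / 2)"
proof -
  let ?n = "real DIM('a)"
  define S where "S = 1 + smoothing_const TYPE('a) 1"
  have S: "S \<ge> 0" using smoothing_const_nonneg[of "TYPE('a)" 1] by (simp add: S_def)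
  have n1: "?n \<ge> 1" using DIM_positive[where 'a = 'a] by linarith
  have nb: "?n + \<beta> > 1" using n1 \<beta> by linarith
  have p: "1 < p" "p \<le> 2" "p \<le> q" using nb q1 by (auto simp: p_def)
  define \<kappa> where "\<kappa> = (1 + \<beta>) / 2"
  have \<kappa>: "0 \<le> \<kappa>" "\<kappa> < 1" using \<beta> by (auto simp: \<kappa>_def)
  \<comment> \<open>The exponent \<open>p\<close> is defined by (n + beta)(p - 1) = 1, which makes
    the smoothing exponent equal to kappa = (1 + beta)/2.\<close>
  have expo: "?n * (p - 1) / 2 + \<beta> / 2 * p = \<kappa>"
  proof -
    have "(?n + \<beta>) * (p - 1) = 1" using nb by (simp add: p_def)
    then show ?thesis by (simp add: \<kappa>_def field_simps)
  qed
  define K where "K = M powr (q - p) * S * b powr p * 2 powr \<kappa>"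
  have K: "K \<ge> 0" using S by (simp add: K_def)
  have bound: "(LINT x|lborel. \<bar>u \<tau> x\<bar> powr q) \<le> K * \<tau> powr (- \<kappa>)" if \<tau>: "\<tau> > 0" "\<tau> \<le> t" for \<tau>
  proof -
    have h: "0 < \<tau> / 2" "\<tau> / 2 < \<tau>" "\<tau> / 2 < t" using \<tau> by auto
    let ?A = "b * (\<tau> / 2) powr (- \<beta> / 2)"
    have A0: "?A > 0" using b \<tau> by simp
    have AEM: "AE x in lborel. \<bar>u \<tau> x\<bar> \<le> M" using Linf_bound_preserved[OF _ _ bd, of \<tau>] \<tau> M by simp
    have "(LINT x|lborel. \<bar>u \<tau> x\<bar> powr q) \<le> (LINT x|lborel. M powr (q - p) * \<bar>u \<tau> x\<bar> powr p)"
    proof (rule integral_mono_AE)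
      show "AE x in lborel. \<bar>u \<tau> x\<bar> powr q \<le> M powr (q - p) * \<bar>u \<tau> x\<bar> powr p"
        using AEM
      proof eventually_elim
        case (elim x)
        have "\<bar>u \<tau> x\<bar> powr q = \<bar>u \<tau> x\<bar> powr (q - p) * \<bar>u \<tau> x\<bar> powr p" by (simp add: powr_add[symmetric])
        also have "\<dots> \<le> M powr (q - p) * \<bar>u \<tau> x\<bar> powr p" using elim p by (intro mult_right_mono powr_mono2) auto
        finally show ?case .
      qed
    qed (use u_intp[OF \<tau>(1)] p q in auto)
    also have "\<dots> = M powr (q - p) * (LINT x|lborel. \<bar>u \<tau> x\<bar> powr p)" by simp
    also have "\<dots> \<le> M powr (q - p) * (S * (\<tau> / 2) powr (- (?n * (p - 1) / 2)) * ?A powr p)"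
      using Lp_smoothing[OF h(1,2) A0 A[OF h(1,3)] p(1), of 1] p(2) by (intro mult_left_mono) (auto simp: S_def)
    also have "\<dots> = M powr (q - p) * S * b powr p * ((\<tau> / 2) powr (- (?n * (p - 1) / 2)) * (\<tau> / 2) powr (- \<beta> / 2 * p))"
      using b \<tau> by (simp add: powr_mult powr_powr)
    also have "(\<tau> / 2) powr (- (?n * (p - 1) / 2)) * (\<tau> / 2) powr (- \<beta> / 2 * p) = (\<tau> / 2) powr (- \<kappa>)"
      unfolding powr_add[symmetric] by (intro arg_cong[of _ _ "(powr) (\<tau> / 2)"]) (simp add: expo[symmetric])
    also have "(\<tau> / 2) powr (- \<kappa>) = 2 powr \<kappa> * \<tau> powr (- \<kappa>)"
      using \<tau> by (simp add: powr_divide powr_minus field_simps)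
    finally show ?thesis by (simp add: K_def mult.assoc)
  qed
  have "(LINT x|lborel. \<bar>u t x\<bar>) \<le> \<epsilon> * t powr (- \<beta> / 2) + norm a * heat_const TYPE('a) * K * (2 + 1 / (1 - \<kappa>)) * (t / 2) powr (1/2 - \<kappa>)"
    by (rule decay_from_power_bound[OF t K \<kappa> bound heat])
  also have "(t / 2) powr (1/2 - \<kappa>) = 2 powr (\<beta> / 2) * t powr (- \<beta> / 2)"
  proof -
    have "1/2 - \<kappa> = - (\<beta> / 2)" by (simp add: \<kappa>_def field_simps)
    then show ?thesis using half_powr_minus[OF t, of "\<beta> / 2"] by simp
  qed
  finally have "(LINT x|lborel. \<bar>u t x\<bar>)
    \<le> \<epsilon> * t powr (- \<beta> / 2) + norm a * heat_const TYPE('a) * K * (2 + 1 / (1 - \<kappa>)) * (2 powr (\<beta> / 2) * t powr (- \<beta> / 2))" .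
  moreover have "e * z + h * h' * (m * s * y * k) * c * (w * z) = (e + h * h' * m * s * k * c * w * y) * z"
    for c e h h' k m s w y z :: real
    by (simp add: distrib_right)
  ultimately show ?thesis unfolding K_def S_def \<kappa>_def by (simp only:)
qed

lemma L1_norm_continuous: "continuous_on {0..} (\<lambda>t. LINT x|lborel. \<bar>u t x\<bar>)"
  unfolding continuous_on_def
proof
  fix t :: real assume "t \<in> {0..}"
  then have t: "t \<ge> 0" by simp
  have "((\<lambda>s. (LINT x|lborel. \<bar>u s x\<bar>) - (LINT x|lborel. \<bar>u t x\<bar>)) \<longlongrightarrow> 0) (at t within {0..})"
  proof (rule Lim_null_comparison[OF _ u_cont1[OF t]])
    have "eventually (\<lambda>s. s \<in> {0..}) (at t within {0..})" by (simp add: eventually_at_filter)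
    then show "eventually (\<lambda>s. norm ((LINT x|lborel. \<bar>u s x\<bar>) - (LINT x|lborel. \<bar>u t x\<bar>)) \<le> (LINT x|lborel. \<bar>u s x - u t x\<bar>)) (at t within {0..})"
    proof eventually_elim
      case (elim s)
      have i: "integrable lborel (u s)" "integrable lborel (u t)" using u_int elim t by auto
      have "(LINT x|lborel. \<bar>u s x\<bar>) - (LINT x|lborel. \<bar>u t x\<bar>) = (LINT x|lborel. \<bar>u s x\<bar> - \<bar>u t x\<bar>)" using i by simp
      then show ?case
        using integral_abs_mono(2)[of lborel "\<lambda>x. \<bar>u s x - u t x\<bar>" "\<lambda>x. \<bar>u s x\<bar> - \<bar>u t x\<bar>"] i by auto
    qed
  qed
  then show "((\<lambda>t. LINT x|lborel. \<bar>u t x\<bar>) \<longlongrightarrow> (LINT x|lborel. \<bar>u t x\<bar>)) (at t within {0..})" by (rule LIM_zero_cancel)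
qed

text \<open>Continuity argument for g(t) = t^(beta/2) ||u(t)||_1. At a first time with g >= 2
  epsilon the critical step gives epsilon plus a quantity smaller than epsilon, a
  contradiction.\<close>

theorem critical_decay:
  fixes M \<beta> :: real
  assumes \<beta>: "0 < \<beta>" "\<beta> < 1" and M: "M \<ge> 1" and q1: "1 + 1 / (real DIM('a) + \<beta>) \<le> q"
    and bd: "AE x in lborel. \<bar>u 0 x\<bar> \<le> M" and \<epsilon>: "\<epsilon> > 0"
    and heat: "\<And>t. t > 0 \<Longrightarrow> (LINT x|lborel. \<bar>conv (heat_kernel t) (u 0) x\<bar>) \<le> \<epsilon> * t powr (- \<beta> / 2)"
  defines "p \<equiv> 1 + 1 / (real DIM('a) + \<beta>)"
  assumes small: "norm a * heat_const TYPE('a) * M powr (q - p) * (1 + smoothing_const TYPE('a) 1)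
      * 2 powr ((1 + \<beta>) / 2) * (2 + 1 / (1 - (1 + \<beta>) / 2)) * 2 powr (\<beta> / 2) * (2 * \<epsilon>) powr p < \<epsilon>"
  shows "\<exists>C. \<forall>t>0. (LINT x|lborel. \<bar>u t x\<bar>) \<le> C * (1 + t) powr (- \<beta> / 2)"
proof (rule decay_normalised[OF \<beta>(1)])
  fix T :: real assume T: "T > 0"
  define D where "D = norm a * heat_const TYPE('a) * M powr (q - p) * (1 + smoothing_const TYPE('a) 1)
      * 2 powr ((1 + \<beta>) / 2) * (2 + 1 / (1 - (1 + \<beta>) / 2)) * 2 powr (\<beta> / 2) * (2 * \<epsilon>) powr p"
  have D: "D < \<epsilon>" using small unfolding D_def .
  define g where "g t = t powr (\<beta> / 2) * (LINT x|lborel. \<bar>u t x\<bar>)" for t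
  have gA: "(LINT x|lborel. \<bar>u t x\<bar>) = g t * t powr (- \<beta> / 2)" if "t > 0" for t
    using that by (simp add: g_def powr_minus)
  have "g T < 2 * \<epsilon>"
  proof (rule ccontr)
    assume "\<not> g T < 2 * \<epsilon>"
    define S where "S = {t \<in> {0..T}. 2 * \<epsilon> \<le> g t}"
    have cg: "continuous_on {0..T} g"
      unfolding g_def using \<beta> by (intro continuous_intros continuous_on_powr' continuous_on_subset[OF L1_norm_continuous]) auto
    have "S = {0..T} \<inter> g -` {2 * \<epsilon>..}" by (auto simp: S_def)
    then have "closed S" using continuous_closed_preimage[OF cg, of "{2 * \<epsilon>..}"] by simp
    then have "compact ({0..T} \<inter> S)" by (intro compact_Int_closed) auto
    moreover have "{0..T} \<inter> S = S" by (auto simp: S_def)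
    ultimately have "compact S" by simp
    moreover have "S \<noteq> {}" using \<open>\<not> g T < 2 * \<epsilon>\<close> T by (auto simp: S_def)
    ultimately obtain t where t: "t \<in> S" "\<And>s. s \<in> S \<Longrightarrow> t \<le> s" using compact_attains_inf[of S] by blast
    \<comment> \<open>Since \<open>0 powr (\<beta> / 2) = 0\<close>, the first time of failure is
      positive and the critical step applies there.\<close>
    have "g 0 = 0" by (simp add: g_def)
    moreover have tS: "0 \<le> t" "2 * \<epsilon> \<le> g t" using t(1) by (simp_all add: S_def)
    ultimately have "t \<noteq> 0" using \<epsilon> by auto
    then have t0: "t > 0" using tS(1) by simp
    have "(LINT x|lborel. \<bar>u s x\<bar>) \<le> 2 * \<epsilon> * s powr (- \<beta> / 2)" if s: "0 < s" "s < t" for s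
    proof -
      have "g s < 2 * \<epsilon>" using t(2)[of s] t(1) s by (auto simp: S_def not_le[symmetric])
      then show ?thesis unfolding gA[OF s(1)] by (intro mult_right_mono) auto
    qed
    then have "(LINT x|lborel. \<bar>u t x\<bar>) \<le> (\<epsilon> + D) * t powr (- \<beta> / 2)"
      unfolding D_def p_def using \<epsilon> by (intro critical_step[OF \<beta> M q1 bd t0 heat[OF t0]]) auto
    also have "\<dots> < (2 * \<epsilon>) * t powr (- \<beta> / 2)"
      using D t0 by (intro mult_strict_right_mono) auto
    finally have "g t * t powr (- \<beta> / 2) < (2 * \<epsilon>) * t powr (- \<beta> / 2)" unfolding gA[OF t0] .
    then have "g t < 2 * \<epsilon>" by (rule mult_right_less_imp_less) simp
    then show False using tS(2) by simp
  qed
  then show "(LINT x|lborel. \<bar>u T x\<bar>) \<le> 2 * \<epsilon> * T powr (- \<beta> / 2)"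
    unfolding gA[OF T] by (intro mult_right_mono) auto
qed

end

theorem theorem2p1:
  fixes a :: "real ^ 'n" and q \<beta> :: real
  assumes "q > 1" and "0 < \<beta>" and "\<beta> < 1"
  shows
    "(q > 1 + 1 / real CARD('n) \<longrightarrow>
       (\<forall>(u0 :: real ^ 'n \<Rightarrow> real) u.
          u0 \<in> Lp_space 1 \<inter> Lp_space q \<and>
          (\<exists>C. \<forall>t>0. Lp_norm 1 (heat_semigroup t u0) \<le> C * t powr (- \<beta> / 2)) \<and>
          cauchy_solution a q u0 u \<longrightarrow>
          (\<exists>C. \<forall>t>0. Lp_norm 1 (u t) \<le> C * (1 + t) powr (- \<beta> / 2))))
     \<and>
     (1 + 1 / (real CARD('n) + \<beta>) \<le> q \<and> q \<le> 1 + 1 / real CARD('n) \<longrightarrow>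
       (\<forall>M :: real. \<exists>\<epsilon>>0. \<forall>(u0 :: real ^ 'n \<Rightarrow> real) u.
          u0 \<in> Lp_space 1 \<inter> Linf_space \<and> Linf_norm u0 \<le> ereal M \<and>
          (\<exists>C. \<forall>t>0. Lp_norm 1 (heat_semigroup t u0) \<le> C * t powr (- \<beta> / 2)) \<and>
          (SUP t\<in>{0<..}. t powr (\<beta> / 2) * Lp_norm 1 (heat_semigroup t u0)) < \<epsilon> \<and>
          cauchy_solution a q u0 u \<longrightarrow>
          (\<exists>C. \<forall>t>0. Lp_norm 1 (u t) \<le> C * (1 + t) powr (- \<beta> / 2))))"
proof (intro conjI impI allI)
  \<comment> \<open>The curve attains its initial value only almost everywhere; convolutions do not
    see the difference.\<close>
  have heat_eq: "conv (heat_kernel t) (u 0) = heat_semigroup t u0"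
    if "cauchy_solution a q u0 u" "u0 \<in> borel_measurable borel" "u 0 \<in> borel_measurable borel" for t and u0 and u :: "real \<Rightarrow> real ^ 'n \<Rightarrow> real"
  proof
    fix x
    have "AE y in lborel. u 0 y = u0 y" using that(1) by (simp add: cauchy_solution_def)
    then show "conv (heat_kernel t) (u 0) x = heat_semigroup t u0 x"
      unfolding heat_semigroup_eq_conv conv_def using that(2,3) by (intro integral_cong_AE) (auto elim!: eventually_mono)
  qed
  {
    fix u0 :: "real ^ 'n \<Rightarrow> real" and u
    assume n: "q > 1 + 1 / real CARD('n)"
      and *: "u0 \<in> Lp_space 1 \<inter> Lp_space q \<and>
          (\<exists>C. \<forall>t>0. Lp_norm 1 (heat_semigroup t u0) \<le> C * t powr (- \<beta> / 2)) \<and> cauchy_solution a q u0 u"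
    then have sol: "cauchy_solution a q u0 u" by simp
    obtain v where "viscous_flow a q u v" by (rule cauchy_solution_viscous_flow[OF assms(1) sol])
    then interpret viscous_flow a q u v .
    have m: "u0 \<in> borel_measurable borel" "u 0 \<in> borel_measurable borel" using * u_meas[of 0] by (auto simp: Lp_space_def)
    have "AE y in lborel. u 0 y = u0 y" using sol by (simp add: cauchy_solution_def)
    then have "AE y in lborel. \<bar>u 0 y\<bar> powr q = \<bar>u0 y\<bar> powr q" by eventually_elim simp
    then have "integrable lborel (\<lambda>x. \<bar>u 0 x\<bar> powr q) \<longleftrightarrow> integrable lborel (\<lambda>x. \<bar>u0 x\<bar> powr q)"
      by (intro integrable_cong_AE) (use m in auto)
    then have "integrable lborel (\<lambda>x. \<bar>u 0 x\<bar> powr q)" using * by (simp add: Lp_space_def)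
    moreover obtain C where "\<And>t. t > 0 \<Longrightarrow> Lp_norm 1 (heat_semigroup t u0) \<le> C * t powr (- \<beta> / 2)" using * by blast
    ultimately show "\<exists>C. \<forall>t>0. Lp_norm 1 (u t) \<le> C * (1 + t) powr (- \<beta> / 2)"
      using supercritical_decay[of \<beta> C] n assms by (simp add: Lp_norm_1 heat_eq[OF sol m])
  next
    fix M :: real
    assume qq: "1 + 1 / (real CARD('n) + \<beta>) \<le> q \<and> q \<le> 1 + 1 / real CARD('n)"
    define p where "p = 1 + 1 / (real CARD('n) + \<beta>)"
    have p: "p > 1" using assms(2) by (simp add: p_def add_nonneg_pos)
    \<comment> \<open>The critical estimate asks for a bound of at least 1; enlarging
      \<open>M\<close> only weakens the pointwise bound on the datum.\<close>
    define M' where "M' = max M 1"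
    define D where "D = norm a * heat_const TYPE(real ^ 'n) * M' powr (q - p) * (1 + smoothing_const TYPE(real ^ 'n) 1)
      * 2 powr ((1 + \<beta>) / 2) * (2 + 1 / (1 - (1 + \<beta>) / 2)) * 2 powr (\<beta> / 2)"
    have D: "D \<ge> 0"
      unfolding D_def using heat_const_pos[where 'a = "real ^ 'n"] smoothing_const_nonneg[of "TYPE(real ^ 'n)" 1] assms
      by (intro mult_nonneg_nonneg add_nonneg_nonneg) auto
    \<comment> \<open>Chosen so that D 2^p epsilon^(p-1) < 1, which is possible because p > 1. It
      depends on \<open>a\<close>, q, beta, \<open>M\<close> and the dimension, but on no initial
      datum, as the order of the quantifiers requires.\<close>
    define \<epsilon> where "\<epsilon> = (1 / (D * 2 powr p + 1)) powr (1 / (p - 1))"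
    have D1: "D * 2 powr p + 1 > 0" using D by (simp add: add_nonneg_pos)
    have \<epsilon>: "\<epsilon> > 0" using D1 by (simp add: \<epsilon>_def)
    have small: "D * (2 * \<epsilon>) powr p < \<epsilon>"
    proof -
      have "\<epsilon> powr (p - 1) = 1 / (D * 2 powr p + 1)" using p D1 by (simp add: \<epsilon>_def powr_powr)
      then have "D * 2 powr p * \<epsilon> powr (p - 1) < 1" using D1 by (simp add: divide_less_eq)
      then have "D * 2 powr p * \<epsilon> powr (p - 1) * \<epsilon> < 1 * \<epsilon>" using \<epsilon> by (intro mult_strict_right_mono)
      moreover have "\<epsilon> powr (p - 1) * \<epsilon> = \<epsilon> powr p" using \<epsilon> by (simp add: powr_diff)
      ultimately show ?thesis using \<epsilon> by (simp add: powr_mult mult.assoc)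
    qed
    show "\<exists>\<epsilon>>0. \<forall>(u0 :: real ^ 'n \<Rightarrow> real) u.
          u0 \<in> Lp_space 1 \<inter> Linf_space \<and> Linf_norm u0 \<le> ereal M \<and>
          (\<exists>C. \<forall>t>0. Lp_norm 1 (heat_semigroup t u0) \<le> C * t powr (- \<beta> / 2)) \<and>
          (SUP t\<in>{0<..}. t powr (\<beta> / 2) * Lp_norm 1 (heat_semigroup t u0)) < \<epsilon> \<and>
          cauchy_solution a q u0 u \<longrightarrow>
          (\<exists>C. \<forall>t>0. Lp_norm 1 (u t) \<le> C * (1 + t) powr (- \<beta> / 2))"
    proof (rule exI[of _ \<epsilon>], intro conjI \<epsilon> allI impI)
      fix u0 :: "real ^ 'n \<Rightarrow> real" and u
      assume *: "u0 \<in> Lp_space 1 \<inter> Linf_space \<and> Linf_norm u0 \<le> ereal M \<and>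
          (\<exists>C. \<forall>t>0. Lp_norm 1 (heat_semigroup t u0) \<le> C * t powr (- \<beta> / 2)) \<and>
          (SUP t\<in>{0<..}. t powr (\<beta> / 2) * Lp_norm 1 (heat_semigroup t u0)) < \<epsilon> \<and>
          cauchy_solution a q u0 u"
      then have sol: "cauchy_solution a q u0 u" and uM: "Linf_norm u0 \<le> ereal M" by blast+
      obtain v where "viscous_flow a q u v" by (rule cauchy_solution_viscous_flow[OF assms(1) sol])
      then interpret viscous_flow a q u v .
      have m: "u0 \<in> borel_measurable borel" "u 0 \<in> borel_measurable borel" using * u_meas[of 0] by (auto simp: Lp_space_def)
      obtain C where C: "\<And>t. t > 0 \<Longrightarrow> Lp_norm 1 (heat_semigroup t u0) \<le> C * t powr (- \<beta> / 2)" using * by blast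
      \<comment> \<open>A supremum of reals is an upper bound only for sets bounded above; the
        constant \<open>C\<close> provides this boundedness.\<close>
      have "t powr (\<beta> / 2) * Lp_norm 1 (heat_semigroup t u0) \<le> C" if "t \<in> {0<..}" for t
        using C[of t] that by (simp add: powr_minus divide_inverse[symmetric] pos_le_divide_eq mult.commute)
      then have bdd: "bdd_above ((\<lambda>t. t powr (\<beta> / 2) * Lp_norm 1 (heat_semigroup t u0)) ` {0<..})"
        by (intro bdd_aboveI[of _ C]) auto
      have heat: "Lp_norm 1 (heat_semigroup t u0) \<le> \<epsilon> * t powr (- \<beta> / 2)" if t: "t > 0" for t
      proof -
        have "t powr (\<beta> / 2) * Lp_norm 1 (heat_semigroup t u0) \<le> (SUP t\<in>{0<..}. t powr (\<beta> / 2) * Lp_norm 1 (heat_semigroup t u0))"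
          by (rule cSUP_upper[OF _ bdd]) (use t in simp)
        also have "\<dots> \<le> \<epsilon>" using * by simp
        finally show ?thesis using t by (simp add: powr_minus divide_inverse[symmetric] pos_le_divide_eq mult.commute)
      qed
      have "AE x in lborel. ereal \<bar>u0 x\<bar> \<le> Linf_norm u0" unfolding Linf_norm_def by (rule esssup_AE)
      moreover have "AE y in lborel. u 0 y = u0 y" using sol by (simp add: cauchy_solution_def)
      ultimately have "AE x in lborel. \<bar>u 0 x\<bar> \<le> M'"
      proof eventually_elim
        case (elim x)
        have "ereal \<bar>u 0 x\<bar> \<le> ereal M" unfolding elim(2) by (rule order_trans[OF elim(1) uM])
        then show ?case unfolding M'_def ereal_less_eq by linarith
      qed
      then show "\<exists>C. \<forall>t>0. Lp_norm 1 (u t) \<le> C * (1 + t) powr (- \<beta> / 2)"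
        using critical_decay[of \<beta> M' \<epsilon>] assms(2,3) qq \<epsilon> heat small
        by (simp add: Lp_norm_1 heat_eq[OF sol m] D_def p_def M'_def)
    qed
  }
qed

end
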